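(* Let $(X,d)$ be a separable, complete metric space, $p\in[1,\infty)$, $\Omega\subset\mathbb{R}^n$ open and bounded, and $u\in W^{1,p}(\Omega;X)$. Then the Korevaar--Schoen $p$-energy $E^p(u)$ of $u$ has the following explicit representation: $$E^p(u)=\int_\Omega\left(\frac{1}{\mathcal{H}^{n-1}(S^{n-1})}\int_{S^{n-1}}|\partial_\nu u|^p(x)\,\mathrm{d}\mathcal{H}^{n-1}(\nu)\right)\mathrm{d}\mathcal{L}^n(x),$$ where $$|\partial_\nu u|(x)=\sup_{\xi\in\mathscr{D}}\left|\nu\cdot\nabla\big(d(u,\xi)\big)(x)\right|\quad\text{for a.e. }x\in\Omega,$$ and $\mathscr{D}\subset X$ is any countable dense subset.
   Context: $\mathcal{L}^n$ is Lebesgue measure on $\mathbb{R}^n$, $\mathcal{H}^{n-1}$ is $(n-1)$-dimensional Hausdorff measure, $S^{n-1}$ is the unit sphere of $\mathbb{R}^n$, $B_1(0)$ is the unit ball of $\mathbb{R}^n$ and $\omega_n=\mathcal{L}^n(B_1(0))$. For $\xi\in X$, $d(u,\xi)$ denotes the real function $x\mapsto d(u(x),\xi)$ on $\Omega$, and $\nabla(d(u,\xi))$ its weak gradient. $L^p(\Omega;X)$ is the set of measurable $u:\Omega\to X$ such that for some (hence every) $\xi\in X$ the function $d(u,\xi)$ is in $L^p(\Omega)$. Korevaar--Schoen energy. For $u\in L^p(\Omega;X)$ and $h>0$ let $\Omega_h=\{x\in\Omega:\operatorname{dist}(x,\partial\Omega)>h\}$, $c_{n,p}=\frac{n+p}{n\,\omega_n}$,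 and $$e^u_{h,p}(x)=c_{n,p}\int_{B_1(0)}\frac{d(u(x),u(x+hv))^p}{h^p}\,\mathrm{d}\mathcal{L}^n(v)\ \text{ if }x\in\Omega_h,\qquad e^u_{h,p}(x)=0\ \text{ otherwise.}$$ Then $$E^p(u)=\sup_{f\in C_c(\Omega),\,0\le f\le1}\ \limsup_{h\to0^+}\int_\Omega e^u_{h,p}(x)f(x)\,\mathrm{d}x.$$ Sobolev spaces. For $p\in(1,\infty)$, $u\in W^{1,p}(\Omega;X)$ means $u\in L^p(\Omega;X)$ and $E^p(u)<\infty$. For $p=1$, $u\in W^{1,1}(\Omega;X)$ means $u\in L^1(\Omega;X)$, $E^1(u)<\infty$, and the measure $\mu$ which is the weak limit of $e^u_{h,1}\,\mathrm{d}\mathcal{L}^n$ as $h\to0^+$ (this limit is known to exist when $E^1(u)<\infty$) is absolutely continuous with respect to $\mathcal{L}^n$. Known characterization (making the quantities in the statement meaningful): for $p\in[1,\infty)$, $u\in W^{1,p}(\Omega;X)$ if and only if (i) $d(u,\xi)\in W^{1,p}(\Omega)$ for every $\xi\in X$, and (ii) there is $g\in L^p(\Omega)$ with $|\nabla(d(u,\xi))|\le g$ $\mathcal{L}^n$-a.e. for every $\xi\in X$. *)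

theory Defs
  imports "HOL-Analysis.Analysis"
begin

section \<open>Hausdorff measure\<close>

text \<open>Normalised so that the \<open>s\<close>-dimensional measure agrees with Lebesgue measure on
  \<open>s\<close>-dimensional Euclidean space. With the convention \<open>0 ^ 0 = 1\<close>, nonempty sets of
  diameter \<open>0\<close> have weight \<open>1\<close> when \<open>s = 0\<close>, so that this case yields the counting measure;
  the empty set needs the separate clause. Boundedness is demanded explicitly since
  \<open>diameter\<close> is not meaningful for unbounded sets.\<close>

definition hausdorff_weight :: "nat \<Rightarrow> 'a::metric_space set \<Rightarrow> ennreal" where
  "hausdorff_weight s C =
     (if C = {} then 0 else ennreal (unit_ball_vol (real s) * (diameter C / 2) ^ s))"

definition hausdorff_premeasure :: "nat \<Rightarrow> real \<Rightarrow> 'a::metric_space set \<Rightarrow> ennreal" where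
  "hausdorff_premeasure s \<delta> A =
     (INF C \<in> {C :: nat \<Rightarrow> 'a set. A \<subseteq> (\<Union>i. C i) \<and> (\<forall>i. bounded (C i) \<and> diameter (C i) \<le> \<delta>)}.
        \<Sum>i. hausdorff_weight s (C i))"

definition hausdorff_outer :: "nat \<Rightarrow> 'a::metric_space set \<Rightarrow> ennreal" where
  "hausdorff_outer s A = (SUP \<delta>\<in>{0<..}. hausdorff_premeasure s \<delta> A)"

definition hausdorff_measure :: "nat \<Rightarrow> 'a::metric_space measure" where
  "hausdorff_measure s = measure_of UNIV (sets borel) (hausdorff_outer s)"


section \<open>Test functions and weak gradients\<close>

primrec k_times_cont_diff :: "nat \<Rightarrow> ('a::euclidean_space \<Rightarrow> real) \<Rightarrow> bool" where
  "k_times_cont_diff 0 f \<longleftrightarrow> continuous_on UNIV f"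
| "k_times_cont_diff (Suc k) f \<longleftrightarrow>
     (\<forall>x. f differentiable (at x)) \<and>
     (\<forall>i\<in>Basis. k_times_cont_diff k (\<lambda>x. frechet_derivative f (at x) i))"

text \<open>Functions on \<open>\<Omega>\<close> with compact support in \<open>\<Omega>\<close> are identified with their extension by zero.\<close>

definition C_c :: "'a::euclidean_space set \<Rightarrow> ('a \<Rightarrow> real) set" where
  "C_c \<Omega> = {\<phi>. continuous_on UNIV \<phi> \<and> compact (closure {x. \<phi> x \<noteq> 0}) \<and> closure {x. \<phi> x \<noteq> 0} \<subseteq> \<Omega>}"

definition C_c_infinity :: "'a::euclidean_space set \<Rightarrow> ('a \<Rightarrow> real) set" where
  "C_c_infinity \<Omega> = {\<phi> \<in> C_c \<Omega>. \<forall>k. k_times_cont_diff k \<phi>}"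

definition locally_integrable_on ::
    "'a::euclidean_space set \<Rightarrow> ('a \<Rightarrow> 'b::{banach, second_countable_topology}) \<Rightarrow> bool" where
  "locally_integrable_on \<Omega> f \<longleftrightarrow> (\<forall>K. compact K \<and> K \<subseteq> \<Omega> \<longrightarrow> set_integrable lebesgue K f)"

definition is_weak_gradient ::
    "'a::euclidean_space set \<Rightarrow> ('a \<Rightarrow> real) \<Rightarrow> ('a \<Rightarrow> 'a) \<Rightarrow> bool" where
  "is_weak_gradient \<Omega> f g \<longleftrightarrow>
     locally_integrable_on \<Omega> f \<and> locally_integrable_on \<Omega> g \<and>
     (\<forall>\<phi>\<in>C_c_infinity \<Omega>. \<forall>i\<in>Basis.
        (LINT x:\<Omega>|lebesgue. f x * frechet_derivative \<phi> (at x) i) =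
        - (LINT x:\<Omega>|lebesgue. (g x \<bullet> i) * \<phi> x))"

text \<open>A representative of the almost-everywhere equivalence class of weak gradients.\<close>

definition weak_gradient :: "'a::euclidean_space set \<Rightarrow> ('a \<Rightarrow> real) \<Rightarrow> 'a \<Rightarrow> 'a" where
  "weak_gradient \<Omega> f = (SOME g. is_weak_gradient \<Omega> f g)"


section \<open>Metric-valued maps and the Korevaar--Schoen energy\<close>

definition Lp_map ::
    "real \<Rightarrow> 'a::euclidean_space set \<Rightarrow> ('a \<Rightarrow> 'b::polish_space) \<Rightarrow> bool" where
  "Lp_map p \<Omega> u \<longleftrightarrow>
     u \<in> borel_measurable (lebesgue_on \<Omega>) \<and>
     (\<exists>\<xi>. integrable (lebesgue_on \<Omega>) (\<lambda>x. dist (u x) \<xi> powr p))"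

definition KS_constant :: "'a::euclidean_space itself \<Rightarrow> real \<Rightarrow> real" where
  "KS_constant _ p =
     (real DIM('a) + p) / (real DIM('a) * measure lebesgue (ball (0::'a) 1))"

definition inner_domain :: "'a::euclidean_space set \<Rightarrow> real \<Rightarrow> 'a set" where
  "inner_domain \<Omega> h = {x \<in> \<Omega>. infdist x (frontier \<Omega>) > h}"

definition KS_density ::
    "real \<Rightarrow> 'a::euclidean_space set \<Rightarrow> ('a \<Rightarrow> 'b::polish_space) \<Rightarrow> real \<Rightarrow> 'a \<Rightarrow> ennreal" where
  "KS_density p \<Omega> u h x =
     (if x \<in> inner_domain \<Omega> h
      then ennreal (KS_constant TYPE('a) p) *
           (\<integral>\<^sup>+v\<in>ball 0 1. ennreal (dist (u x) (u (x + h *\<^sub>R v)) powr p / h powr p) \<partial>lebesgue)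
      else 0)"

definition KS_energy ::
    "real \<Rightarrow> 'a::euclidean_space set \<Rightarrow> ('a \<Rightarrow> 'b::polish_space) \<Rightarrow> ennreal" where
  "KS_energy p \<Omega> u =
     (SUP f \<in> {f \<in> C_c \<Omega>. \<forall>x. 0 \<le> f x \<and> f x \<le> 1}.
        Limsup (at_right 0) (\<lambda>h. \<integral>\<^sup>+x\<in>\<Omega>. KS_density p \<Omega> u h x * ennreal (f x) \<partial>lebesgue))"

text \<open>\<open>\<mu>\<close> is a Radon measure on the open set \<open>\<Omega>\<close>; convergence is tested against \<open>C_c \<Omega>\<close>. The
  densities are finite everywhere for \<open>u\<close> in \<open>L\<^sup>p\<close>, so passing to real values loses nothing.\<close>

definition KS_weak_limit ::
    "real \<Rightarrow> 'a::euclidean_space set \<Rightarrow> ('a \<Rightarrow> 'b::polish_space) \<Rightarrow> 'a measure \<Rightarrow> bool" where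
  "KS_weak_limit p \<Omega> u \<mu> \<longleftrightarrow>
     sets \<mu> = sets (restrict_space borel \<Omega>) \<and>
     (\<forall>K. compact K \<and> K \<subseteq> \<Omega> \<longrightarrow> emeasure \<mu> K < \<infinity>) \<and>
     (\<forall>\<phi>\<in>C_c \<Omega>.
        ((\<lambda>h. LINT x:\<Omega>|lebesgue. enn2real (KS_density p \<Omega> u h x) * \<phi> x)
          \<longlongrightarrow> (LINT x|\<mu>. \<phi> x)) (at_right 0))"

definition Sobolev_map ::
    "real \<Rightarrow> 'a::euclidean_space set \<Rightarrow> ('a \<Rightarrow> 'b::polish_space) \<Rightarrow> bool" where
  "Sobolev_map p \<Omega> u \<longleftrightarrow>
     Lp_map p \<Omega> u \<and> KS_energy p \<Omega> u < \<infinity> \<and>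
     (p = 1 \<longrightarrow>
        (\<exists>\<mu>. KS_weak_limit 1 \<Omega> u \<mu> \<and> absolutely_continuous (restrict_space lborel \<Omega>) \<mu>))"


section \<open>Directional derivatives\<close>

definition abs_dir_deriv ::
    "'a::euclidean_space set \<Rightarrow> ('a \<Rightarrow> 'b::polish_space) \<Rightarrow> 'b set \<Rightarrow> 'a \<Rightarrow> 'a \<Rightarrow> ennreal" where
  "abs_dir_deriv \<Omega> u D \<nu> x =
     (SUP \<xi>\<in>D. ennreal \<bar>\<nu> \<bullet> weak_gradient \<Omega> (\<lambda>y. dist (u y) \<xi>) x\<bar>)"

text \<open>Real powers of extended nonnegative numbers, for positive exponents.\<close>

definition ennreal_powr :: "ennreal \<Rightarrow> real \<Rightarrow> ennreal" where
  "ennreal_powr a p = (if a = \<infinity> then \<infinity> else ennreal (enn2real a powr p))"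

end

theory Submission
  imports Defs
begin

text \<open>
Both sides of the formula are averages of one directional quantity. They are compared through
the intermediate expression
  \<open>c \<integral>\<^sub>\<Omega> \<integral>\<^sub>B sup\<^sub>\<xi> \<bar>v \<bullet> \<nabla>d(u,\<xi>)(x)\<bar>\<^sup>p dv dx\<close>,
where \<open>B\<close> is the unit ball, \<open>\<xi>\<close> runs through \<open>D\<close> and \<open>c\<close> is the normalising constant of the
energy; below it is called \<open>slope_energy\<close>.

The right hand side of the formula equals this expression because the supremum is homogeneous of
degree \<open>p\<close> in \<open>v\<close>: its average over the sphere is \<open>c\<close> times its integral over the ball
(\<open>sphere_average_eq_ball_average\<close>). Instead of polar coordinates, the proof uses that the Hausdorff
measure of the sphere and the image of \<open>\<bar>v\<bar>\<^sup>p dv\<close> under \<open>v \<mapsto> v/\<bar>v\<bar>\<close> are both invariant under the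
reflections exchanging two points of the sphere. Balls around points of the sphere therefore have a mass
that depends on the radius alone, and two finite measures with this property are proportional
(\<open>uniformly_distributed_unique\<close>). That the Hausdorff measure is a Borel measure, and that it is
positive and finite on the sphere, is shown by Caratheodory's criterion and by comparing coverings
with volumes.

For the left hand side, density of \<open>D\<close> gives \<open>d(y,z) = sup\<^sub>\<xi> \<bar>d(y,\<xi>) - d(z,\<xi>)\<bar>\<close>, so the difference
quotients of \<open>u\<close> are suprema of difference quotients of the real functions \<open>d(u,\<xi>)\<close>. A function \<open>F\<close>
with weak gradient satisfies
  \<open>F(x + hv) - F(x) = h \<integral>\<^sub>0\<^sup>1 v \<bullet> \<nabla>F(x + thv) dt\<close>
for almost every \<open>x\<close> (\<open>weak_gradient_line\<close>). By Jensen's inequality, Fubini's theorem and translation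
invariance, the energy at every small scale \<open>h\<close> is at most \<open>slope_energy\<close>
(\<open>KS_energy_le_slope_energy\<close>). Conversely, translations are continuous in \<open>L\<^sup>1\<close>, so the same formula
shows that the difference quotients of \<open>d(u,\<xi>)\<close> converge locally in \<open>L\<^sup>1\<close> to \<open>v \<bullet> \<nabla>d(u,\<xi>)\<close>. For finitely
many \<open>\<xi>\<close> they converge almost everywhere along a subsequence; Fatou's lemma and monotone convergence
then give the other inequality (\<open>slope_energy_le_KS_energy\<close>).

Sobolev maps are defined by their energy alone, so the weak gradients have to be constructed first
(\<open>weak_gradient_exists_of_Sobolev\<close>). Difference quotients in the directions of a ball with centre
\<open>i/2\<close> and radius \<open>1/2\<close>, tested against a smooth \<open>\<phi>\<close>, converge to a multiple of \<open>-\<integral> F \<partial>\<^sub>i\<phi>\<close>, because the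
mean of this ball is \<open>i/2\<close> (\<open>difference_quotient_limit\<close>). For \<open>p > 1\<close> the quotients are bounded
in \<open>L\<^sup>p\<close> and have a weak limit (\<open>Lp_bounded_imp_weak_limit\<close>). For \<open>p = 1\<close> the limit functional is
dominated by \<open>\<integral> w \<bar>\<phi>\<bar>\<close>, where \<open>w\<close> is the density of the limit measure, and such a functional is given
by a function (\<open>dominated_functional_representation\<close>). Both facts are obtained by minimizing a
strictly convex functional: the midpoint inequality makes every minimizing sequence Cauchy
in \<open>L\<^sup>1\<close>.
\<close>

section \<open>Smooth bump functions\<close>

lemma k_times_cont_diff_Suc_imp:
  "k_times_cont_diff (Suc k) f \<Longrightarrow> k_times_cont_diff k f"
proof (induction k arbitrary: f)
  case 0
  then show ?case
    by (auto simp: continuous_on_eq_continuous_at intro: differentiable_imp_continuous_within)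
next
  case (Suc k)
  have "f differentiable (at x)" for x using Suc.prems by simp
  moreover have "k_times_cont_diff k (\<lambda>x. frechet_derivative f (at x) i)" if "i \<in> Basis" for i
    using Suc.prems that by (intro Suc.IH) auto
  ultimately show ?case by simp
qed

lemma k_times_cont_diff_const: "k_times_cont_diff k (\<lambda>x. c)"
proof (induction k arbitrary: c)
  case (Suc k)
  have "frechet_derivative (\<lambda>x. c) (at x) = (\<lambda>h. 0)" for x :: 'a
    by (rule frechet_derivative_at[symmetric]) (auto intro!: derivative_eq_intros)
  then show ?case using Suc by auto
qed auto

lemma k_times_cont_diff_add:
  "k_times_cont_diff k f \<Longrightarrow> k_times_cont_diff k g \<Longrightarrow> k_times_cont_diff k (\<lambda>x. f x + g x)"
proof (induction k arbitrary: f g)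
  case (Suc k)
  then have d: "\<And>x. f differentiable (at x)" "\<And>x. g differentiable (at x)" by auto
  have "frechet_derivative (\<lambda>x. f x + g x) (at x) =
      (\<lambda>i. frechet_derivative f (at x) i + frechet_derivative g (at x) i)" for x
    by (rule frechet_derivative_at[symmetric])
       (intro has_derivative_add d[unfolded frechet_derivative_works])
  then show ?case using Suc d by auto
qed (auto intro: continuous_intros)

lemma k_times_cont_diff_mult:
  "k_times_cont_diff k f \<Longrightarrow> k_times_cont_diff k g \<Longrightarrow> k_times_cont_diff k (\<lambda>x. f x * g x)"
proof (induction k arbitrary: f g)
  case (Suc k)
  then have d: "\<And>x. f differentiable (at x)" "\<And>x. g differentiable (at x)" by auto
  have eq: "frechet_derivative (\<lambda>x. f x * g x) (at x) =
      (\<lambda>i. f x * frechet_derivative g (at x) i + frechet_derivative f (at x) i * g x)" for x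
    by (rule frechet_derivative_at[symmetric])
       (intro has_derivative_mult d[unfolded frechet_derivative_works])
  have fg: "k_times_cont_diff k f" "k_times_cont_diff k g"
    using Suc.prems by (auto intro: k_times_cont_diff_Suc_imp)
  have "k_times_cont_diff k (\<lambda>x. f x * frechet_derivative g (at x) i + frechet_derivative f (at x) i * g x)"
    if "i \<in> Basis" for i
    using Suc.prems that fg by (intro k_times_cont_diff_add Suc.IH) auto
  then show ?case using d by (auto simp: eq)
qed (auto intro: continuous_intros)

lemma k_times_cont_diff_prod:
  "finite I \<Longrightarrow> (\<And>i. i \<in> I \<Longrightarrow> k_times_cont_diff k (f i)) \<Longrightarrow> k_times_cont_diff k (\<lambda>x. \<Prod>i\<in>I. f i x)"
  by (induction I rule: finite_induct) (auto intro: k_times_cont_diff_const k_times_cont_diff_mult)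

lemma frechet_derivative_shift:
  assumes "f differentiable (at (x + a))"
  shows "((\<lambda>x. f (x + a)) has_derivative frechet_derivative f (at (x + a))) (at x)"
proof -
  have "(f has_derivative frechet_derivative f (at (x+a))) (at (x+a))"
    using assms frechet_derivative_works by blast
  moreover have "((\<lambda>x. x + a) has_derivative (\<lambda>x. x)) (at x)"
    by (auto intro!: derivative_eq_intros)
  ultimately show ?thesis
    using has_derivative_compose by blast
qed

lemma k_times_cont_diff_shift:
  "k_times_cont_diff k f \<Longrightarrow> k_times_cont_diff k (\<lambda>x. f (x + a))"
proof (induction k arbitrary: f)
  case (Suc k)
  have d: "\<And>x. f differentiable (at x)" using Suc.prems by auto
  have eq: "frechet_derivative (\<lambda>x. f (x + a)) (at x) = frechet_derivative f (at (x + a))" for x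
    by (rule frechet_derivative_at[symmetric]) (rule frechet_derivative_shift[OF d])
  have "(\<lambda>x. f (x + a)) differentiable (at x)" for x
    using frechet_derivative_shift[OF d] unfolding differentiable_def by blast
  then show ?case using Suc by (auto simp: eq)
next
  case 0
  then show ?case by (auto intro!: continuous_on_compose2[of UNIV f] continuous_intros)
qed

text \<open>The family \<open>P(1/t) exp(-1/t)\<close>, extended by zero to \<open>t \<le> 0\<close>, with \<open>P\<close> a polynomial. Differentiation maps the family
to itself, so smoothness of \<open>exp(-1/t)\<close> follows by induction on the order.\<close>

definition flat :: "real poly \<Rightarrow> real \<Rightarrow> real" where
  "flat P t = (if t \<le> 0 then 0 else poly P (1 / t) * exp (- (1 / t)))"

lemma poly_exp_decay: "((\<lambda>s. poly P s * exp (- s)) \<longlongrightarrow> (0::real)) at_top"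
proof -
  have "((\<lambda>s. coeff P i * (s ^ i / exp s)) \<longlongrightarrow> coeff P i * 0) at_top" for i
    by (intro tendsto_intros tendsto_power_div_exp_0)
  then have "((\<lambda>s. \<Sum>i\<le>degree P. coeff P i * (s ^ i / exp s)) \<longlongrightarrow> (\<Sum>i\<le>degree P. coeff P i * 0)) at_top"
    by (intro tendsto_sum)
  then show ?thesis
    by (simp add: poly_altdef exp_minus divide_simps sum_divide_distrib sum_distrib_right)
qed

lemma flat_DERIV: "(flat P has_real_derivative flat ([:0,0,1:] * (P - pderiv P)) t) (at t)"
proof -
  consider "t < 0" | "t > 0" | "t = 0" by linarith
  then show ?thesis
  proof cases
    case 1
    have "((\<lambda>_. 0) has_real_derivative 0) (at t)" by simp
    then have "(flat P has_real_derivative 0) (at t)"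
      by (rule has_field_derivative_transform_within_open[where S="{..<0}"]) (use 1 in \<open>auto simp: flat_def\<close>)
    then show ?thesis using 1 by (simp add: flat_def)
  next
    case 2
    have "((\<lambda>t. poly P (1/t) * exp (- (1/t))) has_real_derivative
       (poly (pderiv P) (1/t) * (- (1 / t^2)) * exp (- (1/t)) + poly P (1/t) * (exp (- (1/t)) * (1/t^2)))) (at t)"
      using 2 by (auto intro!: derivative_eq_intros DERIV_chain2[of "poly P"] poly_DERIV simp: power2_eq_square field_simps)
    moreover have "flat ([:0,0,1:] * (P - pderiv P)) t =
       (poly (pderiv P) (1/t) * (- (1 / t^2)) * exp (- (1/t)) + poly P (1/t) * (exp (- (1/t)) * (1/t^2)))"
      using 2 by (simp add: flat_def field_simps power2_eq_square)
    ultimately have "((\<lambda>t. poly P (1/t) * exp (- (1/t))) has_real_derivative flat ([:0,0,1:] * (P - pderiv P)) t) (at t)"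
      by simp
    then show ?thesis
      by (rule has_field_derivative_transform_within_open[where S="{0<..}"]) (use 2 in \<open>auto simp: flat_def\<close>)
  next
    case 3
    have "((\<lambda>h. flat P h / h) \<longlongrightarrow> 0) (at_right 0)"
    proof -
      have "((\<lambda>h. poly (pCons 0 P) (inverse h) * exp (- (inverse h))) \<longlongrightarrow> 0) (at_right 0)"
        by (rule filterlim_compose[OF poly_exp_decay filterlim_inverse_at_top_right])
      moreover have "\<forall>\<^sub>F h in at_right 0. poly (pCons 0 P) (inverse h) * exp (- (inverse h)) = flat P h / h"
        unfolding eventually_at_right_field by (rule exI[of _ 1]) (auto simp: flat_def field_simps)
      ultimately show ?thesis by (blast intro: Lim_transform_eventually)
    qed
    moreover have "((\<lambda>h. flat P h / h) \<longlongrightarrow> 0) (at_left 0)"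
    proof (rule tendsto_eventually)
      show "\<forall>\<^sub>F h in at_left 0. flat P h / h = 0"
        unfolding eventually_at_left_field by (rule exI[of _ "-1"]) (auto simp: flat_def)
    qed
    ultimately have "((\<lambda>h. flat P h / h) \<longlongrightarrow> 0) (at 0)" by (simp add: filterlim_split_at)
    then show ?thesis using 3 by (simp add: DERIV_def flat_def)
  qed
qed

lemma flat_nonneg: "flat 1 t \<ge> 0" and flat_le_1: "flat 1 t \<le> 1"
  by (auto simp: flat_def)

lemma k_times_cont_diff_flat:
  "k_times_cont_diff k (\<lambda>x. flat P (x \<bullet> w + d))"
proof (induction k arbitrary: P)
  case 0
  have "continuous_on UNIV (flat P)"
    by (meson DERIV_isCont continuous_at_imp_continuous_on flat_DERIV)
  then show ?case by (auto intro!: continuous_on_compose2[of UNIV "flat P"] continuous_intros)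
next
  case (Suc k)
  have D: "((\<lambda>x. flat P (x \<bullet> w + d)) has_derivative
     (\<lambda>i. flat ([:0,0,1:] * (P - pderiv P)) (x \<bullet> w + d) * (i \<bullet> w))) (at x)" for x
  proof -
    have "((\<lambda>x. x \<bullet> w + d) has_derivative (\<lambda>i. i \<bullet> w)) (at x)"
      by (auto intro!: derivative_eq_intros)
    from DERIV_compose_FDERIV[OF flat_DERIV this] show ?thesis
      by (simp only: mult.commute)
  qed
  then have eq: "frechet_derivative (\<lambda>x. flat P (x \<bullet> w + d)) (at x) =
     (\<lambda>i. flat ([:0,0,1:] * (P - pderiv P)) (x \<bullet> w + d) * (i \<bullet> w))" for x
    by (metis frechet_derivative_at)
  show ?case
    using D by (auto simp: eq differentiable_def simp del: mult_pCons_left intro!: k_times_cont_diff_mult Suc.IH k_times_cont_diff_const)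
qed

text \<open>For \<open>m \<longlongrightarrow> \<infinity>\<close> these functions tend to the indicator of the open box: each factor
\<open>exp(-1/(m s))\<close> tends to \<open>1\<close> for \<open>s > 0\<close> and vanishes for \<open>s \<le> 0\<close>.\<close>

definition box_bump :: "real \<Rightarrow> 'a::euclidean_space \<Rightarrow> 'a \<Rightarrow> 'a \<Rightarrow> real" where
  "box_bump m a b x = (\<Prod>i\<in>Basis. flat 1 (m * (x \<bullet> i - a \<bullet> i)) * flat 1 (m * (b \<bullet> i - x \<bullet> i)))"

lemma k_times_cont_diff_box_bump: "k_times_cont_diff k (box_bump m a b)"
proof -
  have *: "k_times_cont_diff k (\<lambda>x. flat 1 (m * (x \<bullet> i - c)))" for m c :: real and i :: 'a
    using k_times_cont_diff_flat[of k 1 "m *\<^sub>R i" "- (m * c)"] by (simp add: algebra_simps)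
  have "k_times_cont_diff k (\<lambda>x. \<Prod>i\<in>Basis. flat 1 (m * (x \<bullet> i - a \<bullet> i)) * flat 1 ((-m) * (x \<bullet> i - b \<bullet> i)))"
    by (intro k_times_cont_diff_prod k_times_cont_diff_mult *) auto
  then show ?thesis unfolding box_bump_def[abs_def] by (simp add: algebra_simps)
qed

lemma box_bump_nonneg: "0 \<le> box_bump m a b x" and box_bump_le_1: "box_bump m a b x \<le> 1"
  unfolding box_bump_def
  by (auto intro!: prod_nonneg prod_le_1 mult_nonneg_nonneg mult_le_one flat_nonneg flat_le_1)

lemma box_bump_outside: "m > 0 \<Longrightarrow> x \<notin> box a b \<Longrightarrow> box_bump m a b x = 0"
  unfolding box_bump_def box_def by (auto simp: flat_def mult_le_0_iff not_less)

lemma box_bump_tendsto: "(\<lambda>m. box_bump (real (Suc m)) a b x) \<longlonglongrightarrow> indicator (box a b) x"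
proof (cases "x \<in> box a b")
  case True
  have lim: "(\<lambda>m. flat 1 (real (Suc m) * c)) \<longlonglongrightarrow> 1" if "c > 0" for c :: real
  proof -
    have "(\<lambda>m. exp (- (inverse (real (Suc m)) * inverse c))) \<longlonglongrightarrow> exp (- (0 * inverse c))"
      by (intro tendsto_intros LIMSEQ_inverse_real_of_nat)
    then show ?thesis using that by (simp add: flat_def field_simps zero_less_mult_iff mult_le_0_iff del: of_nat_Suc)
  qed
  have "(\<lambda>m. box_bump (real (Suc m)) a b x) \<longlonglongrightarrow> (\<Prod>i\<in>(Basis::'a set). 1 * 1)"
    unfolding box_bump_def using True by (intro tendsto_prod tendsto_mult lim) (auto simp: box_def)
  then show ?thesis using True by simp
next
  case False
  then show ?thesis by (simp add: box_bump_outside)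
qed

lemma box_bump_C_c_infinity:
  assumes "cbox a b \<subseteq> W" "m > 0"
  shows "box_bump m a b \<in> C_c_infinity W"
proof -
  have "{x. box_bump m a b x \<noteq> 0} \<subseteq> cbox a b"
    using box_bump_outside[OF assms(2)] box_subset_cbox by blast
  then have cl: "closure {x. box_bump m a b x \<noteq> 0} \<subseteq> cbox a b"
    by (rule closure_minimal) (rule closed_cbox)
  moreover have "compact (closure {x. box_bump m a b x \<noteq> 0})"
    using cl by (meson bounded_cbox bounded_subset closed_closure compact_eq_bounded_closed)
  moreover have "continuous_on UNIV (box_bump m a b)"
    using k_times_cont_diff_box_bump[of 0] by simp
  ultimately show ?thesis
    using assms by (auto simp: C_c_infinity_def C_c_def k_times_cont_diff_box_bump)
qed

lemma enn2real_eq_imp_eq: "enn2real a = enn2real b \<Longrightarrow> a \<noteq> \<infinity> \<Longrightarrow> b \<noteq> \<infinity> \<Longrightarrow> a = b"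
  by (cases a; cases b) auto

text \<open>The measures with densities \<open>F\<^sup>+\<close> and \<open>F\<^sup>-\<close> agree on boxes, hence on all Borel sets, so their
densities agree almost everywhere.\<close>

lemma AE_zero_if_integral_boxes_zero:
  fixes F :: "'a::euclidean_space \<Rightarrow> real"
  assumes F: "integrable lborel F" and 0: "\<And>a b. (LINT x|lborel. F x * indicator (box a b) x) = 0"
  shows "AE x in lborel. F x = 0"
proof -
  let ?P = "density lborel (\<lambda>x. ennreal (F x))" and ?N = "density lborel (\<lambda>x. ennreal (- F x))"
  have [measurable]: "F \<in> borel_measurable borel" using F by auto
  have fin: "(\<integral>\<^sup>+x. ennreal (F x) * indicator B x \<partial>lborel) \<noteq> \<infinity>"
       "(\<integral>\<^sup>+x. ennreal (- F x) * indicator B x \<partial>lborel) \<noteq> \<infinity>" if "B \<in> sets borel" for B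
  proof -
    have le: "(\<integral>\<^sup>+x. ennreal (s * F x) * indicator B x \<partial>lborel) \<le> (\<integral>\<^sup>+x. norm (F x) \<partial>lborel)" if "\<bar>s\<bar> \<le> 1" for s
    proof (intro nn_integral_mono)
      fix x
      have "s * F x \<le> 1 * \<bar>F x\<bar>"
        using mult_right_mono[OF that, of "\<bar>F x\<bar>"] abs_ge_self[of "s * F x"] by (simp add: abs_mult)
      then show "ennreal (s * F x) * indicator B x \<le> ennreal (norm (F x))"
        by (auto simp: indicator_def intro: ennreal_leI)
    qed
    have "(\<integral>\<^sup>+x. norm (F x) \<partial>lborel) < \<infinity>" using F by (simp add: integrable_iff_bounded)
    then show "(\<integral>\<^sup>+x. ennreal (F x) * indicator B x \<partial>lborel) \<noteq> \<infinity>"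
       "(\<integral>\<^sup>+x. ennreal (- F x) * indicator B x \<partial>lborel) \<noteq> \<infinity>"
      using le[of 1] le[of "-1"] by (auto simp: top_unique)
  qed
  have eqbox: "emeasure ?P (box a b) = emeasure ?N (box a b)" for a b
  proof -
    have int: "integrable lborel (\<lambda>x. F x * indicator (box a b) x)"
      using integrable_mult_indicator[OF _ F, of "box a b"] by (simp add: mult.commute)
    have "(LINT x|lborel. F x * indicator (box a b) x) =
      enn2real (\<integral>\<^sup>+x. ennreal (F x * indicator (box a b) x) \<partial>lborel) -
      enn2real (\<integral>\<^sup>+x. ennreal (- (F x * indicator (box a b) x)) \<partial>lborel)"
      by (rule real_lebesgue_integral_def[OF int])
    moreover have "(\<integral>\<^sup>+x. ennreal (F x * indicator (box a b) x) \<partial>lborel) = (\<integral>\<^sup>+x. ennreal (F x) * indicator (box a b) x \<partial>lborel)"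
      by (intro nn_integral_cong) (auto simp: indicator_def)
    moreover have "(\<integral>\<^sup>+x. ennreal (- (F x * indicator (box a b) x)) \<partial>lborel) = (\<integral>\<^sup>+x. ennreal (- F x) * indicator (box a b) x \<partial>lborel)"
      by (intro nn_integral_cong) (auto simp: indicator_def)
    ultimately have "enn2real (\<integral>\<^sup>+x. ennreal (F x) * indicator (box a b) x \<partial>lborel) =
       enn2real (\<integral>\<^sup>+x. ennreal (- F x) * indicator (box a b) x \<partial>lborel)"
      using 0[of a b] by simp
    then show ?thesis
      using enn2real_eq_imp_eq[OF _ fin[of "box a b"]] by (simp add: emeasure_density)
  qed
  have "?P = ?N"
  proof (rule measure_eqI_generator_eq)
    let ?E = "range (\<lambda>(a, b). box a b::'a set)"
    show "Int_stable ?E" by (auto simp: Int_stable_def box_Int_box)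
    show "?E \<subseteq> Pow UNIV" "sets ?P = sigma_sets UNIV ?E" "sets ?N = sigma_sets UNIV ?E"
      by (simp_all add: borel_eq_box)
    let ?A = "\<lambda>n::nat. box (- (real n *\<^sub>R One)) (real n *\<^sub>R One) :: 'a set"
    show "range ?A \<subseteq> ?E" "(\<Union>i. ?A i) = UNIV" unfolding UN_box_eq_UNIV by auto
    show "emeasure ?P (?A i) \<noteq> \<infinity>" for i using fin(1)[of "?A i"] by (simp add: emeasure_density)
    show "emeasure ?P X = emeasure ?N X" if "X \<in> ?E" for X using that eqbox by auto
  qed
  then have "AE x in lborel. ennreal (F x) = ennreal (- F x)"
    by (intro sigma_finite_measure.density_unique[OF sigma_finite_lborel]) auto
  then show ?thesis
  proof (rule AE_mp, intro AE_I2 impI)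
    fix x assume "ennreal (F x) = ennreal (- F x)"
    then show "F x = 0"
      by (cases "F x \<ge> 0") (auto simp: ennreal_neg)
  qed
qed

text \<open>Bump functions approximate indicators of boxes, so \<open>F\<close> has vanishing integral over every box whose
closure lies in \<open>W\<close>. This settles \<open>F = 0\<close> on each such box, and countably many of them cover \<open>W\<close> up
to their boundaries, which are null sets.\<close>

lemma AE_zero_if_test_integrals_zero:
  fixes F :: "'a::euclidean_space \<Rightarrow> real"
  assumes W: "open W" and F[measurable]: "F \<in> borel_measurable borel"
    and loc: "\<And>K. compact K \<Longrightarrow> K \<subseteq> W \<Longrightarrow> set_integrable lborel K F"
    and 0: "\<And>\<phi>. \<phi> \<in> C_c_infinity W \<Longrightarrow> (LINT x|lborel. F x * \<phi> x) = 0"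
  shows "AE x in lborel. x \<in> W \<longrightarrow> F x = 0"
proof -
  have box0: "(LINT x|lborel. F x * indicator (box a b) x) = 0" if ab: "cbox a b \<subseteq> W" for a b
  proof -
    have i: "integrable lborel (\<lambda>x. indicator (cbox a b) x *\<^sub>R F x)"
      using loc[OF compact_cbox ab] by (simp add: set_integrable_def)
    have "(\<lambda>m. LINT x|lborel. F x * box_bump (real (Suc m)) a b x) \<longlonglongrightarrow> (LINT x|lborel. F x * indicator (box a b) x)"
    proof (rule integral_dominated_convergence[where w="\<lambda>x. norm (indicator (cbox a b) x *\<^sub>R F x)"])
      show "(\<lambda>x. F x * box_bump (real (Suc m)) a b x) \<in> borel_measurable lborel" for m
      proof -
        have "box_bump (real (Suc m)) a b \<in> borel_measurable borel"
          using k_times_cont_diff_box_bump[of 0 "real (Suc m)" a b]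
          by (simp only: k_times_cont_diff.simps borel_measurable_continuous_onI)
        then show ?thesis by simp
      qed
      show "AE x in lborel. (\<lambda>m. F x * box_bump (real (Suc m)) a b x) \<longlonglongrightarrow> F x * indicator (box a b) x"
        by (intro AE_I2 tendsto_mult tendsto_const box_bump_tendsto)
      show "AE x in lborel. norm (F x * box_bump (real (Suc m)) a b x) \<le> norm (indicator (cbox a b) x *\<^sub>R F x)" for m
      proof (intro AE_I2)
        fix x
        show "norm (F x * box_bump (real (Suc m)) a b x) \<le> norm (indicator (cbox a b) x *\<^sub>R F x)"
        proof (cases "x \<in> box a b")
          case True
          then have "x \<in> cbox a b" using box_subset_cbox by blast
          then show ?thesis
            using mult_left_mono[OF box_bump_le_1[of "real (Suc m)" a b x], of "\<bar>F x\<bar>"] box_bump_nonneg[of "real (Suc m)" a b x]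
            by (simp add: abs_mult)
        next
          case False
          then show ?thesis by (simp add: box_bump_outside)
        qed
      qed
    qed (use i in \<open>auto intro: integrable_norm\<close>)
    moreover have "(LINT x|lborel. F x * box_bump (real (Suc m)) a b x) = 0" for m
      by (intro 0 box_bump_C_c_infinity ab) auto
    ultimately show ?thesis by (simp add: LIMSEQ_const_iff)
  qed
  have one: "AE x in lborel. x \<in> box c d \<longrightarrow> F x = 0" if cd: "cbox c d \<subseteq> W" for c d
  proof -
    have "AE x in lborel. F x * indicator (box c d) x = 0"
    proof (rule AE_zero_if_integral_boxes_zero)
      have "integrable lborel (\<lambda>x. indicator (box c d) x *\<^sub>R (indicator (cbox c d) x *\<^sub>R F x))"
        using loc[OF compact_cbox cd] by (intro integrable_mult_indicator[of "box c d"]) (auto simp: set_integrable_def)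
      moreover have eq: "indicator (box c d) x *\<^sub>R (indicator (cbox c d) x *\<^sub>R F x) = F x * indicator (box c d) x" for x
        using box_subset_cbox[of c d] by (auto simp: indicator_def)
      ultimately show "integrable lborel (\<lambda>x. F x * indicator (box c d) x)" by (simp only: eq)
      fix a b
      obtain a' b' where ab: "box c d \<inter> box a b = box a' b'" using box_Int_box[of c d a b] by blast
      show "(LINT x|lborel. F x * indicator (box c d) x * indicator (box a b) x) = 0"
      proof (cases "box a' b' = {}")
        case True
        then have "F x * indicator (box c d) x * indicator (box a b) x = 0" for x
          using ab by (auto simp: indicator_def)
        then show ?thesis by (simp only: integral_zero)
      next
        case False
        then have "cbox a' b' \<subseteq> cbox c d"
          using ab box_subset_cbox[of c d] closure_minimal[of "box a' b'" "cbox c d"] by (auto simp: closure_box)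
        then have "(LINT x|lborel. F x * indicator (box a' b') x) = 0" using cd by (intro box0) auto
        moreover have "F x * indicator (box c d) x * indicator (box a b) x = F x * indicator (box a' b') x" for x
          unfolding ab[symmetric] by (auto simp: indicator_def)
        ultimately show ?thesis by (simp only:)
      qed
    qed
    then show ?thesis by (auto simp: indicator_def elim!: AE_mp)
  qed
  \<comment> \<open>The cover consists of closed boxes; only their interiors have been treated so far.\<close>
  obtain \<D> where D: "countable \<D>" "\<D> \<subseteq> Pow W" "\<And>X. X \<in> \<D> \<Longrightarrow> \<exists>a b. X = cbox a b" "\<Union>\<D> = W"
    by (rule open_countable_Union_open_cbox[OF W]) (rule that)
  have "AE x in lborel. x \<in> X \<longrightarrow> F x = 0" if XD: "X \<in> \<D>" for X
  proof -
    obtain a b where X: "X = cbox a b" using D(3)[OF XD] by blast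
    have "AE x in lborel. x \<in> box a b \<longrightarrow> F x = 0" by (rule one) (use D(2) XD X in auto)
    moreover have "AE x in lborel. x \<notin> cbox a b - box a b"
    proof (rule AE_not_in)
      have "emeasure lborel (cbox a b - box a b) = emeasure lborel (cbox a b) - emeasure lborel (box a b)"
        by (rule emeasure_Diff) (rule emeasure_lborel_box_finite[THEN less_imp_neq, unfolded infinity_ennreal_def] | simp | rule box_subset_cbox)+
      then show "cbox a b - box a b \<in> null_sets lborel"
        by (simp add: null_sets_def emeasure_lborel_cbox_eq emeasure_lborel_box_eq)
    qed
    ultimately show ?thesis unfolding X by eventually_elim auto
  qed
  then have "AE x in lborel. \<forall>X\<in>\<D>. x \<in> X \<longrightarrow> F x = 0" using D(1) by (subst AE_ball_countable) auto
  then show ?thesis using D(4) by (auto elim!: AE_mp)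
qed

section \<open>Translations\<close>

lemma nn_integral_lborel_shift:
  fixes f :: "'a::euclidean_space \<Rightarrow> ennreal"
  assumes [measurable]: "f \<in> borel_measurable borel"
  shows "(\<integral>\<^sup>+x. f (x + z) \<partial>lborel) = (\<integral>\<^sup>+x. f x \<partial>lborel)"
proof -
  have "(\<integral>\<^sup>+x. f x \<partial>lborel) = (\<integral>\<^sup>+x. f x \<partial>distr lborel borel ((+) z))"
    by (simp add: lborel_distr_plus)
  also have "\<dots> = (\<integral>\<^sup>+x. f (x + z) \<partial>lborel)"
    by (subst nn_integral_distr) (auto simp: add.commute)
  finally show ?thesis by simp
qed

lemma integrable_lborel_shift:
  fixes f :: "'a::euclidean_space \<Rightarrow> 'b::{banach, second_countable_topology}"
  assumes "integrable lborel f"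
  shows "integrable lborel (\<lambda>x. f (x + z))"
proof -
  have [measurable]: "f \<in> borel_measurable borel" using assms by auto
  show ?thesis
    using assms nn_integral_lborel_shift[of "\<lambda>x. ennreal (norm (f x))" z]
    by (simp add: integrable_iff_bounded)
qed

lemma integral_lborel_shift:
  fixes f :: "'a::euclidean_space \<Rightarrow> 'b::{banach, second_countable_topology}"
  assumes [measurable]: "f \<in> borel_measurable borel"
  shows "(LINT x|lborel. f (x + z)) = (LINT x|lborel. f x)"
proof -
  have "(LINT x|lborel. f x) = (LINT x|distr lborel borel ((+) z). f x)"
    by (simp add: lborel_distr_plus)
  also have "\<dots> = (LINT x|lborel. f (x + z))"
    by (subst integral_distr) (auto simp: add.commute)
  finally show ?thesis by simp
qed

text \<open>The \<open>L\<^sup>1\<close> modulus of continuity of \<open>g\<close> under the translation by \<open>z\<close>.\<close>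

definition L1_shift :: "('a::euclidean_space \<Rightarrow> 'b::{banach, second_countable_topology}) \<Rightarrow> 'a \<Rightarrow> ennreal" where
  "L1_shift g z = (\<integral>\<^sup>+x. ennreal (norm (g (x + z) - g x)) \<partial>lborel)"

lemma L1_shift_triangle:
  fixes f g :: "'a::euclidean_space \<Rightarrow> 'b::{banach, second_countable_topology}"
  assumes [measurable]: "f \<in> borel_measurable borel" "g \<in> borel_measurable borel"
  shows "L1_shift f z \<le> L1_shift g z + 2 * (\<integral>\<^sup>+x. ennreal (norm (f x - g x)) \<partial>lborel)"
proof -
  have "L1_shift f z \<le> (\<integral>\<^sup>+x. ennreal (norm (g (x + z) - g x)) + (ennreal (norm (f (x + z) - g (x + z))) + ennreal (norm (f x - g x))) \<partial>lborel)"
    unfolding L1_shift_def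
  proof (intro nn_integral_mono)
    fix x
    have "norm (f (x + z) - f x) = norm ((g (x + z) - g x) + (f (x + z) - g (x + z)) - (f x - g x))" by simp
    then have "norm (f (x + z) - f x) \<le> norm (g (x + z) - g x) + (norm (f (x + z) - g (x + z)) + norm (f x - g x))"
      using norm_triangle_ineq4[of "(g (x + z) - g x) + (f (x + z) - g (x + z))" "f x - g x"]
        norm_triangle_ineq[of "g (x + z) - g x" "f (x + z) - g (x + z)"] by linarith
    then show "ennreal (norm (f (x + z) - f x)) \<le> ennreal (norm (g (x + z) - g x)) + (ennreal (norm (f (x + z) - g (x + z))) + ennreal (norm (f x - g x)))"
      by (simp flip: ennreal_plus)
  qed
  also have "\<dots> = L1_shift g z + ((\<integral>\<^sup>+x. ennreal (norm (f (x + z) - g (x + z))) \<partial>lborel) + (\<integral>\<^sup>+x. ennreal (norm (f x - g x)) \<partial>lborel))"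
    by (simp add: nn_integral_add L1_shift_def)
  also have "(\<integral>\<^sup>+x. ennreal (norm (f (x + z) - g (x + z))) \<partial>lborel) = (\<integral>\<^sup>+x. ennreal (norm (f x - g x)) \<partial>lborel)"
    by (rule nn_integral_lborel_shift) simp
  finally show ?thesis by (simp add: mult_2)
qed

lemma L1_shift_le:
  fixes g :: "'a::euclidean_space \<Rightarrow> 'b::{banach, second_countable_topology}"
  assumes [measurable]: "g \<in> borel_measurable borel"
  shows "L1_shift g z \<le> 2 * (\<integral>\<^sup>+x. ennreal (norm (g x)) \<partial>lborel)"
  using L1_shift_triangle[OF assms, of "\<lambda>x. 0" z] by (simp add: L1_shift_def)

text \<open>Continuity of translations passes to \<open>L\<^sup>1\<close> limits, because the modulus changes by at most twice the
distance of the functions.\<close>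

lemma L1_shift_approx:
  fixes f :: "'a::euclidean_space \<Rightarrow> 'b::{banach, second_countable_topology}"
  assumes f: "f \<in> borel_measurable borel" and z: "z \<longlonglongrightarrow> 0"
    and g: "\<And>e. e > 0 \<Longrightarrow> \<exists>g. g \<in> borel_measurable borel \<and> (\<integral>\<^sup>+x. ennreal (norm (f x - g x)) \<partial>lborel) \<le> ennreal e \<and> (\<lambda>n. L1_shift g (z n)) \<longlonglongrightarrow> 0"
  shows "(\<lambda>n. L1_shift f (z n)) \<longlonglongrightarrow> 0"
proof (rule order_tendstoI)
  fix a :: ennreal assume "0 < a"
  then obtain e where e: "0 < e" "ennreal (4 * e) \<le> a"
  proof (cases a)
    case (real r) then show ?thesis using \<open>0 < a\<close> that[of "r/4"] by auto
  next
    case top then show ?thesis using that[of 1] by auto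
  qed
  obtain g where g': "g \<in> borel_measurable borel" "(\<integral>\<^sup>+x. ennreal (norm (f x - g x)) \<partial>lborel) \<le> ennreal e" "(\<lambda>n. L1_shift g (z n)) \<longlonglongrightarrow> 0"
    using g[OF e(1)] by auto
  have "\<forall>\<^sub>F n in sequentially. L1_shift g (z n) < ennreal e"
    using order_tendstoD(2)[OF g'(3), of "ennreal e"] e by simp
  then show "\<forall>\<^sub>F n in sequentially. L1_shift f (z n) < a"
  proof eventually_elim
    case (elim n)
    have "L1_shift f (z n) \<le> ennreal e + 2 * ennreal e"
      using L1_shift_triangle[OF f g'(1), of "z n"] elim g'(2)
      by (meson add_mono le_less mult_left_mono order_trans zero_le)
    also have "\<dots> = ennreal (3 * e)"
    proof -
      have "2 * ennreal e = ennreal (2 * e)" using e by (simp add: ennreal_mult)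
      then show ?thesis using e by (simp flip: ennreal_plus)
    qed
    also have "\<dots> < ennreal (4 * e)" using e by (intro ennreal_lessI) auto
    finally show ?case using e(2) by simp
  qed
qed simp

text \<open>For \<open>x \<in> U\<close> also \<open>x + z \<in> U\<close> once \<open>z\<close> is small, so the part of \<open>U\<close> that leaves \<open>U\<close> under the
translation tends to zero by dominated convergence. The part entering \<open>U\<close> has the same volume, by
translation invariance.\<close>

lemma L1_shift_open_indicator:
  fixes U :: "'a::euclidean_space set" and c :: "'b::{banach, second_countable_topology}"
  assumes U: "open U" "emeasure lborel U < \<infinity>" and z: "z \<longlonglongrightarrow> 0"
  shows "(\<lambda>n. L1_shift (\<lambda>x. indicator U x *\<^sub>R c) (z n)) \<longlonglongrightarrow> 0"
proof -
  have [measurable]: "U \<in> sets borel" using U by auto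
  have i: "integrable lborel (indicator U :: 'a \<Rightarrow> real)" using U by (simp add: integrable_indicator_iff)
  have i': "integrable lborel (\<lambda>x. indicator U (x + y) :: real)" for y
    using integrable_lborel_shift[OF i] .
  define m where "m n x = max 0 (indicator U x - indicator U (x + z n) :: real)" for n x
  have mi: "integrable lborel (m n)" for n
    unfolding m_def by (intro integrable_max Bochner_Integration.integrable_diff i i') auto
  have lim: "(\<lambda>n. LINT x|lborel. m n x) \<longlonglongrightarrow> (LINT x|(lborel::'a measure). 0::real)"
  proof (rule integral_dominated_convergence[where w="indicator U"])
    show "AE x in lborel. (\<lambda>n. m n x) \<longlonglongrightarrow> 0"
    proof (intro AE_I2)
      fix x
      show "(\<lambda>n. m n x) \<longlonglongrightarrow> 0"
      proof (cases "x \<in> U")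
        case True
        have "(\<lambda>n. x + z n) \<longlonglongrightarrow> x + 0" by (intro tendsto_intros z)
        then have "\<forall>\<^sub>F n in sequentially. x + z n \<in> U"
          using U(1) True by (auto simp: tendsto_def)
        then have "\<forall>\<^sub>F n in sequentially. m n x = 0"
          by eventually_elim (auto simp: m_def indicator_def)
        then show ?thesis by (rule tendsto_eventually)
      next
        case False
        then show ?thesis by (simp add: m_def)
      qed
    qed
  qed (auto simp: m_def i indicator_def mi[unfolded m_def])
  have eq: "L1_shift (\<lambda>x. indicator U x *\<^sub>R c) (z n) = ennreal (norm c * (2 * (LINT x|lborel. m n x)))" for n
  proof -
    \<comment> \<open>\<open>\<bar>s - t\<bar> = s - t + 2 max 0 (t - s)\<close>; the integral of \<open>s - t\<close> vanishes.\<close>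
    have "norm (indicator U (x + z n) *\<^sub>R c - indicator U x *\<^sub>R c) =
       norm c * (indicator U (x + z n) - indicator U x + 2 * m n x)" for x
      by (auto simp: m_def indicator_def)
    then have "L1_shift (\<lambda>x. indicator U x *\<^sub>R c) (z n) =
       (\<integral>\<^sup>+x. ennreal (norm c * (indicator U (x + z n) - indicator U x + 2 * m n x)) \<partial>lborel)"
      by (simp add: L1_shift_def)
    also have "\<dots> = ennreal (LINT x|lborel. norm c * (indicator U (x + z n) - indicator U x + 2 * m n x))"
      by (intro nn_integral_eq_integral AE_I2 integrable_mult_right Bochner_Integration.integrable_add Bochner_Integration.integrable_diff i i' mi)
         (auto simp: m_def indicator_def)
    also have "(LINT x|lborel. norm c * (indicator U (x + z n) - indicator U x + 2 * m n x)) =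
        norm c * ((LINT x|lborel. indicator U (x + z n)) - (LINT x|lborel. indicator U x) + 2 * (LINT x|lborel. m n x))"
      using i i' mi by simp
    also have "(LINT x|lborel. indicator U (x + z n) :: real) = (LINT x|lborel. indicator U x)"
      by (rule integral_lborel_shift) auto
    finally show ?thesis by simp
  qed
  have "(\<lambda>n. ennreal (norm c * (2 * (LINT x|lborel. m n x)))) \<longlonglongrightarrow> ennreal (norm c * (2 * 0))"
    using lim by (intro tendsto_intros) auto
  then show ?thesis by (simp add: eq)
qed

text \<open>Continuity of translations in \<open>L\<^sup>1\<close>, by approximation: Borel sets of finite measure are
approximated by open sets from outside, integrable functions by simple ones.\<close>

proposition L1_shift_tendsto_0:
  fixes g :: "'a::euclidean_space \<Rightarrow> 'b::{banach, second_countable_topology}"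
  assumes "integrable lborel g" and z: "z \<longlonglongrightarrow> 0"
  shows "(\<lambda>n. L1_shift g (z n)) \<longlonglongrightarrow> 0"
  using assms(1)
proof induction
  case (base A c)
  have [measurable]: "A \<in> sets borel" using base by simp
  show ?case
  proof (rule L1_shift_approx[OF _ z])
    fix e :: real assume "e > 0"
    then have "0 < e / (1 + norm c)" by (simp add: add_pos_nonneg)
    then obtain U where U: "open U" "A \<subseteq> U" "emeasure lborel (U - A) < ennreal (e / (1 + norm c))"
      using outer_regular_lborel[of A "e / (1 + norm c)"] by auto
    have [measurable]: "U \<in> sets borel" using U by auto
    have "emeasure lborel U \<le> emeasure lborel A + emeasure lborel (U - A)"
      using U(2) emeasure_subadditive[of A lborel "U - A"] by (simp add: Un_absorb1)
    also have "\<dots> < \<infinity>" using base U(3) by (auto simp: less_top[symmetric] intro: ennreal_less_top dest: less_trans)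
    finally have fin: "emeasure lborel U < \<infinity>" .
    have "(\<integral>\<^sup>+x. ennreal (norm (indicator A x *\<^sub>R c - indicator U x *\<^sub>R c)) \<partial>lborel) =
      (\<integral>\<^sup>+x. ennreal (norm c) * indicator (U - A) x \<partial>lborel)"
      using U(2) by (intro nn_integral_cong) (auto simp: indicator_def)
    also have "\<dots> = ennreal (norm c) * emeasure lborel (U - A)"
      by (simp add: nn_integral_cmult_indicator)
    also have "\<dots> \<le> ennreal (norm c) * ennreal (e / (1 + norm c))"
      using U(3) by (intro mult_left_mono) auto
    also have "\<dots> = ennreal (norm c * (e / (1 + norm c)))"
      using \<open>e > 0\<close> by (intro ennreal_mult[symmetric]) auto
    also have "\<dots> \<le> ennreal e"
      using \<open>e > 0\<close> by (intro ennreal_leI) (simp add: field_simps add_pos_nonneg)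
    finally show "\<exists>g. g \<in> borel_measurable borel \<and> (\<integral>\<^sup>+x. ennreal (norm (indicator A x *\<^sub>R c - g x)) \<partial>lborel) \<le> ennreal e \<and> (\<lambda>n. L1_shift g (z n)) \<longlonglongrightarrow> 0"
      using L1_shift_open_indicator[OF U(1) fin z, of c] by (intro exI[of _ "\<lambda>x. indicator U x *\<^sub>R c"]) auto
  qed simp
next
  case (add f g)
  have [measurable]: "f \<in> borel_measurable borel" "g \<in> borel_measurable borel" using add by auto
  have le: "L1_shift (\<lambda>x. f x + g x) y \<le> L1_shift f y + L1_shift g y" for y
  proof -
    have "L1_shift (\<lambda>x. f x + g x) y \<le> (\<integral>\<^sup>+x. ennreal (norm (f (x + y) - f x)) + ennreal (norm (g (x + y) - g x)) \<partial>lborel)"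
      unfolding L1_shift_def
      by (intro nn_integral_mono) (simp add: norm_diff_triangle_ineq flip: ennreal_plus)
    then show ?thesis by (simp add: nn_integral_add L1_shift_def)
  qed
  have "(\<lambda>n. L1_shift f (z n) + L1_shift g (z n)) \<longlonglongrightarrow> 0 + 0"
    by (intro tendsto_add add.IH)
  then have "(\<lambda>n. L1_shift f (z n) + L1_shift g (z n)) \<longlonglongrightarrow> 0" by simp
  from tendsto_sandwich[OF _ _ tendsto_const this] show ?case
    using le by (simp add: always_eventually)
next
  case (lim f s)
  have [measurable]: "f \<in> borel_measurable borel"
    using borel_measurable_integrable[OF lim.hyps(4)] by simp
  have [measurable]: "s i \<in> borel_measurable borel" for i
    using borel_measurable_integrable[OF lim.hyps(1)[of i]] by simp
  show ?case
  proof (rule L1_shift_approx[OF _ z])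
    fix e :: real assume "e > 0"
    have "(\<lambda>i. \<integral>\<^sup>+x. norm (f x - s i x) \<partial>lborel) \<longlonglongrightarrow> (\<integral>\<^sup>+x. 0 \<partial>(lborel::'a measure))"
    proof (rule nn_integral_dominated_convergence[where w="\<lambda>x. ennreal (3 * norm (f x))"])
      show "AE x in lborel. ennreal (norm (f x - s j x)) \<le> ennreal (3 * norm (f x))" for j
      proof (intro AE_I2 ennreal_leI)
        fix x
        show "norm (f x - s j x) \<le> 3 * norm (f x)"
          using lim.hyps(3)[of x j] norm_triangle_ineq4[of "f x" "s j x"] by simp
      qed
      show "(\<integral>\<^sup>+x. ennreal (3 * norm (f x)) \<partial>lborel) < \<infinity>"
        using lim.hyps(4) by (simp add: ennreal_mult integrable_iff_bounded nn_integral_cmult ennreal_mult_less_top)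
      show "AE x in lborel. (\<lambda>i. ennreal (norm (f x - s i x))) \<longlonglongrightarrow> 0"
      proof (intro AE_I2)
        fix x
        have "(\<lambda>i. ennreal (norm (f x - s i x))) \<longlonglongrightarrow> ennreal (norm (f x - f x))"
          using lim.hyps(2)[of x] by (intro tendsto_intros) auto
        then show "(\<lambda>i. ennreal (norm (f x - s i x))) \<longlonglongrightarrow> 0" by simp
      qed
    qed auto
    then have "(\<lambda>i. \<integral>\<^sup>+x. norm (f x - s i x) \<partial>lborel) \<longlonglongrightarrow> 0" by simp
    then have "\<forall>\<^sub>F i in sequentially. (\<integral>\<^sup>+x. norm (f x - s i x) \<partial>lborel) < ennreal e"
      using \<open>e > 0\<close> by (auto dest: order_tendstoD(2)[where a="ennreal e"])
    then obtain i where "(\<integral>\<^sup>+x. norm (f x - s i x) \<partial>lborel) < ennreal e"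
      by (auto simp: eventually_sequentially)
    then show "\<exists>g. g \<in> borel_measurable borel \<and> (\<integral>\<^sup>+x. ennreal (norm (f x - g x)) \<partial>lborel) \<le> ennreal e \<and> (\<lambda>n. L1_shift g (z n)) \<longlonglongrightarrow> 0"
      using lim.IH[of i] by (intro exI[of _ "s i"]) auto
  qed simp
qed

section \<open>Weak limits from convex minimization\<close>

text \<open>Completeness of \<open>L\<^sup>1\<close>: a subsequence converges almost everywhere, and Fatou's lemma shows that its
limit is the \<open>L\<^sup>1\<close> limit of the whole sequence.\<close>

lemma L1_Cauchy_imp_limit:
  fixes s :: "nat \<Rightarrow> 'a \<Rightarrow> real"
  assumes s: "\<And>n. integrable M (s n)"
    and Cauchy: "\<And>e. e > 0 \<Longrightarrow> \<exists>N. \<forall>i\<ge>N. \<forall>j\<ge>N. (LINT x|M. norm (s i x - s j x)) < e"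
  obtains f where "integrable M f" "(\<lambda>n. LINT x|M. norm (s n x - f x)) \<longlonglongrightarrow> 0"
proof -
  have [measurable]: "s n \<in> borel_measurable M" for n using s by auto
  obtain r where r: "strict_mono r" "AE x in M. Cauchy (\<lambda>i. s (r i) x)"
    using cauchy_L1_AE_cauchy_subseq[OF s Cauchy] by blast
  define f where "f x = lim (\<lambda>i. s (r i) x)" for x
  have f[measurable]: "f \<in> borel_measurable M"
    unfolding f_def by (rule borel_measurable_lim_metric) simp
  have ae: "AE x in M. (\<lambda>i. s (r i) x) \<longlonglongrightarrow> f x"
    using r(2) by eventually_elim (simp add: f_def Cauchy_convergent_iff convergent_LIMSEQ_iff)
  have key: "(\<integral>\<^sup>+x. ennreal (norm (s n x - f x)) \<partial>M) \<le> ennreal e"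
    if N: "\<forall>i\<ge>N. \<forall>j\<ge>N. (LINT x|M. norm (s i x - s j x)) < e" and n: "n \<ge> N" for e N n
  proof -
    have "(\<integral>\<^sup>+x. ennreal (norm (s n x - f x)) \<partial>M) = (\<integral>\<^sup>+x. liminf (\<lambda>i. ennreal (norm (s n x - s (r i) x))) \<partial>M)"
    proof (rule nn_integral_cong_AE)
      show "AE x in M. ennreal (norm (s n x - f x)) = liminf (\<lambda>i. ennreal (norm (s n x - s (r i) x)))"
        using ae
      proof eventually_elim
        case (elim x)
        have "(\<lambda>i. ennreal (norm (s n x - s (r i) x))) \<longlonglongrightarrow> ennreal (norm (s n x - f x))"
          by (intro tendsto_intros elim)
        then show ?case by (rule lim_imp_Liminf[OF trivial_limit_sequentially, symmetric])
      qed
    qed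
    also have "\<dots> \<le> liminf (\<lambda>i. \<integral>\<^sup>+x. ennreal (norm (s n x - s (r i) x)) \<partial>M)"
      by (rule nn_integral_liminf) auto
    also have "\<dots> \<le> ennreal e"
    proof -
      have "\<forall>\<^sub>F i in sequentially. (\<integral>\<^sup>+x. ennreal (norm (s n x - s (r i) x)) \<partial>M) \<le> ennreal e"
        unfolding eventually_sequentially
      proof (intro exI[of _ N] allI impI)
        fix i assume "N \<le> i"
        then have "N \<le> r i" using seq_suble[OF r(1), of i] by linarith
        then have "(LINT x|M. norm (s n x - s (r i) x)) \<le> e" using N n less_imp_le by blast
        moreover have "(\<integral>\<^sup>+x. ennreal (norm (s n x - s (r i) x)) \<partial>M) = ennreal (LINT x|M. norm (s n x - s (r i) x))"
          using s by (intro nn_integral_eq_integral) auto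
        ultimately show "(\<integral>\<^sup>+x. ennreal (norm (s n x - s (r i) x)) \<partial>M) \<le> ennreal e" by (simp add: ennreal_leI)
      qed
      then have "liminf (\<lambda>i. \<integral>\<^sup>+x. ennreal (norm (s n x - s (r i) x)) \<partial>M) \<le> liminf (\<lambda>i::nat. ennreal e)"
        by (rule Liminf_mono)
      then show ?thesis by (simp add: Liminf_const)
    qed
    finally show ?thesis .
  qed
  have int: "integrable M f"
  proof -
    obtain N where N: "\<forall>i\<ge>N. \<forall>j\<ge>N. (LINT x|M. norm (s i x - s j x)) < 1" using Cauchy[of 1] by auto
    have "integrable M (\<lambda>x. s N x - f x)"
      using key[OF N order_refl] by (auto simp: integrable_iff_bounded intro: le_less_trans)
    from Bochner_Integration.integrable_diff[OF s[of N] this] show ?thesis by simp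
  qed
  have "(\<lambda>n. LINT x|M. norm (s n x - f x)) \<longlonglongrightarrow> 0"
  proof (rule LIMSEQ_I)
    fix e :: real assume "e > 0"
    then obtain N where N: "\<forall>i\<ge>N. \<forall>j\<ge>N. (LINT x|M. norm (s i x - s j x)) < e / 2" using Cauchy[of "e/2"] by auto
    have "norm ((LINT x|M. norm (s n x - f x)) - 0) < e" if "n \<ge> N" for n
    proof -
      have "(\<integral>\<^sup>+x. ennreal (norm (s n x - f x)) \<partial>M) = ennreal (LINT x|M. norm (s n x - f x))"
        using s int by (intro nn_integral_eq_integral) auto
      then have "(LINT x|M. norm (s n x - f x)) \<le> e / 2"
        using key[OF N that] \<open>e > 0\<close> by (simp add: ennreal_le_iff)
      then show ?thesis using \<open>e > 0\<close> by (simp add: integral_nonneg_AE)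
    qed
    then show "\<exists>N. \<forall>n\<ge>N. norm ((LINT x|M. norm (s n x - f x)) - 0) < e" by blast
  qed
  with int show ?thesis by (rule that)
qed

text \<open>Near-minimizers \<open>H n\<close> of \<open>J\<close> on a decreasing sequence of midpoint-convex sets. The infima over
\<open>C n\<close> increase and are bounded, so they converge; as the midpoint of \<open>H m\<close> and \<open>H n\<close> lies in
\<open>C (min m n)\<close>, its value cannot be much smaller than the average of the two values. For a uniformly
convex \<open>J\<close> this forces \<open>H m\<close> and \<open>H n\<close> to be close.\<close>

lemma midpoint_minimizing_sequence:
  fixes J :: "'c \<Rightarrow> real" and mid :: "'c \<Rightarrow> 'c \<Rightarrow> 'c" and C :: "nat \<Rightarrow> 'c set"
  assumes mid: "\<And>n a b. a \<in> C n \<Longrightarrow> b \<in> C n \<Longrightarrow> mid a b \<in> C n"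
    and dec: "\<And>m n. m \<le> n \<Longrightarrow> C n \<subseteq> C m"
    and lb: "\<And>a. a \<in> C 0 \<Longrightarrow> L \<le> J a" and ub: "\<And>n. \<exists>a\<in>C n. J a \<le> U"
  obtains H where "\<And>n. H n \<in> C n"
    "\<And>n a. a \<in> C n \<Longrightarrow> J (H n) \<le> J a + 1 / real (Suc n)"
    "\<And>e. e > 0 \<Longrightarrow> \<exists>N. \<forall>m\<ge>N. \<forall>n\<ge>N. (J (H m) + J (H n)) / 2 - J (mid (H m) (H n)) < e"
proof -
  define I where "I n = Inf (J ` C n)" for n
  have C0: "a \<in> C n \<Longrightarrow> a \<in> C 0" for a n using dec[of 0 n] by auto
  have bdd: "bdd_below (J ` C n)" for n using lb C0 by (auto simp: bdd_below_def)
  have ne: "J ` C n \<noteq> {}" for n using ub[of n] by auto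
  have I_le: "a \<in> C n \<Longrightarrow> I n \<le> J a" for a n unfolding I_def using bdd by (auto intro: cInf_lower)
  have "\<exists>a\<in>C n. J a < I n + 1 / real (Suc n)" for n
    using cInf_lessD[OF ne, of n "I n + 1 / real (Suc n)"] by (auto simp: I_def)
  then obtain H where H: "\<And>n. H n \<in> C n" "\<And>n. J (H n) < I n + 1 / real (Suc n)" by metis
  have "I m \<le> I n" if "m \<le> n" for m n
    unfolding I_def using ne bdd dec[OF that] by (intro cInf_superset_mono) auto
  then have mono: "incseq I" by (simp add: incseq_def)
  moreover have "I n \<le> U" for n using ub[of n] I_le[of _ n] by force
  ultimately obtain l where "I \<longlonglongrightarrow> l" using incseq_convergent by blast
  then have "Cauchy I" by (simp add: LIMSEQ_imp_Cauchy)
  show ?thesis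
  proof (rule that[of H])
    show "J (H n) \<le> J a + 1 / real (Suc n)" if "a \<in> C n" for n a using H(2)[of n] I_le[OF that] by linarith
    fix e :: real assume "e > 0"
    obtain N1 where N1: "\<And>m n. m \<ge> N1 \<Longrightarrow> n \<ge> N1 \<Longrightarrow> \<bar>I m - I n\<bar> < e/2"
      using \<open>Cauchy I\<close> \<open>e > 0\<close> unfolding Cauchy_def dist_real_def by (metis half_gt_zero)
    obtain N2 where N2: "1 / real (Suc N2) < e/2" using \<open>e > 0\<close> nat_approx_posE[of "e/2"] by auto
    show "\<exists>N. \<forall>m\<ge>N. \<forall>n\<ge>N. (J (H m) + J (H n)) / 2 - J (mid (H m) (H n)) < e"
    proof (intro exI[of _ "max N1 N2"] allI impI)
      fix m n assume mn: "max N1 N2 \<le> m" "max N1 N2 \<le> n"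
      have inv: "1 / real (Suc k) \<le> 1 / real (Suc N2)" if "k \<ge> N2" for k
        using that by (intro divide_left_mono) auto
      have "mid (H m) (H n) \<in> C (min m n)"
        using H(1) dec by (intro mid) (meson min.cobounded1 min.cobounded2 subsetD)+
      then have "I (min m n) \<le> J (mid (H m) (H n))" by (rule I_le)
      moreover have "\<bar>I m - I (min m n)\<bar> < e/2" "\<bar>I n - I (min m n)\<bar> < e/2"
        using N1[of m "min m n"] N1[of n "min m n"] mn by auto
      ultimately show "(J (H m) + J (H n)) / 2 - J (mid (H m) (H n)) < e"
        using H(2)[of m] H(2)[of n] inv[of m] inv[of n] mn N2
        unfolding max.bounded_iff by argo
    qed
  qed (rule H(1))
qed

lemma integrable_mult_bounded_function:
  fixes f \<psi> :: "'a \<Rightarrow> real"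
  assumes f: "integrable M f" and \<psi>: "\<psi> \<in> borel_measurable M" and b: "\<And>x. \<bar>\<psi> x\<bar> \<le> b"
  shows "integrable M (\<lambda>x. f x * \<psi> x)"
proof (rule Bochner_Integration.integrable_bound)
  show "integrable M (\<lambda>x. b * f x)" using f by simp
  show "(\<lambda>x. f x * \<psi> x) \<in> borel_measurable M" using f \<psi> by auto
  show "AE x in M. norm (f x * \<psi> x) \<le> norm (b * f x)"
  proof (intro AE_I2)
    fix x
    have "\<bar>\<psi> x\<bar> \<le> \<bar>b\<bar>" using b[of x] by linarith
    then show "norm (f x * \<psi> x) \<le> norm (b * f x)"
      using mult_right_mono[of "\<bar>\<psi> x\<bar>" "\<bar>b\<bar>" "\<bar>f x\<bar>"] by (simp add: abs_mult mult.commute)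
  qed
qed

lemma L1_tendsto_integral_mult:
  fixes s :: "nat \<Rightarrow> 'a \<Rightarrow> real"
  assumes s: "\<And>n. integrable M (s n)" and H: "integrable M H" "(\<lambda>n. LINT x|M. norm (s n x - H x)) \<longlonglongrightarrow> 0"
    and \<psi>: "\<psi> \<in> borel_measurable M" and b: "\<And>x. \<bar>\<psi> x\<bar> \<le> b"
  shows "(\<lambda>n. LINT x|M. s n x * \<psi> x) \<longlonglongrightarrow> (LINT x|M. H x * \<psi> x)"
proof (rule LIM_zero_cancel, rule Lim_null_comparison)
  note b\<psi> = integrable_mult_bounded_function[OF _ \<psi> b]
  show "(\<lambda>n. b * (LINT x|M. norm (s n x - H x))) \<longlonglongrightarrow> 0"
    using tendsto_mult_left[OF H(2), of b] by simp
  show "\<forall>\<^sub>F n in sequentially. norm ((LINT x|M. s n x * \<psi> x) - (LINT x|M. H x * \<psi> x)) \<le> b * (LINT x|M. norm (s n x - H x))"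
  proof (intro always_eventually allI)
    fix n
    have i: "integrable M (\<lambda>x. s n x - H x)" using H(1) s by simp
    have "(LINT x|M. s n x * \<psi> x) - (LINT x|M. H x * \<psi> x) = (LINT x|M. (s n x - H x) * \<psi> x)"
      using b\<psi>[OF H(1)] b\<psi>[OF s] by (simp add: left_diff_distrib)
    also have "norm \<dots> \<le> (LINT x|M. norm ((s n x - H x) * \<psi> x))" by (rule integral_norm_bound)
    also have "\<dots> \<le> (LINT x|M. b * norm (s n x - H x))"
    proof (rule integral_mono)
      show "norm ((s n x - H x) * \<psi> x) \<le> b * norm (s n x - H x)" for x
        using mult_right_mono[OF b[of x], of "\<bar>s n x - H x\<bar>"] by (simp add: abs_mult mult.commute)
      show "integrable M (\<lambda>x. norm ((s n x - H x) * \<psi> x))" by (intro integrable_norm b\<psi> i)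
      show "integrable M (\<lambda>x. b * norm (s n x - H x))" by (intro integrable_mult_right integrable_norm i)
    qed
    also have "\<dots> = b * (LINT x|M. norm (s n x - H x))" by simp
    finally show "norm ((LINT x|M. s n x * \<psi> x) - (LINT x|M. H x * \<psi> x)) \<le> b * (LINT x|M. norm (s n x - H x))"
      by simp
  qed
qed

text \<open>Turns smallness of \<open>\<integral> t\<^sup>2\<close> on a finite measure space into smallness of \<open>\<integral> \<bar>t\<bar>\<close>.\<close>

lemma abs_le_plus_square: "\<eta> > 0 \<Longrightarrow> \<bar>t\<bar> \<le> \<eta> + t\<^sup>2 / (\<eta>::real)"
proof (cases "\<bar>t\<bar> \<le> \<eta>")
  case False
  assume "\<eta> > 0"
  then have "\<bar>t\<bar> * \<eta> \<le> \<bar>t\<bar> * \<bar>t\<bar>" using False by (intro mult_left_mono) auto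
  then show ?thesis using \<open>\<eta> > 0\<close> by (simp add: field_simps power2_eq_square) (smt (verit) mult_pos_pos)
qed (smt (verit) divide_nonneg_pos zero_le_power2)

lemma quadratic_nonneg_imp_zero:
  fixes A B :: real
  assumes "B \<ge> 0" and le: "\<And>t. 0 \<le> t * A + t\<^sup>2 * B"
  shows "A = 0"
proof -
  have "0 \<le> (- A / (B + 1)) * A + (- A / (B + 1))\<^sup>2 * B" by (rule le)
  also have "\<dots> = - (A / (B + 1))\<^sup>2"
    using assms(1) by (simp add: power2_eq_square divide_simps) (simp add: algebra_simps)
  finally show ?thesis using assms(1) by simp
qed

text \<open>A functional dominated by \<open>\<integral> \<bar>f\<bar> dM\<close> is also bounded with respect to the \<open>L\<^sup>2(M)\<close> norm, since \<open>M\<close> is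
finite, so it is represented as in the Riesz theorem: minimize \<open>J f = \<integral> f\<^sup>2/2 - T f\<close> over \<open>V\<close>. The
parallelogram identity makes a minimizing sequence Cauchy, and the vanishing first variation of \<open>J\<close> at
the limit \<open>H\<close> says that \<open>H\<close> represents \<open>T\<close>. Only convergence in \<open>L\<^sup>1(M)\<close> is recorded, which suffices as
the members of \<open>V\<close> are bounded.\<close>

lemma dominated_functional_representation:
  fixes V :: "('a \<Rightarrow> real) set" and T :: "('a \<Rightarrow> real) \<Rightarrow> real"
  assumes "finite_measure M"
    and meas: "\<And>f. f \<in> V \<Longrightarrow> f \<in> borel_measurable M" and bnd: "\<And>f. f \<in> V \<Longrightarrow> \<exists>c. \<forall>x. \<bar>f x\<bar> \<le> c"
    and V0: "(\<lambda>x. 0) \<in> V" and V: "\<And>f g c. f \<in> V \<Longrightarrow> g \<in> V \<Longrightarrow> (\<lambda>x. f x + c * g x) \<in> V"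
    and T: "\<And>f g c. f \<in> V \<Longrightarrow> g \<in> V \<Longrightarrow> T (\<lambda>x. f x + c * g x) = T f + c * T g"
    and dom: "\<And>f. f \<in> V \<Longrightarrow> \<bar>T f\<bar> \<le> c * (LINT x|M. \<bar>f x\<bar>)" and c: "c \<ge> 0"
  obtains H where "integrable M H" "\<And>f. f \<in> V \<Longrightarrow> T f = (LINT x|M. H x * f x)"
proof -
  interpret finite_measure M by fact
  have [measurable]: "\<And>f. f \<in> V \<Longrightarrow> f \<in> borel_measurable M" by fact
  have int: "integrable M f" if "f \<in> V" for f
  proof -
    obtain a where "\<forall>x. \<bar>f x\<bar> \<le> a" using bnd[OF \<open>f \<in> V\<close>] by blast
    then show ?thesis using meas[OF \<open>f \<in> V\<close>] by (intro integrable_const_bound[where B=a]) auto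
  qed
  have int2: "integrable M (\<lambda>x. f x * g x)" if fg: "f \<in> V" "g \<in> V" for f g
  proof -
    obtain a b where "\<forall>x. \<bar>f x\<bar> \<le> a" "\<forall>x. \<bar>g x\<bar> \<le> b" using bnd fg by meson
    then have "\<bar>f x * g x\<bar> \<le> a * b" for x unfolding abs_mult by (intro mult_mono) (auto intro: order_trans[OF abs_ge_zero])
    then show ?thesis using fg by (intro integrable_const_bound[where B="a*b"]) (auto simp: meas borel_measurable_times)
  qed
  have T0: "T (\<lambda>x. 0) = 0" using dom[OF V0] by simp
  have Vs: "(\<lambda>x. c * f x) \<in> V" and Ts: "T (\<lambda>x. c * f x) = c * T f" if "f \<in> V" for f c
    using V[OF V0 that, of c] T[OF V0 that, of c] by (auto simp: T0)
  define mid where "mid f g = (\<lambda>x. (f x + g x) / 2 :: real)" for f g :: "'a \<Rightarrow> real"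
  have mid_eq: "mid f g = (\<lambda>x. (1/2) * f x + (1/2) * g x)" for f g by (auto simp: mid_def)
  have mid: "mid f g \<in> V" and Tmid: "T (mid f g) = (T f + T g) / 2" if "f \<in> V" "g \<in> V" for f g
    using V[OF Vs[OF that(1), of "1/2"] that(2), of "1/2"] T[OF Vs[OF that(1), of "1/2"] that(2), of "1/2"]
      Ts[OF that(1), of "1/2"]
    by (auto simp: mid_eq)
  define J where "J f = (LINT x|M. f x * f x) / 2 - T f" for f
  have lb: "- (c\<^sup>2 * measure M (space M) / 2) \<le> J f" if "f \<in> V" for f
  proof -
    have "(LINT x|M. - (c\<^sup>2 / 2)) \<le> (LINT x|M. f x * f x / 2 - c * \<bar>f x\<bar>)"
    proof (rule integral_mono)
      fix x
      have "0 \<le> (\<bar>f x\<bar> - c)\<^sup>2" by simp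
      then show "- (c\<^sup>2 / 2) \<le> f x * f x / 2 - c * \<bar>f x\<bar>" by (simp add: power2_eq_square algebra_simps abs_mult_self_eq)
    qed (use that int int2 in auto)
    also have "\<dots> = (LINT x|M. f x * f x) / 2 - c * (LINT x|M. \<bar>f x\<bar>)" using that int int2 by simp
    finally show ?thesis using dom[OF that] unfolding J_def by (simp add: mult.commute)
  qed
  obtain \<phi> where \<phi>: "\<And>n. \<phi> n \<in> V" "\<And>n a. a \<in> V \<Longrightarrow> J (\<phi> n) \<le> J a + 1 / real (Suc n)"
    and defect: "\<And>e. e > 0 \<Longrightarrow> \<exists>N. \<forall>m\<ge>N. \<forall>n\<ge>N. (J (\<phi> m) + J (\<phi> n)) / 2 - J (mid (\<phi> m) (\<phi> n)) < e"
    using midpoint_minimizing_sequence[of "\<lambda>_. V" mid "- (c\<^sup>2 * measure M (space M) / 2)" J "J (\<lambda>x. 0)"] mid lb V0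
    by (metis order_refl)
  have d_eq: "(J f + J g) / 2 - J (mid f g) = (LINT x|M. (f x - g x)\<^sup>2) / 8" if fg: "f \<in> V" "g \<in> V" for f g
  proof -
    have 1: "(LINT x|M. mid f g x * mid f g x) = ((LINT x|M. f x * f x) + 2 * (LINT x|M. f x * g x) + (LINT x|M. g x * g x)) / 4"
    proof -
      have "(LINT x|M. mid f g x * mid f g x) = (LINT x|M. (f x * f x + 2 * (f x * g x) + g x * g x) / 4)"
        by (simp add: mid_def field_simps)
      then show ?thesis using int2 fg by simp
    qed
    have 2: "(LINT x|M. (f x - g x)\<^sup>2) = (LINT x|M. f x * f x) - 2 * (LINT x|M. f x * g x) + (LINT x|M. g x * g x)"
    proof -
      have "(LINT x|M. (f x - g x)\<^sup>2) = (LINT x|M. f x * f x - 2 * (f x * g x) + g x * g x)"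
        by (simp add: power2_eq_square algebra_simps)
      then show ?thesis using int2 fg by simp
    qed
    show ?thesis unfolding J_def 1 2 Tmid[OF fg] by (simp add: field_simps)
  qed
  have Cauchy: "\<exists>N. \<forall>i\<ge>N. \<forall>j\<ge>N. (LINT x|M. norm (\<phi> i x - \<phi> j x)) < e" if e0: "e > 0" for e
  proof -
    \<comment> \<open>The summand \<open>1\<close> keeps the denominator of \<open>\<eta>\<close> positive when \<open>M\<close> is the null measure.\<close>
    define m0 where "m0 = measure M (space M) + 1"
    have m0: "m0 > 0" "measure M (space M) < m0" by (auto simp: m0_def add_nonneg_pos)
    define \<eta> where "\<eta> = e / (2 * m0)"
    have \<eta>: "\<eta> > 0" using m0 that by (simp add: \<eta>_def)
    obtain N where N: "\<forall>m\<ge>N. \<forall>n\<ge>N. (J (\<phi> m) + J (\<phi> n)) / 2 - J (mid (\<phi> m) (\<phi> n)) < \<eta> * e / 16"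
      using defect[of "\<eta> * e / 16"] \<eta> e0 by (meson divide_pos_pos mult_pos_pos zero_less_numeral)
    have "(LINT x|M. norm (\<phi> i x - \<phi> j x)) < e" if ij: "i \<ge> N" "j \<ge> N" for i j
    proof -
      have sq: "integrable M (\<lambda>x. (\<phi> i x - \<phi> j x)\<^sup>2)"
      proof -
        have "integrable M (\<lambda>x. \<phi> i x * \<phi> i x - 2 * (\<phi> i x * \<phi> j x) + \<phi> j x * \<phi> j x)"
          using \<phi>(1) int2 by simp
        then show ?thesis by (simp add: power2_eq_square algebra_simps)
      qed
      have "(LINT x|M. norm (\<phi> i x - \<phi> j x)) \<le> (LINT x|M. \<eta> + (\<phi> i x - \<phi> j x)\<^sup>2 / \<eta>)"
        using \<phi>(1) int sq abs_le_plus_square[OF \<eta>] by (intro integral_mono) auto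
      also have "\<dots> = \<eta> * measure M (space M) + (LINT x|M. (\<phi> i x - \<phi> j x)\<^sup>2) / \<eta>"
        using sq by (simp add: mult.commute)
      also have "\<dots> < \<eta> * m0 + (\<eta> * e / 2) / \<eta>"
      proof (rule add_strict_mono)
        show "\<eta> * measure M (space M) < \<eta> * m0" using m0 \<eta> by simp
        have "(LINT x|M. (\<phi> i x - \<phi> j x)\<^sup>2) / 8 < \<eta> * e / 16"
          using N ij d_eq[OF \<phi>(1) \<phi>(1)] by metis
        then show "(LINT x|M. (\<phi> i x - \<phi> j x)\<^sup>2) / \<eta> < (\<eta> * e / 2) / \<eta>" using \<eta> by (intro divide_strict_right_mono) auto
      qed
      also have "\<dots> = e" using \<eta> m0 by (simp add: \<eta>_def)
      finally show ?thesis .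
    qed
    then show ?thesis by blast
  qed
  obtain H where H: "integrable M H" "(\<lambda>n. LINT x|M. norm (\<phi> n x - H x)) \<longlonglongrightarrow> 0"
    using L1_Cauchy_imp_limit[OF int[OF \<phi>(1)] Cauchy] by blast
  show ?thesis
  proof (rule that[OF H(1)])
    fix \<psi> assume \<psi>: "\<psi> \<in> V"
    obtain b where b: "\<forall>x. \<bar>\<psi> x\<bar> \<le> b" using bnd[OF \<psi>] by blast
    have lim: "(\<lambda>n. LINT x|M. \<phi> n x * \<psi> x) \<longlonglongrightarrow> (LINT x|M. H x * \<psi> x)"
      using L1_tendsto_integral_mult[OF int[OF \<phi>(1)] H meas[OF \<psi>] b[rule_format]] .
    \<comment> \<open>Comparison of \<open>J\<close> at the near-minimizer \<open>\<phi> n\<close> with \<open>J\<close> at \<open>\<phi> n + t \<psi>\<close>, in the limit.\<close>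
    have ineq: "0 \<le> t * ((LINT x|M. H x * \<psi> x) - T \<psi>) + t\<^sup>2 * ((LINT x|M. \<psi> x * \<psi> x) / 2)" for t
    proof (rule LIMSEQ_le)
      show "(\<lambda>n. - (1 / real (Suc n))) \<longlonglongrightarrow> 0"
        using tendsto_minus[OF LIMSEQ_inverse_real_of_nat] by (simp add: inverse_eq_divide)
      show "(\<lambda>n. t * ((LINT x|M. \<phi> n x * \<psi> x) - T \<psi>) + t\<^sup>2 * ((LINT x|M. \<psi> x * \<psi> x) / 2)) \<longlonglongrightarrow>
        t * ((LINT x|M. H x * \<psi> x) - T \<psi>) + t\<^sup>2 * ((LINT x|M. \<psi> x * \<psi> x) / 2)"
        by (intro tendsto_intros lim)
      have "- (1 / real (Suc n)) \<le> t * ((LINT x|M. \<phi> n x * \<psi> x) - T \<psi>) + t\<^sup>2 * ((LINT x|M. \<psi> x * \<psi> x) / 2)" for n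
      proof -
        have "(LINT x|M. (\<phi> n x + t * \<psi> x) * (\<phi> n x + t * \<psi> x)) =
           (LINT x|M. \<phi> n x * \<phi> n x + (2 * t) * (\<phi> n x * \<psi> x) + t\<^sup>2 * (\<psi> x * \<psi> x))"
          by (intro Bochner_Integration.integral_cong) (auto simp: power2_eq_square algebra_simps)
        also have "\<dots> = (LINT x|M. \<phi> n x * \<phi> n x) + (2 * t) * (LINT x|M. \<phi> n x * \<psi> x) + t\<^sup>2 * (LINT x|M. \<psi> x * \<psi> x)"
          using int2 \<phi>(1) \<psi> by simp
        finally have "J (\<lambda>x. \<phi> n x + t * \<psi> x) = J (\<phi> n) + t * ((LINT x|M. \<phi> n x * \<psi> x) - T \<psi>) + t\<^sup>2 * ((LINT x|M. \<psi> x * \<psi> x) / 2)"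
          unfolding J_def T[OF \<phi>(1) \<psi>] by (simp add: algebra_simps add_divide_distrib)
        then show ?thesis using \<phi>(2)[OF V[OF \<phi>(1) \<psi>], of n n t] by linarith
      qed
      then show "\<exists>N. \<forall>n\<ge>N. - (1 / real (Suc n)) \<le> t * ((LINT x|M. \<phi> n x * \<psi> x) - T \<psi>) + t\<^sup>2 * ((LINT x|M. \<psi> x * \<psi> x) / 2)"
        by blast
    qed
    show "T \<psi> = (LINT x|M. H x * \<psi> x)"
      using quadratic_nonneg_imp_zero[OF _ ineq] by (simp add: integral_nonneg_AE)
  qed
qed

text \<open>Closure under midpoints is all the convexity that the minimization below requires, and it comes with an
induction rule in place of convex combinations.\<close>

inductive_set midpoint_hull :: "('a \<Rightarrow> real) set \<Rightarrow> ('a \<Rightarrow> real) set" for S where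
  base: "f \<in> S \<Longrightarrow> f \<in> midpoint_hull S"
| mid: "f \<in> midpoint_hull S \<Longrightarrow> g \<in> midpoint_hull S \<Longrightarrow> (\<lambda>x. (f x + g x) / 2) \<in> midpoint_hull S"

lemma midpoint_hull_mono: "S \<subseteq> T \<Longrightarrow> midpoint_hull S \<subseteq> midpoint_hull T"
proof
  fix f assume "S \<subseteq> T" "f \<in> midpoint_hull S"
  from this(2,1) show "f \<in> midpoint_hull T"
    by induction (auto intro: midpoint_hull.intros)
qed

lemma powr_midpoint_le:
  fixes a b p :: real
  assumes "p \<ge> 1"
  shows "\<bar>(a + b) / 2\<bar> powr p \<le> (\<bar>a\<bar> powr p + \<bar>b\<bar> powr p) / 2"
proof -
  have half: "(y / 2) powr p \<le> y powr p / 2" if "y \<ge> 0" for y :: real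
  proof -
    have "2 powr 1 \<le> 2 powr p" using assms by (intro powr_mono) auto
    then show ?thesis using that by (simp only: powr_divide) (rule frac_le, auto)
  qed
  have "((\<bar>a\<bar> + \<bar>b\<bar>) / 2) powr p \<le> (\<bar>a\<bar> powr p + \<bar>b\<bar> powr p) / 2"
  proof (cases "a = 0 \<or> b = 0")
    case True then show ?thesis using half[of "\<bar>a\<bar>"] half[of "\<bar>b\<bar>"] by auto
  next
    case False
    then show ?thesis
      using convex_onD[OF powr_convex[OF assms], of "1/2" "\<bar>a\<bar>" "\<bar>b\<bar>"] by (simp add: field_simps)
  qed
  moreover have "\<bar>(a + b) / 2\<bar> powr p \<le> ((\<bar>a\<bar> + \<bar>b\<bar>) / 2) powr p"
    using assms by (intro powr_mono2) auto
  ultimately show ?thesis by linarith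
qed

lemma le_one_plus_powr: "p \<ge> 1 \<Longrightarrow> \<bar>a\<bar> \<le> 1 + \<bar>a\<bar> powr (p::real)"
proof (cases "\<bar>a\<bar> \<le> 1")
  case False
  assume "p \<ge> 1"
  then have "\<bar>a\<bar> powr 1 \<le> \<bar>a\<bar> powr p" using False by (intro powr_mono) auto
  then show ?thesis using False by simp
qed (smt (verit) powr_ge_zero)

text \<open>The midpoint defect of \<open>t \<mapsto> sqrt (1 + t\<^sup>2)\<close>, a strictly convex function of linear growth.\<close>

definition sqrt_defect :: "real \<Rightarrow> real \<Rightarrow> real" where
  "sqrt_defect a b = (sqrt (1 + a\<^sup>2) + sqrt (1 + b\<^sup>2)) / 2 - sqrt (1 + ((a + b) / 2)\<^sup>2)"

text \<open>With \<open>s\<close>, \<open>t\<close>, \<open>m\<close> the three square roots, \<open>(s + t)\<^sup>2 - 4 m\<^sup>2 = 2 (s t - (1 + a b))\<close> and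
\<open>(s t)\<^sup>2 - (1 + a b)\<^sup>2 = (a - b)\<^sup>2\<close>. Dividing by the sum of the roots in each identity links the defect
to \<open>(a - b)\<^sup>2\<close>.\<close>

lemma sqrt_defect_bounds:
  shows "0 \<le> sqrt_defect a b"
    and "\<bar>a\<bar> \<le> R \<Longrightarrow> \<bar>b\<bar> \<le> R \<Longrightarrow> (a - b)\<^sup>2 \<le> 8 * (1 + R\<^sup>2)\<^sup>2 * sqrt_defect a b"
proof -
  define s t m where "s = sqrt (1 + a\<^sup>2)" and "t = sqrt (1 + b\<^sup>2)" and "m = sqrt (1 + ((a + b) / 2)\<^sup>2)"
  have s: "s\<^sup>2 = 1 + a\<^sup>2" "s \<ge> 1" and t: "t\<^sup>2 = 1 + b\<^sup>2" "t \<ge> 1" and m: "m\<^sup>2 = 1 + ((a + b) / 2)\<^sup>2" "m \<ge> 1"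
    by (auto simp: s_def t_def m_def)
  have st1: "1 \<le> s * t" using s t by (metis mult_mono' mult_1 zero_le_one order_trans)
  have id1: "(s * t)\<^sup>2 - (1 + a * b)\<^sup>2 = (a - b)\<^sup>2"
    by (simp add: power_mult_distrib s t) (simp add: power2_eq_square algebra_simps)
  then have "(1 + a * b)\<^sup>2 \<le> (s * t)\<^sup>2" by (smt (verit) zero_le_power2)
  then have ab: "\<bar>1 + a * b\<bar> \<le> s * t" using st1 by (simp add: abs_le_square_iff[symmetric])
  have id2: "(s + t)\<^sup>2 - 4 * m\<^sup>2 = 2 * (s * t - (1 + a * b))"
    by (simp add: power2_sum s t m) (simp add: power2_eq_square algebra_simps)
  have d: "sqrt_defect a b = (s + t) / 2 - m" by (simp add: sqrt_defect_def s_def t_def m_def)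
  have id3: "((s + t) / 2 - m) * (s + t + 2 * m) * 2 = (s + t)\<^sup>2 - 4 * m\<^sup>2"
    by (simp add: power2_eq_square field_simps)
  have pos: "0 < s + t + 2 * m" using s t m by simp
  have "0 \<le> ((s + t) / 2 - m) * (s + t + 2 * m) * 2" unfolding id3 id2 using ab by simp
  then show nonneg: "0 \<le> sqrt_defect a b" using pos d by (simp add: zero_le_mult_iff)
  assume R: "\<bar>a\<bar> \<le> R" "\<bar>b\<bar> \<le> R"
  have aR: "a\<^sup>2 \<le> R\<^sup>2" "b\<^sup>2 \<le> R\<^sup>2" using R by (metis abs_le_square_iff abs_of_nonneg abs_ge_zero order_trans)+
  define Q where "Q = 1 + R\<^sup>2"
  have Q: "Q \<ge> 1" by (simp add: Q_def)
  have sQ: "s \<le> Q" "t \<le> Q"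
    using aR s t unfolding Q_def by (smt (verit) power2_eq_square mult_le_cancel_left1)+
  have stQ: "s * t \<le> Q"
  proof -
    have "(s - t)\<^sup>2 \<ge> 0" by simp
    then have "2 * (s * t) \<le> s\<^sup>2 + t\<^sup>2" by (simp add: power2_diff)
    then show ?thesis using aR by (simp add: s t Q_def)
  qed
  have mQ: "2 * m \<le> s + t" using nonneg d by simp
  have "(a - b)\<^sup>2 = (s * t - (1 + a * b)) * (s * t + (1 + a * b))"
    unfolding id1[symmetric] by (simp add: power2_eq_square algebra_simps)
  also have "\<dots> \<le> (s * t - (1 + a * b)) * (2 * Q)"
    using ab stQ by (intro mult_left_mono) auto
  also have "s * t - (1 + a * b) = sqrt_defect a b * (s + t + 2 * m)"
  proof -
    have "y = x" if "x * 2 = 2 * y" for x y :: real using that by simp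
    from this[OF trans[OF id3 id2]] show ?thesis unfolding d .
  qed
  also have "sqrt_defect a b * (s + t + 2 * m) * (2 * Q) \<le> (sqrt_defect a b * (4 * Q)) * (2 * Q)"
    using nonneg Q sQ mQ by (intro mult_right_mono mult_left_mono) auto
  also have "\<dots> = 8 * Q\<^sup>2 * sqrt_defect a b" by (simp add: power2_eq_square)
  finally show "(a - b)\<^sup>2 \<le> 8 * (1 + R\<^sup>2)\<^sup>2 * sqrt_defect a b" unfolding Q_def .
qed

text \<open>Where \<open>a\<close> and \<open>b\<close> are at most \<open>R\<close>, uniform convexity controls the difference; elsewhere it is
absorbed by the \<open>p\<close>-th powers with the small factor \<open>R powr (1 - p)\<close>. This is the place where \<open>p > 1\<close>
enters.\<close>

lemma abs_diff_le_defect: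
  fixes a b p R \<eta> :: real
  assumes p: "1 < p" and \<eta>: "\<eta> > 0" and R: "R > 0"
  shows "\<bar>a - b\<bar> \<le> \<eta> + 8 * (1 + R\<^sup>2)\<^sup>2 / \<eta> * sqrt_defect a b + 2 / R powr (p - 1) * (\<bar>a\<bar> powr p + \<bar>b\<bar> powr p)"
proof -
  have n1: "0 \<le> 8 * (1 + R\<^sup>2)\<^sup>2 / \<eta> * sqrt_defect a b" using \<eta> sqrt_defect_bounds(1) by simp
  have n2: "0 \<le> 2 / R powr (p - 1) * (\<bar>a\<bar> powr p + \<bar>b\<bar> powr p)" by simp
  show ?thesis
  proof (cases "\<bar>a\<bar> \<le> R \<and> \<bar>b\<bar> \<le> R")
    case True
    have "\<bar>a - b\<bar> \<le> \<eta> + (a - b)\<^sup>2 / \<eta>" using abs_le_plus_square[OF \<eta>] .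
    also have "(a - b)\<^sup>2 / \<eta> \<le> 8 * (1 + R\<^sup>2)\<^sup>2 * sqrt_defect a b / \<eta>"
      using sqrt_defect_bounds(2)[of a R b] True \<eta> by (intro divide_right_mono) auto
    also have "8 * (1 + R\<^sup>2)\<^sup>2 * sqrt_defect a b / \<eta> = 8 * (1 + R\<^sup>2)\<^sup>2 / \<eta> * sqrt_defect a b" by simp
    finally show ?thesis using n2 by linarith
  next
    case False
    define c where "c = max \<bar>a\<bar> \<bar>b\<bar>"
    have c: "R < c" "\<bar>a\<bar> \<le> c" "\<bar>b\<bar> \<le> c" using False by (auto simp: c_def)
    have "R powr (p - 1) \<le> c powr (p - 1)" using c R p by (intro powr_mono2) auto
    then have "c * R powr (p - 1) \<le> c * c powr (p - 1)" using c R by (intro mult_left_mono) auto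
    also have "\<dots> = c powr p" using c R by (simp add: powr_mult_base)
    also have "\<dots> \<le> \<bar>a\<bar> powr p + \<bar>b\<bar> powr p" by (auto simp: c_def max_def)
    finally have "c \<le> (\<bar>a\<bar> powr p + \<bar>b\<bar> powr p) / R powr (p - 1)" using R by (simp add: field_simps)
    moreover have "\<bar>a - b\<bar> \<le> 2 * c" using c by linarith
    moreover have "2 / R powr (p - 1) * (\<bar>a\<bar> powr p + \<bar>b\<bar> powr p) = 2 * ((\<bar>a\<bar> powr p + \<bar>b\<bar> powr p) / R powr (p - 1))"
      by simp
    ultimately have "\<bar>a - b\<bar> \<le> 2 / R powr (p - 1) * (\<bar>a\<bar> powr p + \<bar>b\<bar> powr p)" by linarith
    then show ?thesis using n1 \<eta> by linarith
  qed
qed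

text \<open>Weak sequential compactness of bounded sets in \<open>L\<^sup>p\<close>, in the form of one function \<open>H\<close> that computes every
limit of \<open>\<integral> G n \<phi>\<close> that happens to exist. Near-minimizers \<open>\<phi> n\<close> of \<open>\<integral> sqrt (1 + f\<^sup>2)\<close> on the midpoint hulls
of the tails \<open>{G n, G (n + 1), \<dots>}\<close> converge in \<open>L\<^sup>1\<close> to some \<open>H\<close>, and a convergent sequence
of integrals has the same limit along elements of these hulls.\<close>

proposition Lp_bounded_imp_weak_limit:
  fixes G :: "nat \<Rightarrow> 'a \<Rightarrow> real"
  assumes "finite_measure M" and p: "1 < p"
    and G[measurable]: "\<And>n. G n \<in> borel_measurable M"
    and Gint: "\<And>n. integrable M (\<lambda>x. \<bar>G n x\<bar> powr p)"
    and GB: "\<And>n. (LINT x|M. \<bar>G n x\<bar> powr p) \<le> B"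
  obtains H where "integrable M H"
    "\<And>\<phi> c T. \<phi> \<in> borel_measurable M \<Longrightarrow> (\<And>x. \<bar>\<phi> x\<bar> \<le> c) \<Longrightarrow> (\<lambda>n. LINT x|M. G n x * \<phi> x) \<longlonglongrightarrow> T
       \<Longrightarrow> (LINT x|M. H x * \<phi> x) = T"
proof -
  interpret finite_measure M by fact
  define C where "C n = midpoint_hull (G ` {n..})" for n
  define mid where "mid f g = (\<lambda>x. (f x + g x) / 2 :: real)" for f g :: "'a \<Rightarrow> real"
  define J where "J f = (LINT x|M. sqrt (1 + (f x)\<^sup>2))" for f
  define good where "good f \<longleftrightarrow> f \<in> borel_measurable M \<and> integrable M (\<lambda>x. \<bar>f x\<bar> powr p) \<and> (LINT x|M. \<bar>f x\<bar> powr p) \<le> B" for f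
  have good_mid: "good (mid f g)" if fg: "good f" "good g" for f g
  proof -
    have m[measurable]: "f \<in> borel_measurable M" "g \<in> borel_measurable M" using fg by (auto simp: good_def)
    have le: "\<bar>mid f g x\<bar> powr p \<le> (\<bar>f x\<bar> powr p + \<bar>g x\<bar> powr p) / 2" for x
      using p powr_midpoint_le[of p] by (simp add: mid_def)
    have i: "integrable M (\<lambda>x. (\<bar>f x\<bar> powr p + \<bar>g x\<bar> powr p) / 2)" using fg by (simp add: good_def)
    have [measurable]: "mid f g \<in> borel_measurable M" by (simp add: mid_def)
    have i2: "integrable M (\<lambda>x. \<bar>mid f g x\<bar> powr p)"
      using le by (intro Bochner_Integration.integrable_bound[OF i]) (auto intro!: AE_I2)
    have "(LINT x|M. \<bar>mid f g x\<bar> powr p) \<le> (LINT x|M. (\<bar>f x\<bar> powr p + \<bar>g x\<bar> powr p) / 2)"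
      by (rule integral_mono[OF i2 i le])
    also have "\<dots> = ((LINT x|M. \<bar>f x\<bar> powr p) + (LINT x|M. \<bar>g x\<bar> powr p)) / 2" using fg by (simp add: good_def)
    also have "\<dots> \<le> B" using fg by (simp add: good_def)
    finally show ?thesis using i2 by (simp add: good_def)
  qed
  have C_good: "good f" if "f \<in> C n" for f n
    using that unfolding C_def
  proof induction
    case (base f) then show ?case using G Gint GB by (auto simp: good_def)
  next
    case (mid f g) then show ?case using good_mid[of f g] by (simp add: mid_def)
  qed
  have C_mid: "mid f g \<in> C n" if "f \<in> C n" "g \<in> C n" for f g n
    using that unfolding C_def mid_def by (rule midpoint_hull.mid)
  have C_dec: "C n \<subseteq> C m" if "m \<le> n" for m n
    unfolding C_def using that by (intro midpoint_hull_mono) auto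
  have int: "integrable M f" if "good f" for f
  proof (rule Bochner_Integration.integrable_bound)
    show "integrable M (\<lambda>x. 1 + \<bar>f x\<bar> powr p)" using that by (simp add: good_def)
    show "AE x in M. norm (f x) \<le> norm (1 + \<bar>f x\<bar> powr p)"
      using le_one_plus_powr[of p] p by (intro AE_I2) (simp add: abs_of_nonneg)
  qed (use that in \<open>simp add: good_def\<close>)
  have sqrt_le: "sqrt (1 + t\<^sup>2) \<le> 1 + \<bar>t\<bar>" for t :: real
    by (rule real_le_lsqrt) (auto simp: power2_eq_square algebra_simps)
  have intJ: "integrable M (\<lambda>x. sqrt (1 + (f x)\<^sup>2))" if "good f" for f
  proof (rule Bochner_Integration.integrable_bound)
    show "integrable M (\<lambda>x. 1 + \<bar>f x\<bar>)" using int[OF that] by simp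
    show "AE x in M. norm (sqrt (1 + (f x)\<^sup>2)) \<le> norm (1 + \<bar>f x\<bar>)"
      using sqrt_le by (intro AE_I2) (simp add: abs_of_nonneg)
    have [measurable]: "f \<in> borel_measurable M" using that by (simp add: good_def)
    show "(\<lambda>x. sqrt (1 + (f x)\<^sup>2)) \<in> borel_measurable M" by measurable
  qed
  have ub: "\<exists>a\<in>C n. J a \<le> 2 * measure M (space M) + B" for n
  proof
    show "G n \<in> C n" unfolding C_def by (intro midpoint_hull.base) auto
    then have g: "good (G n)" by (rule C_good)
    have "J (G n) \<le> (LINT x|M. 2 + \<bar>G n x\<bar> powr p)" unfolding J_def
    proof (rule integral_mono[OF intJ[OF g]])
      show "sqrt (1 + (G n x)\<^sup>2) \<le> 2 + \<bar>G n x\<bar> powr p" for x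
        using sqrt_le[of "G n x"] le_one_plus_powr[of p "G n x"] p by linarith
    qed (use g in \<open>simp add: good_def\<close>)
    also have "\<dots> = 2 * measure M (space M) + (LINT x|M. \<bar>G n x\<bar> powr p)" using g by (simp add: good_def)
    finally show "J (G n) \<le> 2 * measure M (space M) + B" using GB[of n] by linarith
  qed
  have lb: "0 \<le> J a" for a unfolding J_def by (simp add: integral_nonneg_AE)
  obtain \<phi> where \<phi>: "\<And>n. \<phi> n \<in> C n"
    and defect: "\<And>e. e > 0 \<Longrightarrow> \<exists>N. \<forall>m\<ge>N. \<forall>n\<ge>N. (J (\<phi> m) + J (\<phi> n)) / 2 - J (mid (\<phi> m) (\<phi> n)) < e"
    by (rule midpoint_minimizing_sequence[of C mid 0 J "2 * measure M (space M) + B"])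
      (erule (1) C_mid | erule C_dec | rule lb | rule ub | (rule that; assumption))+
  note \<phi>g = C_good[OF \<phi>]
  have d_eq: "(J f + J g) / 2 - J (mid f g) = (LINT x|M. sqrt_defect (f x) (g x))"
    and d_int: "integrable M (\<lambda>x. sqrt_defect (f x) (g x))" if fg: "good f" "good g" for f g
    using intJ[OF fg(1)] intJ[OF fg(2)] intJ[OF good_mid[OF fg]] by (auto simp: J_def sqrt_defect_def mid_def)
  have B0: "0 \<le> B" using GB[of 0] by (rule order_trans[rotated]) (simp add: integral_nonneg_AE)
  have Cauchy: "\<exists>N. \<forall>i\<ge>N. \<forall>j\<ge>N. (LINT x|M. norm (\<phi> i x - \<phi> j x)) < e" if e0: "e > 0" for e
  proof -
    \<comment> \<open>The summand \<open>1\<close> keeps the denominator of \<open>\<eta>\<close> positive when \<open>M\<close> is the null measure.\<close>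
    define m0 where "m0 = measure M (space M) + 1"
    have m0: "m0 > 0" "measure M (space M) < m0" by (auto simp: m0_def add_nonneg_pos)
    define \<eta> where "\<eta> = e / (3 * m0)"
    have \<eta>: "\<eta> > 0" using m0 e0 by (simp add: \<eta>_def)
    \<comment> \<open>With this \<open>R\<close> the tail term of the previous estimate is at most \<open>4 B e / (12 B + 1)\<close>.\<close>
    define R where "R = ((12 * B + 1) / e) powr (1 / (p - 1))"
    have R: "R > 0" "R powr (p - 1) = (12 * B + 1) / e"
      using p B0 e0 by (auto simp: R_def powr_powr)
    define K where "K = 8 * (1 + R\<^sup>2)\<^sup>2 / \<eta>"
    have "0 < 1 + R\<^sup>2" by (simp add: add_pos_nonneg)
    then have K: "K > 0" using \<eta> by (simp add: K_def)
    obtain N where N: "\<forall>m\<ge>N. \<forall>n\<ge>N. (J (\<phi> m) + J (\<phi> n)) / 2 - J (mid (\<phi> m) (\<phi> n)) < e / (3 * K)"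
      using defect[of "e / (3 * K)"] K e0 by auto
    have "(LINT x|M. norm (\<phi> i x - \<phi> j x)) < e" if ij: "i \<ge> N" "j \<ge> N" for i j
    proof -
      have gi: "integrable M (\<lambda>x. \<bar>\<phi> i x\<bar> powr p)" "(LINT x|M. \<bar>\<phi> i x\<bar> powr p) \<le> B"
        and gj: "integrable M (\<lambda>x. \<bar>\<phi> j x\<bar> powr p)" "(LINT x|M. \<bar>\<phi> j x\<bar> powr p) \<le> B"
        using \<phi>g by (auto simp: good_def)
      have "(LINT x|M. norm (\<phi> i x - \<phi> j x)) \<le>
        (LINT x|M. \<eta> + K * sqrt_defect (\<phi> i x) (\<phi> j x) + 2 / R powr (p - 1) * (\<bar>\<phi> i x\<bar> powr p + \<bar>\<phi> j x\<bar> powr p))"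
        using abs_diff_le_defect[OF p \<eta> R(1)] gi gj d_int[OF \<phi>g \<phi>g] int[OF \<phi>g]
        by (intro integral_mono) (auto simp: K_def)
      also have "\<dots> = \<eta> * measure M (space M) + K * (LINT x|M. sqrt_defect (\<phi> i x) (\<phi> j x)) +
         2 / R powr (p - 1) * ((LINT x|M. \<bar>\<phi> i x\<bar> powr p) + (LINT x|M. \<bar>\<phi> j x\<bar> powr p))"
        using gi gj d_int[OF \<phi>g \<phi>g] by simp
      also have "\<dots> < e / 3 + e / 3 + e / 3"
      proof (rule add_less_le_mono[OF add_strict_mono])
        show "\<eta> * measure M (space M) < e / 3"
          using mult_strict_left_mono[OF m0(2) \<eta>] m0(1) by (simp add: \<eta>_def)
        have "(LINT x|M. sqrt_defect (\<phi> i x) (\<phi> j x)) < e / (3 * K)"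
          using N ij d_eq[OF \<phi>g \<phi>g] by metis
        then show "K * (LINT x|M. sqrt_defect (\<phi> i x) (\<phi> j x)) < e / 3" using K by (simp add: field_simps)
        have "2 / R powr (p - 1) * ((LINT x|M. \<bar>\<phi> i x\<bar> powr p) + (LINT x|M. \<bar>\<phi> j x\<bar> powr p)) \<le> 2 / R powr (p - 1) * (2 * B)"
          using gi gj by (intro mult_left_mono) auto
        also have "\<dots> \<le> e / 3" unfolding R(2) using B0 e0 by (simp add: field_simps)
        finally show "2 / R powr (p - 1) * ((LINT x|M. \<bar>\<phi> i x\<bar> powr p) + (LINT x|M. \<bar>\<phi> j x\<bar> powr p)) \<le> e / 3" .
      qed
      finally show ?thesis by simp
    qed
    then show ?thesis by blast
  qed
  obtain H where H: "integrable M H" "(\<lambda>n. LINT x|M. norm (\<phi> n x - H x)) \<longlonglongrightarrow> 0"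
    using L1_Cauchy_imp_limit[OF int[OF \<phi>g] Cauchy] by blast
  show ?thesis
  proof (rule that[OF H(1)])
    fix \<psi> c T assume \<psi>: "\<psi> \<in> borel_measurable M" "\<And>x. \<bar>\<psi> x\<bar> \<le> c" and T: "(\<lambda>n. LINT x|M. G n x * \<psi> x) \<longlonglongrightarrow> T"
    have lim: "(\<lambda>n. LINT x|M. \<phi> n x * \<psi> x) \<longlonglongrightarrow> (LINT x|M. H x * \<psi> x)"
      by (rule L1_tendsto_integral_mult[OF int[OF \<phi>g] H \<psi>])
    have "(\<lambda>n. LINT x|M. \<phi> n x * \<psi> x) \<longlonglongrightarrow> T"
    proof (rule LIMSEQ_I)
      fix e :: real assume "e > 0"
      then obtain N where N: "\<And>n. n \<ge> N \<Longrightarrow> norm ((LINT x|M. G n x * \<psi> x) - T) < e"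
        using LIMSEQ_D[OF T] by blast
      have "\<bar>(LINT x|M. f x * \<psi> x) - T\<bar> < e" if "f \<in> C n" "n \<ge> N" for f n
        using that(1) C_good[OF that(1)] unfolding C_def
      proof induction
        case (base f) then show ?case using N that(2) by auto
      next
        case (mid f g)
        have g: "good f" "good g" using mid.hyps C_good unfolding C_def by auto
        have "(LINT x|M. (f x + g x) / 2 * \<psi> x) = (LINT x|M. (f x * \<psi> x + g x * \<psi> x) / 2)"
          by (simp add: algebra_simps)
        also have "\<dots> = ((LINT x|M. f x * \<psi> x) + (LINT x|M. g x * \<psi> x)) / 2"
          using g[THEN int] integrable_mult_bounded_function[OF _ \<psi>] by simp
        finally have eq: "(LINT x|M. (f x + g x) / 2 * \<psi> x) - T =
          (((LINT x|M. f x * \<psi> x) - T) + ((LINT x|M. g x * \<psi> x) - T)) / 2" by (simp only:) simp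
        have "\<bar>(a + b) / 2\<bar> < e" if "\<bar>a\<bar> < e" "\<bar>b\<bar> < e" for a b
          using that abs_triangle_ineq[of a b] by simp
        from this[OF mid.IH(1)[OF g(1)] mid.IH(2)[OF g(2)]] show ?case unfolding eq .
      qed
      then show "\<exists>N. \<forall>n\<ge>N. norm ((LINT x|M. \<phi> n x * \<psi> x) - T) < e" using \<phi> by (auto intro!: exI[of _ N])
    qed
    then show "(LINT x|M. H x * \<psi> x) = T" using lim LIMSEQ_unique by blast
  qed
qed

section \<open>Metric outer measures\<close>

lemma suminf_tail_small:
  fixes f :: "nat \<Rightarrow> ennreal"
  assumes fin: "(\<Sum>i. f i) < \<infinity>" and "e > 0"
  shows "\<exists>n. (\<Sum>i. f (i + n)) < ennreal e"
proof -
  have fi: "f i < \<infinity>" for i using fin by (metis ennreal_suminf_lessD infinity_ennreal_def)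
  define r where "r i = enn2real (f i)" for i
  have fr: "f i = ennreal (r i)" for i using fi[of i] by (simp add: r_def)
  have r0: "0 \<le> r i" for i by (simp add: r_def)
  have "summable r" using fin r0 unfolding fr by (simp add: suminf_ennreal_eq summable_suminf_not_top less_top[symmetric])
  then obtain N where N: "\<And>n. n \<ge> N \<Longrightarrow> norm (\<Sum>i. r (i + n)) < e" using suminf_exist_split[OF \<open>e > 0\<close>] by blast
  have "(\<Sum>i. f (i + N)) = ennreal (\<Sum>i. r (i + N))"
    unfolding fr using \<open>summable r\<close> r0 by (intro suminf_ennreal2) auto
  also have "\<dots> < ennreal e" using N[of N] by (intro ennreal_lessI) (use \<open>e > 0\<close> in auto)
  finally show ?thesis by blast
qed

text \<open>Caratheodory's criterion. Let \<open>B k\<close> be the points of \<open>A\<close> at distance at least \<open>1/(k+1)\<close> from \<open>F\<close>. Then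
\<open>\<mu> (A \<inter> F) + \<mu> (B k) \<le> \<mu> A\<close> by additivity on separated sets, and \<open>\<mu> (B k)\<close> tends to \<open>\<mu> (A - F)\<close>: the
shells \<open>R k\<close> between consecutive distances satisfy \<open>\<Sum> \<mu> (R k) \<le> 2 \<mu> A\<close>, because shells whose
indices have the same parity are separated from each other.\<close>

proposition metric_outer_measure_closed:
  fixes \<mu> :: "'a::metric_space set \<Rightarrow> ennreal"
  assumes outer: "outer_measure_space UNIV \<mu>"
    and sep: "\<And>A B d. 0 < d \<Longrightarrow> (\<And>x y. x \<in> A \<Longrightarrow> y \<in> B \<Longrightarrow> d \<le> dist x y) \<Longrightarrow> \<mu> A + \<mu> B \<le> \<mu> (A \<union> B)"
    and F: "closed F"
  shows "F \<in> lambda_system UNIV UNIV \<mu>"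
proof -
  have mono: "A \<subseteq> B \<Longrightarrow> \<mu> A \<le> \<mu> B" for A B
    using outer by (auto simp: outer_measure_space_def increasing_def)
  have empty: "\<mu> {} = 0" using outer by (auto simp: outer_measure_space_def positive_def)
  have csub: "\<mu> (\<Union>i. A i) \<le> (\<Sum>i. \<mu> (A i))" for A :: "nat \<Rightarrow> 'a set"
  proof -
    have "\<mu> (\<Union>i. A i) = \<mu> (\<Union>i. disjointed A i)" by (simp add: UN_disjointed_eq)
    also have "\<dots> \<le> (\<Sum>i. \<mu> (disjointed A i))"
      using outer disjoint_family_disjointed[of A] by (simp add: outer_measure_space_def countably_subadditive_def)
    also have "\<dots> \<le> (\<Sum>i. \<mu> (A i))" by (intro suminf_le mono disjointed_subset) auto
    finally show ?thesis .
  qed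
  have sub: "\<mu> (A \<union> B) \<le> \<mu> A + \<mu> B" for A B
  proof -
    have "\<mu> (A \<union> B) = \<mu> (\<Union>i. binaryset A B i)" by (simp add: UN_binaryset_eq)
    also have "\<dots> \<le> (\<Sum>i. \<mu> (binaryset A B i))" by (rule csub)
    also have "\<dots> = \<mu> A + \<mu> B" by (simp add: suminf_binaryset_eq empty)
    finally show ?thesis .
  qed
  have key: "\<mu> (A \<inter> F) + \<mu> (A - F) \<le> \<mu> A" if F0: "F \<noteq> {}" for A
  proof (cases "\<mu> A = \<infinity>")
    case False
    define g where "g x = infdist x F" for x
    define B where "B k = {x \<in> A. 1 / real (Suc k) \<le> g x}" for k
    define R where "R k = {x \<in> A. 1 / real (Suc (Suc k)) \<le> g x \<and> g x < 1 / real (Suc k)}" for k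
    have lip: "g x \<le> g y + dist x y" for x y unfolding g_def by (rule infdist_triangle)
    have gpos: "0 < g x" if "x \<notin> F" for x
      using F F0 that unfolding g_def by (metis infdist_pos_not_in_closed)
    have ABk: "\<mu> (A \<inter> F) + \<mu> (B k) \<le> \<mu> A" for k
    proof -
      have "\<mu> (A \<inter> F) + \<mu> (B k) \<le> \<mu> ((A \<inter> F) \<union> B k)"
      proof (rule sep)
        show "0 < 1 / real (Suc k)" by simp
        fix x y assume "x \<in> A \<inter> F" "y \<in> B k"
        then show "1 / real (Suc k) \<le> dist x y"
          using lip[of y x] by (simp add: B_def g_def dist_commute)
      qed
      also have "\<dots> \<le> \<mu> A" by (intro mono) (auto simp: B_def)
      finally show ?thesis .
    qed
    have sepR: "d \<le> dist x y" if "x \<in> R j" "y \<in> R k" "Suc (Suc j) \<le> k" "d = 1 / real (Suc (Suc j)) - 1 / real (Suc (Suc (Suc j)))" for x y j k d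
    proof -
      have "1 / real (Suc k) \<le> 1 / real (Suc (Suc (Suc j)))" using that(3) by (intro divide_left_mono) auto
      then show ?thesis using that(1,2,4) lip[of x y] by (simp add: R_def)
    qed
    have sum_sep: "(\<Sum>i<n. \<mu> (R (2 * i + c))) \<le> \<mu> (\<Union>i<n. R (2 * i + c))" for n c
    proof (induction n)
      case (Suc n)
      show ?case
      proof (cases n)
        case (Suc m)
        have "(\<Sum>i<Suc n. \<mu> (R (2 * i + c))) \<le> \<mu> (\<Union>i<n. R (2 * i + c)) + \<mu> (R (2 * n + c))"
          using Suc.IH by (simp add: add_right_mono)
        also have "\<dots> \<le> \<mu> ((\<Union>i<n. R (2 * i + c)) \<union> R (2 * n + c))"
        proof (rule sep)
          define l where "l = 2 * m + c"
          show "0 < 1 / real (Suc (Suc l)) - 1 / real (Suc (Suc (Suc l)))"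
            using divide_strict_left_mono[of "real (Suc (Suc l))" "real (Suc (Suc (Suc l)))" 1] by simp
          fix x y assume xy: "x \<in> (\<Union>i<n. R (2 * i + c))" "y \<in> R (2 * n + c)"
          then obtain i where i: "i < n" "x \<in> R (2 * i + c)" by auto
          have "1 / real (Suc (Suc l)) \<le> 1 / real (Suc (Suc (2 * i + c)))"
            using i(1) Suc by (intro divide_left_mono) (auto simp: l_def)
          then have "1 / real (Suc (Suc l)) \<le> g x" using i(2) by (simp add: R_def)
          moreover have "1 / real (Suc (2 * n + c)) \<le> 1 / real (Suc (Suc (Suc l)))"
            using Suc by (intro divide_left_mono) (auto simp: l_def)
          then have "g y \<le> 1 / real (Suc (Suc (Suc l)))" using xy(2) by (simp add: R_def)
          ultimately show "1 / real (Suc (Suc l)) - 1 / real (Suc (Suc (Suc l))) \<le> dist x y"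
            using lip[of x y] by linarith
        qed
        also have "(\<Union>i<n. R (2 * i + c)) \<union> R (2 * n + c) = (\<Union>i<Suc n. R (2 * i + c))"
          by (auto simp: less_Suc_eq)
        finally show ?thesis .
      qed (simp add: lessThan_Suc)
    qed simp
    \<comment> \<open>Shells of even and of odd index are summed separately.\<close>
    have sum_le: "(\<Sum>i<n. \<mu> (R i)) \<le> 2 * \<mu> A" for n
    proof -
      have "(\<Sum>i<n. \<mu> (R i)) \<le> (\<Sum>i<2*n. \<mu> (R i))"
        by (rule sum_mono2) auto
      also have "\<dots> = (\<Sum>i<n. \<mu> (R (2 * i + 0))) + (\<Sum>i<n. \<mu> (R (2 * i + 1)))"
      proof (induction n)
        case (Suc n)
        have "{..<2 * Suc n} = insert (2 * n + 1) (insert (2 * n) {..<2 * n})" by auto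
        then show ?case using Suc by (simp add: add.assoc add.commute add.left_commute)
      qed simp
      also have "\<dots> \<le> \<mu> A + \<mu> A"
        by (intro add_mono order_trans[OF sum_sep] mono) (auto simp: R_def)
      finally show ?thesis by (simp add: mult_2)
    qed
    have "(\<Sum>i. \<mu> (R i)) \<le> 2 * \<mu> A" by (intro suminf_le_const) (use sum_le in auto)
    also have "\<dots> < \<infinity>" using False by (simp add: ennreal_mult_less_top less_top)
    finally have fin: "(\<Sum>i. \<mu> (R i)) < \<infinity>" .
    show ?thesis
    proof (rule ennreal_le_epsilon)
      fix e :: real assume "0 < e"
      then obtain n where n: "(\<Sum>i. \<mu> (R (i + n))) < ennreal e" using suminf_tail_small[OF fin] by blast
      have "A - F \<subseteq> B n \<union> (\<Union>i. R (i + n))"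
      proof
        fix x assume x: "x \<in> A - F"
        then have "0 < g x" using gpos by auto
        then obtain m where m: "1 / real (Suc m) < g x" using nat_approx_posE by blast
        define k where "k = (LEAST k. 1 / real (Suc k) \<le> g x)"
        have k: "1 / real (Suc k) \<le> g x" unfolding k_def
          by (rule LeastI[of "\<lambda>k. 1 / real (Suc k) \<le> g x" m]) (use m in simp)
        show "x \<in> B n \<union> (\<Union>i. R (i + n))"
        proof (cases "k \<le> n")
          case True
          then have "1 / real (Suc n) \<le> 1 / real (Suc k)" by (intro divide_left_mono) auto
          then show ?thesis using k x by (auto simp: B_def)
        next
          case False
          then obtain j where j: "k = Suc (j + n)" by (metis add.commute less_imp_Suc_add not_le)
          have "\<not> 1 / real (Suc (j + n)) \<le> g x"
            using not_less_Least[of "j + n" "\<lambda>k. 1 / real (Suc k) \<le> g x"] j unfolding k_def by simp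
          then have "x \<in> R (j + n)" using k x j by (auto simp: R_def)
          then show ?thesis by blast
        qed
      qed
      then have "\<mu> (A - F) \<le> \<mu> (B n) + \<mu> (\<Union>i. R (i + n))" using mono sub order_trans by blast
      also have "\<dots> \<le> \<mu> (B n) + ennreal e"
        using csub[of "\<lambda>i. R (i + n)"] n by (intro add_left_mono) auto
      finally have "\<mu> (A \<inter> F) + \<mu> (A - F) \<le> \<mu> (A \<inter> F) + (\<mu> (B n) + ennreal e)" by (rule add_left_mono)
      also have "\<dots> \<le> \<mu> A + ennreal e" using ABk[of n] by (simp add: add.assoc[symmetric] add_right_mono)
      finally show "\<mu> (A \<inter> F) + \<mu> (A - F) \<le> \<mu> A + ennreal e" .
    qed
  qed simp
  have key': "\<mu> (A \<inter> F) + \<mu> (A - F) \<le> \<mu> A" for A using key[of A] empty by (cases "F = {}") auto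
  have "\<mu> A \<le> \<mu> (A \<inter> F) + \<mu> (A - F)" for A using sub[of "A \<inter> F" "A - F"] by (simp add: Int_Diff_Un)
  then have eq: "\<mu> (A \<inter> F) + \<mu> (A - F) = \<mu> A" for A using key' by (simp add: antisym)
  have "\<mu> (F \<inter> A) + \<mu> ((UNIV - F) \<inter> A) = \<mu> A" for A
    using eq[of A] by (simp add: Int_commute Diff_eq Compl_eq_Diff_UNIV[symmetric])
  then show ?thesis by (simp add: lambda_system_def)
qed

corollary metric_outer_measure_borel:
  fixes \<mu> :: "'a::metric_space set \<Rightarrow> ennreal"
  assumes outer: "outer_measure_space UNIV \<mu>"
    and sep: "\<And>A B d. 0 < d \<Longrightarrow> (\<And>x y. x \<in> A \<Longrightarrow> y \<in> B \<Longrightarrow> d \<le> dist x y) \<Longrightarrow> \<mu> A + \<mu> B \<le> \<mu> (A \<union> B)"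
  shows "measure_space UNIV (sets borel) \<mu>"
proof -
  interpret sigma_algebra "UNIV :: 'a set" UNIV by (rule sigma_algebra_Pow[of UNIV, simplified])
  have ms: "measure_space UNIV (lambda_system UNIV UNIV \<mu>) \<mu>" by (rule caratheodory_lemma[OF outer])
  have closed_in: "Collect closed \<subseteq> lambda_system UNIV UNIV \<mu>"
    using metric_outer_measure_closed[OF outer] sep by blast
  have "sets borel \<subseteq> lambda_system UNIV UNIV \<mu>"
    unfolding borel_eq_closed
    using ms closed_in
    by (simp add: measure_space_def sigma_algebra.sigma_sets_subset)
  then show ?thesis
    by (rule measure_down[OF ms, rotated]) (metis sets.sigma_algebra_axioms space_borel)
qed

section \<open>Hausdorff measure\<close>

lemma hausdorff_premeasure_le:
  assumes "A \<subseteq> (\<Union>i. C i)" "\<And>i. bounded (C i)" "\<And>i. diameter (C i) \<le> \<delta>"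
  shows "hausdorff_premeasure s \<delta> A \<le> (\<Sum>i. hausdorff_weight s (C i))"
  unfolding hausdorff_premeasure_def using assms by (intro INF_lower) auto

lemma hausdorff_premeasure_greatest:
  assumes "\<And>C. A \<subseteq> (\<Union>i. C i) \<Longrightarrow> (\<And>i. bounded (C i)) \<Longrightarrow> (\<And>i. diameter (C i) \<le> \<delta>) \<Longrightarrow> c \<le> (\<Sum>i. hausdorff_weight s (C i))"
  shows "c \<le> hausdorff_premeasure s \<delta> A"
  unfolding hausdorff_premeasure_def using assms by (intro INF_greatest) auto

lemma hausdorff_premeasure_mono: "A \<subseteq> B \<Longrightarrow> hausdorff_premeasure s \<delta> A \<le> hausdorff_premeasure s \<delta> B"
  by (rule hausdorff_premeasure_greatest) (rule hausdorff_premeasure_le, auto)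

lemma hausdorff_premeasure_antimono: "\<delta> \<le> \<delta>' \<Longrightarrow> hausdorff_premeasure s \<delta>' A \<le> hausdorff_premeasure s \<delta> A"
  by (rule hausdorff_premeasure_greatest) (rule hausdorff_premeasure_le, auto intro: order_trans)

lemma hausdorff_premeasure_empty: "0 \<le> \<delta> \<Longrightarrow> hausdorff_premeasure s \<delta> {} = 0"
  using hausdorff_premeasure_le[of "{}" "\<lambda>_. {}" \<delta> s] by (simp add: hausdorff_weight_def)

lemma hausdorff_premeasure_le_outer: "0 < \<delta> \<Longrightarrow> hausdorff_premeasure s \<delta> A \<le> hausdorff_outer s A"
  unfolding hausdorff_outer_def by (rule SUP_upper) auto

lemma hausdorff_premeasure_countably_subadditive:
  fixes A :: "nat \<Rightarrow> 'a::metric_space set"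
  assumes \<delta>: "0 \<le> \<delta>"
  shows "hausdorff_premeasure s \<delta> (\<Union>i. A i) \<le> (\<Sum>i. hausdorff_premeasure s \<delta> (A i))"
proof (cases "(\<Sum>i. hausdorff_premeasure s \<delta> (A i)) = \<infinity>")
  case False
  then have fin: "hausdorff_premeasure s \<delta> (A i) < \<infinity>" for i
    by (metis ennreal_suminf_lessD infinity_ennreal_def less_top)
  show ?thesis
  proof (rule ennreal_le_epsilon)
    fix e :: real assume e: "0 < e"
    have "\<exists>C. A i \<subseteq> (\<Union>j. C j) \<and> (\<forall>j. bounded (C j) \<and> diameter (C j) \<le> \<delta>) \<and>
      (\<Sum>j. hausdorff_weight s (C j)) \<le> hausdorff_premeasure s \<delta> (A i) + ennreal (e * (1/2) ^ Suc i)" for i :: nat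
    proof -
      have "hausdorff_premeasure s \<delta> (A i) < hausdorff_premeasure s \<delta> (A i) + ennreal (e * (1/2) ^ Suc i)"
        using fin[of i] e by (simp add: ennreal_add_left_cancel_less[of _ 0, simplified])
      then show ?thesis unfolding hausdorff_premeasure_def[of s \<delta> "A i"] INF_less_iff by (auto intro: less_imp_le)
    qed
    then obtain C where C: "\<And>i. A i \<subseteq> (\<Union>j. C i j)" "\<And>i j. bounded (C i j)" "\<And>i j. diameter (C i j) \<le> \<delta>"
      "\<And>i. (\<Sum>j. hausdorff_weight s (C i j)) \<le> hausdorff_premeasure s \<delta> (A i) + ennreal (e * (1/2) ^ Suc i)"
      by metis
    have "hausdorff_premeasure s \<delta> (\<Union>i. A i) \<le> (\<Sum>n. hausdorff_weight s (case_prod C (prod_decode n)))"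
    proof (rule hausdorff_premeasure_le)
      show "(\<Union>i. A i) \<subseteq> (\<Union>n. case_prod C (prod_decode n))"
      proof
        fix x assume "x \<in> (\<Union>i. A i)"
        then obtain i j where "x \<in> C i j" using C(1) by blast
        then show "x \<in> (\<Union>n. case_prod C (prod_decode n))" by (intro UN_I[of "prod_encode (i, j)"]) auto
      qed
    qed (use C in \<open>auto split: prod.split\<close>)
    also have "\<dots> = (\<Sum>i j. hausdorff_weight s (C i j))"
      using suminf_ennreal_2dimen[of "\<lambda>i. \<Sum>j. hausdorff_weight s (C i j)" "\<lambda>(i,j). hausdorff_weight s (C i j)"]
      by (simp add: case_prod_beta comp_def)
    also have "\<dots> \<le> (\<Sum>i. hausdorff_premeasure s \<delta> (A i) + ennreal (e * (1/2) ^ Suc i))"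
      by (intro suminf_le C(4)) auto
    also have "\<dots> = (\<Sum>i. hausdorff_premeasure s \<delta> (A i)) + (\<Sum>i. ennreal (e * (1/2) ^ Suc i))"
      by (intro suminf_add[symmetric]) auto
    also have "(\<Sum>i. ennreal (e * (1/2) ^ Suc i)) = ennreal (e * 1)"
      using e by (intro suminf_ennreal_eq sums_mult power_half_series) auto
    finally show "hausdorff_premeasure s \<delta> (\<Union>i. A i) \<le> (\<Sum>i. hausdorff_premeasure s \<delta> (A i)) + ennreal e" by simp
  qed
qed simp

text \<open>A set of diameter at most \<open>\<delta> < d\<close> cannot meet both \<open>A\<close> and \<open>B\<close>, so each covering of the union splits into
coverings of the two parts.\<close>

lemma hausdorff_premeasure_separated:
  assumes "0 \<le> \<delta>" "\<delta> < d" and sep: "\<And>x y. x \<in> A \<Longrightarrow> y \<in> B \<Longrightarrow> d \<le> dist x y"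
  shows "hausdorff_premeasure s \<delta> A + hausdorff_premeasure s \<delta> B \<le> hausdorff_premeasure s \<delta> (A \<union> B)"
proof (rule hausdorff_premeasure_greatest)
  fix C :: "nat \<Rightarrow> 'a set"
  assume C: "A \<union> B \<subseteq> (\<Union>i. C i)" "\<And>i. bounded (C i)" "\<And>i. diameter (C i) \<le> \<delta>"
  define CA where "CA i = (if C i \<inter> A \<noteq> {} then C i else {})" for i
  define CB where "CB i = (if C i \<inter> A \<noteq> {} then {} else C i)" for i
  have no: "C i \<inter> B = {}" if "C i \<inter> A \<noteq> {}" for i
  proof (rule ccontr)
    assume "C i \<inter> B \<noteq> {}"
    then obtain x y where xy: "x \<in> C i" "x \<in> A" "y \<in> C i" "y \<in> B" using \<open>C i \<inter> A \<noteq> {}\<close> by auto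
    then have "dist x y \<le> \<delta>" using diameter_bounded_bound[OF C(2) xy(1,3)] C(3)[of i] by linarith
    then show False using sep[OF xy(2,4)] assms(2) by linarith
  qed
  have "hausdorff_premeasure s \<delta> A \<le> (\<Sum>i. hausdorff_weight s (CA i))"
  proof (rule hausdorff_premeasure_le)
    show "A \<subseteq> (\<Union>i. CA i)"
    proof
      fix x assume "x \<in> A"
      then obtain i where "x \<in> C i" using C(1) by blast
      then show "x \<in> (\<Union>i. CA i)" using \<open>x \<in> A\<close> by (intro UN_I[of i]) (auto simp: CA_def)
    qed
    show "bounded (CA i)" "diameter (CA i) \<le> \<delta>" for i
      using C(2)[of i] C(3)[of i] assms(1) by (simp_all add: CA_def)
  qed
  moreover have "hausdorff_premeasure s \<delta> B \<le> (\<Sum>i. hausdorff_weight s (CB i))"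
  proof (rule hausdorff_premeasure_le)
    show "B \<subseteq> (\<Union>i. CB i)"
    proof
      fix x assume "x \<in> B"
      then obtain i where "x \<in> C i" using C(1) by blast
      then show "x \<in> (\<Union>i. CB i)" using no[of i] \<open>x \<in> B\<close> by (intro UN_I[of i]) (auto simp: CB_def)
    qed
    show "bounded (CB i)" "diameter (CB i) \<le> \<delta>" for i
      using C(2)[of i] C(3)[of i] assms(1) by (simp_all add: CB_def)
  qed
  moreover have "(\<Sum>i. hausdorff_weight s (C i)) = (\<Sum>i. hausdorff_weight s (CA i)) + (\<Sum>i. hausdorff_weight s (CB i))"
  proof -
    have "hausdorff_weight s ({} :: 'a set) = 0" by (simp add: hausdorff_weight_def)
    then have "hausdorff_weight s (C i) = hausdorff_weight s (CA i) + hausdorff_weight s (CB i)" for i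
      by (simp add: CA_def CB_def)
    then show ?thesis by (simp add: suminf_add[symmetric])
  qed
  ultimately show "hausdorff_premeasure s \<delta> A + hausdorff_premeasure s \<delta> B \<le> (\<Sum>i. hausdorff_weight s (C i))"
    by (simp add: add_mono)
qed

lemma hausdorff_outer_space: "outer_measure_space UNIV (hausdorff_outer s :: 'a::metric_space set \<Rightarrow> ennreal)"
  unfolding outer_measure_space_def
proof (intro conjI)
  show "positive UNIV (hausdorff_outer s :: 'a set \<Rightarrow> ennreal)"
    unfolding positive_def hausdorff_outer_def by (auto simp: hausdorff_premeasure_empty)
  show "increasing UNIV (hausdorff_outer s :: 'a set \<Rightarrow> ennreal)"
    unfolding increasing_def hausdorff_outer_def by (auto intro!: SUP_mono hausdorff_premeasure_mono)
  show "countably_subadditive UNIV (hausdorff_outer s :: 'a set \<Rightarrow> ennreal)"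
    unfolding countably_subadditive_def hausdorff_outer_def[of s "\<Union>(range _)"]
  proof (intro allI impI SUP_least)
    fix A :: "nat \<Rightarrow> 'a set" and \<delta> :: real assume "\<delta> \<in> {0<..}"
    then have "0 < \<delta>" by simp
    then have "hausdorff_premeasure s \<delta> (\<Union>i. A i) \<le> (\<Sum>i. hausdorff_premeasure s \<delta> (A i))"
      by (intro hausdorff_premeasure_countably_subadditive) simp
    also have "\<dots> \<le> (\<Sum>i. hausdorff_outer s (A i))"
      using \<open>0 < \<delta>\<close> by (intro suminf_le hausdorff_premeasure_le_outer) auto
    finally show "hausdorff_premeasure s \<delta> (\<Union>i. A i) \<le> (\<Sum>i. hausdorff_outer s (A i))" .
  qed
qed

lemma hausdorff_outer_separated:
  assumes d: "0 < d" and sep: "\<And>x y. x \<in> A \<Longrightarrow> y \<in> B \<Longrightarrow> d \<le> dist x y"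
  shows "hausdorff_outer s A + hausdorff_outer s B \<le> hausdorff_outer s (A \<union> B)"
proof -
  have *: "hausdorff_premeasure s \<delta> A + hausdorff_premeasure s \<delta>' B \<le> hausdorff_outer s (A \<union> B)" if "\<delta> > 0" "\<delta>' > 0" for \<delta> \<delta>'
  proof -
    define \<epsilon> where "\<epsilon> = min (min \<delta> \<delta>') (d / 2)"
    have \<epsilon>: "0 < \<epsilon>" "\<epsilon> \<le> \<delta>" "\<epsilon> \<le> \<delta>'" "\<epsilon> < d" using that d by (auto simp: \<epsilon>_def)
    have "hausdorff_premeasure s \<delta> A + hausdorff_premeasure s \<delta>' B \<le> hausdorff_premeasure s \<epsilon> A + hausdorff_premeasure s \<epsilon> B"
      using \<epsilon> by (intro add_mono hausdorff_premeasure_antimono)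
    also have "\<dots> \<le> hausdorff_premeasure s \<epsilon> (A \<union> B)" using \<epsilon> sep by (intro hausdorff_premeasure_separated[of _ d]) auto
    also have "\<dots> \<le> hausdorff_outer s (A \<union> B)" by (rule hausdorff_premeasure_le_outer) (rule \<epsilon>)
    finally show ?thesis .
  qed
  then show ?thesis
  proof -
    have ne: "{0::real<..} \<noteq> {}" by (auto intro: exI[of _ 1])
    have "hausdorff_outer s A + hausdorff_outer s B = (SUP \<delta>\<in>{0<..}. hausdorff_premeasure s \<delta> A + hausdorff_outer s B)"
      unfolding hausdorff_outer_def[of s A] by (rule ennreal_SUP_add_left[OF ne, symmetric])
    also have "\<dots> \<le> hausdorff_outer s (A \<union> B)"
    proof (rule SUP_least)
      fix \<delta> :: real assume "\<delta> \<in> {0<..}"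
      have "hausdorff_premeasure s \<delta> A + hausdorff_outer s B = (SUP \<delta>'\<in>{0<..}. hausdorff_premeasure s \<delta> A + hausdorff_premeasure s \<delta>' B)"
        unfolding hausdorff_outer_def by (rule ennreal_SUP_add_right[OF ne])
      also have "\<dots> \<le> hausdorff_outer s (A \<union> B)"
        using \<open>\<delta> \<in> {0<..}\<close> * by (intro SUP_least) auto
      finally show "hausdorff_premeasure s \<delta> A + hausdorff_outer s B \<le> hausdorff_outer s (A \<union> B)" .
    qed
    finally show ?thesis .
  qed
qed

lemma measure_space_hausdorff: "measure_space UNIV (sets borel) (hausdorff_outer s :: 'a::metric_space set \<Rightarrow> ennreal)"
  by (rule metric_outer_measure_borel[OF hausdorff_outer_space]) (rule hausdorff_outer_separated)

lemma sets_hausdorff_measure [simp, measurable_cong]: "sets (hausdorff_measure s) = sets borel"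
  unfolding hausdorff_measure_def by (simp add: sigma_algebra.sigma_sets_eq[OF sets.sigma_algebra_axioms, of borel, simplified])

lemma space_hausdorff_measure [simp]: "space (hausdorff_measure s) = UNIV"
  by (simp add: hausdorff_measure_def)

lemma emeasure_hausdorff_measure:
  "A \<in> sets borel \<Longrightarrow> emeasure (hausdorff_measure s) A = hausdorff_outer s A"
  unfolding hausdorff_measure_def using measure_space_hausdorff[of s]
  by (intro emeasure_measure_of_sigma) (auto simp: measure_space_def)

lemma diameter_isometry:
  assumes "\<And>x y. dist (T x) (T y) = dist x y"
  shows "diameter (T ` C) = diameter C"
proof -
  have "(\<lambda>(x, y). dist x y) ` (T ` C \<times> T ` C) = (\<lambda>(x, y). dist x y) ` (C \<times> C)"
    by (force simp: assms image_iff)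
  then show ?thesis unfolding diameter_def by simp
qed

lemma hausdorff_outer_isometry_le:
  assumes T: "\<And>x y. dist (T x) (T y) = dist x y"
  shows "hausdorff_outer s (T ` A) \<le> hausdorff_outer s A"
  unfolding hausdorff_outer_def
proof (rule SUP_mono, rule bexI)
  fix \<delta>
  show "hausdorff_premeasure s \<delta> (T ` A) \<le> hausdorff_premeasure s \<delta> A"
  proof (rule hausdorff_premeasure_greatest)
    fix C :: "nat \<Rightarrow> 'a set"
    assume C: "A \<subseteq> (\<Union>i. C i)" "\<And>i. bounded (C i)" "\<And>i. diameter (C i) \<le> \<delta>"
    have "bounded (T ` C i)" for i
    proof -
      obtain x r where "C i \<subseteq> cball x r" using C(2)[of i] by (auto simp: bounded_def subset_eq)
      then have "T ` C i \<subseteq> cball (T x) r" by (auto simp: T)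
      then show ?thesis using bounded_cball bounded_subset by blast
    qed
    then have "hausdorff_premeasure s \<delta> (T ` A) \<le> (\<Sum>i. hausdorff_weight s (T ` C i))"
      using C by (intro hausdorff_premeasure_le) (auto simp: diameter_isometry[OF T] image_UN[symmetric])
    then show "hausdorff_premeasure s \<delta> (T ` A) \<le> (\<Sum>i. hausdorff_weight s (C i))"
      by (simp add: hausdorff_weight_def diameter_isometry[OF T] cong: if_cong)
  qed
qed

section \<open>Uniformly distributed measures\<close>

text \<open>Fubini's theorem for the set of pairs at distance less than \<open>r\<close>: its product measure, restricted to pairs
whose \<open>M\<close>-component lies in \<open>V\<close>, equals the right hand side and is at least the left hand side.\<close>

lemma uniformly_distributed_ball_inequality:
  fixes M N :: "'a::{metric_space, second_countable_topology} measure"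
  assumes M: "sigma_finite_measure M" "sets M = sets borel" and N: "sigma_finite_measure N" "sets N = sets borel"
    and S: "AE x in M. x \<in> S" "AE x in N. x \<in> S"
    and g: "\<And>x. x \<in> S \<Longrightarrow> emeasure M (ball x r) = g" and h: "\<And>x. x \<in> S \<Longrightarrow> emeasure N (ball x r) = h"
    and V: "open V" "\<And>x. x \<in> W \<Longrightarrow> ball x r \<subseteq> V" and W: "W \<in> sets borel"
  shows "g * emeasure N W \<le> h * emeasure M V"
proof -
  interpret P: pair_sigma_finite M N using M N by (simp add: pair_sigma_finite_def)
  have [measurable_cong]: "sets M = sets borel" "sets N = sets borel" by fact+
  have [measurable]: "V \<in> sets borel" "W \<in> sets borel" using V W by auto
  have "g * emeasure N W = (\<integral>\<^sup>+x. g * indicator W x \<partial>N)"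
    by (simp add: nn_integral_cmult_indicator)
  also have "\<dots> \<le> (\<integral>\<^sup>+x. emeasure M (V \<inter> ball x r) \<partial>N)"
  proof (rule nn_integral_mono_AE)
    show "AE x in N. g * indicator W x \<le> emeasure M (V \<inter> ball x r)"
      using S(2)
    proof eventually_elim
      case (elim x)
      then show ?case using g[OF elim] V(2)[of x] by (auto simp: indicator_def Int_absorb1)
    qed
  qed
  also have "\<dots> = (\<integral>\<^sup>+x. \<integral>\<^sup>+y. indicator V y * indicator {z. dist (fst z) (snd z) < r} (y, x) \<partial>M \<partial>N)"
  proof (rule nn_integral_cong)
    fix x
    have "emeasure M (V \<inter> ball x r) = (\<integral>\<^sup>+y. indicator (V \<inter> ball x r) y \<partial>M)" by simp
    also have "\<dots> = (\<integral>\<^sup>+y. indicator V y * indicator {z. dist (fst z) (snd z) < r} (y, x) \<partial>M)"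
      by (intro nn_integral_cong) (auto simp: indicator_def dist_commute)
    finally show "emeasure M (V \<inter> ball x r) = \<dots>" .
  qed
  also have "\<dots> = (\<integral>\<^sup>+y. \<integral>\<^sup>+x. indicator V y * indicator {z. dist (fst z) (snd z) < r} (y, x) \<partial>N \<partial>M)"
    by (rule P.Fubini') measurable
  also have "\<dots> = (\<integral>\<^sup>+y. indicator V y * emeasure N (ball y r) \<partial>M)"
  proof (rule nn_integral_cong)
    fix y
    have "(\<integral>\<^sup>+x. indicator V y * indicator {z. dist (fst z) (snd z) < r} (y, x) \<partial>N) = (\<integral>\<^sup>+x. indicator V y * indicator (ball y r) x \<partial>N)"
      by (intro nn_integral_cong) (auto simp: indicator_def)
    also have "\<dots> = indicator V y * emeasure N (ball y r)" by (simp add: nn_integral_cmult_indicator)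
    finally show "(\<integral>\<^sup>+x. indicator V y * indicator {z. dist (fst z) (snd z) < r} (y, x) \<partial>N) = \<dots>" .
  qed
  also have "\<dots> = (\<integral>\<^sup>+y. h * indicator V y \<partial>M)"
    using S(1) by (intro nn_integral_cong_AE) (auto elim!: AE_mp simp: h mult.commute)
  also have "\<dots> = h * emeasure M V" by (simp add: nn_integral_cmult_indicator)
  finally show ?thesis .
qed

text \<open>The previous inequality with \<open>W n\<close> the points at distance at least \<open>1/(n+1)\<close> from the complement
of \<open>V\<close>; the sets \<open>W n\<close> exhaust \<open>V\<close>, and the ratio of the masses of balls does not depend on the radius.\<close>

lemma uniformly_distributed_open_inequality:
  fixes M N :: "'a::{metric_space, second_countable_topology} measure"
  assumes M: "sigma_finite_measure M" "sets M = sets borel" and N: "sigma_finite_measure N" "sets N = sets borel"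
    and S: "AE x in M. x \<in> S" "AE x in N. x \<in> S"
    and g: "\<And>x r. x \<in> S \<Longrightarrow> r > 0 \<Longrightarrow> emeasure M (ball x r) = g r" and h: "\<And>x r. x \<in> S \<Longrightarrow> r > 0 \<Longrightarrow> emeasure N (ball x r) = h r"
    and pos: "\<And>r. r > 0 \<Longrightarrow> g r \<noteq> 0 \<and> g r \<noteq> \<infinity>"
    and c: "\<And>r. r > 0 \<Longrightarrow> h r * a = b * g r"
    and V: "open V"
  shows "a * emeasure N V \<le> b * emeasure M V"
proof (cases "V = UNIV")
  case True
  have "g 1 * emeasure N V \<le> h 1 * emeasure M V"
    using uniformly_distributed_ball_inequality[OF M N S, of 1 "g 1" "h 1" V V] g h V True by auto
  then have "a * (g 1 * emeasure N V) \<le> a * (h 1 * emeasure M V)" by (rule mult_left_mono) simp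
  also have "\<dots> = (h 1 * a) * emeasure M V" by (simp add: ac_simps)
  also have "\<dots> = g 1 * (b * emeasure M V)" by (subst c) (simp_all add: ac_simps)
  finally have "g 1 * (a * emeasure N V) \<le> g 1 * (b * emeasure M V)" by (simp add: ac_simps)
  then show ?thesis using pos[of 1] by (simp add: ennreal_mult_le_mult_iff)
next
  case False
  then have ne: "- V \<noteq> {}" by auto
  define W where "W n = {x. 1 / real (Suc n) \<le> infdist x (- V)}" for n
  have Wb: "W n \<in> sets borel" for n
    unfolding W_def by (intro borel_closed closed_Collect_le continuous_intros)
  have Wn: "a * emeasure N (W n) \<le> b * emeasure M V" for n
  proof -
    let ?r = "1 / real (Suc n)"
    have "g ?r * emeasure N (W n) \<le> h ?r * emeasure M V"
    proof (rule uniformly_distributed_ball_inequality[OF M N S _ _ V _ Wb])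
      fix x assume x: "x \<in> W n"
      show "ball x ?r \<subseteq> V"
      proof
        fix y assume "y \<in> ball x ?r"
        show "y \<in> V"
        proof (rule ccontr)
          assume "y \<notin> V"
          then have "infdist x (- V) \<le> dist x y" by (intro infdist_le) auto
          then show False using x \<open>y \<in> ball x ?r\<close> by (auto simp: W_def)
        qed
      qed
    qed (use g h in auto)
    then have "a * (g ?r * emeasure N (W n)) \<le> a * (h ?r * emeasure M V)" by (rule mult_left_mono) simp
    also have "\<dots> = (h ?r * a) * emeasure M V" by (simp add: ac_simps)
    also have "\<dots> = g ?r * (b * emeasure M V)" by (subst c) (simp_all add: ac_simps)
    finally have "g ?r * (a * emeasure N (W n)) \<le> g ?r * (b * emeasure M V)" by (simp add: ac_simps)
    then show ?thesis using pos[of ?r] by (simp add: ennreal_mult_le_mult_iff)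
  qed
  have "emeasure N V = (SUP n. emeasure N (W n))"
  proof -
    have "V = (\<Union>n. W n)"
    proof safe
      fix x assume "x \<in> V"
      then have "0 < infdist x (- V)"
        using V ne by (metis ComplD closed_Compl infdist_pos_not_in_closed)
      then obtain n where "1 / real (Suc n) < infdist x (- V)" using nat_approx_posE by blast
      then show "x \<in> (\<Union>n. W n)" by (auto simp: W_def intro!: exI[of _ n])
    next
      fix x n assume "x \<in> W n"
      then have "infdist x (- V) > 0" unfolding W_def by (simp add: less_le_trans[rotated])
      then show "x \<in> V" by (metis ComplI infdist_zero less_irrefl)
    qed
    moreover have "incseq W"
    proof (rule incseq_SucI, safe)
      fix n x assume "x \<in> W n"
      moreover have "1 / real (Suc (Suc n)) \<le> 1 / real (Suc n)" by (intro divide_left_mono) auto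
      ultimately show "x \<in> W (Suc n)" unfolding W_def by simp
    qed
    ultimately show ?thesis using SUP_emeasure_incseq[of W N] Wb N(2) by (simp add: image_subset_iff)
  qed
  then have "a * emeasure N V = (SUP n. a * emeasure N (W n))" by (simp add: SUP_mult_left_ennreal)
  also have "\<dots> \<le> b * emeasure M V" using Wn by (rule SUP_least)
  finally show ?thesis .
qed

text \<open>Christensen's theorem: a measure whose balls have a mass independent of the centre is determined by its
total mass. Choosing both sets as the whole space in the ball inequality identifies the ratio
of the masses of balls.\<close>

proposition uniformly_distributed_unique:
  fixes M N :: "'a::{metric_space, second_countable_topology} measure"
  assumes M: "finite_measure M" "sets M = sets borel" and N: "finite_measure N" "sets N = sets borel"
    and S: "AE x in M. x \<in> S" "AE x in N. x \<in> S"
    and g: "\<And>x r. x \<in> S \<Longrightarrow> r > 0 \<Longrightarrow> emeasure M (ball x r) = g r" and h: "\<And>x r. x \<in> S \<Longrightarrow> r > 0 \<Longrightarrow> emeasure N (ball x r) = h r"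
    and pos: "\<And>r. r > 0 \<Longrightarrow> g r \<noteq> 0" "\<And>r. r > 0 \<Longrightarrow> h r \<noteq> 0" and ne: "S \<noteq> {}"
  shows "scale_measure (emeasure M UNIV) N = scale_measure (emeasure N UNIV) M"
proof -
  interpret M: finite_measure M by fact
  interpret N: finite_measure N by fact
  note sf = M.sigma_finite_measure_axioms M(2) N.sigma_finite_measure_axioms N(2)
  note sf' = N.sigma_finite_measure_axioms N(2) M.sigma_finite_measure_axioms M(2)
  let ?a = "emeasure M UNIV" and ?b = "emeasure N UNIV"
  obtain x0 where x0: "x0 \<in> S" using ne by auto
  have fin: "g r \<noteq> \<infinity>" "h r \<noteq> \<infinity>" if "r > 0" for r
    using g[OF x0 that] h[OF x0 that] by (metis M.emeasure_finite infinity_ennreal_def, metis N.emeasure_finite infinity_ennreal_def)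
  have c: "h r * ?a = ?b * g r" if "r > 0" for r
  proof (rule antisym)
    show "h r * ?a \<le> ?b * g r"
      using uniformly_distributed_ball_inequality[where V=UNIV and W=UNIV and r=r, OF sf' S(2,1) h g] that by (simp add: mult.commute)
    show "?b * g r \<le> h r * ?a"
      using uniformly_distributed_ball_inequality[where V=UNIV and W=UNIV and r=r, OF sf S g h] that by (simp add: mult.commute)
  qed
  have eq: "?a * emeasure N V = ?b * emeasure M V" if V: "open V" for V
  proof (rule antisym)
    show "?a * emeasure N V \<le> ?b * emeasure M V"
      using uniformly_distributed_open_inequality[where a="?a" and b="?b", OF sf S g h _ c V] pos fin by simp
    show "?b * emeasure M V \<le> ?a * emeasure N V"
      using uniformly_distributed_open_inequality[where a="?b" and b="?a", OF sf' S(2,1) h g _ _ V] pos fin c by (simp add: mult.commute)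
  qed
  show ?thesis
  proof (rule measure_eqI_generator_eq[where E="Collect open" and A="\<lambda>_. UNIV"])
    show "Int_stable (Collect open :: 'a set set)" by (auto simp: Int_stable_def)
    show "sets (scale_measure ?a N) = sigma_sets UNIV (Collect open)" "sets (scale_measure ?b M) = sigma_sets UNIV (Collect open)"
      by (simp_all add: M N borel_def)
    show "emeasure (scale_measure ?a N) X = emeasure (scale_measure ?b M) X" if "X \<in> Collect open" for X
      using eq[of X] that by simp
    show "emeasure (scale_measure ?a N) UNIV \<noteq> \<infinity>"
      using M.emeasure_finite[of UNIV] N.emeasure_finite[of UNIV] by (simp add: ennreal_mult_eq_top_iff)
  qed auto
qed

section \<open>Reflections\<close>

definition reflection :: "'a::real_inner \<Rightarrow> 'a \<Rightarrow> 'a" where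
  "reflection w x = x - (2 * (x \<bullet> w) / (w \<bullet> w)) *\<^sub>R w"

lemma linear_reflection: "linear (reflection w)"
  by (rule linearI) (simp_all add: reflection_def inner_add_left add_divide_distrib distrib_left scaleR_add_left scaleR_diff_right)

lemma reflection_involution: "reflection w (reflection w x) = x"
  by (cases "w = 0") (simp_all add: reflection_def inner_diff_left scaleR_diff_left[symmetric] algebra_simps divide_simps)

lemma norm_reflection: "norm (reflection w x) = norm x"
proof (cases "w = 0")
  case False
  then have "reflection w x \<bullet> reflection w x = x \<bullet> x"
    by (simp add: reflection_def inner_diff_left inner_diff_right field_simps inner_commute power2_eq_square)
  then show ?thesis by (simp add: norm_eq_sqrt_inner)
qed (simp add: reflection_def)

lemma dist_reflection: "dist (reflection w x) (reflection w y) = dist x y"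
  using norm_reflection[of w "x - y"] linear_reflection[of w] by (simp add: dist_norm linear_diff[symmetric])

lemma reflection_swap: "norm x = norm y \<Longrightarrow> reflection (x - y) x = y"
proof (cases "x = y")
  case False
  assume "norm x = norm y"
  then have "x \<bullet> x = y \<bullet> y" by (simp add: norm_eq_sqrt_inner)
  then have "(x - y) \<bullet> (x - y) = 2 * (x \<bullet> (x - y))" by (simp add: inner_diff_left inner_diff_right inner_commute)
  moreover have "(x - y) \<bullet> (x - y) \<noteq> 0" using False by simp
  ultimately show ?thesis by (simp add: reflection_def)
qed (simp add: reflection_def)

lemma measurable_reflection [measurable]: "reflection w \<in> borel_measurable (borel :: 'a::euclidean_space measure)"
  unfolding reflection_def[abs_def] by measurable

lemma vimage_reflection_ball: "reflection w -` ball x r = ball (reflection w x) r"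
proof (intro set_eqI)
  fix y
  have "dist x (reflection w y) = dist (reflection w x) y"
    using dist_reflection[of w x "reflection w y"] by (simp add: reflection_involution)
  then show "y \<in> reflection w -` ball x r \<longleftrightarrow> y \<in> ball (reflection w x) r" by simp
qed

text \<open>The image of Lebesgue measure gives each ball its volume, so it agrees with Lebesgue measure on
open sets.\<close>

lemma distr_reflection_lborel: "distr lborel borel (reflection w) = (lborel :: 'a::euclidean_space measure)"
proof -
  let ?T = "reflection w :: 'a \<Rightarrow> 'a" and ?N = "distr lborel borel (reflection w) :: 'a measure"
  have ball: "emeasure lborel (ball x r) = ennreal (unit_ball_vol (real DIM('a)) * r ^ DIM('a))" if "r > 0" for x :: 'a and r
    using that by (simp add: emeasure_ball)
  have ballN: "emeasure ?N (ball x r) = ennreal (unit_ball_vol (real DIM('a)) * r ^ DIM('a))" if "r > 0" for x :: 'a and r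
    using that by (simp add: emeasure_distr vimage_reflection_ball ball)
  have sf: "sigma_finite_measure ?N"
  proof (standard, intro exI conjI)
    show "countable (range (\<lambda>n. ball 0 (real n) :: 'a set))" by simp
    show "range (\<lambda>n. ball 0 (real n)) \<subseteq> sets ?N" by auto
    show "\<Union> (range (\<lambda>n. ball 0 (real n))) = space ?N" by (auto simp: reals_Archimedean2)
    show "\<forall>a\<in>range (\<lambda>n. ball 0 (real n)). emeasure ?N a \<noteq> \<infinity>"
    proof safe
      fix n :: nat
      assume *: "emeasure ?N (ball 0 (real n)) = \<infinity>"
      show False using * ballN[of "real n" 0] by (cases "n = 0") auto
    qed
  qed
  have pos: "ennreal (unit_ball_vol (real DIM('a)) * r ^ DIM('a)) \<noteq> 0 \<and> ennreal (unit_ball_vol (real DIM('a)) * r ^ DIM('a)) \<noteq> \<infinity>" if "r > 0" for r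
    using that by (simp add: ennreal_eq_0_iff not_le)
  have le1: "emeasure ?N V \<le> emeasure lborel V" if "open V" for V
    using uniformly_distributed_open_inequality[where M=lborel and N="?N" and S=UNIV and a=1 and b=1, OF sigma_finite_lborel _ sf _ _ _ ball ballN pos _ that] by simp
  have le2: "emeasure lborel V \<le> emeasure ?N V" if "open V" for V
    using uniformly_distributed_open_inequality[where N=lborel and M="?N" and S=UNIV and a=1 and b=1, OF sf _ sigma_finite_lborel _ _ _ ballN ball pos _ that] by simp
  have "lborel = ?N"
  proof (rule lborel_eqI)
    fix l u :: 'a assume "\<And>b. b \<in> Basis \<Longrightarrow> l \<bullet> b \<le> u \<bullet> b"
    then show "emeasure ?N (box l u) = (\<Prod>b\<in>Basis. (u - l) \<bullet> b)"
      using le1[OF open_box, of l u] le2[OF open_box, of l u] emeasure_lborel_box[of l u] by (simp add: antisym)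
  qed simp
  then show ?thesis by simp
qed

section \<open>The Hausdorff measure of the sphere\<close>

lemma power_diff_le: "0 \<le> b \<Longrightarrow> b \<le> a \<Longrightarrow> a ^ Suc k - b ^ Suc k \<le> real (Suc k) * (a - b) * a ^ k" for a b :: real
proof (induction k)
  case (Suc k)
  have "a ^ Suc (Suc k) - b ^ Suc (Suc k) = a * (a ^ Suc k - b ^ Suc k) + b ^ Suc k * (a - b)"
    by (simp add: algebra_simps)
  also have "\<dots> \<le> a * (real (Suc k) * (a - b) * a ^ k) + a ^ Suc k * (a - b)"
    using Suc by (intro add_mono mult_left_mono mult_right_mono power_mono) auto
  also have "\<dots> = real (Suc (Suc k)) * (a - b) * a ^ Suc k" by (simp add: algebra_simps)
  finally show ?case .
qed simp

text \<open>The balls of radius \<open>h\<close> around the points of \<open>F\<close> are disjoint and lie in the shell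
\<open>1 - h \<le> \<bar>x\<bar> < 1 + h\<close>, whose volume is of order \<open>h\<close>.\<close>

lemma separated_sphere_card_le:
  fixes F :: "'a::euclidean_space set"
  assumes F: "finite F" "F \<subseteq> sphere 0 1" and h: "0 < h" "h \<le> 1"
    and sep: "\<And>x y. x \<in> F \<Longrightarrow> y \<in> F \<Longrightarrow> x \<noteq> y \<Longrightarrow> 2 * h \<le> dist x y"
  shows "real (card F) * h ^ (DIM('a) - 1) \<le> real DIM('a) * 2 ^ DIM('a)"
proof -
  define \<omega> where "\<omega> = unit_ball_vol (real DIM('a))"
  have \<omega>: "\<omega> > 0" by (simp add: \<omega>_def)
  have vol: "measure lborel (ball x r) = \<omega> * r ^ DIM('a)" if "r \<ge> 0" for x :: 'a and r
    using content_ball[OF that, of x] by (simp add: \<omega>_def)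
  let ?U = "\<Union>x\<in>F. ball x h"
  have disj: "disjoint_family_on (\<lambda>x. ball x h) F"
    unfolding disjoint_family_on_def
  proof (intro ballI impI)
    fix x y assume xy: "x \<in> F" "y \<in> F" "x \<noteq> y"
    show "ball x h \<inter> ball y h = {}"
    proof (rule ccontr)
      assume "ball x h \<inter> ball y h \<noteq> {}"
      then obtain z where "dist x z < h" "dist y z < h" by auto
      then show False using sep[OF xy] dist_triangle2[of x y z] by linarith
    qed
  qed
  have "measure lborel ?U = (\<Sum>x\<in>F. measure lborel (ball x h))"
    using F(1) disj by (intro measure_finite_Union) (auto simp: emeasure_lborel_ball_finite less_top[symmetric] emeasure_ball h less_imp_le)
  then have U: "measure lborel ?U = real (card F) * (\<omega> * h ^ DIM('a))" using h by (simp add: vol)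
  have sub: "?U \<union> ball 0 (1 - h) \<subseteq> ball 0 (1 + h)"
  proof safe
    fix x y assume "x \<in> F" "y \<in> ball x h"
    then show "y \<in> ball 0 (1 + h)" using F(2) norm_triangle_ineq2[of y x] by (auto simp: dist_norm norm_minus_commute)
  next
    fix y :: 'a assume "y \<in> ball 0 (1 - h)" then show "y \<in> ball 0 (1 + h)" using h by auto
  qed
  have dis2: "?U \<inter> ball 0 (1 - h) = {}"
  proof safe
    fix x y assume "x \<in> F" "y \<in> ball x h" "y \<in> ball 0 (1 - h)"
    then show "y \<in> {}" using F(2) norm_triangle_ineq2[of x y] by (auto simp: dist_norm)
  qed
  have fm: "ball x r \<in> fmeasurable lborel" for x :: 'a and r
    using emeasure_bounded_finite[OF bounded_ball, of x r] by (simp add: fmeasurable_def)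
  have fU: "?U \<in> fmeasurable lborel" using F(1) fm by (intro fmeasurable.finite_UN) auto
  have "measure lborel ?U + measure lborel (ball (0::'a) (1 - h)) = measure lborel (?U \<union> ball 0 (1 - h))"
    by (rule measure_Union[symmetric]) (use fm[THEN fmeasurableD2] fU[THEN fmeasurableD2] fU dis2 in auto)
  also have "\<dots> \<le> measure lborel (ball (0::'a) (1 + h))"
    using fm fU by (intro measure_mono_fmeasurable sub) auto
  finally have "real (card F) * (\<omega> * h ^ DIM('a)) \<le> \<omega> * (1 + h) ^ DIM('a) - \<omega> * (1 - h) ^ DIM('a)"
    using h by (simp add: U vol)
  then have "\<omega> * (real (card F) * h ^ DIM('a)) \<le> \<omega> * ((1 + h) ^ DIM('a) - (1 - h) ^ DIM('a))"
    by (simp add: algebra_simps)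
  then have 1: "real (card F) * h ^ DIM('a) \<le> (1 + h) ^ DIM('a) - (1 - h) ^ DIM('a)" using \<omega> by simp
  obtain k where k: "DIM('a) = Suc k" using DIM_positive[where 'a='a] gr0_conv_Suc by blast
  have "(1 + h) ^ DIM('a) - (1 - h) ^ DIM('a) \<le> real DIM('a) * (2 * h) * (1 + h) ^ k"
    using power_diff_le[of "1 - h" "1 + h" k] h by (simp add: k)
  also have "\<dots> \<le> real DIM('a) * (2 * h) * 2 ^ k"
    using h by (intro mult_left_mono power_mono) auto
  finally have "h * (real (card F) * h ^ k) \<le> h * (real DIM('a) * 2 ^ DIM('a))" using 1 by (simp add: k algebra_simps)
  then show ?thesis using h by (simp add: k)
qed

lemma exists_maximal_separated:
  fixes h :: real
  assumes h: "0 < h" "h \<le> 1"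
  obtains F :: "'a::euclidean_space set" where "finite F" "F \<subseteq> sphere 0 1"
    "\<And>x y. x \<in> F \<Longrightarrow> y \<in> F \<Longrightarrow> x \<noteq> y \<Longrightarrow> 2 * h \<le> dist x y"
    "sphere 0 1 \<subseteq> (\<Union>x\<in>F. ball x (2 * h))"
proof -
  define P where "P F \<longleftrightarrow> finite F \<and> F \<subseteq> sphere (0::'a) 1 \<and> (\<forall>x\<in>F. \<forall>y\<in>F. x \<noteq> y \<longrightarrow> 2 * h \<le> dist x y)" for F
  obtain b :: nat where b: "real DIM('a) * 2 ^ DIM('a) / h ^ (DIM('a) - 1) < real b" using reals_Archimedean2 by blast
  have "card F < b" if "P F" for F
  proof -
    have "real (card F) * h ^ (DIM('a) - 1) \<le> real DIM('a) * 2 ^ DIM('a)"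
      using that h by (intro separated_sphere_card_le) (auto simp: P_def)
    then have "real (card F) \<le> real DIM('a) * 2 ^ DIM('a) / h ^ (DIM('a) - 1)" using h by (simp add: field_simps)
    then show ?thesis using b by linarith
  qed
  moreover have "P {}" by (simp add: P_def)
  ultimately obtain F where F: "P F" "\<And>G. P G \<Longrightarrow> card G \<le> card F"
    using ex_has_greatest_nat[of P "{}" card b] by blast
  have "sphere 0 1 \<subseteq> (\<Union>x\<in>F. ball x (2 * h))"
  proof (rule ccontr)
    assume "\<not> sphere 0 1 \<subseteq> (\<Union>x\<in>F. ball x (2 * h))"
    then obtain z where z: "z \<in> sphere 0 1" "\<And>x. x \<in> F \<Longrightarrow> 2 * h \<le> dist x z" by (force simp: not_less)
    have "z \<notin> F" using z(2)[of z] h by auto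
    have "P (insert z F)" using F(1) z by (auto simp: P_def dist_commute)
    then have "card (insert z F) \<le> card F" by (rule F(2))
    then show False using \<open>z \<notin> F\<close> F(1) by (simp add: P_def)
  qed
  then show ?thesis using that F(1) unfolding P_def by blast
qed

text \<open>A maximal separated subset of the sphere yields a covering by balls of radius \<open>2 h\<close> whose number is of
order \<open>h powr (1 - n)\<close>, where \<open>n\<close> is the dimension.\<close>

lemma hausdorff_sphere_finite: "hausdorff_outer (DIM('a) - 1) (sphere (0::'a::euclidean_space) 1) < \<infinity>"
proof -
  define k where "k = DIM('a) - 1"
  define \<kappa> where "\<kappa> = unit_ball_vol (real k)"
  have \<kappa>: "\<kappa> \<ge> 0" by (simp add: \<kappa>_def)
  define K where "K = real DIM('a) * 2 ^ DIM('a) * 2 ^ k * \<kappa>"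
  have bound: "hausdorff_premeasure k \<delta> (sphere (0::'a) 1) \<le> ennreal K" if "\<delta> > 0" for \<delta>
  proof -
    define h where "h = min 1 (\<delta> / 4)"
    have h: "0 < h" "h \<le> 1" "4 * h \<le> \<delta>" using that by (auto simp: h_def)
    obtain F :: "'a set" where F: "finite F" "F \<subseteq> sphere 0 1"
      "\<And>x y. x \<in> F \<Longrightarrow> y \<in> F \<Longrightarrow> x \<noteq> y \<Longrightarrow> 2 * h \<le> dist x y"
      "sphere 0 1 \<subseteq> (\<Union>x\<in>F. ball x (2 * h))"
      by (rule exists_maximal_separated[OF h(1,2), where 'a='a]) (rule that; assumption)
    obtain xs where xs: "set xs = F" "distinct xs" using finite_distinct_list[OF F(1)] by blast
    define C where "C i = (if i < length xs then ball (xs ! i) (2 * h) else {})" for i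
    have diam: "0 \<le> diameter (ball x (2 * h))" "diameter (ball x (2 * h)) \<le> 4 * h" for x :: 'a
    proof -
      show "0 \<le> diameter (ball x (2 * h))" by (rule diameter_ge_0) simp
      show "diameter (ball x (2 * h)) \<le> 4 * h"
      proof (rule diameter_le)
        fix y z assume "y \<in> ball x (2 * h)" "z \<in> ball x (2 * h)"
        then show "norm (y - z) \<le> 4 * h" using dist_triangle3[of y z x] by (simp add: dist_norm)
      qed (use h in auto)
    qed
    have "hausdorff_premeasure k \<delta> (sphere (0::'a) 1) \<le> (\<Sum>i. hausdorff_weight k (C i))"
    proof (rule hausdorff_premeasure_le)
      show "sphere 0 1 \<subseteq> (\<Union>i. C i)"
      proof
        fix z :: 'a assume "z \<in> sphere 0 1"
        then obtain x where "x \<in> F" "z \<in> ball x (2 * h)" using F(4) by blast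
        then obtain i where "i < length xs" "z \<in> ball (xs ! i) (2 * h)" using xs(1) by (metis in_set_conv_nth)
        then show "z \<in> (\<Union>i. C i)" by (intro UN_I[of i]) (auto simp: C_def)
      qed
      show "bounded (C i)" "diameter (C i) \<le> \<delta>" for i
        using diam(2)[of "xs ! i"] h that by (simp_all add: C_def)
    qed
    also have "\<dots> = (\<Sum>i<length xs. hausdorff_weight k (C i))"
      by (rule suminf_finite) (auto simp: C_def hausdorff_weight_def)
    also have "\<dots> \<le> (\<Sum>i<length xs. ennreal (\<kappa> * (2 * h) ^ k))"
    proof (rule sum_mono)
      fix i assume "i \<in> {..<length xs}"
      have "\<kappa> * (diameter (ball (xs ! i) (2 * h)) / 2) ^ k \<le> \<kappa> * (2 * h) ^ k"
        using diam[of "xs ! i"] \<kappa> h by (intro mult_left_mono power_mono) auto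
      then show "hausdorff_weight k (C i) \<le> ennreal (\<kappa> * (2 * h) ^ k)"
        by (auto simp: C_def hausdorff_weight_def \<kappa>_def intro: ennreal_leI)
    qed
    also have "\<dots> = ennreal (real (card F) * (\<kappa> * (2 * h) ^ k))"
      using \<kappa> h xs distinct_card[OF xs(2)] by (simp add: ennreal_mult'' ennreal_of_nat_eq_real_of_nat[symmetric] ennreal_mult)
    also have "\<dots> \<le> ennreal K"
    proof (rule ennreal_leI)
      have "real (card F) * (\<kappa> * (2 * h) ^ k) = (real (card F) * h ^ k) * (2 ^ k * \<kappa>)" by (simp add: power_mult_distrib)
      also have "\<dots> \<le> (real DIM('a) * 2 ^ DIM('a)) * (2 ^ k * \<kappa>)"
        using separated_sphere_card_le[OF F(1,2) h(1,2) F(3)] \<kappa> by (intro mult_right_mono) (auto simp: k_def)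
      finally show "real (card F) * (\<kappa> * (2 * h) ^ k) \<le> K" by (simp add: K_def mult.assoc)
    qed
    finally show ?thesis .
  qed
  have "hausdorff_outer k (sphere (0::'a) 1) \<le> ennreal K"
    unfolding hausdorff_outer_def by (intro SUP_least bound) simp
  then show ?thesis unfolding k_def by (simp add: le_less_trans)
qed

text \<open>A cone over a set of diameter \<open>e\<close> is covered by about \<open>1/e\<close> balls of radius \<open>2 e\<close> along the segment from the origin to a
point of the set.\<close>

lemma cone_volume_le:
  fixes C :: "'a::euclidean_space set"
  assumes C: "C \<subseteq> sphere 0 1" "C \<in> sets borel" and e: "0 < e" "e \<le> 1" and diam: "\<And>x y. x \<in> C \<Longrightarrow> y \<in> C \<Longrightarrow> dist x y \<le> e"
  shows "emeasure lborel (ball 0 1 \<inter> sgn -` C) \<le> ennreal (unit_ball_vol (real DIM('a)) * 2 ^ Suc DIM('a) * e ^ (DIM('a) - 1))"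
proof (cases "C = {}")
  case False
  then obtain x0 where x0: "x0 \<in> C" by auto
  define \<omega> where "\<omega> = unit_ball_vol (real DIM('a))"
  have \<omega>: "\<omega> \<ge> 0" by (simp add: \<omega>_def)
  define J where "J = nat \<lfloor>1 / e\<rfloor> + 1"
  have J: "real J \<le> 2 / e"
  proof -
    have "real J \<le> 1 / e + 1" using e by (simp add: J_def)
    also have "\<dots> \<le> 2 / e" using e by (simp add: field_simps)
    finally show ?thesis .
  qed
  have sub: "ball 0 1 \<inter> sgn -` C \<subseteq> (\<Union>j<J. cball ((real j * e) *\<^sub>R x0) (2 * e))"
  proof
    fix v assume v: "v \<in> ball 0 1 \<inter> sgn -` C"
    define j where "j = nat \<lfloor>norm v / e\<rfloor>"
    have fl: "real j = of_int \<lfloor>norm v / e\<rfloor>" using e by (simp add: j_def)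
    have j1: "real j \<le> norm v / e" "norm v / e < real j + 1" unfolding fl by linarith+
    have je: "real j * e \<le> norm v" "norm v < real j * e + e" using j1 e by (simp_all add: field_simps)
    have "norm v / e \<le> 1 / e" using v e by (simp add: divide_right_mono)
    then have "\<lfloor>norm v / e\<rfloor> \<le> \<lfloor>1 / e\<rfloor>" by (rule floor_mono)
    then have "j < J" unfolding j_def J_def by (simp add: nat_mono le_imp_less_Suc)
    have "dist ((real j * e) *\<^sub>R x0) v \<le> 2 * e"
    proof -
      have vs: "v = norm v *\<^sub>R sgn v" by (cases "v = 0") (simp_all add: sgn_div_norm)
      have "(real j * e) *\<^sub>R x0 - v = (real j * e) *\<^sub>R (x0 - sgn v) - (norm v - real j * e) *\<^sub>R sgn v"
        by (subst (1) vs) (simp add: algebra_simps)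
      then have "norm ((real j * e) *\<^sub>R x0 - v) \<le> norm ((real j * e) *\<^sub>R (x0 - sgn v)) + norm ((norm v - real j * e) *\<^sub>R sgn v)"
        by (metis norm_triangle_ineq4)
      also have "\<dots> = (real j * e) * dist x0 (sgn v) + (norm v - real j * e) * norm (sgn v)"
        using je e by (simp add: dist_norm)
      also have "\<dots> \<le> 1 * e + e * 1"
      proof (intro add_mono mult_mono)
        show "real j * e \<le> 1" using je v by simp
        show "dist x0 (sgn v) \<le> e" using diam[OF x0] v by auto
        show "norm v - real j * e \<le> e" using je by linarith
        show "norm (sgn v) \<le> 1" by (simp add: norm_sgn)
      qed (use e je in auto)
      finally show ?thesis by (simp add: dist_norm)
    qed
    then show "v \<in> (\<Union>j<J. cball ((real j * e) *\<^sub>R x0) (2 * e))" using \<open>j < J\<close> by auto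
  qed
  have "emeasure lborel (ball 0 1 \<inter> sgn -` C) \<le> emeasure lborel (\<Union>j<J. cball ((real j * e) *\<^sub>R x0) (2 * e))"
    by (intro emeasure_mono sub) auto
  also have "\<dots> \<le> (\<Sum>j<J. emeasure lborel (cball ((real j * e) *\<^sub>R x0) (2 * e)))"
    by (intro emeasure_subadditive_finite) auto
  also have "\<dots> = (\<Sum>j<J. ennreal (\<omega> * (2 * e) ^ DIM('a)))"
    using e by (intro sum.cong refl) (simp add: emeasure_cball \<omega>_def)
  also have "\<dots> = ennreal (real J * (\<omega> * (2 * e) ^ DIM('a)))"
    using e \<omega> by (simp add: ennreal_mult ennreal_of_nat_eq_real_of_nat)
  also have "\<dots> \<le> ennreal (2 / e * (\<omega> * (2 * e) ^ DIM('a)))"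
    using e \<omega> J by (intro ennreal_leI mult_right_mono) auto
  also have "2 / e * (\<omega> * (2 * e) ^ DIM('a)) = \<omega> * 2 ^ Suc DIM('a) * e ^ (DIM('a) - 1)"
  proof -
    obtain k where k: "DIM('a) = Suc k" using DIM_positive[where 'a='a] gr0_conv_Suc by blast
    show ?thesis using e by (simp add: k power_mult_distrib)
  qed
  finally show ?thesis by (simp add: \<omega>_def)
qed simp

lemma borel_measurable_sgn_vector [measurable]: "(sgn :: 'a::euclidean_space \<Rightarrow> 'a) \<in> borel_measurable borel"
  unfolding sgn_div_norm[abs_def] by measurable

text \<open>The cones over the members of a covering of the sphere cover the ball, and the volume of each
cone is bounded by a multiple of the Hausdorff weight of its base.\<close>

lemma hausdorff_sphere_pos: "0 < hausdorff_outer (DIM('a) - 1) (sphere (0::'a::euclidean_space) 1)"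
proof -
  define k where "k = DIM('a) - 1"
  define \<kappa> where "\<kappa> = unit_ball_vol (real k)"
  define \<omega> where "\<omega> = unit_ball_vol (real DIM('a))"
  have \<kappa>: "\<kappa> > 0" and \<omega>: "\<omega> > 0" by (simp_all add: \<kappa>_def \<omega>_def)
  define K where "K = \<omega> * 2 ^ Suc DIM('a) * 2 ^ k / \<kappa>"
  have K: "K > 0" using \<kappa> \<omega> by (simp add: K_def)
  have weight: "emeasure lborel (ball 0 1 \<inter> sgn -` (closure C \<inter> sphere 0 1)) \<le> ennreal K * hausdorff_weight k C"
    if C: "bounded C" "diameter C \<le> 1 / 2" for C :: "'a set"
  proof (cases "C = {}")
    case False
    define d where "d = diameter C"
    have d: "0 \<le> d" "d \<le> 1 / 2" using C diameter_ge_0 by (auto simp: d_def)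
    have dd: "dist x y \<le> d" if "x \<in> closure C" "y \<in> closure C" for x y
      using diameter_bounded_bound[OF bounded_closure[OF C(1)] that] C by (simp add: d_def diameter_closure)
    define m where "m = emeasure lborel (ball 0 1 \<inter> sgn -` (closure C \<inter> sphere 0 1))"
    \<comment> \<open>The bound on cones needs a positive diameter, so it is used for \<open>e > d\<close> and passed to the limit.\<close>
    have le: "m \<le> ennreal (\<omega> * 2 ^ Suc DIM('a) * e ^ k)" if "d < e" "e < 1" for e
      unfolding m_def k_def \<omega>_def
    proof (rule cone_volume_le)
      show "dist x y \<le> e" if "x \<in> closure C \<inter> sphere 0 1" "y \<in> closure C \<inter> sphere 0 1" for x y
        using dd[of x y] that \<open>d < e\<close> by simp
    qed (use that d in auto)
    have "m \<le> ennreal (\<omega> * 2 ^ Suc DIM('a) * d ^ k)"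
    proof (rule tendsto_lowerbound)
      show "((\<lambda>e. ennreal (\<omega> * 2 ^ Suc DIM('a) * e ^ k)) \<longlongrightarrow> ennreal (\<omega> * 2 ^ Suc DIM('a) * d ^ k)) (at_right d)"
        by (intro tendsto_intros)
      show "\<forall>\<^sub>F e in at_right d. m \<le> ennreal (\<omega> * 2 ^ Suc DIM('a) * e ^ k)"
        unfolding eventually_at_right_field using le d by (intro exI[of _ 1]) auto
    qed simp
    also have "\<omega> * 2 ^ Suc DIM('a) * d ^ k = K * (\<kappa> * (d / 2) ^ k)"
      using \<kappa> by (simp add: K_def power_divide)
    also have "ennreal \<dots> = ennreal K * hausdorff_weight k C"
      using False K \<kappa> d by (simp add: hausdorff_weight_def d_def \<kappa>_def ennreal_mult)
    finally show ?thesis by (simp add: m_def)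
  qed simp
  have "ennreal (\<omega> / K) \<le> hausdorff_premeasure k (1 / 2) (sphere (0::'a) 1)"
  proof (rule hausdorff_premeasure_greatest)
    fix C :: "nat \<Rightarrow> 'a set"
    assume C: "sphere 0 1 \<subseteq> (\<Union>i. C i)" "\<And>i. bounded (C i)" "\<And>i. diameter (C i) \<le> 1 / 2"
    have meas: "ball 0 1 \<inter> sgn -` (closure (C i) \<inter> sphere 0 1) \<in> sets borel" for i
    proof -
      have "sgn -` (closure (C i) \<inter> sphere 0 1) \<inter> space borel \<in> sets borel"
        by (intro measurable_sets[OF borel_measurable_sgn_vector]) auto
      then show ?thesis by auto
    qed
    have "ennreal \<omega> = emeasure lborel (ball (0::'a) 1)" by (simp add: emeasure_ball \<omega>_def)
    also have "\<dots> = emeasure lborel (ball (0::'a) 1 - {0})"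
      by (rule emeasure_Diff_null_set[symmetric]) (auto simp: null_sets_def)
    also have "\<dots> \<le> emeasure lborel (\<Union>i. ball 0 1 \<inter> sgn -` (closure (C i) \<inter> sphere 0 1))"
    proof (rule emeasure_mono)
      show "ball (0::'a) 1 - {0} \<subseteq> (\<Union>i. ball 0 1 \<inter> sgn -` (closure (C i) \<inter> sphere 0 1))"
      proof
        fix v :: 'a assume v: "v \<in> ball 0 1 - {0}"
        then have "sgn v \<in> sphere 0 1" by (simp add: norm_sgn)
        then obtain i where "sgn v \<in> C i" using C(1) by blast
        then show "v \<in> (\<Union>i. ball 0 1 \<inter> sgn -` (closure (C i) \<inter> sphere 0 1))"
          using v \<open>sgn v \<in> sphere 0 1\<close> closure_subset by (intro UN_I[of i]) auto
      qed
      show "(\<Union>i. ball 0 1 \<inter> sgn -` (closure (C i) \<inter> sphere 0 1)) \<in> sets lborel"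
        unfolding sets_lborel by (rule sets.countable_nat_UN) (use meas in blast)
    qed
    also have "\<dots> \<le> (\<Sum>i. emeasure lborel (ball 0 1 \<inter> sgn -` (closure (C i) \<inter> sphere 0 1)))"
      by (intro emeasure_subadditive_countably) (use meas in auto)
    also have "\<dots> \<le> (\<Sum>i. ennreal K * hausdorff_weight k (C i))"
      by (intro suminf_le weight C) auto
    also have "\<dots> = ennreal K * (\<Sum>i. hausdorff_weight k (C i))" by simp
    finally have "ennreal (1 / K) * ennreal \<omega> \<le> ennreal (1 / K) * (ennreal K * (\<Sum>i. hausdorff_weight k (C i)))"
      by (rule mult_left_mono) simp
    moreover have "ennreal (1 / K) * ennreal K = 1" using K by (simp flip: ennreal_mult)
    ultimately show "ennreal (\<omega> / K) \<le> (\<Sum>i. hausdorff_weight k (C i))"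
      using K \<omega> by (simp add: mult.assoc[symmetric] flip: ennreal_mult)
  qed
  also have "\<dots> \<le> hausdorff_outer k (sphere (0::'a) 1)" by (rule hausdorff_premeasure_le_outer) simp
  finally show ?thesis using K \<omega> unfolding k_def by (simp add: less_le_trans[rotated])
qed

lemma ball_sphere_borel [measurable]:
  "ball x r \<in> sets borel" "sphere x r \<in> sets borel" for x :: "'a::euclidean_space"
  by (auto intro: borel_closed closed_sphere)

text \<open>Finitely many balls of radius \<open>r\<close> cover the compact set; if one were a null set, all of them would be.\<close>

lemma uniformly_distributed_ball_pos:
  fixes M :: "'a::{metric_space, second_countable_topology} measure"
  assumes M: "sets M = sets borel" and S: "compact S" "AE x in M. x \<in> S"
    and g: "\<And>x y. x \<in> S \<Longrightarrow> y \<in> S \<Longrightarrow> emeasure M (ball x r) = emeasure M (ball y r)"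
    and pos: "emeasure M UNIV \<noteq> 0" and r: "r > 0" and x: "x \<in> S"
  shows "emeasure M (ball x r) \<noteq> 0"
proof
  assume 0: "emeasure M (ball x r) = 0"
  have [measurable_cong]: "sets M = sets borel" by fact
  obtain F where F: "F \<subseteq> S" "finite F" "S \<subseteq> (\<Union>y\<in>F. ball y r)"
    using compactE_image[OF S(1), of S "\<lambda>y. ball y r"] r by (metis UN_I centre_in_ball open_ball subsetI)
  have "ball y r \<in> null_sets M" if "y \<in> F" for y
    using g[of y x] F(1) that x 0 M by (auto simp: null_sets_def)
  then have "(\<Union>y\<in>F. ball y r) \<in> null_sets M" using F(2) by (intro null_sets.finite_UN) auto
  then have "AE y in M. y \<notin> (\<Union>y\<in>F. ball y r)" by (rule AE_not_in)
  with S(2) have "AE y in M. False" by eventually_elim (use F(3) in auto)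
  then have "emeasure M (space M) = 0" by (simp add: AE_iff_null null_sets_def)
  then show False using pos sets_eq_imp_space_eq[OF M] by simp
qed

section \<open>Averages over the sphere\<close>

lemma nn_integral_lborel_scale:
  fixes f :: "'a::euclidean_space \<Rightarrow> ennreal"
  assumes [measurable]: "f \<in> borel_measurable borel" and c: "c > 0"
  shows "(\<integral>\<^sup>+x. f x \<partial>lborel) = ennreal (c ^ DIM('a)) * (\<integral>\<^sup>+x. f (c *\<^sub>R x) \<partial>lborel)"
proof -
  have "(\<integral>\<^sup>+x. f x \<partial>lborel) = (\<integral>\<^sup>+x. f x \<partial>density (distr lborel borel (\<lambda>x. 0 + c *\<^sub>R x)) (\<lambda>_. \<bar>c\<bar> ^ DIM('a)))"
    using lborel_affine[of c "0::'a"] c by simp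
  also have "\<dots> = (\<integral>\<^sup>+x. ennreal (c ^ DIM('a)) * f (c *\<^sub>R x) \<partial>lborel)"
    using c by (simp add: nn_integral_density nn_integral_distr)
  finally show ?thesis by (simp add: nn_integral_cmult)
qed

lemma powr_difference_quotient: "((\<lambda>t::real. (1 - t powr a) / (1 - t)) \<longlongrightarrow> a) (at_left 1)"
proof -
  have "((\<lambda>t. t powr a) has_real_derivative a * 1 powr (a - 1)) (at 1)"
    by (auto intro!: derivative_eq_intros)
  then have "((\<lambda>t. (t powr a - 1) / (t - 1)) \<longlongrightarrow> a) (at 1)"
    by (simp add: has_field_derivative_iff)
  then have "((\<lambda>t. (t powr a - 1) / (t - 1)) \<longlongrightarrow> a) (at_left 1)"
    by (rule tendsto_mono[rotated]) (simp add: at_le)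
  moreover have "(t powr a - 1) / (t - 1) = (1 - t powr a) / (1 - t)" for t
    by (metis minus_diff_eq minus_divide_divide)
  ultimately show ?thesis by simp
qed

text \<open>By scaling, \<open>\<integral> \<bar>v\<bar>\<^sup>p\<close> over the ball of radius \<open>t\<close> is \<open>t powr (n + p)\<close> times the value \<open>m\<close> for the unit ball. The
integral over the shell between the two balls is therefore \<open>m (1 - t powr (n + p))\<close>, while the integrand is
close to \<open>1\<close> there and the volume is \<open>\<omega> (1 - t\<^sup>n)\<close>. Dividing by \<open>1 - t\<close> and letting \<open>t\<close> tend to \<open>1\<close> gives
\<open>m (n + p) = n \<omega>\<close>.\<close>

lemma unit_ball_moment:
  fixes p :: real
  assumes p: "p > 0"
  shows "(\<integral>\<^sup>+v. ennreal (norm v powr p) * indicator (ball 0 1) v \<partial>(lborel::'a::euclidean_space measure)) =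
    ennreal (real DIM('a) * unit_ball_vol (real DIM('a)) / (real DIM('a) + p))"
proof -
  define n where "n = DIM('a)"
  define \<omega> where "\<omega> = unit_ball_vol (real n)"
  have \<omega>: "\<omega> > 0" by (simp add: \<omega>_def)
  define M where "M t = (\<integral>\<^sup>+v. ennreal (norm v powr p) * indicator (ball 0 t) v \<partial>(lborel::'a measure))" for t
  define S where "S t = (\<integral>\<^sup>+v. ennreal (norm v powr p) * indicator (ball 0 1 - ball 0 t) v \<partial>(lborel::'a measure))" for t
  have vol: "emeasure lborel (ball (0::'a) t) = ennreal (\<omega> * t ^ n)" if "t > 0" for t
    using that by (simp add: emeasure_ball \<omega>_def n_def)
  have diff: "emeasure lborel (ball (0::'a) 1 - ball 0 t) = ennreal (\<omega> * (1 - t ^ n))" if t: "0 < t" "t < 1" for t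
  proof -
    have "emeasure lborel (ball (0::'a) 1 - ball 0 t) = emeasure lborel (ball (0::'a) 1) - emeasure lborel (ball (0::'a) t)"
      using t emeasure_bounded_finite[OF bounded_ball, of "0::'a" t] by (intro emeasure_Diff) auto
    then show ?thesis using t \<omega> by (simp add: vol ennreal_minus algebra_simps)
  qed
  have Mt: "M t = ennreal (t powr (real n + p)) * M 1" if t: "0 < t" for t
  proof -
    have "M t = ennreal (t ^ n) * (\<integral>\<^sup>+v. ennreal (norm (t *\<^sub>R v) powr p) * indicator (ball 0 t) (t *\<^sub>R v) \<partial>(lborel::'a measure))"
      unfolding M_def n_def by (rule nn_integral_lborel_scale) (use t in auto)
    also have "(\<integral>\<^sup>+v. ennreal (norm (t *\<^sub>R v) powr p) * indicator (ball 0 t) (t *\<^sub>R v) \<partial>(lborel::'a measure)) =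
      (\<integral>\<^sup>+v. ennreal (t powr p) * (ennreal (norm v powr p) * indicator (ball 0 1) v) \<partial>(lborel::'a measure))"
      using t by (intro nn_integral_cong) (auto simp: indicator_def powr_mult ennreal_mult')
    also have "\<dots> = ennreal (t powr p) * M 1" unfolding M_def by (rule nn_integral_cmult) measurable
    finally show ?thesis using t by (simp add: powr_add powr_realpow ennreal_mult mult.assoc)
  qed
  have split: "M 1 = M t + S t" if t: "0 < t" "t < 1" for t
  proof -
    have "M 1 = (\<integral>\<^sup>+v. ennreal (norm v powr p) * indicator (ball 0 t) v + ennreal (norm v powr p) * indicator (ball 0 1 - ball 0 t) v \<partial>(lborel::'a measure))"
      unfolding M_def using t by (intro nn_integral_cong) (auto simp: indicator_def)
    also have "\<dots> = M t + S t" unfolding M_def S_def by (intro nn_integral_add) auto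
    finally show ?thesis .
  qed
  have pw: "norm v powr p \<le> 1" if "norm v < 1" for v :: 'a
    using that p by (simp add: powr_le1)
  have M1: "M 1 \<le> ennreal \<omega>"
  proof -
    have "M 1 \<le> (\<integral>\<^sup>+v. indicator (ball 0 1) v \<partial>(lborel::'a measure))"
      unfolding M_def by (intro nn_integral_mono) (auto simp: indicator_def pw)
    then show ?thesis using vol[of 1] by simp
  qed
  define m where "m = enn2real (M 1)"
  have "M 1 < top" using M1 by (rule le_less_trans) simp
  then have m: "M 1 = ennreal m" "m \<ge> 0" by (simp_all add: m_def)
  have S_up: "S t \<le> ennreal (\<omega> * (1 - t ^ n))" if t: "0 < t" "t < 1" for t
  proof -
    have "S t \<le> (\<integral>\<^sup>+v. indicator (ball 0 1 - ball 0 t) v \<partial>(lborel::'a measure))"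
      unfolding S_def by (intro nn_integral_mono) (auto simp: indicator_def pw)
    then show ?thesis using diff[OF t] by simp
  qed
  have S_low: "ennreal (t powr p * (\<omega> * (1 - t ^ n))) \<le> S t" if t: "0 < t" "t < 1" for t
  proof -
    have "ennreal (t powr p * (\<omega> * (1 - t ^ n))) = (\<integral>\<^sup>+v. ennreal (t powr p) * indicator (ball 0 1 - ball 0 t) v \<partial>(lborel::'a measure))"
      using diff[OF t] t \<omega> by (simp add: nn_integral_cmult_indicator ennreal_mult power_le_one)
    also have "\<dots> \<le> S t"
      unfolding S_def using p t by (intro nn_integral_mono) (auto simp: indicator_def intro!: ennreal_leI powr_mono2)
    finally show ?thesis .
  qed
  have S_eq: "S t = ennreal (m * (1 - t powr (real n + p)))" if t: "0 < t" "t < 1" for t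
  proof -
    have a: "t powr (real n + p) \<le> 1" using t p by (simp add: powr_le1)
    have "ennreal m = ennreal (t powr (real n + p) * m) + S t" using split[OF t] Mt[OF t(1)] m by (simp add: ennreal_mult)
    then have "S t = ennreal m - ennreal (t powr (real n + p) * m)" by simp
    also have "\<dots> = ennreal (m - t powr (real n + p) * m)" using m a by (intro ennreal_minus) simp
    finally show ?thesis by (simp add: algebra_simps)
  qed
  have ev: "\<forall>\<^sub>F t in at_left 1. 0 < t \<and> t < (1::real)"
    unfolding eventually_at_left_field by (intro exI[of _ 0]) auto
  have limm: "((\<lambda>t. m * ((1 - t powr (real n + p)) / (1 - t))) \<longlongrightarrow> m * (real n + p)) (at_left 1)"
    by (intro tendsto_intros powr_difference_quotient)
  have limu: "((\<lambda>t. \<omega> * ((1 - t powr real n) / (1 - t))) \<longlongrightarrow> \<omega> * real n) (at_left 1)"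
    by (intro tendsto_intros powr_difference_quotient)
  have liml: "((\<lambda>t. t powr p * (\<omega> * ((1 - t powr real n) / (1 - t)))) \<longlongrightarrow> 1 powr p * (\<omega> * real n)) (at_left 1)"
    by (intro tendsto_intros powr_difference_quotient) auto
  have "m * (real n + p) \<le> \<omega> * real n"
  proof (rule tendsto_le[OF _ limu limm])
    show "\<forall>\<^sub>F t in at_left 1. m * ((1 - t powr (real n + p)) / (1 - t)) \<le> \<omega> * ((1 - t powr real n) / (1 - t))"
      using ev
    proof eventually_elim
      case (elim t)
      have "t ^ n \<le> 1" using elim by (simp add: power_le_one)
      then have "m * (1 - t powr (real n + p)) \<le> \<omega> * (1 - t ^ n)"
        using S_up[of t] S_eq[of t] elim \<omega> by (simp add: ennreal_le_iff)
      then show ?case using elim by (simp add: powr_realpow divide_right_mono)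
    qed
  qed simp
  moreover have "1 powr p * (\<omega> * real n) \<le> m * (real n + p)"
  proof (rule tendsto_le[OF _ limm liml])
    show "\<forall>\<^sub>F t in at_left 1. t powr p * (\<omega> * ((1 - t powr real n) / (1 - t))) \<le> m * ((1 - t powr (real n + p)) / (1 - t))"
      using ev
    proof eventually_elim
      case (elim t)
      have "t powr (real n + p) \<le> 1" using elim p by (simp add: powr_le1)
      then have "t powr p * (\<omega> * (1 - t ^ n)) \<le> m * (1 - t powr (real n + p))"
        using S_low[of t] S_eq[of t] elim m by (simp add: ennreal_le_iff)
      then show ?case using elim by (simp add: powr_realpow divide_right_mono)
    qed
  qed simp
  ultimately have "m * (real n + p) = real n * \<omega>" by (simp add: mult.commute)
  then have "m = real n * \<omega> / (real n + p)" using p by (simp add: eq_divide_eq)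
  then show ?thesis using m by (simp add: M_def n_def \<omega>_def)
qed

definition sphere_hausdorff :: "'a::euclidean_space measure" where
  "sphere_hausdorff = density (hausdorff_measure (DIM('a) - 1)) (indicator (sphere 0 1))"

text \<open>The image of \<open>\<bar>v\<bar>\<^sup>p dv\<close> on the unit ball under the radial projection to the sphere.\<close>

definition sphere_moment :: "real \<Rightarrow> 'a::euclidean_space measure" where
  "sphere_moment p = distr (density lborel (\<lambda>v. ennreal (norm v powr p) * indicator (ball 0 1) v)) borel sgn"

lemma sets_sphere_measures [measurable_cong, simp]: "sets sphere_hausdorff = sets borel" "sets (sphere_moment p) = sets borel"
  by (simp_all add: sphere_hausdorff_def sphere_moment_def)

lemma emeasure_sphere_hausdorff:
  "A \<in> sets borel \<Longrightarrow> emeasure (sphere_hausdorff :: 'a::euclidean_space measure) A = hausdorff_outer (DIM('a) - 1) (A \<inter> sphere 0 1)"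
  unfolding sphere_hausdorff_def
  by (subst emeasure_density) (auto simp: emeasure_hausdorff_measure[symmetric] indicator_inter_arith[symmetric] Int_commute)

lemma emeasure_sphere_moment:
  fixes A :: "'a::euclidean_space set"
  assumes [measurable]: "A \<in> sets borel"
  shows "emeasure (sphere_moment p) A = (\<integral>\<^sup>+v. ennreal (norm v powr p) * indicator (ball 0 1) v * indicator A (sgn v) \<partial>lborel)"
proof -
  have "emeasure (sphere_moment p) A = (\<integral>\<^sup>+v. indicator A v \<partial>sphere_moment p)" by simp
  also have "\<dots> = (\<integral>\<^sup>+v. ennreal (norm v powr p) * indicator (ball 0 1) v * indicator A (sgn v) \<partial>lborel)"
    unfolding sphere_moment_def
    by (subst nn_integral_distr, simp, simp, subst nn_integral_density) simp_all
  finally show ?thesis .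
qed

lemma sphere_hausdorff_ball:
  fixes x y :: "'a::euclidean_space"
  assumes xy: "x \<in> sphere 0 1" "y \<in> sphere 0 1"
  shows "emeasure sphere_hausdorff (ball x r) = emeasure sphere_hausdorff (ball y r)"
proof -
  have le: "emeasure sphere_hausdorff (ball y r) \<le> emeasure sphere_hausdorff (ball x r)" if "norm x = 1" "norm y = 1" for x y :: 'a
  proof -
    let ?T = "reflection (x - y)"
    have T: "?T x = y" using that by (intro reflection_swap) simp
    have "ball y r \<inter> sphere 0 1 \<subseteq> ?T ` (ball x r \<inter> sphere 0 1)"
    proof
      fix z assume z: "z \<in> ball y r \<inter> sphere 0 1"
      have "dist x (?T z) = dist y z" using dist_reflection[of "x - y" x "?T z"] T by (simp add: reflection_involution)
      then show "z \<in> ?T ` (ball x r \<inter> sphere 0 1)"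
        using z by (intro image_eqI[of _ _ "?T z"]) (auto simp: reflection_involution norm_reflection)
    qed
    then have "hausdorff_outer (DIM('a) - 1) (ball y r \<inter> sphere 0 1) \<le> hausdorff_outer (DIM('a) - 1) (?T ` (ball x r \<inter> sphere 0 1))"
      using hausdorff_outer_space[where 'a='a] by (auto simp: outer_measure_space_def increasing_def)
    also have "\<dots> \<le> hausdorff_outer (DIM('a) - 1) (ball x r \<inter> sphere 0 1)"
      by (rule hausdorff_outer_isometry_le) (rule dist_reflection)
    finally show ?thesis by (simp add: emeasure_sphere_hausdorff)
  qed
  show ?thesis using le[of x y] le[of y x] xy by (simp add: antisym)
qed

lemma sphere_moment_ball:
  fixes x y :: "'a::euclidean_space"
  assumes xy: "x \<in> sphere 0 1" "y \<in> sphere 0 1"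
  shows "emeasure (sphere_moment p) (ball x r) = emeasure (sphere_moment p) (ball y r)"
proof -
  let ?T = "reflection (x - y)"
  have T: "?T x = y" using xy by (intro reflection_swap) simp
  have "emeasure (sphere_moment p) (ball y r) = (\<integral>\<^sup>+v. ennreal (norm v powr p) * indicator (ball 0 1) v * indicator (ball y r) (sgn v) \<partial>distr lborel borel ?T)"
    by (simp add: emeasure_sphere_moment distr_reflection_lborel)
  also have "\<dots> = (\<integral>\<^sup>+v. ennreal (norm (?T v) powr p) * indicator (ball 0 1) (?T v) * indicator (ball y r) (sgn (?T v)) \<partial>lborel)"
    by (subst nn_integral_distr) auto
  also have "\<dots> = emeasure (sphere_moment p) (ball x r)"
    unfolding emeasure_sphere_moment[OF borel_open[OF open_ball]]
  proof (intro nn_integral_cong)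
    fix v :: 'a
    have sgnT: "sgn (?T v) = ?T (sgn v)" by (simp add: sgn_div_norm norm_reflection linear_cmul[OF linear_reflection])
    have "dist y (?T (sgn v)) = dist x (sgn v)" using dist_reflection[of "x - y" x "sgn v"] T by simp
    then show "ennreal (norm (?T v) powr p) * indicator (ball 0 1) (?T v) * indicator (ball y r) (sgn (?T v)) =
      ennreal (norm v powr p) * indicator (ball 0 1) v * indicator (ball x r) (sgn v)"
      by (simp add: sgnT norm_reflection indicator_def)
  qed
  finally show ?thesis by simp
qed

text \<open>For a homogeneous \<open>\<Phi>\<close> the integral over the ball is the integral of \<open>\<Phi>\<close> with respect to \<open>sphere_moment\<close>. This
measure is proportional to the Hausdorff measure of the sphere, and \<open>KS_constant\<close> is the reciprocal
of its total mass.\<close>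

theorem sphere_average_eq_ball_average:
  fixes \<Phi> :: "'a::euclidean_space \<Rightarrow> ennreal" and p :: real
  assumes p: "p > 0" and [measurable]: "\<Phi> \<in> borel_measurable borel"
    and hom: "\<And>c v. c > 0 \<Longrightarrow> \<Phi> (c *\<^sub>R v) = ennreal (c powr p) * \<Phi> v"
  shows "(\<integral>\<^sup>+\<nu>\<in>sphere 0 1. \<Phi> \<nu> \<partial>hausdorff_measure (DIM('a) - 1)) / emeasure (hausdorff_measure (DIM('a) - 1)) (sphere (0::'a) 1)
    = ennreal (KS_constant TYPE('a) p) * (\<integral>\<^sup>+v. \<Phi> v * indicator (ball 0 1) v \<partial>lborel)"
proof -
  let ?S = "sphere (0::'a) 1"
  define H where "H = emeasure (hausdorff_measure (DIM('a) - 1)) ?S"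
  define \<mu> where "\<mu> = real DIM('a) * unit_ball_vol (real DIM('a)) / (real DIM('a) + p)"
  have \<mu>: "\<mu> > 0" using p by (simp add: \<mu>_def)
  have H: "H \<noteq> 0" "H \<noteq> \<infinity>"
    using hausdorff_sphere_pos[where 'a='a] hausdorff_sphere_finite[where 'a='a] by (auto simp: H_def emeasure_hausdorff_measure)
  have HU: "emeasure sphere_hausdorff (UNIV::'a set) = H" by (simp add: emeasure_sphere_hausdorff H_def emeasure_hausdorff_measure)
  have MU: "emeasure (sphere_moment p) (UNIV::'a set) = ennreal \<mu>"
    using unit_ball_moment[OF p, where 'a='a] by (simp add: emeasure_sphere_moment \<mu>_def)
  have sp: "space sphere_hausdorff = (UNIV::'a set)" "space (sphere_moment p) = (UNIV::'a set)"
    by (simp_all add: sphere_hausdorff_def sphere_moment_def)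
  have fin: "finite_measure (sphere_hausdorff::'a measure)" "finite_measure (sphere_moment p :: 'a measure)"
    by (rule finite_measureI, simp add: sp HU H[unfolded infinity_ennreal_def] MU)+
  have aeH: "AE x in sphere_hausdorff. x \<in> ?S"
    unfolding sphere_hausdorff_def by (subst AE_density) (auto simp: indicator_def)
  have aeM: "AE x in sphere_moment p. x \<in> ?S"
    unfolding sphere_moment_def
  proof (subst AE_distr_iff)
    show "AE v in density lborel (\<lambda>v. ennreal (norm v powr p) * indicator (ball 0 1) v). sgn v \<in> ?S"
      by (subst AE_density) (auto intro!: AE_I2 simp: norm_sgn)
  qed auto
  obtain x0 :: 'a where x0: "x0 \<in> ?S" using vector_choose_size[of 1] by auto
  have eq: "scale_measure H (sphere_moment p) = scale_measure (ennreal \<mu>) (sphere_hausdorff :: 'a measure)"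
    unfolding HU[symmetric] MU[symmetric]
  proof (rule uniformly_distributed_unique[OF fin(1) _ fin(2) _ aeH aeM])
    show "emeasure sphere_hausdorff (ball x r) = emeasure sphere_hausdorff (ball x0 r)" if "x \<in> ?S" for x r
      using that x0 by (rule sphere_hausdorff_ball)
    show "emeasure (sphere_moment p) (ball x r) = emeasure (sphere_moment p) (ball x0 r)" if "x \<in> ?S" for x r
      using that x0 by (rule sphere_moment_ball)
    show "emeasure sphere_hausdorff (ball x0 r) \<noteq> 0" if "r > 0" for r
      by (rule uniformly_distributed_ball_pos[OF _ compact_sphere aeH _ _ that x0]) (use sphere_hausdorff_ball HU H in auto)
    show "emeasure (sphere_moment p) (ball x0 r) \<noteq> 0" if "r > 0" for r
      by (rule uniformly_distributed_ball_pos[OF _ compact_sphere aeM _ _ that x0]) (use sphere_moment_ball MU \<mu> in auto)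
    show "?S \<noteq> {}" using x0 by auto
  qed simp_all
  have "H * (\<integral>\<^sup>+v. \<Phi> v \<partial>sphere_moment p) = ennreal \<mu> * (\<integral>\<^sup>+v. \<Phi> v \<partial>sphere_hausdorff)"
    using arg_cong[OF eq, of "\<lambda>M. \<integral>\<^sup>+v. \<Phi> v \<partial>M"] by (simp add: nn_integral_scale_measure)
  moreover have "(\<integral>\<^sup>+v. \<Phi> v \<partial>sphere_hausdorff) = (\<integral>\<^sup>+\<nu>\<in>?S. \<Phi> \<nu> \<partial>hausdorff_measure (DIM('a) - 1))"
    unfolding sphere_hausdorff_def by (simp add: nn_integral_density mult.commute)
  moreover have "(\<integral>\<^sup>+v. \<Phi> v \<partial>sphere_moment p) = (\<integral>\<^sup>+v. \<Phi> v * indicator (ball 0 1) v \<partial>lborel)"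
  proof -
    have "(\<integral>\<^sup>+v. \<Phi> v \<partial>sphere_moment p) = (\<integral>\<^sup>+v. ennreal (norm v powr p) * indicator (ball 0 1) v * \<Phi> (sgn v) \<partial>lborel)"
      unfolding sphere_moment_def by (simp add: nn_integral_distr nn_integral_density)
    also have "\<dots> = (\<integral>\<^sup>+v. \<Phi> v * indicator (ball 0 1) v \<partial>lborel)"
    proof (rule nn_integral_cong_AE)
      have "AE v in lborel. v \<noteq> (0::'a)" by (rule AE_lborel_singleton)
      then show "AE v in lborel. ennreal (norm v powr p) * indicator (ball 0 1) v * \<Phi> (sgn v) = \<Phi> v * indicator (ball (0::'a) 1) v"
      proof eventually_elim
        case (elim v)
        then have "\<Phi> v = ennreal (norm v powr p) * \<Phi> (sgn v)"
          using hom[of "norm v" "sgn v"] by (simp add: sgn_div_norm)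
        then show ?case by (simp add: ac_simps)
      qed
    qed
    finally show ?thesis .
  qed
  ultimately have key: "H * (\<integral>\<^sup>+v. \<Phi> v * indicator (ball 0 1) v \<partial>lborel) = ennreal \<mu> * (\<integral>\<^sup>+\<nu>\<in>?S. \<Phi> \<nu> \<partial>hausdorff_measure (DIM('a) - 1))"
    by simp
  have KS: "KS_constant TYPE('a) p = 1 / \<mu>"
    using content_ball[of 1 "0::'a"] by (simp add: KS_constant_def \<mu>_def)
  have "(\<integral>\<^sup>+\<nu>\<in>?S. \<Phi> \<nu> \<partial>hausdorff_measure (DIM('a) - 1)) = ennreal (1 / \<mu>) * (ennreal \<mu> * (\<integral>\<^sup>+\<nu>\<in>?S. \<Phi> \<nu> \<partial>hausdorff_measure (DIM('a) - 1)))"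
    using \<mu> by (simp add: mult.assoc[symmetric] flip: ennreal_mult)
  also have "\<dots> = (ennreal (1 / \<mu>) * (\<integral>\<^sup>+v. \<Phi> v * indicator (ball 0 1) v \<partial>lborel)) * H"
    unfolding key[symmetric] by (simp add: ac_simps)
  finally show ?thesis
    using H unfolding KS by (simp only: H_def[symmetric]) (simp add: mult_divide_eq_ennreal)
qed

section \<open>Test functions\<close>

abbreviation tsupport :: "('a::euclidean_space \<Rightarrow> real) \<Rightarrow> 'a set" where
  "tsupport \<phi> \<equiv> closure {x. \<phi> x \<noteq> 0}"

lemma continuous_compact_support_bounded:
  fixes f :: "'a::euclidean_space \<Rightarrow> real"
  assumes "continuous_on UNIV f" "compact K" "\<And>x. x \<notin> K \<Longrightarrow> f x = 0"
  obtains B where "B \<ge> 0" "\<And>x. \<bar>f x\<bar> \<le> B"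
proof -
  have "bounded (f ` K)"
    using assms by (intro compact_imp_bounded compact_continuous_image) (auto intro: continuous_on_subset)
  then obtain B where B: "\<And>x. x \<in> K \<Longrightarrow> \<bar>f x\<bar> \<le> B" by (auto simp: bounded_iff)
  have "\<bar>f x\<bar> \<le> max B 0" for x using B[of x] assms(3)[of x] by (cases "x \<in> K") auto
  then show ?thesis using that[of "max B 0"] by auto
qed

context
  fixes \<Omega> :: "'a::euclidean_space set" and \<phi> :: "'a \<Rightarrow> real"
  assumes \<phi>: "\<phi> \<in> C_c_infinity \<Omega>"
begin

lemma test_function_continuous: "continuous_on UNIV \<phi>"
  and test_function_support: "compact (tsupport \<phi>)" "tsupport \<phi> \<subseteq> \<Omega>"
  using \<phi> by (auto simp: C_c_infinity_def C_c_def)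

lemma test_function_zero: "x \<notin> tsupport \<phi> \<Longrightarrow> \<phi> x = 0"
  using closure_subset[of "{x. \<phi> x \<noteq> 0}"] by auto

lemma test_function_has_derivative: "(\<phi> has_derivative frechet_derivative \<phi> (at x)) (at x)"
proof -
  have "k_times_cont_diff 1 \<phi>" using \<phi> by (simp add: C_c_infinity_def)
  then show ?thesis by (simp add: frechet_derivative_works)
qed

lemma test_function_derivative_linear: "linear (frechet_derivative \<phi> (at x))"
  using test_function_has_derivative has_derivative_linear by blast

lemma test_function_derivative_expand:
  "frechet_derivative \<phi> (at x) z = (\<Sum>i\<in>Basis. (z \<bullet> i) * frechet_derivative \<phi> (at x) i)"
proof -
  have "frechet_derivative \<phi> (at x) z = frechet_derivative \<phi> (at x) (\<Sum>i\<in>Basis. (z \<bullet> i) *\<^sub>R i)"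
    by (simp add: euclidean_representation)
  also have "\<dots> = (\<Sum>i\<in>Basis. (z \<bullet> i) * frechet_derivative \<phi> (at x) i)"
    by (simp add: linear_sum[OF test_function_derivative_linear] linear_cmul[OF test_function_derivative_linear])
  finally show ?thesis .
qed

lemma test_function_derivative_continuous: "continuous_on UNIV (\<lambda>x. frechet_derivative \<phi> (at x) z)"
proof -
  have "k_times_cont_diff 1 \<phi>" using \<phi> by (simp add: C_c_infinity_def)
  then have "continuous_on UNIV (\<lambda>x. frechet_derivative \<phi> (at x) i)" if "i \<in> Basis" for i
    using that by simp
  then show ?thesis
    by (subst test_function_derivative_expand) (auto intro!: continuous_intros)
qed

lemma test_function_derivative_zero: "x \<notin> tsupport \<phi> \<Longrightarrow> frechet_derivative \<phi> (at x) z = 0"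
proof -
  assume x: "x \<notin> tsupport \<phi>"
  have "((\<lambda>_. 0::real) has_derivative (\<lambda>_. 0)) (at x)" by simp
  then have "(\<phi> has_derivative (\<lambda>_. 0)) (at x)"
  proof (rule has_derivative_transform_within_open[where s="- tsupport \<phi>"])
    show "x \<in> - tsupport \<phi>" using x by simp
    show "0 = \<phi> y" if "y \<in> - tsupport \<phi>" for y using that test_function_zero[of y] by simp
    show "open (- tsupport \<phi>)" by (rule open_Compl) (rule closed_closure)
  qed
  from fun_cong[OF frechet_derivative_at[OF this], of z] show ?thesis by simp
qed

lemma test_function_bounded: obtains B where "B \<ge> 0" "\<And>x. \<bar>\<phi> x\<bar> \<le> B"
  by (rule continuous_compact_support_bounded[OF test_function_continuous test_function_support(1)]) (erule test_function_zero | (rule that; assumption))+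

lemma test_function_derivative_bounded:
  obtains B where "B \<ge> 0" "\<And>x z. \<bar>frechet_derivative \<phi> (at x) z\<bar> \<le> B * norm z"
proof -
  have "\<exists>B\<ge>0. \<forall>x. \<bar>frechet_derivative \<phi> (at x) i\<bar> \<le> B" for i
    using continuous_compact_support_bounded[OF test_function_derivative_continuous test_function_support(1) test_function_derivative_zero]
    by metis
  then obtain B where B: "\<And>i. B i \<ge> 0" "\<And>i x. \<bar>frechet_derivative \<phi> (at x) i\<bar> \<le> B i" by metis
  show ?thesis
  proof (rule that[of "\<Sum>i\<in>Basis. B i"])
    show "(\<Sum>i\<in>Basis. B i) \<ge> 0" using B by (simp add: sum_nonneg)
    fix x z
    have "\<bar>frechet_derivative \<phi> (at x) z\<bar> \<le> (\<Sum>i\<in>Basis. \<bar>(z \<bullet> i) * frechet_derivative \<phi> (at x) i\<bar>)"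
      by (subst test_function_derivative_expand) (rule sum_abs)
    also have "\<dots> \<le> (\<Sum>i\<in>Basis. norm z * B i)"
      unfolding abs_mult using B by (intro sum_mono mult_mono Basis_le_norm) auto
    finally show "\<bar>frechet_derivative \<phi> (at x) z\<bar> \<le> (\<Sum>i\<in>Basis. B i) * norm z"
      by (simp add: sum_distrib_left mult.commute)
  qed
qed

lemma test_function_measurable: "\<phi> \<in> borel_measurable borel"
  "(\<lambda>x. frechet_derivative \<phi> (at x) z) \<in> borel_measurable borel"
  using test_function_continuous test_function_derivative_continuous by (auto intro: borel_measurable_continuous_onI)

text \<open>The fundamental theorem of calculus along the segment from \<open>x\<close> to \<open>x + z\<close>.\<close>

lemma test_function_increment:
  "\<phi> (x + z) - \<phi> x = (LINT t|lborel. frechet_derivative \<phi> (at (x + t *\<^sub>R z)) z * indicator {0..1} t)"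
proof -
  have "(LINT t|lborel. frechet_derivative \<phi> (at (x + t *\<^sub>R z)) z * indicator {0..1} t) = \<phi> (x + 1 *\<^sub>R z) - \<phi> (x + 0 *\<^sub>R z)"
  proof (rule integral_FTC_Icc_real)
    fix t :: real
    have "((\<lambda>t. x + t *\<^sub>R z) has_derivative (\<lambda>h. h *\<^sub>R z)) (at t)" by (auto intro!: derivative_eq_intros)
    from has_derivative_compose[OF this test_function_has_derivative]
    have "((\<lambda>t. \<phi> (x + t *\<^sub>R z)) has_derivative (\<lambda>h. frechet_derivative \<phi> (at (x + t *\<^sub>R z)) (h *\<^sub>R z))) (at t)" .
    then show "((\<lambda>t. \<phi> (x + t *\<^sub>R z)) has_real_derivative frechet_derivative \<phi> (at (x + t *\<^sub>R z)) z) (at t)"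
      by (simp add: has_field_derivative_def linear_cmul[OF test_function_derivative_linear] mult.commute[of _ "frechet_derivative \<phi> (at (x + t *\<^sub>R z)) z"])
    show "isCont (\<lambda>t. frechet_derivative \<phi> (at (x + t *\<^sub>R z)) z) t"
    proof -
      have "continuous_on UNIV (\<lambda>t. frechet_derivative \<phi> (at (x + t *\<^sub>R z)) z)"
        by (rule continuous_on_compose2[OF test_function_derivative_continuous]) (auto intro!: continuous_intros)
      then show ?thesis by (simp add: continuous_on_eq_continuous_at)
    qed
  qed simp
  then show ?thesis by simp
qed

lemma test_function_shift:
  assumes "\<And>x. x \<in> tsupport \<phi> \<Longrightarrow> x - a \<in> \<Omega>'"
  shows "(\<lambda>x. \<phi> (x + a)) \<in> C_c_infinity \<Omega>'"
    and "frechet_derivative (\<lambda>x. \<phi> (x + a)) (at x) z = frechet_derivative \<phi> (at (x + a)) z"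
proof -
  show "frechet_derivative (\<lambda>x. \<phi> (x + a)) (at x) z = frechet_derivative \<phi> (at (x + a)) z"
    using frechet_derivative_shift[of \<phi> x a] test_function_has_derivative[of "x + a"]
    by (metis differentiableI frechet_derivative_at)
  have eq: "{x. \<phi> (x + a) \<noteq> 0} = (\<lambda>x. x - a) ` {x. \<phi> x \<noteq> 0}" by (auto simp: image_iff) (metis add_diff_cancel)
  have cl: "closure {x. \<phi> (x + a) \<noteq> 0} = (\<lambda>x. x - a) ` tsupport \<phi>"
    unfolding eq using closure_translation[of "- a" "{x. \<phi> x \<noteq> 0}"] by (simp add: image_image)
  have "compact (closure {x. \<phi> (x + a) \<noteq> 0})"
    unfolding cl using test_function_support(1) by (intro compact_continuous_image continuous_intros)
  moreover have "closure {x. \<phi> (x + a) \<noteq> 0} \<subseteq> \<Omega>'" unfolding cl using assms by auto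
  moreover have "continuous_on UNIV (\<lambda>x. \<phi> (x + a))"
    by (rule continuous_on_compose2[OF test_function_continuous]) (auto intro!: continuous_intros)
  ultimately show "(\<lambda>x. \<phi> (x + a)) \<in> C_c_infinity \<Omega>'"
    using \<phi> by (auto simp: C_c_infinity_def C_c_def k_times_cont_diff_shift)
qed

end

lemma C_c_infinity_zero: "(\<lambda>x. 0) \<in> C_c_infinity \<Omega>"
  by (simp add: C_c_infinity_def C_c_def k_times_cont_diff_const)

lemma C_c_infinity_lincomb:
  assumes f: "f \<in> C_c_infinity \<Omega>" and g: "g \<in> C_c_infinity \<Omega>"
  shows "(\<lambda>x. f x + c * g x) \<in> C_c_infinity \<Omega>"
    and "frechet_derivative (\<lambda>x. f x + c * g x) (at x) z = frechet_derivative f (at x) z + c * frechet_derivative g (at x) z"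
proof -
  have "{x. f x + c * g x \<noteq> 0} \<subseteq> {x. f x \<noteq> 0} \<union> {x. g x \<noteq> 0}" by auto
  then have cl: "tsupport (\<lambda>x. f x + c * g x) \<subseteq> tsupport f \<union> tsupport g"
    using closure_mono[of "{x. f x + c * g x \<noteq> 0}" "{x. f x \<noteq> 0} \<union> {x. g x \<noteq> 0}"] by (simp only: closure_Un)
  have "compact ((tsupport f \<union> tsupport g) \<inter> tsupport (\<lambda>x. f x + c * g x))"
    by (intro compact_Int_closed compact_Un test_function_support(1)[OF f] test_function_support(1)[OF g] closed_closure)
  then have "compact (tsupport (\<lambda>x. f x + c * g x))"
    using cl by (simp only: Int_absorb1)
  moreover have "tsupport (\<lambda>x. f x + c * g x) \<subseteq> \<Omega>"
    using cl test_function_support(2)[OF f] test_function_support(2)[OF g] by auto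
  moreover have "continuous_on UNIV (\<lambda>x. f x + c * g x)"
    using test_function_continuous[OF f] test_function_continuous[OF g] by (intro continuous_intros)
  moreover have "k_times_cont_diff k (\<lambda>x. f x + c * g x)" for k
    using f g by (intro k_times_cont_diff_add k_times_cont_diff_mult k_times_cont_diff_const) (auto simp: C_c_infinity_def)
  ultimately show "(\<lambda>x. f x + c * g x) \<in> C_c_infinity \<Omega>" by (simp add: C_c_infinity_def C_c_def)
  have "((\<lambda>x. f x + c * g x) has_derivative (\<lambda>z. frechet_derivative f (at x) z + c * frechet_derivative g (at x) z)) (at x)"
    by (intro has_derivative_add has_derivative_mult_right test_function_has_derivative[OF f] test_function_has_derivative[OF g])
  from fun_cong[OF frechet_derivative_at[OF this], of z]
  show "frechet_derivative (\<lambda>x. f x + c * g x) (at x) z = frechet_derivative f (at x) z + c * frechet_derivative g (at x) z"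
    by simp
qed

section \<open>Weak gradients along segments\<close>

text \<open>Weak gradients with Borel representatives on the whole space, integrated against \<open>lborel\<close>. Functions
such as \<open>(x, t) \<mapsto> G (x + t z)\<close> are then measurable for the product measure, which is not automatic for
Lebesgue measurable \<open>G\<close>.\<close>

definition borel_weak_gradient :: "'a::euclidean_space set \<Rightarrow> ('a \<Rightarrow> real) \<Rightarrow> ('a \<Rightarrow> 'a) \<Rightarrow> bool" where
  "borel_weak_gradient \<Omega> F G \<longleftrightarrow> integrable lborel F \<and> G \<in> borel_measurable borel \<and>
     (\<forall>K. compact K \<longrightarrow> K \<subseteq> \<Omega> \<longrightarrow> set_integrable lborel K G) \<and>
     (\<forall>\<phi>\<in>C_c_infinity \<Omega>. \<forall>i\<in>Basis. (LINT x|lborel. F x * frechet_derivative \<phi> (at x) i) = - (LINT x|lborel. (G x \<bullet> i) * \<phi> x))"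

lemma borel_weak_gradient_test:
  assumes FG: "borel_weak_gradient \<Omega> F G" and \<phi>: "\<phi> \<in> C_c_infinity \<Omega>"
  shows "(LINT x|lborel. F x * frechet_derivative \<phi> (at x) z) = - (LINT x|lborel. (z \<bullet> G x) * \<phi> x)"
proof -
  have F: "integrable lborel F" using FG unfolding borel_weak_gradient_def by blast
  have G: "set_integrable lborel (tsupport \<phi>) G"
    using FG test_function_support[OF \<phi>] unfolding borel_weak_gradient_def by blast
  have wg: "\<And>i. i \<in> Basis \<Longrightarrow> (LINT x|lborel. F x * frechet_derivative \<phi> (at x) i) = - (LINT x|lborel. (G x \<bullet> i) * \<phi> x)"
    using FG \<phi> unfolding borel_weak_gradient_def by blast
  obtain B where B: "B \<ge> 0" "\<And>x z. \<bar>frechet_derivative \<phi> (at x) z\<bar> \<le> B * norm z"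
    using test_function_derivative_bounded[OF \<phi>] by metis
  obtain C where C: "C \<ge> 0" "\<And>x. \<bar>\<phi> x\<bar> \<le> C"
    using test_function_bounded[OF \<phi>] by metis
  have iF: "integrable lborel (\<lambda>x. F x * frechet_derivative \<phi> (at x) i)" for i
    using F B(2)[of _ i] test_function_measurable[OF \<phi>] by (intro integrable_mult_bounded_function[where b="B * norm i"]) auto
  have iG: "integrable lborel (\<lambda>x. (G x \<bullet> i) * \<phi> x)" for i
  proof -
    have "integrable lborel (\<lambda>x. (indicator (tsupport \<phi>) x *\<^sub>R G x) \<bullet> i)"
      using G unfolding set_integrable_def by (rule integrable_inner_left)
    then have "integrable lborel (\<lambda>x. ((indicator (tsupport \<phi>) x *\<^sub>R G x) \<bullet> i) * \<phi> x)"
      using C test_function_measurable[OF \<phi>] by (intro integrable_mult_bounded_function[where b=C]) auto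
    moreover have "((indicator (tsupport \<phi>) x *\<^sub>R G x) \<bullet> i) * \<phi> x = (G x \<bullet> i) * \<phi> x" for x
      using test_function_zero[OF \<phi>, of x] by (auto simp: indicator_def)
    ultimately show ?thesis by (simp only:)
  qed
  have "(LINT x|lborel. F x * frechet_derivative \<phi> (at x) z) = (LINT x|lborel. (\<Sum>i\<in>Basis. (z \<bullet> i) * (F x * frechet_derivative \<phi> (at x) i)))"
  proof (intro Bochner_Integration.integral_cong[OF refl])
    fix x
    show "F x * frechet_derivative \<phi> (at x) z = (\<Sum>i\<in>Basis. (z \<bullet> i) * (F x * frechet_derivative \<phi> (at x) i))"
      by (subst test_function_derivative_expand[OF \<phi>, of x z]) (simp add: sum_distrib_left mult.left_commute)
  qed
  also have "\<dots> = (\<Sum>i\<in>Basis. (z \<bullet> i) * (LINT x|lborel. F x * frechet_derivative \<phi> (at x) i))"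
    using iF by (simp add: Bochner_Integration.integral_sum)
  also have "\<dots> = (\<Sum>i\<in>Basis. (z \<bullet> i) * - (LINT x|lborel. (G x \<bullet> i) * \<phi> x))" by (simp add: wg)
  also have "\<dots> = - (LINT x|lborel. (\<Sum>i\<in>Basis. (z \<bullet> i) * ((G x \<bullet> i) * \<phi> x)))"
    using iG by (simp add: Bochner_Integration.integral_sum sum_negf)
  also have "(LINT x|lborel. (\<Sum>i\<in>Basis. (z \<bullet> i) * ((G x \<bullet> i) * \<phi> x))) = (LINT x|lborel. (z \<bullet> G x) * \<phi> x)"
  proof (intro Bochner_Integration.integral_cong[OF refl])
    fix x
    show "(\<Sum>i\<in>Basis. (z \<bullet> i) * ((G x \<bullet> i) * \<phi> x)) = (z \<bullet> G x) * \<phi> x"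
      unfolding euclidean_inner[of z "G x"] by (simp add: sum_distrib_right mult.assoc)
  qed
  finally show ?thesis .
qed

lemma integrable_test_mult:
  assumes "integrable lborel f" "\<phi> \<in> C_c_infinity \<Omega>"
  shows "integrable lborel (\<lambda>x. f x * \<phi> x)"
proof -
  obtain C where C: "C \<ge> 0" "\<And>x. \<bar>\<phi> x\<bar> \<le> C"
    using test_function_bounded[OF assms(2)] by metis
  show ?thesis
    by (rule integrable_mult_bounded_function[OF assms(1) _ C(2)]) (use test_function_measurable[OF assms(2)] in simp)
qed

text \<open>Both sides have the same integral against each test function \<open>\<phi>\<close> on \<open>W\<close>: Fubini's theorem and the translation
by \<open>t z\<close> move the segment integral to \<open>\<phi>\<close>, the weak gradient turns it into the
derivative of \<open>\<phi>\<close> in direction \<open>z\<close>, and integration in \<open>t\<close> gives the increment of \<open>\<phi>\<close>. The set \<open>L\<close>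
contains all segments, so that the translated test functions are supported in \<open>\<Omega>\<close>.\<close>

proposition weak_gradient_line:
  fixes F :: "'a::euclidean_space \<Rightarrow> real" and G :: "'a \<Rightarrow> 'a"
  assumes FG: "borel_weak_gradient \<Omega> F G"
    and W: "open W" and L: "compact L" "L \<subseteq> \<Omega>" "\<And>x t. x \<in> W \<Longrightarrow> 0 \<le> t \<Longrightarrow> t \<le> 1 \<Longrightarrow> x + t *\<^sub>R z \<in> L"
  shows "AE x in lborel. x \<in> W \<longrightarrow> F (x + z) - F x = (LINT t|lborel. indicator {0..1} t * (z \<bullet> G (x + t *\<^sub>R z)))"
proof -
  have F: "integrable lborel F" and Gm[measurable]: "G \<in> borel_measurable borel" and GL: "set_integrable lborel L G"
    using FG L(1,2) unfolding borel_weak_gradient_def by blast+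
  have [measurable]: "F \<in> borel_measurable borel" using borel_measurable_integrable[OF F] by simp
  have [measurable]: "L \<in> sets borel" using L(1) by (simp add: borel_compact)
  define H where "H x = z \<bullet> (indicator L x *\<^sub>R G x)" for x
  have H: "integrable lborel H"
    unfolding H_def by (rule integrable_inner_right) (use GL in \<open>simp add: set_integrable_def\<close>)
  have [measurable]: "H \<in> borel_measurable borel" using borel_measurable_integrable[OF H] by simp
  have Fz: "integrable lborel (\<lambda>x. F (x + z))" by (rule integrable_lborel_shift[OF F])
  define q where "q x t = indicator {0..1} t * H (x + t *\<^sub>R z)" for x :: 'a and t :: real
  define I where "I x = (LINT t|lborel. q x t)" for x
  have qm[measurable]: "case_prod q \<in> borel_measurable (lborel \<Otimes>\<^sub>M lborel)" unfolding q_def by measurable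
  have q: "integrable (lborel \<Otimes>\<^sub>M lborel) (case_prod q)"
    unfolding integrable_iff_bounded
  proof
    have "(\<integral>\<^sup>+p. norm (case_prod q p) \<partial>(lborel \<Otimes>\<^sub>M lborel)) = (\<integral>\<^sup>+t. \<integral>\<^sup>+x. norm (q x t) \<partial>lborel \<partial>lborel)"
      by (subst lborel_pair.nn_integral_snd[symmetric]) (simp_all add: case_prod_beta)
    also have "\<dots> = (\<integral>\<^sup>+t. (\<integral>\<^sup>+x. norm (H x) \<partial>lborel) * indicator {0..1::real} t \<partial>lborel)"
    proof (rule nn_integral_cong)
      fix t :: real
      have "(\<integral>\<^sup>+x. norm (q x t) \<partial>lborel) = indicator {0..1} t * (\<integral>\<^sup>+x. norm (H (x + t *\<^sub>R z)) \<partial>lborel)"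
        by (subst nn_integral_cmult[symmetric]) (auto intro!: nn_integral_cong simp: q_def indicator_def)
      also have "(\<integral>\<^sup>+x. norm (H (x + t *\<^sub>R z)) \<partial>lborel) = (\<integral>\<^sup>+x. norm (H x) \<partial>lborel)"
        by (rule nn_integral_lborel_shift) simp
      finally show "(\<integral>\<^sup>+x. norm (q x t) \<partial>lborel) = (\<integral>\<^sup>+x. norm (H x) \<partial>lborel) * indicator {0..1} t" by (simp add: mult.commute)
    qed
    also have "\<dots> = (\<integral>\<^sup>+x. norm (H x) \<partial>lborel)" by (simp add: nn_integral_cmult_indicator)
    also have "\<dots> < \<infinity>" using H by (simp add: integrable_iff_bounded)
    finally show "(\<integral>\<^sup>+p. norm (case_prod q p) \<partial>(lborel \<Otimes>\<^sub>M lborel)) < \<infinity>" .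
  qed measurable
  have I: "integrable lborel I" unfolding I_def using lborel_pair.integrable_fst'[OF q] by simp
  define E where "E x = F (x + z) - F x - I x" for x
  have E: "integrable lborel E" unfolding E_def using F Fz I by simp
  have "AE x in lborel. x \<in> W \<longrightarrow> E x = 0"
  proof (rule AE_zero_if_test_integrals_zero[OF W])
    show "E \<in> borel_measurable borel" using borel_measurable_integrable[OF E] by simp
    show "set_integrable lborel K E" if "compact K" for K
      unfolding set_integrable_def using E that by (intro integrable_mult_indicator) (auto simp: borel_compact)
    fix \<phi> assume \<phi>: "\<phi> \<in> C_c_infinity W"
    note [measurable] = test_function_measurable[OF \<phi>]
    obtain B where B: "B \<ge> 0" "\<And>x z. \<bar>frechet_derivative \<phi> (at x) z\<bar> \<le> B * norm z"
      using test_function_derivative_bounded[OF \<phi>] by metis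
    define D where "D y t = F y * (frechet_derivative \<phi> (at (y - t *\<^sub>R z)) z * indicator {0..1} t)" for y :: 'a and t :: real
    have Dm[measurable]: "case_prod D \<in> borel_measurable (lborel \<Otimes>\<^sub>M lborel)"
    proof -
      have "(\<lambda>p. frechet_derivative \<phi> (at (fst p - snd p *\<^sub>R z)) z) \<in> borel_measurable (lborel \<Otimes>\<^sub>M lborel)"
        by (rule measurable_compose[OF _ test_function_measurable(2)[OF \<phi>]]) measurable
      then show ?thesis unfolding D_def case_prod_beta by measurable
    qed
    have D: "integrable (lborel \<Otimes>\<^sub>M lborel) (case_prod D)"
      unfolding integrable_iff_bounded
    proof
      have "(\<integral>\<^sup>+p. norm (case_prod D p) \<partial>(lborel \<Otimes>\<^sub>M lborel)) \<le> (\<integral>\<^sup>+p. ennreal (B * norm z) * (norm (F (fst p)) * indicator {0..1::real} (snd p)) \<partial>(lborel \<Otimes>\<^sub>M lborel))"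
      proof (intro nn_integral_mono)
        fix p :: "'a \<times> real"
        have "norm (case_prod D p) \<le> (B * norm z) * (norm (F (fst p)) * indicator {0..1} (snd p))"
          using mult_left_mono[OF B(2)[of "fst p - snd p *\<^sub>R z" z], of "\<bar>F (fst p)\<bar>"]
          by (auto simp: D_def case_prod_beta abs_mult indicator_def algebra_simps)
        then show "ennreal (norm (case_prod D p)) \<le> ennreal (B * norm z) * (norm (F (fst p)) * indicator {0..1} (snd p))"
          using B(1) by (subst ennreal_mult[symmetric]) (auto intro: ennreal_leI)
      qed
      also have "\<dots> = ennreal (B * norm z) * (\<integral>\<^sup>+p. ennreal (norm (F (fst p)) * indicator {0..1::real} (snd p)) \<partial>(lborel \<Otimes>\<^sub>M lborel))"
        by (rule nn_integral_cmult) measurable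
      also have "(\<integral>\<^sup>+p. ennreal (norm (F (fst p)) * indicator {0..1::real} (snd p)) \<partial>(lborel \<Otimes>\<^sub>M lborel)) = (\<integral>\<^sup>+x. norm (F x) \<partial>lborel)"
      proof -
        have "(\<integral>\<^sup>+p. ennreal (norm (F (fst p)) * indicator {0..1::real} (snd p)) \<partial>(lborel \<Otimes>\<^sub>M lborel)) =
          (\<integral>\<^sup>+x. \<integral>\<^sup>+t. ennreal (norm (F x)) * indicator {0..1::real} t \<partial>lborel \<partial>lborel)"
          by (subst lborel.nn_integral_fst[symmetric]) (auto intro!: nn_integral_cong simp: indicator_def)
        then show ?thesis by (simp add: nn_integral_cmult_indicator)
      qed
      also have "ennreal (B * norm z) * \<dots> < \<infinity>" using F by (simp add: integrable_iff_bounded ennreal_mult_less_top)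
      finally show "(\<integral>\<^sup>+p. norm (case_prod D p) \<partial>(lborel \<Otimes>\<^sub>M lborel)) < \<infinity>" .
    qed measurable
    have 1: "(LINT x|lborel. I x * \<phi> x) = (LINT t|lborel. - (LINT y|lborel. D y t))"
    proof -
      obtain C where C: "C \<ge> 0" "\<And>x. \<bar>\<phi> x\<bar> \<le> C" using test_function_bounded[OF \<phi>] by metis
      have q\<phi>: "integrable (lborel \<Otimes>\<^sub>M lborel) (\<lambda>(x, t). q x t * \<phi> x)"
        using integrable_mult_bounded_function[OF q, of "\<lambda>p. \<phi> (fst p)" C] C by (simp add: split_beta')
      have "(LINT x|lborel. I x * \<phi> x) = (LINT x|lborel. LINT t|lborel. q x t * \<phi> x)"
        unfolding I_def by simp
      also have "\<dots> = (LINT t|lborel. LINT x|lborel. q x t * \<phi> x)"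
        using lborel_pair.Fubini_integral[OF q\<phi>] by simp
      also have "\<dots> = (LINT t|lborel. - (LINT y|lborel. D y t))"
      proof (rule Bochner_Integration.integral_cong[OF refl])
        fix t :: real
        show "(LINT x|lborel. q x t * \<phi> x) = - (LINT y|lborel. D y t)"
        proof (cases "t \<in> {0..1}")
          case True
          have sh: "(\<lambda>y. \<phi> (y + (- (t *\<^sub>R z)))) \<in> C_c_infinity \<Omega>"
            using True test_function_support(2)[OF \<phi>] L(2,3) by (intro test_function_shift(1)[OF \<phi>]) auto
          have dsh: "frechet_derivative (\<lambda>y. \<phi> (y + (- (t *\<^sub>R z)))) (at y) z = frechet_derivative \<phi> (at (y - t *\<^sub>R z)) z" for y
            using test_function_shift(2)[OF \<phi>, of "- (t *\<^sub>R z)" UNIV y z] by simp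
          have "(LINT x|lborel. q x t * \<phi> x) = (LINT x|lborel. H (x + t *\<^sub>R z) * \<phi> ((x + t *\<^sub>R z) - t *\<^sub>R z))"
            using True by (simp add: q_def)
          also have "\<dots> = (LINT y|lborel. H y * \<phi> (y - t *\<^sub>R z))"
            by (rule integral_lborel_shift[of "\<lambda>y. H y * \<phi> (y - t *\<^sub>R z)"]) measurable
          also have "\<dots> = (LINT y|lborel. (z \<bullet> G y) * \<phi> (y + (- (t *\<^sub>R z))))"
          proof (intro Bochner_Integration.integral_cong[OF refl])
            fix y
            show "H y * \<phi> (y - t *\<^sub>R z) = (z \<bullet> G y) * \<phi> (y + (- (t *\<^sub>R z)))"
            proof (cases "y \<in> L")
              case True then show ?thesis by (simp add: H_def)
            next
              case False
              then have "y - t *\<^sub>R z \<notin> tsupport \<phi>"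
                using L(3)[of "y - t *\<^sub>R z" t] True test_function_support(2)[OF \<phi>] by auto
              then show ?thesis using test_function_zero[OF \<phi>, of "y - t *\<^sub>R z"] by simp
            qed
          qed
          also have "\<dots> = - (LINT y|lborel. F y * frechet_derivative (\<lambda>y. \<phi> (y + (- (t *\<^sub>R z)))) (at y) z)"
            using borel_weak_gradient_test[OF FG sh, of z] by simp
          also have "\<dots> = - (LINT y|lborel. D y t)" unfolding dsh using True by (simp add: D_def)
          finally show ?thesis .
        next
          case False
          then show ?thesis by (simp add: q_def D_def)
        qed
      qed
      finally show ?thesis .
    qed
    have 2: "(LINT t|lborel. LINT y|lborel. D y t) = (LINT y|lborel. F y * (\<phi> y - \<phi> (y - z)))"
    proof -
      have "(LINT t|lborel. LINT y|lborel. D y t) = (LINT y|lborel. LINT t|lborel. D y t)"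
        using lborel_pair.Fubini_integral[OF D] by simp
      also have "\<dots> = (LINT y|lborel. F y * (\<phi> y - \<phi> (y - z)))"
      proof (rule Bochner_Integration.integral_cong[OF refl])
        fix y
        have "(LINT t|lborel. frechet_derivative \<phi> (at (y - t *\<^sub>R z)) z * indicator {0..1} t) = \<phi> y - \<phi> (y - z)"
        proof -
          have "\<phi> (y + - z) - \<phi> y = (LINT t|lborel. frechet_derivative \<phi> (at (y + t *\<^sub>R (- z))) (- z) * indicator {0..1} t)"
            by (rule test_function_increment[OF \<phi>])
          then show ?thesis by (simp add: linear_neg[OF test_function_derivative_linear[OF \<phi>]])
        qed
        then show "(LINT t|lborel. D y t) = F y * (\<phi> y - \<phi> (y - z))" unfolding D_def by simp
      qed
      finally show ?thesis .
    qed
    have 3: "(LINT x|lborel. F (x + z) * \<phi> x) = (LINT y|lborel. F y * \<phi> (y - z))"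
      using integral_lborel_shift[of "\<lambda>y. F y * \<phi> (y - z)" z] by simp
    have \<phi>z: "(\<lambda>y. \<phi> (y + - z)) \<in> C_c_infinity UNIV" by (rule test_function_shift(1)[OF \<phi>]) simp
    have 4: "(LINT y|lborel. F y * (\<phi> y - \<phi> (y - z))) = (LINT y|lborel. F y * \<phi> y) - (LINT y|lborel. F y * \<phi> (y - z))"
      using integrable_test_mult[OF F \<phi>] integrable_test_mult[OF F \<phi>z] by (simp add: right_diff_distrib)
    have "(LINT x|lborel. E x * \<phi> x) = (LINT x|lborel. F (x + z) * \<phi> x) - (LINT x|lborel. F x * \<phi> x) - (LINT x|lborel. I x * \<phi> x)"
      unfolding E_def using integrable_test_mult[OF F \<phi>] integrable_test_mult[OF Fz \<phi>] integrable_test_mult[OF I \<phi>]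
      by (simp add: left_diff_distrib)
    then show "(LINT x|lborel. E x * \<phi> x) = 0" using 1 2 3 4 by simp
  qed
  then show ?thesis
  proof eventually_elim
    case (elim x)
    show ?case
    proof
      assume x: "x \<in> W"
      have "I x = (LINT t|lborel. indicator {0..1} t * (z \<bullet> G (x + t *\<^sub>R z)))"
        unfolding I_def q_def H_def using L(3)[OF x] by (intro Bochner_Integration.integral_cong) (auto simp: indicator_def)
      then show "F (x + z) - F x = (LINT t|lborel. indicator {0..1} t * (z \<bullet> G (x + t *\<^sub>R z)))"
        using elim x by (simp add: E_def)
    qed
  qed
qed

section \<open>Existence of weak gradients\<close>

lemma integral_lborel_uminus:
  fixes f :: "'a::euclidean_space \<Rightarrow> real"
  assumes [measurable]: "f \<in> borel_measurable borel"
  shows "(LINT x|lborel. f (- x)) = (LINT x|lborel. f x)"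
proof -
  have "(lborel::'a measure) = distr lborel borel (\<lambda>x. - x)"
    using lborel_affine[of "-1" "0::'a"] by (simp add: density_1)
  then have "(LINT x|lborel. f x) = (LINT x|distr lborel borel (\<lambda>x. - x). f x)" by simp
  also have "\<dots> = (LINT x|lborel. f (- x))" by (rule integral_distr) auto
  finally show ?thesis by simp
qed

lemma integral_ball_inner:
  fixes c \<tau> :: "'a::euclidean_space"
  shows "(LINT v|lborel. indicator (ball c r) v * (v \<bullet> \<tau>)) = measure lborel (ball c r) * (c \<bullet> \<tau>)"
proof -
  have fin: "emeasure lborel (ball a r) < \<infinity>" for a :: 'a by (intro emeasure_bounded_finite) simp
  have int: "integrable lborel (\<lambda>v. indicator (ball (0::'a) r) v * (v \<bullet> \<tau>))"
  proof (rule Bochner_Integration.integrable_bound)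
    show "integrable lborel (\<lambda>v. (\<bar>r\<bar> * norm \<tau>) * indicator (ball (0::'a) r) v)"
      using fin[of 0] by (intro integrable_mult_right) (simp add: integrable_indicator_iff)
    show "AE v in lborel. norm (indicator (ball (0::'a) r) v * (v \<bullet> \<tau>)) \<le> norm ((\<bar>r\<bar> * norm \<tau>) * indicator (ball (0::'a) r) v)"
    proof (intro AE_I2)
      fix v :: 'a
      have "\<bar>v \<bullet> \<tau>\<bar> \<le> \<bar>r\<bar> * norm \<tau>" if "v \<in> ball 0 r"
        using that by (intro order_trans[OF Cauchy_Schwarz_ineq2] mult_right_mono) auto
      then show "norm (indicator (ball 0 r) v * (v \<bullet> \<tau>)) \<le> norm ((\<bar>r\<bar> * norm \<tau>) * indicator (ball (0::'a) r) v)"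
        by (auto simp: indicator_def)
    qed
  qed measurable
  have odd: "(LINT v|lborel. indicator (ball (0::'a) r) v * (v \<bullet> \<tau>)) = 0"
  proof -
    have "(LINT v|lborel. indicator (ball (0::'a) r) v * (v \<bullet> \<tau>)) = (LINT v|lborel. indicator (ball (0::'a) r) (- v) * ((- v) \<bullet> \<tau>))"
      by (rule integral_lborel_uminus[symmetric]) measurable
    also have "\<dots> = (LINT v|lborel. - (indicator (ball (0::'a) r) v * (v \<bullet> \<tau>)))"
      by (intro Bochner_Integration.integral_cong) (auto simp: indicator_def)
    finally show ?thesis by simp
  qed
  have "(LINT v|lborel. indicator (ball c r) v * (v \<bullet> \<tau>)) = (LINT v|lborel. indicator (ball c r) (v + c) * ((v + c) \<bullet> \<tau>))"
    by (rule integral_lborel_shift[symmetric]) measurable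
  also have "\<dots> = (LINT v|lborel. indicator (ball 0 r) v * (v \<bullet> \<tau>) + (c \<bullet> \<tau>) * indicator (ball 0 r) v)"
    by (intro Bochner_Integration.integral_cong) (auto simp: indicator_def dist_norm inner_add_left algebra_simps)
  also have "\<dots> = (c \<bullet> \<tau>) * measure lborel (ball (0::'a) r)"
    using int odd fin[of 0] by (simp add: integrable_indicator_iff)
  also have "measure lborel (ball (0::'a) r) = measure lborel (ball c r)"
  proof -
    have "emeasure lborel (ball c r) = (\<integral>\<^sup>+x. indicator (ball c r) (x + c) \<partial>lborel)"
      by (subst nn_integral_lborel_shift) auto
    also have "\<dots> = (\<integral>\<^sup>+x. indicator (ball (0::'a) r) x \<partial>lborel)"
      by (intro nn_integral_cong) (auto simp: indicator_def dist_norm)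
    finally show ?thesis by (simp add: measure_def)
  qed
  finally show ?thesis by (simp add: mult.commute)
qed

lemma test_function_lipschitz:
  assumes \<phi>: "\<phi> \<in> C_c_infinity \<Omega>" and B: "B \<ge> 0" "\<And>x z. \<bar>frechet_derivative \<phi> (at x) z\<bar> \<le> B * norm z"
  shows "\<bar>\<phi> x - \<phi> y\<bar> \<le> B * norm (x - y)"
proof -
  have "norm (\<phi> x - \<phi> y) \<le> B * norm (x - y)"
  proof (rule differentiable_bound[where S=UNIV])
    show "(\<phi> has_derivative frechet_derivative \<phi> (at x)) (at x within UNIV)" for x
      using test_function_has_derivative[OF \<phi>] by simp
    show "onorm (frechet_derivative \<phi> (at x)) \<le> B" for x
      by (rule onorm_bound) (use B in auto)
  qed auto
  then show ?thesis by simp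
qed

text \<open>A substitution moves the difference quotient from \<open>F\<close> to \<open>\<phi>\<close>.\<close>

lemma directional_difference_quotient_limit:
  fixes F :: "'a::euclidean_space \<Rightarrow> real"
  assumes F: "integrable lborel F" and \<phi>: "\<phi> \<in> C_c_infinity \<Omega>"
    and h: "\<And>n. h n > 0" "h \<longlonglongrightarrow> 0"
    and B: "B \<ge> 0" "\<And>x z. \<bar>frechet_derivative \<phi> (at x) z\<bar> \<le> B * norm z"
  shows "(\<lambda>n. LINT x|lborel. (F (x + h n *\<^sub>R v) - F x) / h n * \<phi> x) \<longlonglongrightarrow> - (LINT x|lborel. F x * frechet_derivative \<phi> (at x) v)"
    and "\<bar>LINT x|lborel. (F (x + h n *\<^sub>R v) - F x) / h n * \<phi> x\<bar> \<le> B * norm v * (LINT x|lborel. \<bar>F x\<bar>)"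
proof -
  have [measurable]: "F \<in> borel_measurable borel" using borel_measurable_integrable[OF F] by simp
  note [measurable] = test_function_measurable[OF \<phi>]
  have eq: "(LINT x|lborel. (F (x + h n *\<^sub>R v) - F x) / h n * \<phi> x) = (LINT y|lborel. F y * ((\<phi> (y - h n *\<^sub>R v) - \<phi> y) / h n))" for n
  proof -
    have \<phi>': "(\<lambda>y. \<phi> (y + - (h n *\<^sub>R v))) \<in> C_c_infinity UNIV" by (rule test_function_shift(1)[OF \<phi>]) simp
    have "(LINT x|lborel. F (x + h n *\<^sub>R v) * \<phi> x) = (LINT y|lborel. F y * \<phi> (y - h n *\<^sub>R v))"
      using integral_lborel_shift[of "\<lambda>y. F y * \<phi> (y - h n *\<^sub>R v)" "h n *\<^sub>R v"] by simp
    then have "(LINT x|lborel. F (x + h n *\<^sub>R v) * \<phi> x - F x * \<phi> x) = (LINT y|lborel. F y * \<phi> (y - h n *\<^sub>R v) - F y * \<phi> y)"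
      using integrable_test_mult[OF integrable_lborel_shift[OF F] \<phi>] integrable_test_mult[OF F \<phi>] integrable_test_mult[OF F \<phi>'] by simp
    then have "(LINT x|lborel. F (x + h n *\<^sub>R v) * \<phi> x - F x * \<phi> x) / h n = (LINT y|lborel. F y * \<phi> (y - h n *\<^sub>R v) - F y * \<phi> y) / h n" by simp
    then show ?thesis by (simp add: integral_divide_zero[symmetric] algebra_simps diff_divide_distrib del: integral_divide_zero)
  qed
  have bound: "\<bar>F y * ((\<phi> (y - h n *\<^sub>R v) - \<phi> y) / h n)\<bar> \<le> B * norm v * \<bar>F y\<bar>" for y n
  proof -
    have "\<bar>\<phi> (y - h n *\<^sub>R v) - \<phi> y\<bar> \<le> B * norm v * h n"
      using test_function_lipschitz[OF \<phi> B, of "y - h n *\<^sub>R v" y] h(1)[of n] by (simp add: mult_ac)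
    then have "\<bar>(\<phi> (y - h n *\<^sub>R v) - \<phi> y) / h n\<bar> \<le> B * norm v" using h(1)[of n] by (simp add: field_simps)
    from mult_left_mono[OF this, of "\<bar>F y\<bar>"] show ?thesis by (simp add: abs_mult mult.commute)
  qed
  have int: "integrable lborel (\<lambda>y. B * norm v * \<bar>F y\<bar>)" using F by simp
  show "\<bar>LINT x|lborel. (F (x + h n *\<^sub>R v) - F x) / h n * \<phi> x\<bar> \<le> B * norm v * (LINT x|lborel. \<bar>F x\<bar>)"
  proof -
    have i: "integrable lborel (\<lambda>y. F y * ((\<phi> (y - h n *\<^sub>R v) - \<phi> y) / h n))"
      by (rule Bochner_Integration.integrable_bound[OF int]) (use bound B in \<open>auto intro!: AE_I2 simp: abs_mult\<close>)
    have "\<bar>LINT y|lborel. F y * ((\<phi> (y - h n *\<^sub>R v) - \<phi> y) / h n)\<bar> \<le> (LINT y|lborel. \<bar>F y * ((\<phi> (y - h n *\<^sub>R v) - \<phi> y) / h n)\<bar>)"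
      by (rule integral_abs_bound)
    also have "\<dots> \<le> (LINT y|lborel. B * norm v * \<bar>F y\<bar>)"
      by (rule integral_mono[OF integrable_abs[OF i] int]) (rule bound)
    finally show ?thesis unfolding eq by simp
  qed
  have "(\<lambda>n. LINT y|lborel. F y * ((\<phi> (y - h n *\<^sub>R v) - \<phi> y) / h n)) \<longlonglongrightarrow> (LINT y|lborel. F y * - frechet_derivative \<phi> (at y) v)"
  proof (rule integral_dominated_convergence[OF _ _ int])
    show "AE y in lborel. (\<lambda>n. F y * ((\<phi> (y - h n *\<^sub>R v) - \<phi> y) / h n)) \<longlonglongrightarrow> F y * - frechet_derivative \<phi> (at y) v"
    proof (intro AE_I2 tendsto_mult tendsto_const)
      fix y
      have "((\<lambda>t. \<phi> (y - t *\<^sub>R v)) has_derivative (\<lambda>t. frechet_derivative \<phi> (at (y - 0 *\<^sub>R v)) (- t *\<^sub>R v))) (at 0)"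
        by (rule has_derivative_compose[OF _ test_function_has_derivative[OF \<phi>]]) (auto intro!: derivative_eq_intros)
      then have "((\<lambda>t. \<phi> (y - t *\<^sub>R v)) has_real_derivative (- frechet_derivative \<phi> (at y) v)) (at 0)"
        unfolding has_field_derivative_def
        by (rule has_derivative_eq_rhs)
          (simp add: fun_eq_iff linear_cmul[OF test_function_derivative_linear[OF \<phi>]] linear_neg[OF test_function_derivative_linear[OF \<phi>]])
      then have "((\<lambda>t. (\<phi> (y - t *\<^sub>R v) - \<phi> y) / t) \<longlongrightarrow> - frechet_derivative \<phi> (at y) v) (at 0)"
        by (simp add: DERIV_def)
      moreover have "filterlim h (at 0) sequentially"
        using h by (auto simp: filterlim_at intro!: always_eventually less_imp_neq[symmetric])
      ultimately show "(\<lambda>n. (\<phi> (y - h n *\<^sub>R v) - \<phi> y) / h n) \<longlonglongrightarrow> - frechet_derivative \<phi> (at y) v"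
        by (rule filterlim_compose)
    qed
    show "AE y in lborel. norm (F y * ((\<phi> (y - h n *\<^sub>R v) - \<phi> y) / h n)) \<le> B * norm v * \<bar>F y\<bar>" for n
      using bound by simp
  qed measurable
  then show "(\<lambda>n. LINT x|lborel. (F (x + h n *\<^sub>R v) - F x) / h n * \<phi> x) \<longlonglongrightarrow> - (LINT x|lborel. F x * frechet_derivative \<phi> (at x) v)"
    unfolding eq by simp
qed

text \<open>A ball of directions inside the unit ball whose mean is \<open>i/2\<close>. Averaging over it singles out the partial
derivative in direction \<open>i\<close>; over the whole unit ball the mean vanishes.\<close>

definition half_ball :: "'a::euclidean_space \<Rightarrow> 'a set" where
  "half_ball i = ball ((1/2) *\<^sub>R i) (1/2)"

lemma half_ball_subset: "i \<in> Basis \<Longrightarrow> half_ball i \<subseteq> ball 0 1"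
proof
  fix v assume "i \<in> Basis" "v \<in> half_ball i"
  then have "norm ((1/2) *\<^sub>R i - v) < 1/2" "norm ((1/2) *\<^sub>R i) = 1/2" by (auto simp: half_ball_def dist_norm)
  then show "v \<in> ball 0 1" using norm_triangle_ineq4[of "(1/2) *\<^sub>R i" "(1/2) *\<^sub>R i - v"] by simp
qed

lemma half_ball_measure_pos: "measure lborel (half_ball i) > 0"
  using content_ball[of "1/2" "(1/2) *\<^sub>R i"] by (simp add: half_ball_def)

lemma half_ball_measurable [measurable]: "half_ball i \<in> sets borel" by (simp add: half_ball_def)

lemma half_ball_finite: "emeasure lborel (half_ball i) < \<infinity>"
  unfolding half_ball_def by (intro emeasure_bounded_finite) simp

text \<open>For a fixed direction \<open>v\<close> the limit is \<open>-\<integral> F \<partial>\<^sub>v\<phi>\<close>, which is linear in \<open>v\<close>. Integration over the ball of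
directions replaces \<open>v\<close> by the mean of this ball times its volume.\<close>

lemma difference_quotient_limit:
  fixes F :: "'a::euclidean_space \<Rightarrow> real"
  assumes F: "integrable lborel F" and \<phi>: "\<phi> \<in> C_c_infinity \<Omega>" and i: "i \<in> Basis"
    and h: "\<And>n. h n > 0" "h \<longlonglongrightarrow> 0"
  defines "a \<equiv> \<lambda>n (x, v). indicator (half_ball i) v * ((F (x + h n *\<^sub>R v) - F x) / h n) * \<phi> x"
  shows "integrable (lborel \<Otimes>\<^sub>M lborel) (a n)"
    and "(\<lambda>n. integral\<^sup>L (lborel \<Otimes>\<^sub>M lborel) (a n)) \<longlonglongrightarrow> - (measure lborel (half_ball i) / 2 * (LINT x|lborel. F x * frechet_derivative \<phi> (at x) i))"
proof -
  let ?Q = "half_ball i"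
  have [measurable]: "F \<in> borel_measurable borel" using borel_measurable_integrable[OF F] by simp
  note [measurable] = test_function_measurable[OF \<phi>]
  obtain B where B: "B \<ge> 0" "\<And>x z. \<bar>frechet_derivative \<phi> (at x) z\<bar> \<le> B * norm z"
    using test_function_derivative_bounded[OF \<phi>] by metis
  obtain C where C: "C \<ge> 0" "\<And>x. \<bar>\<phi> x\<bar> \<le> C" using test_function_bounded[OF \<phi>] by metis
  have am[measurable]: "a n \<in> borel_measurable (lborel \<Otimes>\<^sub>M lborel)" for n unfolding a_def by measurable
  have normF: "(\<integral>\<^sup>+x. ennreal \<bar>F (x + z)\<bar> \<partial>lborel) = (\<integral>\<^sup>+x. ennreal \<bar>F x\<bar> \<partial>lborel)" for z
    by (rule nn_integral_lborel_shift) simp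
  have Ffin: "(\<integral>\<^sup>+x. ennreal \<bar>F x\<bar> \<partial>lborel) < \<infinity>" using F by (simp add: integrable_iff_bounded)
  show ai: "integrable (lborel \<Otimes>\<^sub>M lborel) (a n)" for n
    unfolding integrable_iff_bounded
  proof
    have "(\<integral>\<^sup>+p. norm (a n p) \<partial>(lborel \<Otimes>\<^sub>M lborel)) = (\<integral>\<^sup>+v. \<integral>\<^sup>+x. norm (a n (x, v)) \<partial>lborel \<partial>lborel)"
      by (rule lborel_pair.nn_integral_snd[symmetric]) simp
    also have "\<dots> \<le> (\<integral>\<^sup>+v. (ennreal (C / h n) * (2 * (\<integral>\<^sup>+x. ennreal \<bar>F x\<bar> \<partial>lborel))) * indicator ?Q v \<partial>lborel)"
    proof (rule nn_integral_mono)
      fix v :: 'a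
      have "(\<integral>\<^sup>+x. norm (a n (x, v)) \<partial>lborel) \<le> (\<integral>\<^sup>+x. indicator ?Q v * (ennreal (C / h n) * (ennreal \<bar>F (x + h n *\<^sub>R v)\<bar> + ennreal \<bar>F x\<bar>)) \<partial>lborel)"
      proof (rule nn_integral_mono)
        fix x
        have "\<bar>(F (x + h n *\<^sub>R v) - F x) / h n * \<phi> x\<bar> \<le> (\<bar>F (x + h n *\<^sub>R v)\<bar> + \<bar>F x\<bar>) / h n * C"
          unfolding abs_mult abs_divide using h(1)[of n] C by (intro mult_mono divide_right_mono abs_triangle_ineq4) (auto simp: abs_of_pos divide_right_mono)
        then have "norm (a n (x, v)) \<le> indicator ?Q v * (C / h n * (\<bar>F (x + h n *\<^sub>R v)\<bar> + \<bar>F x\<bar>))"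
          by (auto simp: a_def indicator_def field_simps)
        then show "ennreal (norm (a n (x, v))) \<le> indicator ?Q v * (ennreal (C / h n) * (ennreal \<bar>F (x + h n *\<^sub>R v)\<bar> + ennreal \<bar>F x\<bar>))"
          using h(1)[of n] C(1) by (auto simp: indicator_def ennreal_mult[symmetric] simp flip: ennreal_plus intro: ennreal_leI)
      qed
      also have "\<dots> = indicator ?Q v * (ennreal (C / h n) * (2 * (\<integral>\<^sup>+x. ennreal \<bar>F x\<bar> \<partial>lborel)))"
        by (simp add: nn_integral_cmult nn_integral_add normF mult_2)
      finally show "(\<integral>\<^sup>+x. norm (a n (x, v)) \<partial>lborel) \<le> (ennreal (C / h n) * (2 * (\<integral>\<^sup>+x. ennreal \<bar>F x\<bar> \<partial>lborel))) * indicator ?Q v" by (simp add: mult.commute)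
    qed
    also have "\<dots> = (ennreal (C / h n) * (2 * (\<integral>\<^sup>+x. ennreal \<bar>F x\<bar> \<partial>lborel))) * emeasure lborel ?Q"
      by (rule nn_integral_cmult_indicator) simp
    also have "\<dots> < \<infinity>" using Ffin half_ball_finite[of i] by (simp add: ennreal_mult_less_top)
    finally show "(\<integral>\<^sup>+p. norm (a n p) \<partial>(lborel \<Otimes>\<^sub>M lborel)) < \<infinity>" .
  qed measurable
  define L where "L n v = (LINT x|lborel. (F (x + h n *\<^sub>R v) - F x) / h n * \<phi> x)" for n v
  define T where "T v = (LINT x|lborel. F x * frechet_derivative \<phi> (at x) v)" for v
  have aL: "(LINT x|lborel. a n (x, v)) = indicator ?Q v * L n v" for n v
    unfolding a_def L_def by (simp add: mult.assoc)
  have iL: "integrable lborel (\<lambda>v. indicator ?Q v * L n v)" for n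
  proof -
    have "integrable lborel (\<lambda>v. LINT x|lborel. a n (x, v))"
      using lborel_pair.integrable_snd[of "\<lambda>x v. a n (x, v)"] ai[of n] by (simp add: case_prod_beta)
    then show ?thesis by (simp add: aL)
  qed
  have intL: "integral\<^sup>L (lborel \<Otimes>\<^sub>M lborel) (a n) = (LINT v|lborel. indicator ?Q v * L n v)" for n
  proof -
    have "(LINT v|lborel. LINT x|lborel. a n (x, v)) = integral\<^sup>L (lborel \<Otimes>\<^sub>M lborel) (a n)"
      using lborel_pair.integral_snd[of "\<lambda>x v. a n (x, v)"] ai[of n] by (simp add: case_prod_beta)
    then show ?thesis by (simp add: aL)
  qed
  have Tlin: "T v = v \<bullet> (\<Sum>j\<in>Basis. T j *\<^sub>R j)" for v
  proof -
    have iF: "integrable lborel (\<lambda>x. F x * frechet_derivative \<phi> (at x) j)" for j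
      using F B(2)[of _ j] by (intro integrable_mult_bounded_function[where b="B * norm j"]) auto
    have "T v = (LINT x|lborel. (\<Sum>j\<in>Basis. (v \<bullet> j) * (F x * frechet_derivative \<phi> (at x) j)))"
      unfolding T_def
    proof (intro Bochner_Integration.integral_cong[OF refl])
      fix x show "F x * frechet_derivative \<phi> (at x) v = (\<Sum>j\<in>Basis. (v \<bullet> j) * (F x * frechet_derivative \<phi> (at x) j))"
        by (subst test_function_derivative_expand[OF \<phi>, of x v]) (simp add: sum_distrib_left mult.left_commute)
    qed
    also have "\<dots> = (\<Sum>j\<in>Basis. (v \<bullet> j) * T j)" unfolding T_def using iF by (simp add: Bochner_Integration.integral_sum)
    finally show ?thesis by (simp add: inner_sum_right mult.commute)
  qed
  have "(\<lambda>n. LINT v|lborel. indicator ?Q v * L n v) \<longlonglongrightarrow> (LINT v|lborel. indicator ?Q v * - T v)"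
  proof (rule integral_dominated_convergence[where w="\<lambda>v. (B * (LINT x|lborel. \<bar>F x\<bar>)) * indicator ?Q v"])
    show "integrable lborel (\<lambda>v. (B * (LINT x|lborel. \<bar>F x\<bar>)) * indicator ?Q v)"
      using half_ball_finite[of i] by (intro integrable_mult_right) (simp add: integrable_indicator_iff)
    show "(\<lambda>v. indicator ?Q v * L n v) \<in> borel_measurable lborel" for n using iL by (rule borel_measurable_integrable)
    show "(\<lambda>v. indicator ?Q v * - T v) \<in> borel_measurable lborel" by (subst Tlin) measurable
    show "AE v in lborel. (\<lambda>n. indicator ?Q v * L n v) \<longlonglongrightarrow> indicator ?Q v * - T v"
      unfolding L_def T_def by (intro AE_I2 tendsto_mult tendsto_const directional_difference_quotient_limit(1)[OF F \<phi> h B])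
    show "AE v in lborel. norm (indicator ?Q v * L n v) \<le> (B * (LINT x|lborel. \<bar>F x\<bar>)) * indicator ?Q v" for n
    proof (intro AE_I2)
      fix v :: 'a
      show "norm (indicator ?Q v * L n v) \<le> (B * (LINT x|lborel. \<bar>F x\<bar>)) * indicator ?Q v"
      proof (cases "v \<in> ?Q")
        case True
        then have "norm v \<le> 1" using half_ball_subset[OF i] by auto
        have "\<bar>L n v\<bar> \<le> B * norm v * (LINT x|lborel. \<bar>F x\<bar>)"
          unfolding L_def by (rule directional_difference_quotient_limit(2)[OF F \<phi> h B])
        also have "\<dots> \<le> B * 1 * (LINT x|lborel. \<bar>F x\<bar>)"
          using B(1) \<open>norm v \<le> 1\<close> by (intro mult_right_mono mult_left_mono) auto
        finally show ?thesis using True by simp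
      qed simp
    qed
  qed
  moreover have "(LINT v|lborel. indicator ?Q v * - T v) = - (measure lborel ?Q / 2 * T i)"
  proof -
    have "(LINT v|lborel. indicator ?Q v * - T v) = - (LINT v|lborel. indicator ?Q v * (v \<bullet> (\<Sum>j\<in>Basis. T j *\<^sub>R j)))"
      by (subst Tlin) simp
    also have "(LINT v|lborel. indicator ?Q v * (v \<bullet> (\<Sum>j\<in>Basis. T j *\<^sub>R j))) = measure lborel ?Q * (((1/2) *\<^sub>R i) \<bullet> (\<Sum>j\<in>Basis. T j *\<^sub>R j))"
      unfolding half_ball_def by (rule integral_ball_inner)
    also have "((1/2) *\<^sub>R i) \<bullet> (\<Sum>j\<in>Basis. T j *\<^sub>R j) = T i / 2" using Tlin[of i] by simp
    finally show ?thesis by simp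
  qed
  ultimately show "(\<lambda>n. integral\<^sup>L (lborel \<Otimes>\<^sub>M lborel) (a n)) \<longlonglongrightarrow> - (measure lborel ?Q / 2 * (LINT x|lborel. F x * frechet_derivative \<phi> (at x) i))"
    unfolding intL T_def[symmetric] by (simp only:)
qed

lemma borel_weak_gradient_from_partials:
  fixes F :: "'a::euclidean_space \<Rightarrow> real"
  assumes F: "integrable lborel F"
    and g: "\<And>i. i \<in> Basis \<Longrightarrow> \<exists>g. integrable lborel g \<and> (\<forall>\<phi>\<in>C_c_infinity \<Omega>. (LINT x|lborel. F x * frechet_derivative \<phi> (at x) i) = - (LINT x|lborel. g x * \<phi> x))"
  obtains G where "borel_weak_gradient \<Omega> F G"
proof -
  obtain g where g: "\<And>i. i \<in> Basis \<Longrightarrow> integrable lborel (g i)"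
    "\<And>i \<phi>. i \<in> Basis \<Longrightarrow> \<phi> \<in> C_c_infinity \<Omega> \<Longrightarrow> (LINT x|lborel. F x * frechet_derivative \<phi> (at x) i) = - (LINT x|lborel. g i x * \<phi> x)"
    using g by metis
  define G where "G x = (\<Sum>i\<in>Basis. g i x *\<^sub>R i)" for x
  have G: "integrable lborel G" unfolding G_def using g(1) by (intro Bochner_Integration.integrable_sum integrable_scaleR_left) auto
  have Gi: "G x \<bullet> i = g i x" if "i \<in> Basis" for x i
    using that by (simp add: G_def inner_sum_left inner_Basis if_distrib sum.delta cong: if_cong)
  have "borel_weak_gradient \<Omega> F G"
    unfolding borel_weak_gradient_def
  proof (intro conjI allI impI ballI)
    show "integrable lborel F" by fact
    show "G \<in> borel_measurable borel" using borel_measurable_integrable[OF G] by simp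
    show "set_integrable lborel K G" if "compact K" for K
      unfolding set_integrable_def using that by (intro integrable_mult_indicator G) (simp add: borel_compact)
    show "(LINT x|lborel. F x * frechet_derivative \<phi> (at x) i) = - (LINT x|lborel. (G x \<bullet> i) * \<phi> x)" if "\<phi> \<in> C_c_infinity \<Omega>" "i \<in> Basis" for \<phi> i
      using g(2)[OF that(2,1)] Gi[OF that(2)] by simp
  qed
  then show ?thesis by (rule that)
qed

text \<open>For each \<open>i\<close>, the functional \<open>\<phi> \<mapsto> \<integral> F \<partial>\<^sub>i\<phi>\<close> is dominated by the \<open>L\<^sup>1\<close> norm of the measure with density \<open>w\<close> and is
therefore given by a density with respect to it.\<close>

proposition weak_gradient_exists_dominated:
  fixes F :: "'a::euclidean_space \<Rightarrow> real" and w :: "'a \<Rightarrow> real"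
  assumes F: "integrable lborel F" and w: "integrable lborel w" "\<And>x. 0 \<le> w x" and c: "c \<ge> 0"
    and dom: "\<And>\<phi> i. \<phi> \<in> C_c_infinity \<Omega> \<Longrightarrow> i \<in> Basis \<Longrightarrow>
      \<bar>LINT x|lborel. F x * frechet_derivative \<phi> (at x) i\<bar> \<le> c * (LINT x|lborel. w x * \<bar>\<phi> x\<bar>)"
  obtains G where "borel_weak_gradient \<Omega> F G"
proof (rule borel_weak_gradient_from_partials[OF F _ that])
  fix i :: 'a assume i: "i \<in> Basis"
  define M where "M = density lborel (\<lambda>x. ennreal (w x))"
  have [measurable]: "w \<in> borel_measurable borel" using borel_measurable_integrable[OF w(1)] by simp
  have [measurable_cong]: "sets M = sets borel" by (simp add: M_def)
  have fin: "finite_measure M"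
  proof (rule finite_measureI)
    have "emeasure M (space M) = (\<integral>\<^sup>+x. ennreal (w x) \<partial>lborel)" by (simp add: M_def emeasure_density)
    also have "\<dots> < \<infinity>" using w by (simp add: integrable_iff_bounded)
    finally show "emeasure M (space M) \<noteq> \<infinity>" by simp
  qed
  have intM: "(LINT x|M. f x) = (LINT x|lborel. w x * f x)" if [measurable]: "f \<in> borel_measurable borel" for f :: "'a \<Rightarrow> real"
    unfolding M_def by (subst integral_density) (auto simp: w)
  let ?T = "\<lambda>\<phi>. LINT x|lborel. F x * frechet_derivative \<phi> (at x) i"
  obtain H where H: "integrable M H" "\<And>f. f \<in> C_c_infinity \<Omega> \<Longrightarrow> ?T f = (LINT x|M. H x * f x)"
  proof (rule dominated_functional_representation[OF fin, of "C_c_infinity \<Omega>" ?T c])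
    show "f \<in> borel_measurable M" if "f \<in> C_c_infinity \<Omega>" for f
      using test_function_measurable[OF that] by (simp add: M_def)
    show "\<exists>c. \<forall>x. \<bar>f x\<bar> \<le> c" if "f \<in> C_c_infinity \<Omega>" for f using test_function_bounded[OF that] by metis
    show "(\<lambda>x. 0) \<in> C_c_infinity \<Omega>" by (rule C_c_infinity_zero)
    show "(\<lambda>x. f x + c * g x) \<in> C_c_infinity \<Omega>" if "f \<in> C_c_infinity \<Omega>" "g \<in> C_c_infinity \<Omega>" for f g c
      using that by (rule C_c_infinity_lincomb)
    show "?T (\<lambda>x. f x + c * g x) = ?T f + c * ?T g" if fg: "f \<in> C_c_infinity \<Omega>" "g \<in> C_c_infinity \<Omega>" for f g c
    proof -
      have iF: "integrable lborel (\<lambda>x. F x * frechet_derivative \<phi> (at x) i)" if \<phi>: "\<phi> \<in> C_c_infinity \<Omega>" for \<phi>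
      proof -
        obtain B where B: "B \<ge> 0" "\<And>x z. \<bar>frechet_derivative \<phi> (at x) z\<bar> \<le> B * norm z"
          using test_function_derivative_bounded[OF \<phi>] by metis
        show ?thesis using F B(2)[of _ i] test_function_measurable[OF \<phi>]
          by (intro integrable_mult_bounded_function[where b="B * norm i"]) auto
      qed
      have "?T (\<lambda>x. f x + c * g x) = (LINT x|lborel. F x * frechet_derivative f (at x) i + c * (F x * frechet_derivative g (at x) i))"
        by (simp add: C_c_infinity_lincomb(2)[OF fg] algebra_simps)
      then show ?thesis using iF[OF fg(1)] iF[OF fg(2)] by simp
    qed
    show "\<bar>?T f\<bar> \<le> c * (LINT x|M. \<bar>f x\<bar>)" if "f \<in> C_c_infinity \<Omega>" for f
      using dom[OF that i] test_function_measurable[OF that] by (simp add: intM)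
    show "0 \<le> c" by fact
  qed (rule that)
  have [measurable]: "H \<in> borel_measurable borel" using borel_measurable_integrable[OF H(1)] by (simp add: M_def)
  have "integrable lborel (\<lambda>x. - (w x * H x))"
    using H(1) unfolding M_def by (subst (asm) integrable_density) (auto simp: w)
  moreover have "?T \<phi> = - (LINT x|lborel. - (w x * H x) * \<phi> x)" if "\<phi> \<in> C_c_infinity \<Omega>" for \<phi>
    using H(2)[OF that] test_function_measurable[OF that] by (simp add: intM mult.assoc)
  ultimately show "\<exists>g. integrable lborel g \<and> (\<forall>\<phi>\<in>C_c_infinity \<Omega>. ?T \<phi> = - (LINT x|lborel. g x * \<phi> x))"
    by (intro exI[of _ "\<lambda>x. - (w x * H x)"]) auto
qed

text \<open>The difference quotients, as functions of the point and the direction, are bounded in \<open>L\<^sup>p\<close> of the product and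
have a weak limit \<open>H\<close>. Averaging \<open>H\<close> over the directions in the half ball gives a partial derivative of \<open>F\<close>;
the factor \<open>2/m\<close> compensates the volume \<open>m\<close> and the mean \<open>i/2\<close> of the half ball. The sets \<open>K n\<close>, on which the
bound is available at scale \<open>h n\<close>, exhaust \<open>\<Omega>\<close>.\<close>

proposition weak_gradient_exists_Lp:
  fixes F :: "'a::euclidean_space \<Rightarrow> real" and K :: "nat \<Rightarrow> 'a set"
  assumes F: "integrable lborel F" and p: "1 < p" and \<Omega>: "bounded \<Omega>" "\<Omega> \<in> sets borel"
    and K: "\<And>n. K n \<in> sets borel" "\<And>n. K n \<subseteq> \<Omega>" "\<And>L. compact L \<Longrightarrow> L \<subseteq> \<Omega> \<Longrightarrow> \<forall>\<^sub>F n in sequentially. L \<subseteq> K n"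
    and h: "\<And>n. h n > 0" "h \<longlonglongrightarrow> 0"
    and C: "\<And>n. (\<integral>\<^sup>+x. \<integral>\<^sup>+v. ennreal (indicator (K n) x * (indicator (ball 0 1) v * (\<bar>F (x + h n *\<^sub>R v) - F x\<bar> / h n) powr p)) \<partial>lborel \<partial>lborel) \<le> ennreal C"
  obtains G where "borel_weak_gradient \<Omega> F G"
proof (rule borel_weak_gradient_from_partials[OF F _ that])
  fix i :: 'a assume i: "i \<in> Basis"
  let ?Q = "half_ball i" and ?P = "lborel \<Otimes>\<^sub>M lborel :: ('a \<times> 'a) measure"
  have [measurable]: "F \<in> borel_measurable borel" using borel_measurable_integrable[OF F] by simp
  have [measurable]: "\<Omega> \<in> sets borel" "\<And>n. K n \<in> sets borel" by fact+
  define d where "d p = (indicator \<Omega> (fst p) * indicator ?Q (snd p) :: real)" for p :: "'a \<times> 'a"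
  have [measurable]: "d \<in> borel_measurable ?P" unfolding d_def by measurable
  have d0: "0 \<le> d p" for p by (simp add: d_def)
  define M where "M = density ?P (\<lambda>p. ennreal (d p))"
  have [measurable_cong]: "sets M = sets ?P" by (simp add: M_def)
  have fin: "finite_measure M"
  proof (rule finite_measureI)
    have "emeasure M (space M) = (\<integral>\<^sup>+p. ennreal (d p) \<partial>?P)"
    proof -
      have "emeasure M (space M) = (\<integral>\<^sup>+p. 1 \<partial>M)" by simp
      also have "\<dots> = (\<integral>\<^sup>+p. ennreal (d p) * 1 \<partial>?P)"
        unfolding M_def by (rule nn_integral_density) simp_all
      finally show ?thesis by simp
    qed
    also have "\<dots> = (\<integral>\<^sup>+x. \<integral>\<^sup>+v. indicator \<Omega> x * indicator ?Q v \<partial>lborel \<partial>lborel)"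
      by (subst lborel.nn_integral_fst[symmetric]) (auto intro!: nn_integral_cong simp: d_def indicator_def)
    also have "\<dots> = emeasure lborel \<Omega> * emeasure lborel ?Q"
      by (simp add: nn_integral_cmult_indicator nn_integral_multc)
    also have "\<dots> < \<infinity>" using half_ball_finite[of i] emeasure_bounded_finite[OF \<Omega>(1)] by (simp add: ennreal_mult_less_top)
    finally show "emeasure M (space M) \<noteq> \<infinity>" by simp
  qed
  have intM: "(LINT p|M. f p) = (LINT p|?P. d p * f p)" if [measurable]: "f \<in> borel_measurable ?P" for f :: "'a \<times> 'a \<Rightarrow> real"
    unfolding M_def by (subst integral_density) (auto simp: d0)
  define q where "q n p = indicator (K n) (fst p) * ((F (fst p + h n *\<^sub>R snd p) - F (fst p)) / h n)" for n and p :: "'a \<times> 'a"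
  have qm[measurable]: "q n \<in> borel_measurable ?P" for n unfolding q_def by measurable
  have qb: "(\<integral>\<^sup>+z. ennreal (\<bar>q n z\<bar> powr p) \<partial>M) \<le> ennreal C" for n
  proof -
    have "(\<integral>\<^sup>+z. ennreal (\<bar>q n z\<bar> powr p) \<partial>M) = (\<integral>\<^sup>+z. ennreal (d z) * ennreal (\<bar>q n z\<bar> powr p) \<partial>?P)"
      unfolding M_def by (rule nn_integral_density) measurable
    also have "\<dots> \<le> (\<integral>\<^sup>+z. ennreal (indicator (K n) (fst z) * (indicator (ball 0 1) (snd z) * (\<bar>F (fst z + h n *\<^sub>R snd z) - F (fst z)\<bar> / h n) powr p)) \<partial>?P)"
    proof (rule nn_integral_mono)
      fix z :: "'a \<times> 'a"
      have "d z * \<bar>q n z\<bar> powr p \<le> indicator (K n) (fst z) * (indicator (ball 0 1) (snd z) * (\<bar>F (fst z + h n *\<^sub>R snd z) - F (fst z)\<bar> / h n) powr p)"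
        using half_ball_subset[OF i] h(1)[of n] by (auto simp: d_def q_def indicator_def abs_divide)
      then show "ennreal (d z) * ennreal (\<bar>q n z\<bar> powr p) \<le> ennreal (indicator (K n) (fst z) * (indicator (ball 0 1) (snd z) * (\<bar>F (fst z + h n *\<^sub>R snd z) - F (fst z)\<bar> / h n) powr p))"
        by (subst ennreal_mult[symmetric]) (auto simp: d0 intro: ennreal_leI)
    qed
    also have "\<dots> = (\<integral>\<^sup>+x. \<integral>\<^sup>+v. ennreal (indicator (K n) x * (indicator (ball 0 1) v * (\<bar>F (x + h n *\<^sub>R v) - F x\<bar> / h n) powr p)) \<partial>lborel \<partial>lborel)"
      by (subst lborel.nn_integral_fst[symmetric]) simp_all
    finally show ?thesis using C[of n] by (rule order_trans)
  qed
  have qi: "integrable M (\<lambda>z. \<bar>q n z\<bar> powr p)" for n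
    using qb[of n] by (auto simp: integrable_iff_bounded intro: le_less_trans)
  have qB: "(LINT z|M. \<bar>q n z\<bar> powr p) \<le> max C 0" for n
  proof -
    have "ennreal (LINT z|M. \<bar>q n z\<bar> powr p) \<le> ennreal (max C 0)"
      using nn_integral_eq_integral[OF qi[of n]] order_trans[OF qb[of n] ennreal_leI[of C "max C 0"]] by simp
    then show ?thesis by (subst (asm) ennreal_le_iff) auto
  qed
  have qM: "q n \<in> borel_measurable M" for n using qm[of n] by (simp add: M_def)
  obtain H where H: "integrable M H"
    "\<And>\<phi> c T. \<phi> \<in> borel_measurable M \<Longrightarrow> (\<And>x. \<bar>\<phi> x\<bar> \<le> c) \<Longrightarrow> (\<lambda>n. LINT x|M. q n x * \<phi> x) \<longlonglongrightarrow> T \<Longrightarrow> (LINT x|M. H x * \<phi> x) = T"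
  proof (rule Lp_bounded_imp_weak_limit[where G=q, OF fin p qM qi qB])
    fix H assume "integrable M H"
      and "\<And>\<phi> c T. \<phi> \<in> borel_measurable M \<Longrightarrow> (\<And>x. \<bar>\<phi> x\<bar> \<le> c) \<Longrightarrow> (\<lambda>n. LINT x|M. q n x * \<phi> x) \<longlonglongrightarrow> T \<Longrightarrow> (LINT x|M. H x * \<phi> x) = T"
    then show thesis by (rule that)
  qed
  have Hm[measurable]: "H \<in> borel_measurable ?P" using borel_measurable_integrable[OF H(1)] by (simp add: M_def)
  have dH: "integrable ?P (\<lambda>z. d z * H z)"
    using H(1) unfolding M_def by (subst (asm) integrable_density) (auto simp: d0)
  define m where "m = measure lborel ?Q"
  have m: "m > 0" by (simp add: m_def half_ball_measure_pos)
  define g where "g x = 2 / m * (LINT v|lborel. d (x, v) * H (x, v))" for x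
  have g: "integrable lborel g"
    unfolding g_def using lborel_pair.integrable_fst'[OF dH] by simp
  have "(LINT x|lborel. F x * frechet_derivative \<phi> (at x) i) = - (LINT x|lborel. g x * \<phi> x)" if \<phi>: "\<phi> \<in> C_c_infinity \<Omega>" for \<phi>
  proof -
    note [measurable] = test_function_measurable[OF \<phi>]
    obtain c where c: "c \<ge> 0" "\<And>x. \<bar>\<phi> x\<bar> \<le> c" using test_function_bounded[OF \<phi>] by metis
    let ?T = "- (m / 2 * (LINT x|lborel. F x * frechet_derivative \<phi> (at x) i))"
    have "(\<lambda>n. LINT (x, v)|?P. indicator ?Q v * ((F (x + h n *\<^sub>R v) - F x) / h n) * \<phi> x) \<longlonglongrightarrow> ?T"
      unfolding m_def by (rule difference_quotient_limit(2)[OF F \<phi> i h])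
    moreover have "\<forall>\<^sub>F n in sequentially. (LINT (x, v)|?P. indicator ?Q v * ((F (x + h n *\<^sub>R v) - F x) / h n) * \<phi> x) = (LINT z|M. q n z * \<phi> (fst z))"
      using K(3)[OF test_function_support[OF \<phi>]]
    proof eventually_elim
      case (elim n)
      have "(LINT z|M. q n z * \<phi> (fst z)) = (LINT z|?P. d z * (q n z * \<phi> (fst z)))" by (rule intM) measurable
      also have "\<dots> = (LINT (x, v)|?P. indicator ?Q v * ((F (x + h n *\<^sub>R v) - F x) / h n) * \<phi> x)"
      proof (intro Bochner_Integration.integral_cong[OF refl])
        fix z :: "'a \<times> 'a"
        show "d z * (q n z * \<phi> (fst z)) = (case z of (x, v) \<Rightarrow> indicator ?Q v * ((F (x + h n *\<^sub>R v) - F x) / h n) * \<phi> x)"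
        proof (cases "fst z \<in> tsupport \<phi>")
          case True
          then have "fst z \<in> K n" "fst z \<in> \<Omega>" using elim K(2)[of n] by auto
          then show ?thesis by (simp add: d_def q_def case_prod_beta)
        next
          case False
          then show ?thesis using test_function_zero[OF \<phi>, of "fst z"] by (simp add: case_prod_beta)
        qed
      qed
      finally show ?case by simp
    qed
    ultimately have "(\<lambda>n. LINT z|M. q n z * \<phi> (fst z)) \<longlonglongrightarrow> ?T" by (rule Lim_transform_eventually)
    then have "(LINT z|M. H z * \<phi> (fst z)) = ?T"
      using c by (intro H(2)[of "\<lambda>z. \<phi> (fst z)" c]) (simp_all add: M_def)
    moreover have "(LINT z|M. H z * \<phi> (fst z)) = (LINT x|lborel. (LINT v|lborel. d (x, v) * H (x, v)) * \<phi> x)"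
    proof -
      have i\<phi>: "integrable ?P (\<lambda>z. (d z * H z) * \<phi> (fst z))"
        using c by (intro integrable_mult_bounded_function[OF dH, of _ c]) auto
      have "(LINT z|M. H z * \<phi> (fst z)) = (LINT z|?P. (d z * H z) * \<phi> (fst z))"
        by (subst intM) (auto simp: mult.assoc)
      also have "\<dots> = (LINT x|lborel. LINT v|lborel. (d (x, v) * H (x, v)) * \<phi> x)"
        using lborel_pair.integral_fst'[OF i\<phi>] by simp
      finally show ?thesis by simp
    qed
    moreover have "(LINT x|lborel. g x * \<phi> x) = 2 / m * (LINT x|lborel. (LINT v|lborel. d (x, v) * H (x, v)) * \<phi> x)"
      unfolding g_def by (simp add: mult.assoc)
    ultimately show ?thesis using m by simp
  qed
  then show "\<exists>g. integrable lborel g \<and> (\<forall>\<phi>\<in>C_c_infinity \<Omega>. (LINT x|lborel. F x * frechet_derivative \<phi> (at x) i) = - (LINT x|lborel. g x * \<phi> x))"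
    using g by blast
qed

section \<open>Lebesgue integrals of Borel representatives\<close>

lemma lebesgue_measurable_if_AE_eq_borel:
  fixes f g :: "'a::euclidean_space \<Rightarrow> 'b::{second_countable_topology, t2_space}"
  assumes g: "g \<in> borel_measurable borel" and ae: "AE x in lborel. f x = g x"
  shows "f \<in> borel_measurable lebesgue"
proof (rule borel_measurableI)
  fix S :: "'b set" assume "open S"
  obtain N where N: "N \<in> null_sets lborel" "{x \<in> space lborel. f x \<noteq> g x} \<subseteq> N"
    using ae by (auto elim!: AE_E simp: null_sets_def)
  have "g -` S \<inter> space borel \<in> sets borel" using g \<open>open S\<close> by (intro measurable_sets) auto
  then have 1: "g -` S - N \<in> sets lebesgue" using N(1) by (intro sets_completionI_sets) (auto simp: null_sets_def)
  have 2: "f -` S \<inter> N \<in> sets lebesgue" using N(1) by (intro null_sets_completion[OF N(1)]) auto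
  have "f -` S \<inter> space lebesgue = (g -` S - N) \<union> (f -` S \<inter> N)" using N(2) by auto
  then show "f -` S \<inter> space lebesgue \<in> sets lebesgue" using 1 2 by (simp only: sets.Un)
qed

lemma lebesgue_integral_AE_eq_borel:
  fixes f g :: "'a::euclidean_space \<Rightarrow> 'b::{banach, second_countable_topology}"
  assumes g: "g \<in> borel_measurable borel" and ae: "AE x in lborel. f x = g x"
  shows "integral\<^sup>L lebesgue f = integral\<^sup>L lborel g"
    and "integrable lebesgue f \<longleftrightarrow> integrable lborel g"
proof -
  have f: "f \<in> borel_measurable lebesgue" by (rule lebesgue_measurable_if_AE_eq_borel[OF g ae])
  have g': "g \<in> borel_measurable lebesgue" using g by (simp add: measurable_completion)
  have ae': "AE x in lebesgue. f x = g x" using ae by (rule AE_completion)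
  show "integral\<^sup>L lebesgue f = integral\<^sup>L lborel g"
    using integral_cong_AE[OF f g' ae'] g by (simp add: integral_completion)
  show "integrable lebesgue f \<longleftrightarrow> integrable lborel g"
    using integrable_cong_AE[OF f g' ae'] g by (simp add: integrable_completion)
qed

lemma exists_borel_representative_vector:
  fixes g :: "'a::euclidean_space \<Rightarrow> 'b::euclidean_space"
  assumes "g \<in> borel_measurable lebesgue"
  obtains G where "G \<in> borel_measurable borel" "AE x in lborel. g x = G x"
proof -
  have "\<exists>h\<in>borel_measurable lborel. AE x in lborel. g x \<bullet> i = h x" for i
    by (intro completion_ex_borel_measurable_real borel_measurable_inner borel_measurable_const assms)
  then obtain h where h: "\<And>i. h i \<in> borel_measurable lborel" "\<And>i. AE x in lborel. g x \<bullet> i = h i x" by metis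
  define G where "G x = (\<Sum>i\<in>Basis. h i x *\<^sub>R i)" for x
  have "G \<in> borel_measurable borel" unfolding G_def using h(1) by simp
  moreover have "AE x in lborel. \<forall>i\<in>(Basis::'b set). g x \<bullet> i = h i x"
    using h(2) by (subst AE_ball_countable) (auto intro: countable_finite)
  then have "AE x in lborel. g x = G x"
  proof eventually_elim
    case (elim x)
    then show ?case unfolding G_def by (subst euclidean_representation[symmetric]) (auto intro!: sum.cong)
  qed
  ultimately show ?thesis by (rule that)
qed

lemma AE_lborel_affine:
  fixes t :: "'a::euclidean_space"
  assumes "AE x in lborel. P x" and c: "c \<noteq> 0"
  shows "AE x in lborel. P (t + c *\<^sub>R x)"
proof -
  have "AE x in density (distr lborel borel (\<lambda>x. t + c *\<^sub>R x)) (\<lambda>_. ennreal (\<bar>c\<bar> ^ DIM('a))). P x"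
    using assms(1) by (subst (asm) lborel_affine[OF c, of t])
  then have "AE x in distr lborel borel (\<lambda>x. t + c *\<^sub>R x). P x"
    using c by (subst (asm) AE_density) auto
  then show ?thesis by (rule AE_distrD[rotated]) simp
qed

section \<open>Powers of extended nonnegative reals\<close>

lemma ennreal_powr_ennreal: "0 \<le> a \<Longrightarrow> ennreal_powr (ennreal a) p = ennreal (a powr p)"
  by (simp add: ennreal_powr_def)

lemma ennreal_powr_mono: "p > 0 \<Longrightarrow> a \<le> b \<Longrightarrow> ennreal_powr a p \<le> ennreal_powr b p"
  by (cases a; cases b) (auto simp: ennreal_powr_def top_unique intro!: ennreal_leI powr_mono2)

text \<open>The power has the increasing inverse \<open>t \<mapsto> t powr (1/p)\<close>, so an upper bound \<open>c\<close> of the powers gives the upper bound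
\<open>c powr (1/p)\<close> of the \<open>f i\<close>.\<close>

lemma ennreal_powr_SUP:
  fixes f :: "'i \<Rightarrow> ennreal"
  assumes p: "p > 0" and I: "I \<noteq> {}"
  shows "ennreal_powr (SUP i\<in>I. f i) p = (SUP i\<in>I. ennreal_powr (f i) p)"
proof (rule antisym)
  show "(SUP i\<in>I. ennreal_powr (f i) p) \<le> ennreal_powr (SUP i\<in>I. f i) p"
    using p by (intro SUP_least ennreal_powr_mono SUP_upper)
  show "ennreal_powr (SUP i\<in>I. f i) p \<le> (SUP i\<in>I. ennreal_powr (f i) p)"
  proof (cases "(SUP i\<in>I. ennreal_powr (f i) p)")
    case (real c)
    have "f i \<le> ennreal (c powr (1 / p))" if "i \<in> I" for i
    proof -
      have le: "ennreal_powr (f i) p \<le> ennreal c" using that unfolding real(2)[symmetric] by (rule SUP_upper)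
      show ?thesis
      proof (cases "f i")
        case (real a)
        then have "a powr p \<le> c" using le \<open>0 \<le> c\<close> by (simp add: ennreal_powr_def)
        then have "(a powr p) powr (1 / p) \<le> c powr (1 / p)" using p by (intro powr_mono2) auto
        then show ?thesis using p real by (simp add: powr_powr ennreal_leI)
      next
        case top
        then show ?thesis using le by (simp add: ennreal_powr_def top_unique)
      qed
    qed
    then have "(SUP i\<in>I. f i) \<le> ennreal (c powr (1 / p))" by (rule SUP_least)
    then have "ennreal_powr (SUP i\<in>I. f i) p \<le> ennreal_powr (ennreal (c powr (1 / p))) p"
      using p by (intro ennreal_powr_mono)
    also have "\<dots> = ennreal c" using p real by (simp add: ennreal_powr_ennreal powr_powr)
    finally show ?thesis by (simp add: real)
  next
    case top
    show ?thesis unfolding top by simp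
  qed
qed

section \<open>Jensen's inequality on the unit interval\<close>

lemma powr_tangent:
  fixes s m p :: real
  assumes p: "p \<ge> 1" and m: "m > 0" and s: "s \<ge> 0"
  shows "m powr p + p * m powr (p - 1) * (s - m) \<le> s powr p"
proof (cases "s = 0")
  case True
  have "m powr p = m powr (p - 1) * m" using m by (simp add: powr_diff)
  then have "m powr p + p * m powr (p - 1) * (s - m) = m powr p * (1 - p)" using True by (simp add: algebra_simps)
  also have "\<dots> \<le> 0" using p by (simp add: mult_nonneg_nonpos)
  finally show ?thesis using True by simp
next
  case False
  have "s powr p - m powr p \<ge> (p * m powr (p - 1)) * (s - m)"
  proof (rule convex_on_imp_above_tangent)
    show "convex_on {0<..} (\<lambda>x. x powr p)" by (rule powr_convex[OF p])
    show "connected {0::real<..}" by (rule connected_Ioi)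
    show "m \<in> interior {0<..}" using m by (simp add: interior_open)
    show "s \<in> {0<..}" using False s by simp
    show "((\<lambda>x. x powr p) has_real_derivative p * m powr (p - 1)) (at m within {0<..})"
      using m by (auto intro!: derivative_eq_intros)
  qed
  then show ?thesis by simp
qed

text \<open>The inequality of a convex function with its tangent at the mean, integrated. If the right hand side is finite, then
\<open>a\<close> is integrable on the unit interval; otherwise there is nothing to show.\<close>

lemma jensen_powr_unit_interval:
  fixes a :: "real \<Rightarrow> real"
  assumes p: "p \<ge> 1" and [measurable]: "a \<in> borel_measurable borel"
  shows "ennreal (\<bar>LINT t|lborel. indicator {0..1} t * a t\<bar> powr p) \<le> (\<integral>\<^sup>+t. indicator {0..1} t * ennreal (\<bar>a t\<bar> powr p) \<partial>lborel)"
proof -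
  define m where "m = \<bar>LINT t|lborel. indicator {0..1} t * a t\<bar>"
  define R where "R = (\<integral>\<^sup>+t. indicator {0..1} t * ennreal (\<bar>a t\<bar> powr p) \<partial>lborel)"
  show ?thesis
  proof (cases "m = 0 \<or> R = \<infinity>")
    case True then show ?thesis by (auto simp: m_def[symmetric] R_def[symmetric])
  next
    case False
    then have m: "m > 0" and R: "R < \<infinity>" by (auto simp: m_def less_top)
    have ind: "integrable lborel (indicator {0..1} :: real \<Rightarrow> real)" by (simp add: integrable_indicator_iff)
    have ip: "integrable lborel (\<lambda>t. indicator {0..1} t * \<bar>a t\<bar> powr p)"
    proof (subst integrable_iff_bounded, intro conjI)
      have "(\<integral>\<^sup>+t. ennreal (norm (indicator {0..1} t * \<bar>a t\<bar> powr p)) \<partial>lborel) = R"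
        unfolding R_def by (intro nn_integral_cong) (auto simp: indicator_def)
      then show "(\<integral>\<^sup>+t. ennreal (norm (indicator {0..1} t * \<bar>a t\<bar> powr p)) \<partial>lborel) < \<infinity>" using R by simp
    qed measurable
    have ia: "integrable lborel (\<lambda>t. indicator {0..1} t * \<bar>a t\<bar>)"
    proof (rule Bochner_Integration.integrable_bound)
      show "integrable lborel (\<lambda>t. indicator {0..1} t + indicator {0..1} t * \<bar>a t\<bar> powr p)" using ind ip by simp
      show "AE t in lborel. norm (indicator {0..1} t * \<bar>a t\<bar>) \<le> norm (indicator {0..1} t + indicator {0..1} t * \<bar>a t\<bar> powr p)"
        using le_one_plus_powr[OF p] by (intro AE_I2) (auto simp: indicator_def abs_of_nonneg)
    qed measurable
    have R_eq: "R = ennreal (LINT t|lborel. indicator {0..1} t * \<bar>a t\<bar> powr p)"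
      unfolding R_def by (subst nn_integral_eq_integral[OF ip, symmetric]) (auto intro!: nn_integral_cong simp: indicator_def)
    have m_le: "m \<le> (LINT t|lborel. indicator {0..1} t * \<bar>a t\<bar>)"
    proof -
      have "m \<le> (LINT t|lborel. \<bar>indicator {0..1} t * a t\<bar>)" unfolding m_def by (rule integral_abs_bound)
      then show ?thesis by (simp add: abs_mult)
    qed
    have one: "(LINT t|lborel. indicator {0..1::real} t :: real) = 1" by simp
    \<comment> \<open>The tangent of \<open>t \<mapsto> t powr p\<close> at \<open>m\<close> is \<open>t \<mapsto> A + B t\<close>.\<close>
    define A where "A = m powr p - p * m powr (p - 1) * m"
    define B where "B = p * m powr (p - 1)"
    have int_AB: "(LINT t|lborel. A * indicator {0..1} t + B * (indicator {0..1} t * \<bar>a t\<bar>)) = A + B * (LINT t|lborel. indicator {0..1} t * \<bar>a t\<bar>)"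
      using ind ia one by simp
    have "m powr p \<le> m powr p + p * m powr (p - 1) * ((LINT t|lborel. indicator {0..1} t * \<bar>a t\<bar>) - m)"
      using m_le p by simp
    also have "\<dots> = A + B * (LINT t|lborel. indicator {0..1} t * \<bar>a t\<bar>)"
      by (simp add: A_def B_def algebra_simps)
    also have "\<dots> = (LINT t|lborel. (m powr p - p * m powr (p - 1) * m) * indicator {0..1} t + p * m powr (p - 1) * (indicator {0..1} t * \<bar>a t\<bar>))"
      unfolding int_AB[symmetric] unfolding A_def B_def by (rule refl)
    also have "\<dots> \<le> (LINT t|lborel. indicator {0..1} t * \<bar>a t\<bar> powr p)"
    proof (rule integral_mono)
      show "integrable lborel (\<lambda>t. (m powr p - p * m powr (p - 1) * m) * indicator {0..1} t + p * m powr (p - 1) * (indicator {0..1} t * \<bar>a t\<bar>))"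
        using ind ia by (intro Bochner_Integration.integrable_add integrable_mult_right)
      show "(m powr p - p * m powr (p - 1) * m) * indicator {0..1} t + p * m powr (p - 1) * (indicator {0..1} t * \<bar>a t\<bar>) \<le> indicator {0..1} t * \<bar>a t\<bar> powr p" for t
        using powr_tangent[OF p m, of "\<bar>a t\<bar>"] by (auto simp: indicator_def algebra_simps)
    qed (rule ip)
    finally show ?thesis unfolding m_def[symmetric] R_def[symmetric] R_eq by (rule ennreal_leI)
  qed
qed

section \<open>Exhaustion of a bounded open set\<close>

text \<open>Compact subsets that exhaust a bounded open set. The distance to the complement is used instead of the distance to
the frontier, because it is positive exactly on \<open>\<Omega>\<close> and needs no case distinction outside.\<close>

definition inner_layer :: "'a::euclidean_space set \<Rightarrow> nat \<Rightarrow> 'a set" where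
  "inner_layer \<Omega> n = {x. 1 / real (Suc n) \<le> infdist x (- \<Omega>)}"

text \<open>Continuous functions that vanish outside \<open>inner_layer \<Omega> n\<close> and increase to the indicator of \<open>\<Omega>\<close>.\<close>

definition cutoff :: "'a::euclidean_space set \<Rightarrow> nat \<Rightarrow> 'a \<Rightarrow> real" where
  "cutoff \<Omega> n x = min 1 (max 0 (real (Suc n) * infdist x (- \<Omega>) - 1))"

context
  fixes \<Omega> :: "'a::euclidean_space set"
  assumes \<Omega>: "open \<Omega>" "bounded \<Omega>"
begin

lemma complement_nonempty: "- \<Omega> \<noteq> {}"
  using \<Omega>(2) not_bounded_UNIV[where 'a='a] by (metis Compl_empty_eq double_compl)

lemma infdist_complement_pos: "0 < infdist x (- \<Omega>) \<longleftrightarrow> x \<in> \<Omega>"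
proof -
  have "closed (- \<Omega>)" using \<Omega>(1) by (rule closed_Compl)
  then have "x \<in> - \<Omega> \<longleftrightarrow> infdist x (- \<Omega>) = 0" using complement_nonempty by (rule in_closed_iff_infdist_zero)
  then show ?thesis using infdist_nonneg[of x "- \<Omega>"] by auto
qed

lemma inner_layer_subset: "inner_layer \<Omega> n \<subseteq> \<Omega>"
proof
  fix x assume "x \<in> inner_layer \<Omega> n"
  then have "0 < infdist x (- \<Omega>)" unfolding inner_layer_def by (simp add: less_le_trans[rotated])
  then show "x \<in> \<Omega>" by (simp add: infdist_complement_pos)
qed

lemma inner_layer_closed: "closed (inner_layer \<Omega> n)"
  unfolding inner_layer_def by (intro closed_Collect_le continuous_intros)

lemma inner_layer_compact: "compact (inner_layer \<Omega> n)"
  using inner_layer_closed inner_layer_subset bounded_subset[OF \<Omega>(2)] by (simp add: compact_eq_bounded_closed)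

lemma inner_layer_mono: "m \<le> n \<Longrightarrow> inner_layer \<Omega> m \<subseteq> inner_layer \<Omega> n"
proof
  fix x assume "m \<le> n" "x \<in> inner_layer \<Omega> m"
  moreover have "1 / real (Suc n) \<le> 1 / real (Suc m)" using \<open>m \<le> n\<close> by (intro divide_left_mono) auto
  ultimately show "x \<in> inner_layer \<Omega> n" unfolding inner_layer_def by simp
qed

lemma inner_layer_eventually:
  assumes L: "compact L" "L \<subseteq> \<Omega>"
  shows "\<forall>\<^sub>F n in sequentially. L \<subseteq> inner_layer \<Omega> n"
proof (cases "L = {}")
  case False
  obtain x where x: "x \<in> L" "\<And>y. y \<in> L \<Longrightarrow> infdist x (- \<Omega>) \<le> infdist y (- \<Omega>)"
  proof -
    have "continuous_on L (\<lambda>x. infdist x (- \<Omega>))" by (intro continuous_intros)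
    from continuous_attains_inf[OF L(1) False this] show thesis using that by blast
  qed
  then have "0 < infdist x (- \<Omega>)" using L(2) by (auto simp: infdist_complement_pos)
  then obtain n where n: "1 / real (Suc n) < infdist x (- \<Omega>)" using nat_approx_posE by blast
  then have "L \<subseteq> inner_layer \<Omega> n" using x(2) unfolding inner_layer_def by force
  then show ?thesis unfolding eventually_sequentially using inner_layer_mono by blast
qed simp

lemma inner_layer_add:
  assumes x: "x \<in> inner_layer \<Omega> n" and z: "norm z < 1 / real (Suc n)"
  shows "x + z \<in> \<Omega>"
proof -
  have "infdist x (- \<Omega>) \<le> infdist (x + z) (- \<Omega>) + dist x (x + z)" by (rule infdist_triangle)
  then have "0 < infdist (x + z) (- \<Omega>)" using x z by (simp add: inner_layer_def dist_norm)
  then show ?thesis by (simp add: infdist_complement_pos)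
qed

lemma inner_layer_inner_domain:
  assumes x: "x \<in> inner_layer \<Omega> n" and h: "h < 1 / real (Suc n)"
  shows "x \<in> inner_domain \<Omega> h"
proof -
  have x\<Omega>: "x \<in> \<Omega>" using x inner_layer_subset by auto
  have ne: "frontier \<Omega> \<noteq> {}"
    using frontier_eq_empty[of \<Omega>] complement_nonempty x\<Omega> by auto
  have "frontier \<Omega> \<subseteq> - \<Omega>" using \<Omega>(1) by (auto simp: frontier_def interior_open)
  then have "infdist x (- \<Omega>) \<le> infdist x (frontier \<Omega>)" using ne by (rule infdist_mono)
  then show ?thesis using x h x\<Omega> by (simp add: inner_layer_def inner_domain_def)
qed

lemma cutoff_bounds: "0 \<le> cutoff \<Omega> n x" "cutoff \<Omega> n x \<le> 1" by (auto simp: cutoff_def)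

lemma cutoff_nonzero: "cutoff \<Omega> n x \<noteq> 0 \<Longrightarrow> x \<in> inner_layer \<Omega> n"
  by (auto simp: cutoff_def inner_layer_def field_simps max_def min_def split: if_splits)

lemma cutoff_C_c: "cutoff \<Omega> n \<in> C_c \<Omega>"
proof -
  have "closure {x. cutoff \<Omega> n x \<noteq> 0} \<subseteq> inner_layer \<Omega> n"
    using cutoff_nonzero by (intro closure_minimal inner_layer_closed) auto
  moreover from this have "compact (inner_layer \<Omega> n \<inter> closure {x. cutoff \<Omega> n x \<noteq> 0})"
    by (intro compact_Int_closed inner_layer_compact closed_closure)
  moreover have "continuous_on UNIV (cutoff \<Omega> n)"
    unfolding cutoff_def[abs_def] by (intro continuous_intros)
  ultimately show ?thesis using inner_layer_subset[of n] by (simp add: C_c_def Int_absorb1)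
qed

lemma cutoff_mono: "m \<le> n \<Longrightarrow> cutoff \<Omega> m x \<le> cutoff \<Omega> n x"
proof -
  assume "m \<le> n"
  then have "real (Suc m) * infdist x (- \<Omega>) \<le> real (Suc n) * infdist x (- \<Omega>)"
    using infdist_nonneg[of x "- \<Omega>"] by (intro mult_right_mono) auto
  then show ?thesis unfolding cutoff_def by linarith
qed

lemma cutoff_eq_1: "x \<in> inner_layer \<Omega> n \<Longrightarrow> cutoff \<Omega> (2 * n + 1) x = 1"
proof -
  assume "x \<in> inner_layer \<Omega> n"
  then have "1 \<le> real (Suc n) * infdist x (- \<Omega>)" by (simp add: inner_layer_def field_simps)
  then have "1 \<le> real (Suc (2 * n + 1)) * infdist x (- \<Omega>) - 1" by (simp add: algebra_simps)
  then show ?thesis unfolding cutoff_def by linarith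
qed

lemma cutoff_SUP: "(SUP n. ennreal (cutoff \<Omega> n x)) = indicator \<Omega> x"
proof (cases "x \<in> \<Omega>")
  case True
  then have "0 < infdist x (- \<Omega>)" by (simp add: infdist_complement_pos)
  then obtain n where "1 / real (Suc n) < infdist x (- \<Omega>)" using nat_approx_posE by blast
  then have "cutoff \<Omega> (2 * n + 1) x = 1" by (intro cutoff_eq_1) (simp add: inner_layer_def)
  then have "ennreal 1 \<le> (SUP n. ennreal (cutoff \<Omega> n x))" by (metis SUP_upper UNIV_I)
  moreover have "(SUP n. ennreal (cutoff \<Omega> n x)) \<le> ennreal 1"
    by (intro SUP_least ennreal_leI cutoff_bounds)
  ultimately show ?thesis using True by (simp add: antisym)
next
  case False
  then have "cutoff \<Omega> n x = 0" for n using cutoff_nonzero[of n x] inner_layer_subset[of n] by auto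
  then show ?thesis using False by simp
qed

end

section \<open>Difference quotients of the distance functions\<close>

lemma KS_constant_pos: "p > 0 \<Longrightarrow> KS_constant TYPE('a::euclidean_space) p > 0"
  using content_ball[of 1 "0::'a"] by (simp add: KS_constant_def)

text \<open>The Kuratowski embedding: \<open>\<xi>\<close> close to \<open>y\<close> makes \<open>\<bar>d(x,\<xi>) - d(y,\<xi>)\<bar>\<close> close to \<open>d(x,y)\<close>.\<close>

lemma dense_dist_SUP:
  fixes D :: "'b::metric_space set"
  assumes D: "closure D = UNIV"
  shows "ennreal (dist x y) = (SUP \<xi>\<in>D. ennreal \<bar>dist x \<xi> - dist y \<xi>\<bar>)"
proof (rule antisym)
  show "(SUP \<xi>\<in>D. ennreal \<bar>dist x \<xi> - dist y \<xi>\<bar>) \<le> ennreal (dist x y)"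
    by (intro SUP_least ennreal_leI) (metis abs_dist_diff_le dist_commute)
  show "ennreal (dist x y) \<le> (SUP \<xi>\<in>D. ennreal \<bar>dist x \<xi> - dist y \<xi>\<bar>)"
  proof (rule ennreal_le_epsilon)
    fix e :: real assume "0 < e"
    then obtain \<xi> where \<xi>: "\<xi> \<in> D" "dist \<xi> y < e / 2"
      using D closure_approachable[of y D] half_gt_zero by blast
    have "dist x y \<le> dist x \<xi> + dist \<xi> y" by (rule dist_triangle)
    then have "dist x y \<le> \<bar>dist x \<xi> - dist y \<xi>\<bar> + e" using \<xi>(2) by (simp add: dist_commute)
    then have "ennreal (dist x y) \<le> ennreal \<bar>dist x \<xi> - dist y \<xi>\<bar> + ennreal e"
      using \<open>0 < e\<close> by (simp flip: ennreal_plus)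
    also have "\<dots> \<le> (SUP \<xi>\<in>D. ennreal \<bar>dist x \<xi> - dist y \<xi>\<bar>) + ennreal e"
      using \<xi>(1) by (intro add_right_mono SUP_upper)
    finally show "ennreal (dist x y) \<le> (SUP \<xi>\<in>D. ennreal \<bar>dist x \<xi> - dist y \<xi>\<bar>) + ennreal e" .
  qed
qed

lemma dense_dist_quotient_SUP:
  fixes D :: "'b::metric_space set"
  assumes D: "closure D = UNIV" and p: "p > 0" and h: "h > 0"
  shows "ennreal (dist x y powr p / h powr p) = (SUP \<xi>\<in>D. ennreal ((\<bar>dist x \<xi> - dist y \<xi>\<bar> / h) powr p))"
proof -
  have ne: "D \<noteq> {}" using D by auto
  have "ennreal (dist x y / h) = (SUP \<xi>\<in>D. ennreal (\<bar>dist x \<xi> - dist y \<xi>\<bar> / h))"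
  proof -
    have "ennreal (dist x y / h) = ennreal (1 / h) * (SUP \<xi>\<in>D. ennreal \<bar>dist x \<xi> - dist y \<xi>\<bar>)"
      unfolding dense_dist_SUP[OF D, symmetric] using h by (simp flip: ennreal_mult)
    also have "\<dots> = (SUP \<xi>\<in>D. ennreal (1 / h) * ennreal \<bar>dist x \<xi> - dist y \<xi>\<bar>)"
      by (rule SUP_mult_left_ennreal)
    finally show ?thesis using h by (simp flip: ennreal_mult)
  qed
  then have "ennreal_powr (ennreal (dist x y / h)) p = (SUP \<xi>\<in>D. ennreal_powr (ennreal (\<bar>dist x \<xi> - dist y \<xi>\<bar> / h)) p)"
    by (simp add: ennreal_powr_SUP[OF p ne])
  then show ?thesis using h by (simp add: ennreal_powr_ennreal powr_divide)
qed

locale KS_map =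
  fixes \<Omega> :: "'a::euclidean_space set" and u :: "'a \<Rightarrow> 'b::polish_space" and D :: "'b set" and p :: real
  assumes p: "1 \<le> p" and \<Omega>: "open \<Omega>" "bounded \<Omega>" and Lp: "Lp_map p \<Omega> u"
    and D: "countable D" "closure D = UNIV"
begin

lemma D_nonempty: "D \<noteq> {}" using D by auto

lemma \<Omega>_borel [measurable]: "\<Omega> \<in> sets borel" using \<Omega> by simp

lemma dist_u_measurable: "(\<lambda>x. indicator \<Omega> x * dist (u x) \<xi>) \<in> borel_measurable lebesgue"
proof -
  have u[measurable]: "u \<in> borel_measurable (lebesgue_on \<Omega>)" using Lp by (simp add: Lp_map_def)
  have "(\<lambda>x. dist (u x) \<xi>) \<in> borel_measurable (lebesgue_on \<Omega>)" by measurable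
  then show ?thesis by (subst (asm) borel_measurable_restrict_space_iff) auto
qed

lemma dist_u_integrable: "integrable lebesgue (\<lambda>x. indicator \<Omega> x * dist (u x) \<xi>)"
proof -
  obtain \<xi>0 where "integrable (lebesgue_on \<Omega>) (\<lambda>x. dist (u x) \<xi>0 powr p)" using Lp by (auto simp: Lp_map_def)
  then have i: "integrable lebesgue (\<lambda>x. indicator \<Omega> x * dist (u x) \<xi>0 powr p)"
    by (subst (asm) integrable_restrict_space) auto
  have i1: "integrable lebesgue (indicator \<Omega> :: 'a \<Rightarrow> real)"
    using emeasure_bounded_finite[OF \<Omega>(2)] by (simp add: integrable_indicator_iff)
  show ?thesis
  proof (rule Bochner_Integration.integrable_bound)
    show "integrable lebesgue (\<lambda>x. (1 + dist \<xi>0 \<xi>) * indicator \<Omega> x + indicator \<Omega> x * dist (u x) \<xi>0 powr p)"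
      by (intro Bochner_Integration.integrable_add integrable_mult_right i i1)
    show "AE x in lebesgue. norm (indicator \<Omega> x * dist (u x) \<xi>) \<le> norm ((1 + dist \<xi>0 \<xi>) * indicator \<Omega> x + indicator \<Omega> x * dist (u x) \<xi>0 powr p)"
    proof (intro AE_I2)
      fix x
      have "dist (u x) \<xi> \<le> dist (u x) \<xi>0 + dist \<xi>0 \<xi>" by (rule dist_triangle)
      also have "dist (u x) \<xi>0 \<le> 1 + dist (u x) \<xi>0 powr p" using le_one_plus_powr[OF p, of "dist (u x) \<xi>0"] by simp
      finally show "norm (indicator \<Omega> x * dist (u x) \<xi>) \<le> norm ((1 + dist \<xi>0 \<xi>) * indicator \<Omega> x + indicator \<Omega> x * dist (u x) \<xi>0 powr p)"
        by (auto simp: indicator_def abs_of_nonneg)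
    qed
  qed (rule dist_u_measurable)
qed

lemma exists_rep:
  "\<exists>F. F \<in> borel_measurable borel \<and> (\<forall>x. x \<notin> \<Omega> \<longrightarrow> F x = 0) \<and> (AE x in lborel. x \<in> \<Omega> \<longrightarrow> F x = dist (u x) \<xi>)"
proof -
  obtain g where g: "g \<in> borel_measurable lborel" "AE x in lborel. indicator \<Omega> x * dist (u x) \<xi> = g x"
    using completion_ex_borel_measurable_real[OF dist_u_measurable] by metis
  have "AE x in lborel. x \<in> \<Omega> \<longrightarrow> indicator \<Omega> x * g x = dist (u x) \<xi>"
    using g(2) by eventually_elim auto
  then show ?thesis using g(1) by (intro exI[of _ "\<lambda>x. indicator \<Omega> x * g x"]) auto
qed

text \<open>A Borel representative of \<open>d(u,\<xi>)\<close>, extended by zero; \<open>u\<close> itself is only Lebesgue measurable on \<open>\<Omega>\<close>.\<close>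

definition rep :: "'b \<Rightarrow> 'a \<Rightarrow> real" where
  "rep \<xi> = (SOME F. F \<in> borel_measurable borel \<and> (\<forall>x. x \<notin> \<Omega> \<longrightarrow> F x = 0) \<and> (AE x in lborel. x \<in> \<Omega> \<longrightarrow> F x = dist (u x) \<xi>))"

lemma rep_measurable [measurable]: "rep \<xi> \<in> borel_measurable borel"
  and rep_outside: "x \<notin> \<Omega> \<Longrightarrow> rep \<xi> x = 0"
  and rep_AE: "AE x in lborel. x \<in> \<Omega> \<longrightarrow> rep \<xi> x = dist (u x) \<xi>"
  using someI_ex[OF exists_rep[of \<xi>]] unfolding rep_def[symmetric] by blast+

lemma rep_AE_indicator: "AE x in lborel. indicator \<Omega> x * dist (u x) \<xi> = rep \<xi> x"
  using rep_AE[of \<xi>] by eventually_elim (auto simp: indicator_def rep_outside)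

lemma rep_integrable: "integrable lborel (rep \<xi>)"
  using dist_u_integrable[of \<xi>] lebesgue_integral_AE_eq_borel(2)[OF rep_measurable rep_AE_indicator] by blast

text \<open>The points where the representatives for all \<open>\<xi> \<in> D\<close> have the correct value. Almost every point is of this
kind, since \<open>D\<close> is countable.\<close>

definition good :: "'a \<Rightarrow> bool" where
  "good x \<longleftrightarrow> (\<forall>\<xi>\<in>D. x \<in> \<Omega> \<longrightarrow> rep \<xi> x = dist (u x) \<xi>)"

lemma AE_good: "AE x in lborel. good x"
  unfolding good_def using rep_AE D(1) by (subst AE_ball_countable) auto

definition quotient :: "real \<Rightarrow> 'a \<Rightarrow> 'a \<Rightarrow> ennreal" where
  "quotient h x v = (SUP \<xi>\<in>D. ennreal ((\<bar>rep \<xi> (x + h *\<^sub>R v) - rep \<xi> x\<bar> / h) powr p))"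

lemma quotient_measurable [measurable]: "(\<lambda>z. quotient h (fst z) (snd z)) \<in> borel_measurable (lborel \<Otimes>\<^sub>M lborel)"
  unfolding quotient_def by (intro borel_measurable_SUP D(1)) measurable

lemma quotient_measurable' [measurable]: "quotient h x \<in> borel_measurable borel"
  unfolding quotient_def[abs_def] by (intro borel_measurable_SUP D(1)) measurable

definition averaged_quotient :: "real \<Rightarrow> 'a \<Rightarrow> ennreal" where
  "averaged_quotient h x = ennreal (KS_constant TYPE('a) p) * (\<integral>\<^sup>+v. quotient h x v * indicator (ball 0 1) v \<partial>lborel)"

lemma averaged_quotient_measurable [measurable]: "averaged_quotient h \<in> borel_measurable borel"
proof -
  have "(\<lambda>x. \<integral>\<^sup>+v. quotient h x v * indicator (ball 0 1) v \<partial>lborel) \<in> borel_measurable lborel"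
    by (rule lborel.borel_measurable_nn_integral) (simp add: case_prod_beta')
  then show ?thesis unfolding averaged_quotient_def[abs_def] by simp
qed

definition energy_integral :: "real \<Rightarrow> ('a \<Rightarrow> real) \<Rightarrow> ennreal" where
  "energy_integral h \<phi> = (\<integral>\<^sup>+x. averaged_quotient h x * ennreal (\<phi> x) \<partial>lborel)"

text \<open>On the layer of depth more than \<open>h\<close> the density is the average of a supremum of difference quotients of the
representatives, by density of \<open>D\<close>.\<close>

lemma KS_density_eq:
  assumes h: "0 < h" "h < 1 / real (Suc n)" and x: "x \<in> inner_layer \<Omega> n" "good x"
  shows "KS_density p \<Omega> u h x = averaged_quotient h x"
proof -
  have x\<Omega>: "x \<in> \<Omega>" using x inner_layer_subset[OF \<Omega>] by auto
  have "(\<integral>\<^sup>+v\<in>ball 0 1. ennreal (dist (u x) (u (x + h *\<^sub>R v)) powr p / h powr p) \<partial>lebesgue) =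
    (\<integral>\<^sup>+v\<in>ball 0 1. ennreal (dist (u x) (u (x + h *\<^sub>R v)) powr p / h powr p) \<partial>lborel)"
    by (rule nn_integral_completion)
  also have "\<dots> = (\<integral>\<^sup>+v. quotient h x v * indicator (ball 0 1) v \<partial>lborel)"
  proof (rule nn_integral_cong_AE)
    have "AE v in lborel. good (x + h *\<^sub>R v)" using AE_lborel_affine[OF AE_good, of h x] h by simp
    then show "AE v in lborel. ennreal (dist (u x) (u (x + h *\<^sub>R v)) powr p / h powr p) * indicator (ball 0 1) v = quotient h x v * indicator (ball 0 1) v"
    proof eventually_elim
      case (elim v)
      show ?case
      proof (cases "v \<in> ball (0::'a) 1")
        case True
        then have "norm (h *\<^sub>R v) < h" using h by simp
        then have "norm (h *\<^sub>R v) < 1 / real (Suc n)" using h(2) by (rule less_trans)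
        then have y: "x + h *\<^sub>R v \<in> \<Omega>" by (rule inner_layer_add[OF \<Omega> x(1)])
        have "ennreal (dist (u x) (u (x + h *\<^sub>R v)) powr p / h powr p) = quotient h x v"
          unfolding quotient_def dense_dist_quotient_SUP[OF D(2) less_le_trans[OF zero_less_one p] h(1)]
        proof (intro SUP_cong refl)
          fix \<xi> assume "\<xi> \<in> D"
          then have "rep \<xi> x = dist (u x) \<xi>" "rep \<xi> (x + h *\<^sub>R v) = dist (u (x + h *\<^sub>R v)) \<xi>"
            using x(2) elim x\<Omega> y by (auto simp: good_def)
          then show "ennreal ((\<bar>dist (u x) \<xi> - dist (u (x + h *\<^sub>R v)) \<xi>\<bar> / h) powr p) = ennreal ((\<bar>rep \<xi> (x + h *\<^sub>R v) - rep \<xi> x\<bar> / h) powr p)"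
            by (simp add: abs_minus_commute)
        qed
        then show ?thesis by simp
      qed simp
    qed
  qed
  finally show ?thesis
    using inner_layer_inner_domain[OF \<Omega> x(1) h(2)] by (simp add: KS_density_def averaged_quotient_def)
qed

lemma KS_density_AE:
  assumes h: "0 < h" "h < 1 / real (Suc n)"
  shows "AE x in lborel. x \<in> inner_layer \<Omega> n \<longrightarrow> KS_density p \<Omega> u h x = averaged_quotient h x"
  using AE_good by eventually_elim (auto intro: KS_density_eq[OF h])

lemma KS_integral_eq:
  assumes h: "0 < h" "h < 1 / real (Suc n)" and \<phi>: "\<And>x. \<phi> x \<noteq> 0 \<Longrightarrow> x \<in> inner_layer \<Omega> n"
  shows "(\<integral>\<^sup>+x\<in>\<Omega>. KS_density p \<Omega> u h x * ennreal (\<phi> x) \<partial>lebesgue) = energy_integral h \<phi>"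
proof -
  have "(\<integral>\<^sup>+x\<in>\<Omega>. KS_density p \<Omega> u h x * ennreal (\<phi> x) \<partial>lebesgue) = (\<integral>\<^sup>+x\<in>\<Omega>. KS_density p \<Omega> u h x * ennreal (\<phi> x) \<partial>lborel)"
    by (rule nn_integral_completion)
  also have "\<dots> = energy_integral h \<phi>"
    unfolding energy_integral_def
  proof (rule nn_integral_cong_AE)
    show "AE x in lborel. KS_density p \<Omega> u h x * ennreal (\<phi> x) * indicator \<Omega> x = averaged_quotient h x * ennreal (\<phi> x)"
      using KS_density_AE[OF h]
    proof eventually_elim
      case (elim x)
      show ?case
      proof (cases "\<phi> x = 0")
        case False
        then show ?thesis using elim \<phi>[OF False] inner_layer_subset[OF \<Omega>, of n] by auto
      qed simp
    qed
  qed
  finally show ?thesis .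
qed

lemma C_c_inner_layer:
  assumes "\<phi> \<in> C_c \<Omega>"
  obtains n where "\<And>x. \<phi> x \<noteq> 0 \<Longrightarrow> x \<in> inner_layer \<Omega> n"
proof -
  have "compact (tsupport \<phi>)" "tsupport \<phi> \<subseteq> \<Omega>" using assms by (auto simp: C_c_def)
  from inner_layer_eventually[OF \<Omega> this] obtain n where "tsupport \<phi> \<subseteq> inner_layer \<Omega> n"
    by (auto simp: eventually_sequentially)
  then show ?thesis using that[of n] closure_subset[of "{x. \<phi> x \<noteq> 0}"] by blast
qed

lemma eventually_small: "\<forall>\<^sub>F h in at_right 0. 0 < h \<and> h < 1 / real (Suc n)"
  unfolding eventually_at_right_field by (intro exI[of _ "1 / real (Suc n)"]) auto

lemma eventually_KS_integral_eq:
  assumes "\<phi> \<in> C_c \<Omega>"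
  shows "\<forall>\<^sub>F h in at_right 0. (\<integral>\<^sup>+x\<in>\<Omega>. KS_density p \<Omega> u h x * ennreal (\<phi> x) \<partial>lebesgue) = energy_integral h \<phi>"
proof -
  obtain n where n: "\<And>x. \<phi> x \<noteq> 0 \<Longrightarrow> x \<in> inner_layer \<Omega> n" using C_c_inner_layer[OF assms] by blast
  show ?thesis
    using eventually_small[of n] by eventually_elim (auto intro: KS_integral_eq n)
qed

abbreviation cutoffs :: "('a \<Rightarrow> real) set" where
  "cutoffs \<equiv> {\<phi> \<in> C_c \<Omega>. \<forall>x. 0 \<le> \<phi> x \<and> \<phi> x \<le> 1}"

lemma KS_energy_eq: "KS_energy p \<Omega> u = (SUP \<phi>\<in>cutoffs. Limsup (at_right 0) (\<lambda>h. energy_integral h \<phi>))"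
  unfolding KS_energy_def by (intro SUP_cong refl Limsup_eq) (use eventually_KS_integral_eq in auto)

lemma cutoff_in_cutoffs: "cutoff \<Omega> n \<in> cutoffs"
  using cutoff_C_c[OF \<Omega>] cutoff_bounds[OF \<Omega>] by auto

lemma eventually_energy_integral_less:
  assumes "KS_energy p \<Omega> u < E" "\<phi> \<in> cutoffs"
  shows "\<forall>\<^sub>F h in at_right 0. energy_integral h \<phi> < E"
proof -
  have "Limsup (at_right 0) (\<lambda>h. energy_integral h \<phi>) \<le> KS_energy p \<Omega> u"
    unfolding KS_energy_eq using assms(2) by (rule SUP_upper)
  then show ?thesis using assms(1) by (intro Limsup_lessD) (rule le_less_trans)
qed

text \<open>The energy is built from the supremum over \<open>D\<close>, so a single \<open>\<xi>\<close> contributes at most the whole of it.\<close>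

lemma rep_energy_le:
  assumes \<xi>: "\<xi> \<in> D" and [measurable]: "\<phi> \<in> borel_measurable borel"
  shows "ennreal (KS_constant TYPE('a) p) * (\<integral>\<^sup>+x. \<integral>\<^sup>+v. ennreal (\<phi> x) * (indicator (ball 0 1) v * ennreal ((\<bar>rep \<xi> (x + h *\<^sub>R v) - rep \<xi> x\<bar> / h) powr p)) \<partial>lborel \<partial>lborel) \<le> energy_integral h \<phi>"
proof -
  have "(\<integral>\<^sup>+x. \<integral>\<^sup>+v. ennreal (\<phi> x) * (indicator (ball 0 1) v * ennreal ((\<bar>rep \<xi> (x + h *\<^sub>R v) - rep \<xi> x\<bar> / h) powr p)) \<partial>lborel \<partial>lborel)
    \<le> (\<integral>\<^sup>+x. \<integral>\<^sup>+v. ennreal (\<phi> x) * (quotient h x v * indicator (ball 0 1) v) \<partial>lborel \<partial>lborel)"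
  proof (intro nn_integral_mono mult_left_mono)
    fix x v :: 'a
    have "ennreal ((\<bar>rep \<xi> (x + h *\<^sub>R v) - rep \<xi> x\<bar> / h) powr p) \<le> quotient h x v"
      unfolding quotient_def using \<xi> by (rule SUP_upper)
    then show "indicator (ball 0 1) v * ennreal ((\<bar>rep \<xi> (x + h *\<^sub>R v) - rep \<xi> x\<bar> / h) powr p) \<le> quotient h x v * indicator (ball 0 1) v"
      by (auto simp: indicator_def)
  qed simp
  also have "\<dots> = (\<integral>\<^sup>+x. ennreal (\<phi> x) * (\<integral>\<^sup>+v. quotient h x v * indicator (ball 0 1) v \<partial>lborel) \<partial>lborel)"
    by (simp add: nn_integral_cmult)
  finally have "ennreal (KS_constant TYPE('a) p) * (\<integral>\<^sup>+x. \<integral>\<^sup>+v. ennreal (\<phi> x) * (indicator (ball 0 1) v * ennreal ((\<bar>rep \<xi> (x + h *\<^sub>R v) - rep \<xi> x\<bar> / h) powr p)) \<partial>lborel \<partial>lborel)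
    \<le> ennreal (KS_constant TYPE('a) p) * (\<integral>\<^sup>+x. ennreal (\<phi> x) * (\<integral>\<^sup>+v. quotient h x v * indicator (ball 0 1) v \<partial>lborel) \<partial>lborel)"
    by (rule mult_left_mono) simp
  also have "\<dots> = (\<integral>\<^sup>+x. ennreal (KS_constant TYPE('a) p) * (ennreal (\<phi> x) * (\<integral>\<^sup>+v. quotient h x v * indicator (ball 0 1) v \<partial>lborel)) \<partial>lborel)"
    by (rule nn_integral_cmult[symmetric]) (use lborel.borel_measurable_nn_integral[of "\<lambda>x v. quotient h x v * indicator (ball 0 1) v" lborel] in \<open>simp add: case_prod_beta'\<close>)
  also have "\<dots> = energy_integral h \<phi>"
    unfolding energy_integral_def averaged_quotient_def by (simp add: ac_simps)
  finally show ?thesis .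
qed

end

section \<open>Finite energy yields weak gradients\<close>

context KS_map
begin

lemma p_pos: "p > 0" using p by simp

lemma KS_constant_p_pos: "KS_constant TYPE('a) p > 0" using p_pos by (rule KS_constant_pos)

lemma cutoffs_measurable: "\<phi> \<in> cutoffs \<Longrightarrow> \<phi> \<in> borel_measurable borel"
  by (auto simp: C_c_def intro: borel_measurable_continuous_onI)

text \<open>On each layer a scale is chosen at which the energy is below a bound common to all layers; this bounds the
difference quotients of \<open>d(u,\<xi>)\<close> in \<open>L\<^sup>p\<close> there.\<close>

lemma weak_gradient_exists_of_finite_energy:
  assumes p1: "1 < p" and fin: "KS_energy p \<Omega> u < \<infinity>" and \<xi>: "\<xi> \<in> D"
  obtains G where "borel_weak_gradient \<Omega> (rep \<xi>) G"
proof -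
  define c where "c = KS_constant TYPE('a) p"
  have c: "c > 0" using KS_constant_p_pos by (simp add: c_def)
  obtain k where k: "KS_energy p \<Omega> u = ennreal k" "0 \<le> k" using fin by (cases "KS_energy p \<Omega> u") auto
  define E where "E = k + 1"
  have E: "KS_energy p \<Omega> u < ennreal E" "E \<ge> 0"
    using k(2) unfolding k(1) E_def by (auto intro!: ennreal_lessI)
  have "\<exists>h. 0 < h \<and> h < 1 / real (Suc n) \<and> energy_integral h (cutoff \<Omega> (2 * n + 1)) < ennreal E" for n
  proof -
    have "\<forall>\<^sub>F h in at_right 0. (0 < h \<and> h < 1 / real (Suc n)) \<and> energy_integral h (cutoff \<Omega> (2 * n + 1)) < ennreal E"
      by (rule eventually_conj[OF eventually_small eventually_energy_integral_less[OF E(1) cutoff_in_cutoffs]])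
    from eventually_happens'[OF trivial_limit_at_right_real this] show ?thesis by auto
  qed
  then obtain h where h: "\<And>n. 0 < h n" "\<And>n. h n < 1 / real (Suc n)" "\<And>n. energy_integral (h n) (cutoff \<Omega> (2 * n + 1)) < ennreal E"
    by metis
  have h0: "h \<longlonglongrightarrow> 0"
  proof (rule tendsto_sandwich[OF _ _ tendsto_const LIMSEQ_inverse_real_of_nat])
    show "\<forall>\<^sub>F n in sequentially. 0 \<le> h n" using h(1) by (intro always_eventually allI less_imp_le)
    show "\<forall>\<^sub>F n in sequentially. h n \<le> inverse (real (Suc n))"
      using h(2) by (intro always_eventually allI less_imp_le) (simp add: inverse_eq_divide)
  qed
  have bound: "(\<integral>\<^sup>+x. \<integral>\<^sup>+v. ennreal (indicator (inner_layer \<Omega> n) x * (indicator (ball 0 1) v * (\<bar>rep \<xi> (x + h n *\<^sub>R v) - rep \<xi> x\<bar> / h n) powr p)) \<partial>lborel \<partial>lborel) \<le> ennreal (1 / c * E)" for n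
  proof -
    let ?X = "\<integral>\<^sup>+x. \<integral>\<^sup>+v. ennreal (cutoff \<Omega> (2 * n + 1) x) * (indicator (ball 0 1) v * ennreal ((\<bar>rep \<xi> (x + h n *\<^sub>R v) - rep \<xi> x\<bar> / h n) powr p)) \<partial>lborel \<partial>lborel"
    have "(\<integral>\<^sup>+x. \<integral>\<^sup>+v. ennreal (indicator (inner_layer \<Omega> n) x * (indicator (ball 0 1) v * (\<bar>rep \<xi> (x + h n *\<^sub>R v) - rep \<xi> x\<bar> / h n) powr p)) \<partial>lborel \<partial>lborel) \<le> ?X"
      by (intro nn_integral_mono) (auto simp: indicator_def cutoff_eq_1[OF \<Omega>, simplified])
    also have "?X = ennreal (1 / c) * (ennreal c * ?X)"
      using c by (simp add: mult.assoc[symmetric] flip: ennreal_mult)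
    also have "\<dots> \<le> ennreal (1 / c) * ennreal E"
    proof (rule mult_left_mono)
      have "ennreal c * ?X \<le> energy_integral (h n) (cutoff \<Omega> (2 * n + 1))"
        unfolding c_def by (rule rep_energy_le[OF \<xi>]) (rule cutoffs_measurable[OF cutoff_in_cutoffs])
      then show "ennreal c * ?X \<le> ennreal E" using h(3)[of n] by (rule order_trans[OF _ less_imp_le])
    qed simp
    also have "\<dots> = ennreal (1 / c * E)" using c E by (simp flip: ennreal_mult)
    finally show ?thesis .
  qed
  show ?thesis
  proof (rule weak_gradient_exists_Lp[OF rep_integrable p1 \<Omega>(2) \<Omega>_borel _ _ _ h(1) h0 bound that])
    show "inner_layer \<Omega> n \<in> sets borel" for n by (rule borel_closed[OF inner_layer_closed[OF \<Omega>]])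
    show "inner_layer \<Omega> n \<subseteq> \<Omega>" for n by (rule inner_layer_subset[OF \<Omega>])
    show "\<forall>\<^sub>F n in sequentially. L \<subseteq> inner_layer \<Omega> n" if "compact L" "L \<subseteq> \<Omega>" for L
      using that by (rule inner_layer_eventually[OF \<Omega>])
  qed
qed

text \<open>The weak limit is defined through real integrals of the densities; for small \<open>h\<close> the energy bound makes these
densities finite almost everywhere on the support of \<open>\<psi>\<close>, so that the conversion to real values loses nothing.\<close>

lemma energy_integral_tendsto:
  assumes fin: "KS_energy p \<Omega> u < \<infinity>" and \<mu>: "KS_weak_limit p \<Omega> u \<mu>" and \<psi>: "\<psi> \<in> cutoffs"
  shows "((\<lambda>h. energy_integral h \<psi>) \<longlongrightarrow> (\<integral>\<^sup>+x. ennreal (\<psi> x) \<partial>\<mu>)) (at_right 0)"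
proof -
  have [measurable]: "\<psi> \<in> borel_measurable borel" by (rule cutoffs_measurable[OF \<psi>])
  have \<psi>C: "\<psi> \<in> C_c \<Omega>" and \<psi>b: "\<And>x. 0 \<le> \<psi> x" "\<And>x. \<psi> x \<le> 1" using \<psi> by auto
  obtain n where n: "\<And>x. \<psi> x \<noteq> 0 \<Longrightarrow> x \<in> inner_layer \<Omega> n" using C_c_inner_layer[OF \<psi>C] by blast
  have sets\<mu>: "sets \<mu> = sets (restrict_space borel \<Omega>)" using \<mu> by (simp add: KS_weak_limit_def)
  have \<psi>\<mu>: "\<psi> \<in> borel_measurable \<mu>"
    unfolding measurable_cong_sets[OF sets\<mu> refl] by (rule measurable_restrict_space1) simp
  have int: "integrable \<mu> \<psi>"
  proof (subst integrable_iff_bounded, intro conjI \<psi>\<mu>)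
    have K: "inner_layer \<Omega> n \<in> sets \<mu>"
      unfolding sets\<mu> using inner_layer_subset[OF \<Omega>, of n] inner_layer_closed[OF \<Omega>, of n]
      by (subst sets_restrict_space_iff) auto
    have "(\<integral>\<^sup>+x. ennreal (norm (\<psi> x)) \<partial>\<mu>) \<le> (\<integral>\<^sup>+x. indicator (inner_layer \<Omega> n) x \<partial>\<mu>)"
    proof (intro nn_integral_mono)
      fix x show "ennreal (norm (\<psi> x)) \<le> indicator (inner_layer \<Omega> n) x"
        using n[of x] \<psi>b[of x] by (cases "\<psi> x = 0") (auto simp: ennreal_le_1)
    qed
    also have "\<dots> = emeasure \<mu> (inner_layer \<Omega> n)" using K by simp
    also have "\<dots> < \<infinity>"
      using \<mu> inner_layer_compact[OF \<Omega>, of n] inner_layer_subset[OF \<Omega>, of n] by (simp add: KS_weak_limit_def)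
    finally show "(\<integral>\<^sup>+x. ennreal (norm (\<psi> x)) \<partial>\<mu>) < \<infinity>" .
  qed
  have "((\<lambda>h. LINT x:\<Omega>|lebesgue. enn2real (KS_density p \<Omega> u h x) * \<psi> x) \<longlongrightarrow> (LINT x|\<mu>. \<psi> x)) (at_right 0)"
    using \<mu> \<psi>C by (simp add: KS_weak_limit_def)
  then have "((\<lambda>h. ennreal (LINT x:\<Omega>|lebesgue. enn2real (KS_density p \<Omega> u h x) * \<psi> x)) \<longlongrightarrow> ennreal (LINT x|\<mu>. \<psi> x)) (at_right 0)"
    by (rule tendsto_ennrealI)
  also have "ennreal (LINT x|\<mu>. \<psi> x) = (\<integral>\<^sup>+x. ennreal (\<psi> x) \<partial>\<mu>)"
    using \<psi>b by (intro nn_integral_eq_integral[symmetric] int) auto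
  finally have lim: "((\<lambda>h. ennreal (LINT x:\<Omega>|lebesgue. enn2real (KS_density p \<Omega> u h x) * \<psi> x)) \<longlongrightarrow> (\<integral>\<^sup>+x. ennreal (\<psi> x) \<partial>\<mu>)) (at_right 0)" .
  have ev: "\<forall>\<^sub>F h in at_right 0. ennreal (LINT x:\<Omega>|lebesgue. enn2real (KS_density p \<Omega> u h x) * \<psi> x) = energy_integral h \<psi>"
    using eventually_energy_integral_less[OF fin \<psi>] eventually_small[of n]
  proof eventually_elim
    case (elim h)
    have ae: "AE x in lborel. indicator \<Omega> x *\<^sub>R (enn2real (KS_density p \<Omega> u h x) * \<psi> x) = enn2real (averaged_quotient h x) * \<psi> x"
      using KS_density_AE[OF conjunct1[OF elim(2)] conjunct2[OF elim(2)]]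
    proof eventually_elim
      case (elim x)
      then show ?case
        using n[of x] inner_layer_subset[OF \<Omega>, of n] by (cases "\<psi> x = 0") auto
    qed
    have e1: "(LINT x:\<Omega>|lebesgue. enn2real (KS_density p \<Omega> u h x) * \<psi> x) = (LINT x|lborel. enn2real (averaged_quotient h x) * \<psi> x)"
      unfolding set_lebesgue_integral_def by (rule lebesgue_integral_AE_eq_borel(1)[OF _ ae]) measurable
    have fin': "(\<integral>\<^sup>+x. averaged_quotient h x * ennreal (\<psi> x) \<partial>lborel) < \<infinity>" using elim(1) by (simp add: energy_integral_def)
    have e2: "(\<integral>\<^sup>+x. ennreal (enn2real (averaged_quotient h x) * \<psi> x) \<partial>lborel) = (\<integral>\<^sup>+x. averaged_quotient h x * ennreal (\<psi> x) \<partial>lborel)"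
    proof (rule nn_integral_cong_AE)
      have "AE x in lborel. averaged_quotient h x * ennreal (\<psi> x) \<noteq> \<infinity>"
        using fin' by (intro nn_integral_PInf_AE) auto
      then show "AE x in lborel. ennreal (enn2real (averaged_quotient h x) * \<psi> x) = averaged_quotient h x * ennreal (\<psi> x)"
      proof eventually_elim
        case (elim x)
        show ?case
        proof (cases "\<psi> x = 0")
          case False
          then have "averaged_quotient h x \<noteq> top" using elim \<psi>b[of x] by (auto simp: ennreal_mult_eq_top_iff)
          then show ?thesis using \<psi>b[of x] by (simp add: ennreal_mult less_top[symmetric])
        qed simp
      qed
    qed
    have i: "integrable lborel (\<lambda>x. enn2real (averaged_quotient h x) * \<psi> x)"
    proof (subst integrable_iff_bounded, intro conjI)
      have "(\<integral>\<^sup>+x. ennreal (norm (enn2real (averaged_quotient h x) * \<psi> x)) \<partial>lborel) = (\<integral>\<^sup>+x. ennreal (enn2real (averaged_quotient h x) * \<psi> x) \<partial>lborel)"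
        using \<psi>b by (intro nn_integral_cong) simp
      then show "(\<integral>\<^sup>+x. ennreal (norm (enn2real (averaged_quotient h x) * \<psi> x)) \<partial>lborel) < \<infinity>" using fin' e2 by simp
    qed measurable
    have "ennreal (LINT x|lborel. enn2real (averaged_quotient h x) * \<psi> x) = (\<integral>\<^sup>+x. ennreal (enn2real (averaged_quotient h x) * \<psi> x) \<partial>lborel)"
      using \<psi>b by (intro nn_integral_eq_integral[symmetric] i) simp
    then show ?case unfolding e1 energy_integral_def e2 .
  qed
  show ?thesis by (rule Lim_transform_eventually[OF lim ev])
qed

text \<open>Radon-Nikodym density of the limit measure. It is integrable because cutoff functions are bounded by the energy
in the limit and exhaust \<open>\<Omega>\<close>.\<close>

lemma weak_limit_density:
  assumes fin: "KS_energy p \<Omega> u < \<infinity>" and \<mu>: "KS_weak_limit p \<Omega> u \<mu>"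
    and ac: "absolutely_continuous (restrict_space lborel \<Omega>) \<mu>"
  obtains w :: "'a \<Rightarrow> real" where "integrable lborel w" "\<And>x. 0 \<le> w x"
    "\<And>\<psi>. \<psi> \<in> cutoffs \<Longrightarrow> (\<integral>\<^sup>+x. ennreal (\<psi> x) \<partial>\<mu>) = ennreal (LINT x|lborel. w x * \<psi> x)"
proof -
  have sets\<mu>: "sets \<mu> = sets (restrict_space borel \<Omega>)" using \<mu> by (simp add: KS_weak_limit_def)
  have sets\<mu>': "sets \<mu> = sets (restrict_space lborel \<Omega>)" unfolding sets\<mu> by (rule sets_restrict_space_cong) simp
  have "emeasure (restrict_space lborel \<Omega>) (space (restrict_space lborel \<Omega>)) \<noteq> \<infinity>"
    using emeasure_bounded_finite[OF \<Omega>(2)] by (simp add: space_restrict_space emeasure_restrict_space)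
  then interpret R: finite_measure "restrict_space lborel \<Omega>" by (rule finite_measureI)
  obtain W where W: "W \<in> borel_measurable (restrict_space lborel \<Omega>)" "density (restrict_space lborel \<Omega>) W = \<mu>"
    using R.Radon_Nikodym[OF ac sets\<mu>'] by auto
  have Wm[measurable]: "(\<lambda>x. W x * indicator \<Omega> x) \<in> borel_measurable borel"
    using W(1) by (subst (asm) borel_measurable_restrict_space_iff_ennreal) auto
  have int\<mu>: "(\<integral>\<^sup>+x. f x \<partial>\<mu>) = (\<integral>\<^sup>+x. (W x * indicator \<Omega> x) * f x \<partial>lborel)" if f: "f \<in> borel_measurable borel" for f
  proof -
    have "f \<in> borel_measurable (restrict_space lborel \<Omega>)" using f by (intro measurable_restrict_space1) simp
    then have "(\<integral>\<^sup>+x. f x \<partial>\<mu>) = (\<integral>\<^sup>+x. W x * f x \<partial>restrict_space lborel \<Omega>)"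
      unfolding W(2)[symmetric] by (rule nn_integral_density[OF W(1)])
    also have "\<dots> = (\<integral>\<^sup>+x. (W x * f x) * indicator \<Omega> x \<partial>lborel)" by (rule nn_integral_restrict_space) simp
    finally show ?thesis by (simp add: ac_simps)
  qed
  define E where "E = KS_energy p \<Omega> u + 1"
  have E: "KS_energy p \<Omega> u < E" "E < \<infinity>" using fin by (auto simp: E_def ennreal_add_left_cancel_less[of _ 0 1, simplified] less_top[symmetric])
  have le: "(\<integral>\<^sup>+x. ennreal (\<psi> x) \<partial>\<mu>) \<le> E" if \<psi>: "\<psi> \<in> cutoffs" for \<psi>
    by (rule tendsto_upperbound[OF energy_integral_tendsto[OF fin \<mu> \<psi>]])
      (use eventually_energy_integral_less[OF E(1) \<psi>] in \<open>auto elim: eventually_mono intro: less_imp_le\<close>)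
  have "(\<integral>\<^sup>+x. W x * indicator \<Omega> x \<partial>lborel) = (\<integral>\<^sup>+x. (SUP n. (W x * indicator \<Omega> x) * ennreal (cutoff \<Omega> n x)) \<partial>lborel)"
    by (intro nn_integral_cong) (simp add: SUP_mult_left_ennreal[symmetric] cutoff_SUP[OF \<Omega>] indicator_def)
  also have "\<dots> = (SUP n. \<integral>\<^sup>+x. (W x * indicator \<Omega> x) * ennreal (cutoff \<Omega> n x) \<partial>lborel)"
  proof (rule nn_integral_monotone_convergence_SUP)
    show "incseq (\<lambda>n x. (W x * indicator \<Omega> x) * ennreal (cutoff \<Omega> n x))"
      by (auto simp: incseq_def le_fun_def intro!: mult_left_mono ennreal_leI cutoff_mono[OF \<Omega>])
    show "(\<lambda>x. (W x * indicator \<Omega> x) * ennreal (cutoff \<Omega> n x)) \<in> borel_measurable lborel" for n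
      using cutoffs_measurable[OF cutoff_in_cutoffs[of n]] by measurable
  qed
  also have "\<dots> \<le> E"
  proof (rule SUP_least)
    fix n
    have "(\<integral>\<^sup>+x. (W x * indicator \<Omega> x) * ennreal (cutoff \<Omega> n x) \<partial>lborel) = (\<integral>\<^sup>+x. ennreal (cutoff \<Omega> n x) \<partial>\<mu>)"
      using cutoffs_measurable[OF cutoff_in_cutoffs[of n]] by (intro int\<mu>[symmetric]) measurable
    then show "(\<integral>\<^sup>+x. (W x * indicator \<Omega> x) * ennreal (cutoff \<Omega> n x) \<partial>lborel) \<le> E" using le[OF cutoff_in_cutoffs] by simp
  qed
  finally have Wfin: "(\<integral>\<^sup>+x. W x * indicator \<Omega> x \<partial>lborel) < \<infinity>" using E(2) by (rule le_less_trans)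
  define w where "w x = enn2real (W x * indicator \<Omega> x)" for x
  have [measurable]: "w \<in> borel_measurable borel" unfolding w_def by measurable
  have wW: "AE x in lborel. ennreal (w x) = W x * indicator \<Omega> x"
  proof -
    have "AE x in lborel. W x * indicator \<Omega> x \<noteq> \<infinity>" using Wfin by (intro nn_integral_PInf_AE) auto
    then show ?thesis by eventually_elim (simp add: w_def less_top[symmetric])
  qed
  have w0: "0 \<le> w x" for x by (simp add: w_def)
  have w: "integrable lborel w"
  proof (subst integrable_iff_bounded, intro conjI)
    have "(\<integral>\<^sup>+x. ennreal (norm (w x)) \<partial>lborel) = (\<integral>\<^sup>+x. W x * indicator \<Omega> x \<partial>lborel)"
      using wW w0 by (intro nn_integral_cong_AE) (auto elim: AE_mp)
    then show "(\<integral>\<^sup>+x. ennreal (norm (w x)) \<partial>lborel) < \<infinity>" using Wfin by simp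
  qed measurable
  show ?thesis
  proof (rule that[OF w w0])
    fix \<psi> assume \<psi>: "\<psi> \<in> cutoffs"
    have [measurable]: "\<psi> \<in> borel_measurable borel" by (rule cutoffs_measurable[OF \<psi>])
    have \<psi>b: "\<And>x. 0 \<le> \<psi> x" "\<And>x. \<psi> x \<le> 1" using \<psi> by auto
    have i: "integrable lborel (\<lambda>x. w x * \<psi> x)"
      using \<psi>b by (intro integrable_mult_bounded_function[OF w, of _ 1]) auto
    have "(\<integral>\<^sup>+x. ennreal (\<psi> x) \<partial>\<mu>) = (\<integral>\<^sup>+x. (W x * indicator \<Omega> x) * ennreal (\<psi> x) \<partial>lborel)" by (rule int\<mu>) measurable
    also have "\<dots> = (\<integral>\<^sup>+x. ennreal (w x * \<psi> x) \<partial>lborel)"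
      using wW by (intro nn_integral_cong_AE) (auto elim!: AE_mp simp: ennreal_mult w0 \<psi>b)
    also have "\<dots> = ennreal (LINT x|lborel. w x * \<psi> x)"
      using w0 \<psi>b by (intro nn_integral_eq_integral i) simp
    finally show "(\<integral>\<^sup>+x. ennreal (\<psi> x) \<partial>\<mu>) = ennreal (LINT x|lborel. w x * \<psi> x)" .
  qed
qed

text \<open>For \<open>p = 1\<close>, the difference quotients of \<open>d(u,\<xi>)\<close> tested with \<open>\<phi>\<close> are bounded by the energy densities
tested with \<open>\<bar>\<phi>\<bar>\<close>, which converge to \<open>\<integral> w \<bar>\<phi>\<bar>\<close>.\<close>

lemma weak_gradient_exists_of_abs_continuous_limit:
  assumes p1: "p = 1" and fin: "KS_energy p \<Omega> u < \<infinity>" and \<mu>: "KS_weak_limit p \<Omega> u \<mu>"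
    and ac: "absolutely_continuous (restrict_space lborel \<Omega>) \<mu>" and \<xi>: "\<xi> \<in> D"
  obtains G where "borel_weak_gradient \<Omega> (rep \<xi>) G"
proof -
  define c where "c = KS_constant TYPE('a) p"
  have c: "c > 0" using KS_constant_p_pos by (simp add: c_def)
  obtain w :: "'a \<Rightarrow> real" where w: "integrable lborel w" "\<And>x. 0 \<le> w x"
    "\<And>\<psi>. \<psi> \<in> cutoffs \<Longrightarrow> (\<integral>\<^sup>+x. ennreal (\<psi> x) \<partial>\<mu>) = ennreal (LINT x|lborel. w x * \<psi> x)"
  proof (rule weak_limit_density[OF fin \<mu> ac])
    fix w :: "'a \<Rightarrow> real" assume "integrable lborel w" "\<And>x. 0 \<le> w x"
      "\<And>\<psi>. \<psi> \<in> cutoffs \<Longrightarrow> (\<integral>\<^sup>+x. ennreal (\<psi> x) \<partial>\<mu>) = ennreal (LINT x|lborel. w x * \<psi> x)"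
    then show thesis by (rule that)
  qed
  define m where "m = unit_ball_vol (real DIM('a)) * (1 / 2) ^ DIM('a)"
  have m: "measure lborel (half_ball i) = m" for i :: 'a
    using content_ball[of "1/2" "(1/2) *\<^sub>R i"] by (simp add: half_ball_def m_def)
  have m0: "m > 0" by (simp add: m_def)
  define h where "h n = inverse (real (Suc n))" for n
  have h: "\<And>n. h n > 0" "h \<longlonglongrightarrow> 0" unfolding h_def by (simp, rule LIMSEQ_inverse_real_of_nat)
  have hr: "filterlim h (at_right 0) sequentially"
    by (simp add: filterlim_at h less_imp_neq[OF h(1), symmetric])
  show ?thesis
  proof (rule weak_gradient_exists_dominated[OF rep_integrable w(1,2) _ _ that])
    show "0 \<le> 2 / (m * c)" using m0 c by simp
    fix \<phi> i assume \<phi>: "\<phi> \<in> C_c_infinity \<Omega>" and i: "i \<in> (Basis :: 'a set)"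
    let ?P = "lborel \<Otimes>\<^sub>M lborel :: ('a \<times> 'a) measure"
    let ?T = "LINT x|lborel. rep \<xi> x * frechet_derivative \<phi> (at x) i"
    have [measurable]: "\<phi> \<in> borel_measurable borel" using test_function_measurable[OF \<phi>] by simp
    obtain C0 where C0: "C0 \<ge> 0" "\<And>x. \<bar>\<phi> x\<bar> \<le> C0" using test_function_bounded[OF \<phi>] by metis
    define C where "C = C0 + 1"
    have C: "C > 0" using C0(1) by (simp add: C_def)
    have C': "\<bar>\<phi> x\<bar> \<le> C" for x using C0(2)[of x] by (simp add: C_def)
    \<comment> \<open>Normalised to values in the unit interval, as required of a cutoff function.\<close>
    define \<psi> where "\<psi> x = \<bar>\<phi> x\<bar> / C" for x
    have \<psi>: "\<psi> \<in> cutoffs"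
    proof -
      have "{x. \<psi> x \<noteq> 0} = {x. \<phi> x \<noteq> 0}" using C by (auto simp: \<psi>_def)
      moreover have "continuous_on UNIV \<psi>" unfolding \<psi>_def using test_function_continuous[OF \<phi>] C by (intro continuous_intros) auto
      moreover have "0 \<le> \<psi> x \<and> \<psi> x \<le> 1" for x using C C'[of x] by (simp add: \<psi>_def)
      ultimately show ?thesis using test_function_support[OF \<phi>] by (simp add: C_c_def)
    qed
    define a where "a n = (\<lambda>(x, v). indicator (half_ball i) v * ((rep \<xi> (x + h n *\<^sub>R v) - rep \<xi> x) / h n) * \<phi> x)" for n
    have ai: "integrable ?P (a n)" for n unfolding a_def by (rule difference_quotient_limit(1)[OF rep_integrable \<phi> i h])
    have lim: "(\<lambda>n. integral\<^sup>L ?P (a n)) \<longlonglongrightarrow> - (m / 2 * ?T)"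
      unfolding a_def m[of i, symmetric] by (rule difference_quotient_limit(2)[OF rep_integrable \<phi> i h])
    have bound: "ennreal \<bar>integral\<^sup>L ?P (a n)\<bar> \<le> ennreal (C / c) * energy_integral (h n) \<psi>" for n
    proof -
      let ?X = "\<integral>\<^sup>+x. \<integral>\<^sup>+v. ennreal (\<psi> x) * (indicator (ball 0 1) v * ennreal ((\<bar>rep \<xi> (x + h n *\<^sub>R v) - rep \<xi> x\<bar> / h n) powr p)) \<partial>lborel \<partial>lborel"
      have "ennreal \<bar>integral\<^sup>L ?P (a n)\<bar> \<le> (\<integral>\<^sup>+z. norm (a n z) \<partial>?P)"
        using integral_norm_bound_ennreal[OF ai[of n]] by simp
      also have "\<dots> = (\<integral>\<^sup>+x. \<integral>\<^sup>+v. norm (a n (x, v)) \<partial>lborel \<partial>lborel)"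
        using borel_measurable_integrable[OF ai[of n]] by (intro lborel.nn_integral_fst[symmetric]) simp
      also have "\<dots> \<le> (\<integral>\<^sup>+x. \<integral>\<^sup>+v. ennreal C * (ennreal (\<psi> x) * (indicator (ball 0 1) v * ennreal ((\<bar>rep \<xi> (x + h n *\<^sub>R v) - rep \<xi> x\<bar> / h n) powr p))) \<partial>lborel \<partial>lborel)"
      proof (intro nn_integral_mono)
        fix x v :: 'a
        have q0: "0 \<le> \<bar>rep \<xi> (x + h n *\<^sub>R v) - rep \<xi> x\<bar> / h n" using h(1)[of n] by simp
        have "norm (a n (x, v)) \<le> C * (\<psi> x * (indicator (ball 0 1) v * (\<bar>rep \<xi> (x + h n *\<^sub>R v) - rep \<xi> x\<bar> / h n)))"
          using half_ball_subset[OF i] C h(1)[of n] by (auto simp: a_def \<psi>_def indicator_def abs_mult mult.commute)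
        also have "\<dots> = C * (\<psi> x * (indicator (ball 0 1) v * ((\<bar>rep \<xi> (x + h n *\<^sub>R v) - rep \<xi> x\<bar> / h n) powr p)))"
          using h(1)[of n] by (simp add: p1)
        finally have "ennreal (norm (a n (x, v))) \<le> ennreal (C * (\<psi> x * (indicator (ball 0 1) v * ((\<bar>rep \<xi> (x + h n *\<^sub>R v) - rep \<xi> x\<bar> / h n) powr p))))"
          by (rule ennreal_leI)
        also have "\<dots> = ennreal C * (ennreal (\<psi> x) * (indicator (ball 0 1) v * ennreal ((\<bar>rep \<xi> (x + h n *\<^sub>R v) - rep \<xi> x\<bar> / h n) powr p)))"
          using C \<psi> by (subst ennreal_mult, simp, simp, subst ennreal_mult) (auto simp: indicator_def)
        finally show "ennreal (norm (a n (x, v))) \<le> ennreal C * (ennreal (\<psi> x) * (indicator (ball 0 1) v * ennreal ((\<bar>rep \<xi> (x + h n *\<^sub>R v) - rep \<xi> x\<bar> / h n) powr p)))" .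
      qed
      also have "\<dots> = ennreal C * ?X"
      proof -
        have [measurable]: "\<psi> \<in> borel_measurable borel" by (rule cutoffs_measurable[OF \<psi>])
        have "(\<lambda>x. \<integral>\<^sup>+v. ennreal (\<psi> x) * (indicator (ball 0 1) v * ennreal ((\<bar>rep \<xi> (x + h n *\<^sub>R v) - rep \<xi> x\<bar> / h n) powr p)) \<partial>lborel) \<in> borel_measurable lborel"
          by (rule lborel.borel_measurable_nn_integral) measurable
        then show ?thesis by (simp add: nn_integral_cmult)
      qed
      also have "?X = ennreal (1 / c) * (ennreal c * ?X)"
        using c by (simp add: mult.assoc[symmetric] flip: ennreal_mult)
      also have "ennreal C * (ennreal (1 / c) * (ennreal c * ?X)) \<le> ennreal C * (ennreal (1 / c) * energy_integral (h n) \<psi>)"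
        unfolding c_def by (intro mult_left_mono rep_energy_le[OF \<xi>] cutoffs_measurable[OF \<psi>]) auto
      also have "\<dots> = ennreal (C / c) * energy_integral (h n) \<psi>"
        using C c by (simp add: mult.assoc[symmetric] flip: ennreal_mult)
      finally show ?thesis .
    qed
    have "(\<lambda>n. energy_integral (h n) \<psi>) \<longlonglongrightarrow> ennreal (LINT x|lborel. w x * \<psi> x)"
      unfolding w(3)[OF \<psi>, symmetric] by (rule filterlim_compose[OF energy_integral_tendsto[OF fin \<mu> \<psi>] hr])
    then have lim2: "(\<lambda>n. ennreal (C / c) * energy_integral (h n) \<psi>) \<longlonglongrightarrow> ennreal (C / c) * ennreal (LINT x|lborel. w x * \<psi> x)"
      by (intro tendsto_intros) auto
    have lim1: "(\<lambda>n. ennreal \<bar>integral\<^sup>L ?P (a n)\<bar>) \<longlonglongrightarrow> ennreal \<bar>- (m / 2 * ?T)\<bar>"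
      by (intro tendsto_intros lim)
    have "ennreal \<bar>- (m / 2 * ?T)\<bar> \<le> ennreal (C / c) * ennreal (LINT x|lborel. w x * \<psi> x)"
      using bound by (intro LIMSEQ_le[OF lim1 lim2]) auto
    also have "\<dots> = ennreal (1 / c * (LINT x|lborel. w x * \<bar>\<phi> x\<bar>))"
    proof -
      have "(LINT x|lborel. w x * \<psi> x) = (LINT x|lborel. w x * \<bar>\<phi> x\<bar>) / C" by (simp add: \<psi>_def)
      moreover have "0 \<le> (LINT x|lborel. w x * \<bar>\<phi> x\<bar>)" by (simp add: integral_nonneg_AE w(2))
      ultimately show ?thesis using C c by (simp flip: ennreal_mult)
    qed
    finally have "m / 2 * \<bar>?T\<bar> \<le> 1 / c * (LINT x|lborel. w x * \<bar>\<phi> x\<bar>)"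
      using m0 c by (subst (asm) ennreal_le_iff) (auto simp: abs_mult integral_nonneg_AE w(2))
    then show "\<bar>?T\<bar> \<le> 2 / (m * c) * (LINT x|lborel. w x * \<bar>\<phi> x\<bar>)"
      using m0 c by (simp add: field_simps)
  qed
qed

proposition weak_gradient_exists_of_Sobolev:
  assumes S: "Sobolev_map p \<Omega> u" and \<xi>: "\<xi> \<in> D"
  obtains G where "borel_weak_gradient \<Omega> (rep \<xi>) G"
proof (cases "p = 1")
  case True
  then obtain \<mu> where "KS_weak_limit p \<Omega> u \<mu>" "absolutely_continuous (restrict_space lborel \<Omega>) \<mu>"
    using S by (auto simp: Sobolev_map_def)
  then show ?thesis
    using weak_gradient_exists_of_abs_continuous_limit[OF True _ _ _ \<xi> that] S by (auto simp: Sobolev_map_def)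
next
  case False
  then show ?thesis
    using weak_gradient_exists_of_finite_energy[OF _ _ \<xi> that] p S by (auto simp: Sobolev_map_def)
qed

section \<open>Weak gradients of the distance functions\<close>

text \<open>Changes on null sets do not affect the notion, so integrals over \<open>\<Omega>\<close> of Lebesgue measurable functions can
be replaced by Borel integrals over the whole space.\<close>

lemma is_weak_gradient_iff:
  assumes G[measurable]: "G \<in> borel_measurable borel" and gG: "AE x in lborel. x \<in> \<Omega> \<longrightarrow> g x = G x" and G0: "\<And>x. x \<notin> \<Omega> \<Longrightarrow> G x = 0"
  shows "is_weak_gradient \<Omega> (\<lambda>y. dist (u y) \<xi>) g \<longleftrightarrow> borel_weak_gradient \<Omega> (rep \<xi>) G"
proof -
  have f: "locally_integrable_on \<Omega> (\<lambda>y. dist (u y) \<xi>)"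
    unfolding locally_integrable_on_def
  proof (intro allI impI)
    fix K assume K: "compact K \<and> K \<subseteq> \<Omega>"
    have [measurable]: "K \<in> sets borel" using K by (simp add: borel_compact)
    have ae: "AE x in lborel. indicator K x *\<^sub>R dist (u x) \<xi> = indicator K x *\<^sub>R rep \<xi> x"
      using rep_AE[of \<xi>] by eventually_elim (use K in \<open>auto simp: indicator_def\<close>)
    have i: "integrable lborel (\<lambda>x. indicator K x *\<^sub>R rep \<xi> x)"
      by (intro integrable_mult_indicator rep_integrable) simp
    show "set_integrable lebesgue K (\<lambda>y. dist (u y) \<xi>)"
      unfolding set_integrable_def using lebesgue_integral_AE_eq_borel(2)[OF _ ae] i by simp
  qed
  have g: "set_integrable lebesgue K g \<longleftrightarrow> set_integrable lborel K G" if K: "compact K" "K \<subseteq> \<Omega>" for K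
  proof -
    have [measurable]: "K \<in> sets borel" using K by (simp add: borel_compact)
    have ae: "AE x in lborel. indicator K x *\<^sub>R g x = indicator K x *\<^sub>R G x"
      using gG by eventually_elim (use K in \<open>auto simp: indicator_def\<close>)
    show ?thesis unfolding set_integrable_def by (rule lebesgue_integral_AE_eq_borel(2)[OF _ ae]) measurable
  qed
  have F: "(LINT x:\<Omega>|lebesgue. dist (u x) \<xi> * frechet_derivative \<phi> (at x) i) = (LINT x|lborel. rep \<xi> x * frechet_derivative \<phi> (at x) i)"
    if \<phi>: "\<phi> \<in> C_c_infinity \<Omega>" for \<phi> i
  proof -
    note [measurable] = test_function_measurable[OF \<phi>]
    have ae: "AE x in lborel. indicator \<Omega> x *\<^sub>R (dist (u x) \<xi> * frechet_derivative \<phi> (at x) i) = rep \<xi> x * frechet_derivative \<phi> (at x) i"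
      using rep_AE[of \<xi>] by eventually_elim (auto simp: indicator_def rep_outside)
    show ?thesis unfolding set_lebesgue_integral_def by (rule lebesgue_integral_AE_eq_borel(1)[OF _ ae]) measurable
  qed
  have R: "(LINT x:\<Omega>|lebesgue. (g x \<bullet> i) * \<phi> x) = (LINT x|lborel. (G x \<bullet> i) * \<phi> x)"
    if \<phi>: "\<phi> \<in> C_c_infinity \<Omega>" for \<phi> i
  proof -
    note [measurable] = test_function_measurable[OF \<phi>]
    have ae: "AE x in lborel. indicator \<Omega> x *\<^sub>R ((g x \<bullet> i) * \<phi> x) = (G x \<bullet> i) * \<phi> x"
      using gG by eventually_elim (auto simp: indicator_def G0)
    show ?thesis unfolding set_lebesgue_integral_def by (rule lebesgue_integral_AE_eq_borel(1)[OF _ ae]) measurable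
  qed
  show ?thesis
    unfolding is_weak_gradient_def borel_weak_gradient_def using f g F R rep_integrable G
    by (auto simp: locally_integrable_on_def)
qed

text \<open>Existence of some weak gradient makes the choice in \<open>weak_gradient\<close> meaningful. The chosen gradient is measurable as
a limit of its restrictions to the compact layers, and so has a Borel representative.\<close>

lemma weak_gradient_representative:
  assumes S: "Sobolev_map p \<Omega> u" and \<xi>: "\<xi> \<in> D"
  shows "\<exists>G. borel_weak_gradient \<Omega> (rep \<xi>) G \<and> (AE x in lborel. x \<in> \<Omega> \<longrightarrow> weak_gradient \<Omega> (\<lambda>y. dist (u y) \<xi>) x = G x)"
proof -
  obtain G0 where G0: "borel_weak_gradient \<Omega> (rep \<xi>) G0" using weak_gradient_exists_of_Sobolev[OF S \<xi>] by blast
  have [measurable]: "G0 \<in> borel_measurable borel" using G0 unfolding borel_weak_gradient_def by blast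
  define G1 where "G1 x = indicator \<Omega> x *\<^sub>R G0 x" for x
  have [measurable]: "G1 \<in> borel_measurable borel" unfolding G1_def by measurable
  have "borel_weak_gradient \<Omega> (rep \<xi>) G1"
    unfolding borel_weak_gradient_def
  proof (intro conjI allI impI ballI)
    show "integrable lborel (rep \<xi>)" by (rule rep_integrable)
    show "G1 \<in> borel_measurable borel" by measurable
    show "set_integrable lborel K G1" if K: "compact K" "K \<subseteq> \<Omega>" for K
    proof -
      have "set_integrable lborel K G0" using G0 K unfolding borel_weak_gradient_def by blast
      moreover have "indicator K x *\<^sub>R G0 x = indicator K x *\<^sub>R G1 x" for x using K by (auto simp: G1_def indicator_def)
      ultimately show ?thesis unfolding set_integrable_def by (simp only:)
    qed
    fix \<phi> i assume \<phi>: "\<phi> \<in> C_c_infinity \<Omega>" and i: "i \<in> (Basis :: 'a set)"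
    have "(LINT x|lborel. rep \<xi> x * frechet_derivative \<phi> (at x) i) = - (LINT x|lborel. (G0 x \<bullet> i) * \<phi> x)"
      using G0 \<phi> i unfolding borel_weak_gradient_def by blast
    also have "(LINT x|lborel. (G0 x \<bullet> i) * \<phi> x) = (LINT x|lborel. (G1 x \<bullet> i) * \<phi> x)"
    proof (intro Bochner_Integration.integral_cong refl)
      fix x show "(G0 x \<bullet> i) * \<phi> x = (G1 x \<bullet> i) * \<phi> x"
        using test_function_zero[OF \<phi>, of x] test_function_support(2)[OF \<phi>] by (cases "x \<in> \<Omega>") (auto simp: G1_def)
    qed
    finally show "(LINT x|lborel. rep \<xi> x * frechet_derivative \<phi> (at x) i) = - (LINT x|lborel. (G1 x \<bullet> i) * \<phi> x)" .
  qed
  then have "is_weak_gradient \<Omega> (\<lambda>y. dist (u y) \<xi>) G1"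
    by (subst is_weak_gradient_iff[of G1]) (auto simp: G1_def)
  then have wg: "is_weak_gradient \<Omega> (\<lambda>y. dist (u y) \<xi>) (weak_gradient \<Omega> (\<lambda>y. dist (u y) \<xi>))"
    unfolding weak_gradient_def by (rule someI[of "is_weak_gradient \<Omega> (\<lambda>y. dist (u y) \<xi>)" G1])
  let ?g = "weak_gradient \<Omega> (\<lambda>y. dist (u y) \<xi>)"
  have "(\<lambda>x. indicator \<Omega> x *\<^sub>R ?g x) \<in> borel_measurable lebesgue"
  proof (rule borel_measurable_LIMSEQ_metric)
    show "(\<lambda>x. indicator (inner_layer \<Omega> n) x *\<^sub>R ?g x) \<in> borel_measurable lebesgue" for n
    proof -
      have "set_integrable lebesgue (inner_layer \<Omega> n) ?g"
        using wg inner_layer_compact[OF \<Omega>, of n] inner_layer_subset[OF \<Omega>, of n]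
        unfolding is_weak_gradient_def locally_integrable_on_def by blast
      then show ?thesis unfolding set_integrable_def by (rule borel_measurable_integrable)
    qed
    fix x
    have "\<forall>\<^sub>F n in sequentially. indicator (inner_layer \<Omega> n) x *\<^sub>R ?g x = indicator \<Omega> x *\<^sub>R ?g x"
    proof (cases "x \<in> \<Omega>")
      case True
      then have "\<forall>\<^sub>F n in sequentially. {x} \<subseteq> inner_layer \<Omega> n" by (intro inner_layer_eventually[OF \<Omega>]) auto
      then show ?thesis by eventually_elim (use True in auto)
    next
      case False
      then show ?thesis using inner_layer_subset[OF \<Omega>] by (intro always_eventually) (auto simp: indicator_def dest: subsetD)
    qed
    then show "(\<lambda>n. indicator (inner_layer \<Omega> n) x *\<^sub>R ?g x) \<longlonglongrightarrow> indicator \<Omega> x *\<^sub>R ?g x" by (rule tendsto_eventually)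
  qed
  then obtain G2 where G2: "G2 \<in> borel_measurable borel" "AE x in lborel. indicator \<Omega> x *\<^sub>R ?g x = G2 x"
    by (rule exists_borel_representative_vector)
  define G where "G x = indicator \<Omega> x *\<^sub>R G2 x" for x
  have "G \<in> borel_measurable borel" unfolding G_def using G2(1) by measurable
  moreover have ae: "AE x in lborel. x \<in> \<Omega> \<longrightarrow> ?g x = G x"
    using G2(2) by eventually_elim (auto simp: G_def)
  moreover have "x \<notin> \<Omega> \<Longrightarrow> G x = 0" for x by (simp add: G_def)
  ultimately have "borel_weak_gradient \<Omega> (rep \<xi>) G" using wg by (subst (asm) is_weak_gradient_iff) auto
  then show ?thesis using ae by blast
qed

end

locale KS_map_gradient = KS_map \<Omega> u D p
  for \<Omega> :: "'a::euclidean_space set" and u :: "'a \<Rightarrow> 'b::polish_space" and D :: "'b set" and p :: real +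
  fixes G :: "'b \<Rightarrow> 'a \<Rightarrow> 'a"
  assumes G: "\<And>\<xi>. \<xi> \<in> D \<Longrightarrow> borel_weak_gradient \<Omega> (rep \<xi>) (G \<xi>)"
begin

lemma G_measurable: "\<xi> \<in> D \<Longrightarrow> G \<xi> \<in> borel_measurable borel"
  using G unfolding borel_weak_gradient_def by blast

text \<open>The \<open>p\<close>-th power of \<open>\<bar>\<partial>\<^sub>v u\<bar>\<close>, in terms of Borel representatives of the gradients.\<close>

definition slope :: "'a \<Rightarrow> 'a \<Rightarrow> ennreal" where
  "slope x v = (SUP \<xi>\<in>D. ennreal (\<bar>v \<bullet> G \<xi> x\<bar> powr p))"

lemma slope_measurable_pair: "(\<lambda>z. slope (fst z) (snd z)) \<in> borel_measurable (lborel \<Otimes>\<^sub>M lborel)"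
  unfolding slope_def
proof (intro borel_measurable_SUP D(1))
  fix \<xi> assume "\<xi> \<in> D"
  then have [measurable]: "G \<xi> \<in> borel_measurable borel" by (rule G_measurable)
  show "(\<lambda>z. ennreal (\<bar>snd z \<bullet> G \<xi> (fst z)\<bar> powr p)) \<in> borel_measurable (lborel \<Otimes>\<^sub>M lborel)" by measurable
qed

lemma slope_measurable_compose:
  assumes "f \<in> M \<rightarrow>\<^sub>M borel" "g \<in> M \<rightarrow>\<^sub>M borel"
  shows "(\<lambda>x. slope (f x) (g x)) \<in> borel_measurable M"
proof -
  have "(\<lambda>x. (f x, g x)) \<in> M \<rightarrow>\<^sub>M (lborel \<Otimes>\<^sub>M lborel)" using assms by simp
  from measurable_compose[OF this slope_measurable_pair] show ?thesis by simp
qed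

lemma slope_scale: "c > 0 \<Longrightarrow> slope x (c *\<^sub>R v) = ennreal (c powr p) * slope x v"
  unfolding slope_def by (subst SUP_mult_left_ennreal) (simp add: abs_mult powr_mult ennreal_mult)

definition slope_energy :: ennreal where
  "slope_energy = ennreal (KS_constant TYPE('a) p) * (\<integral>\<^sup>+z. indicator \<Omega> (fst z) * (slope (fst z) (snd z) * indicator (ball 0 1) (snd z)) \<partial>(lborel \<Otimes>\<^sub>M lborel))"

lemma slope_energy_iterated:
  "slope_energy = (\<integral>\<^sup>+x. (ennreal (KS_constant TYPE('a) p) * (\<integral>\<^sup>+v. slope x v * indicator (ball 0 1) v \<partial>lborel)) * indicator \<Omega> x \<partial>lborel)"
proof -
  note [measurable] = slope_measurable_compose
  have m: "(\<lambda>x. \<integral>\<^sup>+v. slope x v * indicator (ball 0 1) v \<partial>lborel) \<in> borel_measurable lborel"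
    by (rule lborel.borel_measurable_nn_integral) (simp add: case_prod_beta')
  have "(\<integral>\<^sup>+z. indicator \<Omega> (fst z) * (slope (fst z) (snd z) * indicator (ball 0 1) (snd z)) \<partial>(lborel \<Otimes>\<^sub>M lborel))
    = (\<integral>\<^sup>+x. \<integral>\<^sup>+v. indicator \<Omega> x * (slope x v * indicator (ball 0 1) v) \<partial>lborel \<partial>lborel)"
    by (subst lborel.nn_integral_fst[symmetric]) auto
  also have "\<dots> = (\<integral>\<^sup>+x. indicator \<Omega> x * (\<integral>\<^sup>+v. slope x v * indicator (ball 0 1) v \<partial>lborel) \<partial>lborel)"
    by (intro nn_integral_cong nn_integral_cmult) measurable
  finally have "slope_energy = ennreal (KS_constant TYPE('a) p) * (\<integral>\<^sup>+x. indicator \<Omega> x * (\<integral>\<^sup>+v. slope x v * indicator (ball 0 1) v \<partial>lborel) \<partial>lborel)"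
    unfolding slope_energy_def by (simp only:)
  also have "\<dots> = (\<integral>\<^sup>+x. ennreal (KS_constant TYPE('a) p) * (indicator \<Omega> x * (\<integral>\<^sup>+v. slope x v * indicator (ball 0 1) v \<partial>lborel)) \<partial>lborel)"
    using m by (intro nn_integral_cmult[symmetric]) measurable
  finally show ?thesis by (simp only: ac_simps)
qed

lemma energy_integral_pair:
  assumes [measurable]: "\<phi> \<in> borel_measurable borel"
  shows "energy_integral h \<phi> = ennreal (KS_constant TYPE('a) p) * (\<integral>\<^sup>+z. ennreal (\<phi> (fst z)) * (quotient h (fst z) (snd z) * indicator (ball 0 1) (snd z)) \<partial>(lborel \<Otimes>\<^sub>M lborel))"
proof -
  have m: "(\<lambda>x. \<integral>\<^sup>+v. quotient h x v * indicator (ball 0 1) v \<partial>lborel) \<in> borel_measurable lborel"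
    by (rule lborel.borel_measurable_nn_integral) (simp add: case_prod_beta')
  have "(\<integral>\<^sup>+z. ennreal (\<phi> (fst z)) * (quotient h (fst z) (snd z) * indicator (ball 0 1) (snd z)) \<partial>(lborel \<Otimes>\<^sub>M lborel))
    = (\<integral>\<^sup>+x. \<integral>\<^sup>+v. ennreal (\<phi> x) * (quotient h x v * indicator (ball 0 1) v) \<partial>lborel \<partial>lborel)"
    by (subst lborel.nn_integral_fst[symmetric]) auto
  also have "\<dots> = (\<integral>\<^sup>+x. ennreal (\<phi> x) * (\<integral>\<^sup>+v. quotient h x v * indicator (ball 0 1) v \<partial>lborel) \<partial>lborel)"
    by (intro nn_integral_cong nn_integral_cmult) measurable
  finally have "ennreal (KS_constant TYPE('a) p) * (\<integral>\<^sup>+z. ennreal (\<phi> (fst z)) * (quotient h (fst z) (snd z) * indicator (ball 0 1) (snd z)) \<partial>(lborel \<Otimes>\<^sub>M lborel))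
    = ennreal (KS_constant TYPE('a) p) * (\<integral>\<^sup>+x. ennreal (\<phi> x) * (\<integral>\<^sup>+v. quotient h x v * indicator (ball 0 1) v \<partial>lborel) \<partial>lborel)"
    by (simp only:)
  also have "\<dots> = (\<integral>\<^sup>+x. ennreal (KS_constant TYPE('a) p) * (ennreal (\<phi> x) * (\<integral>\<^sup>+v. quotient h x v * indicator (ball 0 1) v \<partial>lborel)) \<partial>lborel)"
    using m by (intro nn_integral_cmult[symmetric]) measurable
  finally show ?thesis
    unfolding energy_integral_def averaged_quotient_def by (simp only: ac_simps)
qed

lemma segment_in_layer:
  assumes h: "h < 1 / real (Suc n)"
  obtains W m where "open W" "inner_layer \<Omega> n \<subseteq> W"
    "\<And>(x :: 'a) (z :: 'a) (t :: real). x \<in> W \<Longrightarrow> norm z \<le> h \<Longrightarrow> 0 \<le> t \<Longrightarrow> t \<le> 1 \<Longrightarrow> x + t *\<^sub>R z \<in> inner_layer \<Omega> m"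
proof -
  define e where "e = (1 / real (Suc n) - h) / 2"
  have e: "e > 0" using h by (simp add: e_def)
  then obtain m where m: "1 / real (Suc m) < e" using nat_approx_posE by blast
  define W where "W = {x. 1 / real (Suc n) - e < infdist x (- \<Omega>)}"
  show ?thesis
  proof (rule that)
    show "open W" unfolding W_def by (intro open_Collect_less continuous_intros)
    show "inner_layer \<Omega> n \<subseteq> W" unfolding W_def inner_layer_def using e by auto
    fix x z :: 'a and t :: real assume x: "x \<in> W" and z: "norm z \<le> h" and t: "0 \<le> t" "t \<le> 1"
    have "infdist x (- \<Omega>) \<le> infdist (x + t *\<^sub>R z) (- \<Omega>) + dist x (x + t *\<^sub>R z)" by (rule infdist_triangle)
    moreover have "dist x (x + t *\<^sub>R z) \<le> h"
      using t z mult_mono[of t 1 "norm z" h] by (simp add: dist_norm)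
    ultimately have "1 / real (Suc n) - e - h < infdist (x + t *\<^sub>R z) (- \<Omega>)" using x by (simp add: W_def)
    moreover have "a - (a - h) / 2 - h = (a - h) / 2" for a :: real by (simp add: field_simps)
    then have "1 / real (Suc n) - e - h = e" unfolding e_def by this
    ultimately show "x + t *\<^sub>R z \<in> inner_layer \<Omega> m" unfolding inner_layer_def using m by simp
  qed
qed

section \<open>The upper bound\<close>

text \<open>The formula for weak gradients along segments, on a neighbourhood \<open>W\<close> of the layer from which segments of length \<open>h\<close>
stay in a larger layer.\<close>

lemma difference_quotient_line:
  assumes \<xi>: "\<xi> \<in> D" and h: "0 < h" "h < 1 / real (Suc n)" and v: "norm v \<le> 1"
  shows "AE x in lborel. x \<in> inner_layer \<Omega> n \<longrightarrow> (rep \<xi> (x + h *\<^sub>R v) - rep \<xi> x) / h = (LINT t|lborel. indicator {0..1} t * (v \<bullet> G \<xi> (x + (t * h) *\<^sub>R v)))"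
proof -
  obtain W m where W: "open W" "inner_layer \<Omega> n \<subseteq> W"
    "\<And>(x :: 'a) (z :: 'a) (t :: real). x \<in> W \<Longrightarrow> norm z \<le> h \<Longrightarrow> 0 \<le> t \<Longrightarrow> t \<le> 1 \<Longrightarrow> x + t *\<^sub>R z \<in> inner_layer \<Omega> m"
    using segment_in_layer[OF h(2)] by metis
  have z: "norm (h *\<^sub>R v) \<le> h" using h v by (simp add: mult_left_le)
  have "AE x in lborel. x \<in> W \<longrightarrow> rep \<xi> (x + h *\<^sub>R v) - rep \<xi> x = (LINT t|lborel. indicator {0..1} t * ((h *\<^sub>R v) \<bullet> G \<xi> (x + t *\<^sub>R (h *\<^sub>R v))))"
    by (rule weak_gradient_line[OF G[OF \<xi>] W(1) inner_layer_compact[OF \<Omega>] inner_layer_subset[OF \<Omega>] W(3)[OF _ z]])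
  then show ?thesis
  proof eventually_elim
    case (elim x)
    show ?case
    proof
      assume "x \<in> inner_layer \<Omega> n"
      then have "rep \<xi> (x + h *\<^sub>R v) - rep \<xi> x = (LINT t|lborel. h * (indicator {0..1} t * (v \<bullet> G \<xi> (x + (t * h) *\<^sub>R v))))"
        using elim W(2) by (auto simp: mult.left_commute)
      also have "\<dots> = h * (LINT t|lborel. indicator {0..1} t * (v \<bullet> G \<xi> (x + (t * h) *\<^sub>R v)))" by simp
      finally show "(rep \<xi> (x + h *\<^sub>R v) - rep \<xi> x) / h = (LINT t|lborel. indicator {0..1} t * (v \<bullet> G \<xi> (x + (t * h) *\<^sub>R v)))"
        using h(1) by simp
    qed
  qed
qed

text \<open>Jensen's inequality for the average along the segment.\<close>

lemma quotient_le_line_average: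
  assumes h: "0 < h" "h < 1 / real (Suc n)" and v: "norm v \<le> 1"
  shows "AE x in lborel. x \<in> inner_layer \<Omega> n \<longrightarrow> quotient h x v \<le> (\<integral>\<^sup>+t. indicator {0..1} t * slope (x + (t * h) *\<^sub>R v) v \<partial>lborel)"
proof -
  have "AE x in lborel. \<forall>\<xi>\<in>D. x \<in> inner_layer \<Omega> n \<longrightarrow> (rep \<xi> (x + h *\<^sub>R v) - rep \<xi> x) / h = (LINT t|lborel. indicator {0..1} t * (v \<bullet> G \<xi> (x + (t * h) *\<^sub>R v)))"
    using difference_quotient_line[OF _ h v] D(1) by (subst AE_ball_countable) auto
  then show ?thesis
  proof eventually_elim
    case (elim x)
    show ?case
    proof
      assume x: "x \<in> inner_layer \<Omega> n"
      show "quotient h x v \<le> (\<integral>\<^sup>+t. indicator {0..1} t * slope (x + (t * h) *\<^sub>R v) v \<partial>lborel)"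
        unfolding quotient_def
      proof (rule SUP_least)
        fix \<xi> assume \<xi>: "\<xi> \<in> D"
        have [measurable]: "G \<xi> \<in> borel_measurable borel" using \<xi> by (rule G_measurable)
        have "\<bar>rep \<xi> (x + h *\<^sub>R v) - rep \<xi> x\<bar> / h = \<bar>LINT t|lborel. indicator {0..1} t * (v \<bullet> G \<xi> (x + (t * h) *\<^sub>R v))\<bar>"
        proof -
          have "\<bar>rep \<xi> (x + h *\<^sub>R v) - rep \<xi> x\<bar> / h = \<bar>(rep \<xi> (x + h *\<^sub>R v) - rep \<xi> x) / h\<bar>" using h(1) by simp
          also have "(rep \<xi> (x + h *\<^sub>R v) - rep \<xi> x) / h = (LINT t|lborel. indicator {0..1} t * (v \<bullet> G \<xi> (x + (t * h) *\<^sub>R v)))"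
            using elim \<xi> x by blast
          finally show ?thesis .
        qed
        also have "ennreal (\<dots> powr p) \<le> (\<integral>\<^sup>+t. indicator {0..1} t * ennreal (\<bar>v \<bullet> G \<xi> (x + (t * h) *\<^sub>R v)\<bar> powr p) \<partial>lborel)"
          by (rule jensen_powr_unit_interval[OF p]) measurable
        also have "\<dots> \<le> (\<integral>\<^sup>+t. indicator {0..1} t * slope (x + (t * h) *\<^sub>R v) v \<partial>lborel)"
          using \<xi> unfolding slope_def by (intro nn_integral_mono mult_left_mono SUP_upper) auto
        finally show "ennreal ((\<bar>rep \<xi> (x + h *\<^sub>R v) - rep \<xi> x\<bar> / h) powr p) \<le> (\<integral>\<^sup>+t. indicator {0..1} t * slope (x + (t * h) *\<^sub>R v) v \<partial>lborel)" .
      qed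
    qed
  qed
qed

text \<open>The bound by line averages is integrated in \<open>x\<close>; by Fubini's theorem and translation invariance each
translate by \<open>t h v\<close> contributes the same amount.\<close>

lemma energy_integral_le_slope_energy:
  assumes h: "0 < h" "h < 1 / real (Suc n)" and \<phi>: "\<phi> \<in> cutoffs" "\<And>x. \<phi> x \<noteq> 0 \<Longrightarrow> x \<in> inner_layer \<Omega> n"
  shows "energy_integral h \<phi> \<le> slope_energy"
proof -
  note [measurable] = slope_measurable_compose cutoffs_measurable[OF \<phi>(1)]
  let ?A = "\<lambda>v::'a. \<integral>\<^sup>+y. indicator \<Omega> y * slope y v \<partial>lborel"
  have inner: "(\<integral>\<^sup>+x. ennreal (\<phi> x) * quotient h x v \<partial>lborel) \<le> ?A v" if v: "norm v \<le> 1" for v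
  proof -
    have "(\<integral>\<^sup>+x. ennreal (\<phi> x) * quotient h x v \<partial>lborel) \<le> (\<integral>\<^sup>+x. \<integral>\<^sup>+t. indicator {0..1} t * (indicator \<Omega> (x + (t * h) *\<^sub>R v) * slope (x + (t * h) *\<^sub>R v) v) \<partial>lborel \<partial>lborel)"
    proof (rule nn_integral_mono_AE)
      show "AE x in lborel. ennreal (\<phi> x) * quotient h x v \<le> (\<integral>\<^sup>+t. indicator {0..1} t * (indicator \<Omega> (x + (t * h) *\<^sub>R v) * slope (x + (t * h) *\<^sub>R v) v) \<partial>lborel)"
        using quotient_le_line_average[OF h v]
      proof eventually_elim
        case (elim x)
        show ?case
        proof (cases "\<phi> x = 0")
          case False
          then have x: "x \<in> inner_layer \<Omega> n" by (rule \<phi>(2))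
          have "ennreal (\<phi> x) * quotient h x v \<le> 1 * quotient h x v"
            using \<phi>(1) by (intro mult_right_mono) (auto simp: ennreal_le_1)
          also have "\<dots> \<le> (\<integral>\<^sup>+t. indicator {0..1} t * slope (x + (t * h) *\<^sub>R v) v \<partial>lborel)" using elim x by simp
          also have "\<dots> = (\<integral>\<^sup>+t. indicator {0..1} t * (indicator \<Omega> (x + (t * h) *\<^sub>R v) * slope (x + (t * h) *\<^sub>R v) v) \<partial>lborel)"
          proof (rule nn_integral_cong)
            fix t :: real
            have "x + (t * h) *\<^sub>R v \<in> \<Omega>" if t: "t \<in> {0..1}"
            proof -
              have "norm ((t * h) *\<^sub>R v) \<le> 1 * h * 1" using t h(1) v by (simp add: abs_mult mult.assoc) (metis mult.left_commute mult_le_cancel_left1 mult_le_one norm_ge_zero less_le_not_le)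
              then have "norm ((t * h) *\<^sub>R v) < 1 / real (Suc n)" using h(2) by simp
              then show ?thesis by (rule inner_layer_add[OF \<Omega> x])
            qed
            then show "indicator {0..1} t * slope (x + (t * h) *\<^sub>R v) v = indicator {0..1} t * (indicator \<Omega> (x + (t * h) *\<^sub>R v) * slope (x + (t * h) *\<^sub>R v) v)"
              by (auto simp: indicator_def)
          qed
          finally show ?thesis .
        qed simp
      qed
    qed
    also have "\<dots> = (\<integral>\<^sup>+t. \<integral>\<^sup>+x. indicator {0..1} t * (indicator \<Omega> (x + (t * h) *\<^sub>R v) * slope (x + (t * h) *\<^sub>R v) v) \<partial>lborel \<partial>lborel)"
      by (rule lborel_pair.Fubini'[symmetric]) measurable
    also have "\<dots> = (\<integral>\<^sup>+t. ?A v * indicator {0..1::real} t \<partial>lborel)"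
    proof (rule nn_integral_cong)
      fix t :: real
      have "(\<integral>\<^sup>+x. indicator \<Omega> (x + (t * h) *\<^sub>R v) * slope (x + (t * h) *\<^sub>R v) v \<partial>lborel) = ?A v"
        by (rule nn_integral_lborel_shift[of "\<lambda>y. indicator \<Omega> y * slope y v"]) measurable
      then show "(\<integral>\<^sup>+x. indicator {0..1} t * (indicator \<Omega> (x + (t * h) *\<^sub>R v) * slope (x + (t * h) *\<^sub>R v) v) \<partial>lborel) = ?A v * indicator {0..1} t"
        by (subst nn_integral_cmult) (auto simp: mult.commute)
    qed
    also have "\<dots> = ?A v" by (simp add: nn_integral_cmult_indicator)
    finally show ?thesis .
  qed
  have "(\<integral>\<^sup>+z. ennreal (\<phi> (fst z)) * (quotient h (fst z) (snd z) * indicator (ball 0 1) (snd z)) \<partial>(lborel \<Otimes>\<^sub>M lborel))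
    = (\<integral>\<^sup>+v. \<integral>\<^sup>+x. ennreal (\<phi> x) * (quotient h x v * indicator (ball 0 1) v) \<partial>lborel \<partial>lborel)"
    by (subst lborel_pair.nn_integral_snd[symmetric]) auto
  also have "\<dots> \<le> (\<integral>\<^sup>+v. \<integral>\<^sup>+x. indicator \<Omega> x * (slope x v * indicator (ball 0 1) v) \<partial>lborel \<partial>lborel)"
  proof (rule nn_integral_mono)
    fix v :: 'a
    show "(\<integral>\<^sup>+x. ennreal (\<phi> x) * (quotient h x v * indicator (ball 0 1) v) \<partial>lborel) \<le> (\<integral>\<^sup>+x. indicator \<Omega> x * (slope x v * indicator (ball 0 1) v) \<partial>lborel)"
    proof (cases "v \<in> ball 0 1")
      case True
      then show ?thesis using inner[of v] by simp
    qed simp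
  qed
  also have "\<dots> = (\<integral>\<^sup>+z. indicator \<Omega> (fst z) * (slope (fst z) (snd z) * indicator (ball 0 1) (snd z)) \<partial>(lborel \<Otimes>\<^sub>M lborel))"
    by (subst lborel_pair.nn_integral_snd[symmetric]) auto
  finally show ?thesis
    unfolding energy_integral_pair[OF cutoffs_measurable[OF \<phi>(1)]] slope_energy_def by (rule mult_left_mono) simp
qed

theorem KS_energy_le_slope_energy: "KS_energy p \<Omega> u \<le> slope_energy"
  unfolding KS_energy_eq
proof (rule SUP_least)
  fix \<phi> assume \<phi>: "\<phi> \<in> cutoffs"
  then obtain n where n: "\<And>x. \<phi> x \<noteq> 0 \<Longrightarrow> x \<in> inner_layer \<Omega> n" using C_c_inner_layer by blast
  have "\<forall>\<^sub>F h in at_right 0. energy_integral h \<phi> \<le> slope_energy"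
    using eventually_small[of n] by eventually_elim (rule energy_integral_le_slope_energy[OF _ _ \<phi> n]; elim conjE; assumption)
  then have "Limsup (at_right 0) (\<lambda>h. energy_integral h \<phi>) \<le> Limsup (at_right (0::real)) (\<lambda>h. slope_energy)" by (rule Limsup_mono)
  then show "Limsup (at_right 0) (\<lambda>h. energy_integral h \<phi>) \<le> slope_energy" by (simp add: Limsup_const)
qed

end

section \<open>The lower bound\<close>

text \<open>If \<open>a - c\<close> is not integrable, then the right hand side is infinite.\<close>

lemma average_deviation:
  fixes a :: "real \<Rightarrow> real"
  assumes [measurable]: "a \<in> borel_measurable borel"
  shows "ennreal \<bar>(LINT t|lborel. indicator {0..1} t * a t) - c\<bar> \<le> (\<integral>\<^sup>+t. indicator {0..1} t * ennreal \<bar>a t - c\<bar> \<partial>lborel)"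
proof (cases "integrable lborel (\<lambda>t. indicator {0..1} t * (a t - c))")
  case True
  have ind: "integrable lborel (indicator {0..1} :: real \<Rightarrow> real)" by (simp add: integrable_indicator_iff)
  have "(LINT t|lborel. indicator {0..1} t * a t) = (LINT t|lborel. indicator {0..1} t * (a t - c) + c * indicator {0..1} t)"
    by (intro Bochner_Integration.integral_cong) (auto simp: algebra_simps)
  also have "\<dots> = (LINT t|lborel. indicator {0..1} t * (a t - c)) + c"
    using True ind by (subst Bochner_Integration.integral_add) auto
  finally have "\<bar>(LINT t|lborel. indicator {0..1} t * a t) - c\<bar> = \<bar>LINT t|lborel. indicator {0..1} t * (a t - c)\<bar>" by simp
  also have "ennreal \<dots> \<le> (\<integral>\<^sup>+t. ennreal (norm (indicator {0..1} t * (a t - c))) \<partial>lborel)"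
    using integral_norm_bound_ennreal[OF True] by simp
  also have "\<dots> = (\<integral>\<^sup>+t. indicator {0..1} t * ennreal \<bar>a t - c\<bar> \<partial>lborel)"
    by (intro nn_integral_cong) (auto simp: indicator_def)
  finally show ?thesis .
next
  case False
  have "(\<integral>\<^sup>+t. indicator {0..1} t * ennreal \<bar>a t - c\<bar> \<partial>lborel) = (\<integral>\<^sup>+t. ennreal (norm (indicator {0..1} t * (a t - c))) \<partial>lborel)"
    by (intro nn_integral_cong) (auto simp: indicator_def)
  then have "(\<integral>\<^sup>+t. indicator {0..1} t * ennreal \<bar>a t - c\<bar> \<partial>lborel) = \<infinity>"
    using False unfolding integrable_iff_bounded by (auto simp: not_less top_unique)
  then show ?thesis by simp
qed

lemma L1_shift_measurable:
  fixes g :: "'a::euclidean_space \<Rightarrow> 'b::{banach, second_countable_topology}"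
  assumes [measurable]: "g \<in> borel_measurable borel"
  shows "L1_shift g \<in> borel_measurable borel"
proof -
  have "(\<lambda>z. \<integral>\<^sup>+x. ennreal (norm (g (x + z) - g x)) \<partial>lborel) \<in> borel_measurable lborel"
    by (rule lborel.borel_measurable_nn_integral) measurable
  then show ?thesis unfolding L1_shift_def[abs_def] by simp
qed

text \<open>Dominated convergence in \<open>t\<close> and in \<open>v\<close>; the modulus is bounded by twice the \<open>L\<^sup>1\<close> norm.\<close>

lemma averaged_L1_shift_tendsto_0:
  fixes g :: "'a::euclidean_space \<Rightarrow> 'b::{banach, second_countable_topology}"
  assumes g: "integrable lborel g" and h: "h \<longlonglongrightarrow> 0"
  shows "(\<lambda>k. \<integral>\<^sup>+v. indicator (ball 0 1) v * (\<integral>\<^sup>+t. indicator {0..1} t * L1_shift g ((t * h k) *\<^sub>R v) \<partial>lborel) \<partial>lborel) \<longlonglongrightarrow> 0"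
    and "(\<integral>\<^sup>+v. indicator (ball 0 1) v * (\<integral>\<^sup>+t. indicator {0..1} t * L1_shift g ((t * s) *\<^sub>R v) \<partial>lborel) \<partial>lborel) < \<infinity>"
proof -
  have gm: "g \<in> borel_measurable borel" using g by auto
  have m[measurable]: "L1_shift g \<in> borel_measurable borel" using gm by (rule L1_shift_measurable)
  define N where "N = 2 * (\<integral>\<^sup>+x. ennreal (norm (g x)) \<partial>lborel)"
  have N: "N < \<infinity>" using g unfolding N_def integrable_iff_bounded by (simp add: ennreal_mult_less_top)
  have le: "L1_shift g z \<le> N" for z unfolding N_def by (rule L1_shift_le[OF gm])
  have wt: "(\<integral>\<^sup>+t. indicator {0..1::real} t * N \<partial>lborel) = N"
    by (subst mult.commute) (simp add: nn_integral_cmult_indicator)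
  have wv: "(\<integral>\<^sup>+v. indicator (ball 0 1) (v::'a) * N \<partial>lborel) < \<infinity>"
    using emeasure_bounded_finite[of "ball (0::'a) 1"] N
    by (subst mult.commute) (simp add: nn_integral_cmult_indicator ennreal_mult_less_top)
  have inner_le: "(\<integral>\<^sup>+t. indicator {0..1} t * L1_shift g ((t * s) *\<^sub>R v) \<partial>lborel) \<le> N" for s v
  proof -
    have "(\<integral>\<^sup>+t. indicator {0..1} t * L1_shift g ((t * s) *\<^sub>R v) \<partial>lborel) \<le> (\<integral>\<^sup>+t. indicator {0..1::real} t * N \<partial>lborel)"
      by (intro nn_integral_mono mult_left_mono le) simp
    then show ?thesis by (simp only: wt)
  qed
  have inner_m: "(\<lambda>v. \<integral>\<^sup>+t. indicator {0..1} t * L1_shift g ((t * s) *\<^sub>R v) \<partial>lborel) \<in> borel_measurable lborel" for s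
    by (rule lborel.borel_measurable_nn_integral) measurable
  have inner: "(\<lambda>k. \<integral>\<^sup>+t. indicator {0..1} t * L1_shift g ((t * h k) *\<^sub>R v) \<partial>lborel) \<longlonglongrightarrow> (\<integral>\<^sup>+(t::real). 0 \<partial>lborel)" for v
  proof (rule nn_integral_dominated_convergence)
    show "(\<integral>\<^sup>+t. indicator {0..1::real} t * N \<partial>lborel) < \<infinity>" using N wt by simp
    show "AE t in lborel. indicator {0..1} t * L1_shift g ((t * h k) *\<^sub>R v) \<le> indicator {0..1} t * N" for k
      by (intro AE_I2 mult_left_mono le) simp
    show "AE t in lborel. (\<lambda>k. indicator {0..1} t * L1_shift g ((t * h k) *\<^sub>R v)) \<longlonglongrightarrow> 0"
    proof (rule AE_I2)
      fix t :: real
      have "(\<lambda>k. (t * h k) *\<^sub>R v) \<longlonglongrightarrow> (t * 0) *\<^sub>R v" by (intro tendsto_intros h)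
      then have "(\<lambda>k. L1_shift g ((t * h k) *\<^sub>R v)) \<longlonglongrightarrow> 0" by (intro L1_shift_tendsto_0 g) simp
      then show "(\<lambda>k. indicator {0..1} t * L1_shift g ((t * h k) *\<^sub>R v)) \<longlonglongrightarrow> 0" by (auto simp: indicator_def)
    qed
  qed measurable
  have "(\<lambda>k. \<integral>\<^sup>+v. indicator (ball 0 1) v * (\<integral>\<^sup>+t. indicator {0..1} t * L1_shift g ((t * h k) *\<^sub>R v) \<partial>lborel) \<partial>lborel) \<longlonglongrightarrow> (\<integral>\<^sup>+(v::'a). 0 \<partial>lborel)"
  proof (rule nn_integral_dominated_convergence)
    show "(\<integral>\<^sup>+v. indicator (ball 0 1) (v::'a) * N \<partial>lborel) < \<infinity>" by (rule wv)
    show "(\<lambda>v. indicator (ball 0 1) v * (\<integral>\<^sup>+t. indicator {0..1} t * L1_shift g ((t * h k) *\<^sub>R v) \<partial>lborel)) \<in> borel_measurable lborel" for k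
      by (intro borel_measurable_times_ennreal inner_m) measurable
    show "AE v in lborel. indicator (ball 0 1) v * (\<integral>\<^sup>+t. indicator {0..1} t * L1_shift g ((t * h k) *\<^sub>R v) \<partial>lborel) \<le> indicator (ball 0 1) v * N" for k
      by (intro AE_I2 mult_left_mono inner_le) simp
    show "AE v in lborel. (\<lambda>k. indicator (ball 0 1) v * (\<integral>\<^sup>+t. indicator {0..1} t * L1_shift g ((t * h k) *\<^sub>R v) \<partial>lborel)) \<longlonglongrightarrow> 0"
      using inner by (intro AE_I2) (auto simp: indicator_def)
  qed measurable
  then show "(\<lambda>k. \<integral>\<^sup>+v. indicator (ball 0 1) v * (\<integral>\<^sup>+t. indicator {0..1} t * L1_shift g ((t * h k) *\<^sub>R v) \<partial>lborel) \<partial>lborel) \<longlonglongrightarrow> 0" by simp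
  have "(\<integral>\<^sup>+v. indicator (ball 0 1) v * (\<integral>\<^sup>+t. indicator {0..1} t * L1_shift g ((t * s) *\<^sub>R v) \<partial>lborel) \<partial>lborel) \<le> (\<integral>\<^sup>+v. indicator (ball 0 1) (v::'a) * N \<partial>lborel)"
    by (intro nn_integral_mono mult_left_mono inner_le) simp
  then show "(\<integral>\<^sup>+v. indicator (ball 0 1) v * (\<integral>\<^sup>+t. indicator {0..1} t * L1_shift g ((t * s) *\<^sub>R v) \<partial>lborel) \<partial>lborel) < \<infinity>"
    using wv by (rule le_less_trans)
qed

context KS_map_gradient
begin

definition quotient_error :: "nat \<Rightarrow> 'b \<Rightarrow> real \<Rightarrow> 'a \<times> 'a \<Rightarrow> real" where
  "quotient_error n \<xi> h z = indicator (inner_layer \<Omega> n) (fst z) * indicator (ball 0 1) (snd z)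
    * ((rep \<xi> (fst z + h *\<^sub>R snd z) - rep \<xi> (fst z)) / h - snd z \<bullet> G \<xi> (fst z))"

lemma quotient_error_measurable:
  assumes "\<xi> \<in> D"
  shows "quotient_error n \<xi> h \<in> borel_measurable (lborel \<Otimes>\<^sub>M lborel)"
proof -
  note [measurable] = G_measurable[OF assms]
  have [measurable]: "inner_layer \<Omega> n \<in> sets borel" using inner_layer_closed[OF \<Omega>] by (rule borel_closed)
  show ?thesis unfolding quotient_error_def[abs_def] by measurable
qed

text \<open>The deviation of the average of the gradient along a segment from its value at the starting point is
controlled by the moduli of continuity of the gradient, cut off to a layer that contains all segments.\<close>

lemma difference_quotient_error:
  assumes \<xi>: "\<xi> \<in> D" and h: "0 < h" "h \<le> h0" "h0 < 1 / real (Suc n)" and v: "norm v \<le> 1"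
    and seg: "\<And>(x::'a) (z::'a) (t::real). x \<in> inner_layer \<Omega> n \<Longrightarrow> norm z \<le> h0 \<Longrightarrow> 0 \<le> t \<Longrightarrow> t \<le> 1 \<Longrightarrow> x + t *\<^sub>R z \<in> inner_layer \<Omega> m"
  defines "g \<equiv> \<lambda>x. indicator (inner_layer \<Omega> m) x *\<^sub>R G \<xi> x"
  shows "(\<integral>\<^sup>+x. indicator (inner_layer \<Omega> n) x * ennreal \<bar>(rep \<xi> (x + h *\<^sub>R v) - rep \<xi> x) / h - v \<bullet> G \<xi> x\<bar> \<partial>lborel)
    \<le> (\<integral>\<^sup>+t. indicator {0..1} t * L1_shift g ((t * h) *\<^sub>R v) \<partial>lborel)"
proof -
  note [measurable] = G_measurable[OF \<xi>]
  have [measurable]: "inner_layer \<Omega> m \<in> sets borel" for m using inner_layer_closed[OF \<Omega>] by (rule borel_closed)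
  have [measurable]: "g \<in> borel_measurable borel" unfolding g_def by measurable
  have z: "norm (h *\<^sub>R v) \<le> h0"
  proof -
    have "h * norm v \<le> h * 1" using h(1) v by (intro mult_left_mono) auto
    also have "\<dots> \<le> h0" using h(2) by simp
    finally show ?thesis using h(1) by simp
  qed
  have "(\<integral>\<^sup>+x. indicator (inner_layer \<Omega> n) x * ennreal \<bar>(rep \<xi> (x + h *\<^sub>R v) - rep \<xi> x) / h - v \<bullet> G \<xi> x\<bar> \<partial>lborel)
    \<le> (\<integral>\<^sup>+x. \<integral>\<^sup>+t. indicator {0..1} t * ennreal (norm (g (x + (t * h) *\<^sub>R v) - g x)) \<partial>lborel \<partial>lborel)"
  proof (rule nn_integral_mono_AE)
    show "AE x in lborel. indicator (inner_layer \<Omega> n) x * ennreal \<bar>(rep \<xi> (x + h *\<^sub>R v) - rep \<xi> x) / h - v \<bullet> G \<xi> x\<bar>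
      \<le> (\<integral>\<^sup>+t. indicator {0..1} t * ennreal (norm (g (x + (t * h) *\<^sub>R v) - g x)) \<partial>lborel)"
      using difference_quotient_line[OF \<xi> h(1) le_less_trans[OF h(2,3)] v]
    proof eventually_elim
      case (elim x)
      show ?case
      proof (cases "x \<in> inner_layer \<Omega> n")
        case True
        have eq: "G \<xi> (x + (t * h) *\<^sub>R v) = g (x + (t * h) *\<^sub>R v)" if t: "0 \<le> t" "t \<le> 1" for t
          using seg[OF True z t] by (simp add: g_def)
        have gx: "g x = G \<xi> x" using eq[of 0] by simp
        have "ennreal \<bar>(rep \<xi> (x + h *\<^sub>R v) - rep \<xi> x) / h - v \<bullet> G \<xi> x\<bar>
          \<le> (\<integral>\<^sup>+t. indicator {0..1} t * ennreal \<bar>v \<bullet> G \<xi> (x + (t * h) *\<^sub>R v) - v \<bullet> G \<xi> x\<bar> \<partial>lborel)"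
          unfolding elim[rule_format, OF True] by (rule average_deviation) measurable
        also have "\<dots> \<le> (\<integral>\<^sup>+t. indicator {0..1} t * ennreal (norm (g (x + (t * h) *\<^sub>R v) - g x)) \<partial>lborel)"
        proof (rule nn_integral_mono)
          fix t :: real
          show "indicator {0..1} t * ennreal \<bar>v \<bullet> G \<xi> (x + (t * h) *\<^sub>R v) - v \<bullet> G \<xi> x\<bar> \<le> indicator {0..1} t * ennreal (norm (g (x + (t * h) *\<^sub>R v) - g x))"
          proof (cases "t \<in> {0..1}")
            case True
            have "\<bar>v \<bullet> (g (x + (t * h) *\<^sub>R v) - g x)\<bar> \<le> norm v * norm (g (x + (t * h) *\<^sub>R v) - g x)" by (rule Cauchy_Schwarz_ineq2)
            also have "\<dots> \<le> norm (g (x + (t * h) *\<^sub>R v) - g x)" using v by (intro mult_left_le_one_le) auto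
            finally show ?thesis using True eq[of t] gx by (simp add: inner_diff_right ennreal_leI)
          qed simp
        qed
        finally show ?thesis using True by simp
      qed simp
    qed
  qed
  also have "\<dots> = (\<integral>\<^sup>+t. \<integral>\<^sup>+x. indicator {0..1} t * ennreal (norm (g (x + (t * h) *\<^sub>R v) - g x)) \<partial>lborel \<partial>lborel)"
    by (rule lborel_pair.Fubini'[symmetric]) measurable
  also have "\<dots> = (\<integral>\<^sup>+t. indicator {0..1} t * L1_shift g ((t * h) *\<^sub>R v) \<partial>lborel)"
    unfolding L1_shift_def by (intro nn_integral_cong nn_integral_cmult) measurable
  finally show ?thesis .
qed

lemma quotient_error_L1:
  assumes \<xi>: "\<xi> \<in> D" and h: "\<And>k. 0 < h k" "\<And>k. h k \<le> h0" "h0 < 1 / real (Suc n)" "h \<longlonglongrightarrow> 0"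
  shows "integrable (lborel \<Otimes>\<^sub>M lborel) (quotient_error n \<xi> (h k))"
    and "(\<lambda>k. LINT z|(lborel \<Otimes>\<^sub>M lborel). \<bar>quotient_error n \<xi> (h k) z\<bar>) \<longlonglongrightarrow> 0"
proof -
  note [measurable] = G_measurable[OF \<xi>] quotient_error_measurable[OF \<xi>]
  have [measurable]: "inner_layer \<Omega> m \<in> sets borel" for m using inner_layer_closed[OF \<Omega>] by (rule borel_closed)
  obtain W m where W: "open W" "inner_layer \<Omega> n \<subseteq> W"
    "\<And>(x :: 'a) (z :: 'a) (t :: real). x \<in> W \<Longrightarrow> norm z \<le> h0 \<Longrightarrow> 0 \<le> t \<Longrightarrow> t \<le> 1 \<Longrightarrow> x + t *\<^sub>R z \<in> inner_layer \<Omega> m"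
    using segment_in_layer[OF h(3)] by metis
  have seg: "x + t *\<^sub>R z \<in> inner_layer \<Omega> m" if "x \<in> inner_layer \<Omega> n" "norm z \<le> h0" "0 \<le> t" "t \<le> 1" for x z :: 'a and t :: real
    using that W(2,3) by blast
  define g where "g = (\<lambda>x. indicator (inner_layer \<Omega> m) x *\<^sub>R G \<xi> x)"
  have g: "integrable lborel g"
    using G[OF \<xi>] inner_layer_compact[OF \<Omega>, of m] inner_layer_subset[OF \<Omega>, of m]
    unfolding borel_weak_gradient_def set_integrable_def g_def by blast
  have bound: "(\<integral>\<^sup>+z. ennreal \<bar>quotient_error n \<xi> (h k) z\<bar> \<partial>(lborel \<Otimes>\<^sub>M lborel))
    \<le> (\<integral>\<^sup>+v. indicator (ball 0 1) v * (\<integral>\<^sup>+t. indicator {0..1} t * L1_shift g ((t * h k) *\<^sub>R v) \<partial>lborel) \<partial>lborel)" for k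
  proof -
    have "(\<integral>\<^sup>+z. ennreal \<bar>quotient_error n \<xi> (h k) z\<bar> \<partial>(lborel \<Otimes>\<^sub>M lborel))
      = (\<integral>\<^sup>+v. \<integral>\<^sup>+x. ennreal \<bar>quotient_error n \<xi> (h k) (x, v)\<bar> \<partial>lborel \<partial>lborel)"
      by (rule lborel_pair.nn_integral_snd[symmetric]) measurable
    also have "\<dots> \<le> (\<integral>\<^sup>+v. indicator (ball 0 1) v * (\<integral>\<^sup>+t. indicator {0..1} t * L1_shift g ((t * h k) *\<^sub>R v) \<partial>lborel) \<partial>lborel)"
    proof (rule nn_integral_mono)
      fix v :: 'a
      show "(\<integral>\<^sup>+x. ennreal \<bar>quotient_error n \<xi> (h k) (x, v)\<bar> \<partial>lborel) \<le> indicator (ball 0 1) v * (\<integral>\<^sup>+t. indicator {0..1} t * L1_shift g ((t * h k) *\<^sub>R v) \<partial>lborel)"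
      proof (cases "v \<in> ball 0 1")
        case True
        have "(\<integral>\<^sup>+x. ennreal \<bar>quotient_error n \<xi> (h k) (x, v)\<bar> \<partial>lborel)
          = (\<integral>\<^sup>+x. indicator (inner_layer \<Omega> n) x * ennreal \<bar>(rep \<xi> (x + h k *\<^sub>R v) - rep \<xi> x) / h k - v \<bullet> G \<xi> x\<bar> \<partial>lborel)"
          using True by (intro nn_integral_cong) (auto simp: quotient_error_def indicator_def)
        also have "\<dots> \<le> (\<integral>\<^sup>+t. indicator {0..1} t * L1_shift g ((t * h k) *\<^sub>R v) \<partial>lborel)"
          unfolding g_def by (rule difference_quotient_error[OF \<xi> h(1,2,3) _ seg]) (use True in auto)
        finally show ?thesis using True by simp
      next
        case False
        then have "quotient_error n \<xi> (h k) (x, v) = 0" for x by (simp add: quotient_error_def)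
        then show ?thesis by simp
      qed
    qed
    finally show ?thesis .
  qed
  have int: "integrable (lborel \<Otimes>\<^sub>M lborel) (quotient_error n \<xi> (h k))" for k
    using le_less_trans[OF bound averaged_L1_shift_tendsto_0(2)[OF g h(4)], of k] by (subst integrable_iff_bounded) auto
  then show "integrable (lborel \<Otimes>\<^sub>M lborel) (quotient_error n \<xi> (h k))" .
  have "(\<lambda>k. \<integral>\<^sup>+z. ennreal \<bar>quotient_error n \<xi> (h k) z\<bar> \<partial>(lborel \<Otimes>\<^sub>M lborel)) \<longlonglongrightarrow> 0"
  proof (rule tendsto_sandwich[OF _ _ tendsto_const averaged_L1_shift_tendsto_0(1)[OF g h(4)]])
    show "\<forall>\<^sub>F k in sequentially. (\<integral>\<^sup>+z. ennreal \<bar>quotient_error n \<xi> (h k) z\<bar> \<partial>(lborel \<Otimes>\<^sub>M lborel))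
      \<le> (\<integral>\<^sup>+v. indicator (ball 0 1) v * (\<integral>\<^sup>+t. indicator {0..1} t * L1_shift g ((t * h k) *\<^sub>R v) \<partial>lborel) \<partial>lborel)"
      by (rule always_eventually, rule allI, rule bound)
  qed simp
  then have "(\<lambda>k. ennreal (LINT z|(lborel \<Otimes>\<^sub>M lborel). \<bar>quotient_error n \<xi> (h k) z\<bar>)) \<longlonglongrightarrow> ennreal 0"
    using int by (subst (asm) nn_integral_eq_integral) auto
  then show "(\<lambda>k. LINT z|(lborel \<Otimes>\<^sub>M lborel). \<bar>quotient_error n \<xi> (h k) z\<bar>) \<longlonglongrightarrow> 0"
    by (subst (asm) tendsto_ennreal_iff) auto
qed

text \<open>The errors for the finitely many \<open>\<xi> \<in> F\<close> are added up, so that one subsequence of scales makes all difference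
quotients converge almost everywhere. Fatou's lemma compares the integral of the limit with the energies at
these scales.\<close>

lemma truncated_slope_energy_le:
  assumes E: "KS_energy p \<Omega> u < E" and F: "finite F" "F \<subseteq> D" "F \<noteq> {}"
  shows "ennreal (KS_constant TYPE('a) p) * (\<integral>\<^sup>+z. ennreal (cutoff \<Omega> n (fst z)) * ((SUP \<xi>\<in>F. ennreal (\<bar>snd z \<bullet> G \<xi> (fst z)\<bar> powr p)) * indicator (ball 0 1) (snd z)) \<partial>(lborel \<Otimes>\<^sub>M lborel)) \<le> E"
proof -
  let ?P = "(lborel :: 'a measure) \<Otimes>\<^sub>M (lborel :: 'a measure)"
  define c where "c = KS_constant TYPE('a) p"
  have [measurable]: "cutoff \<Omega> n \<in> borel_measurable borel" by (rule cutoffs_measurable[OF cutoff_in_cutoffs])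
  have [measurable]: "G \<xi> \<in> borel_measurable borel" if "\<xi> \<in> F" for \<xi> using that F(2) by (intro G_measurable) auto
  \<comment> \<open>Half the depth of the layer: segments of this length stay away from the complement.\<close>
  define h0 where "h0 = 1 / (2 * real (Suc n))"
  define h where "h k = h0 / real (Suc k)" for k
  have h0: "0 < h0" "h0 < 1 / real (Suc n)" by (auto simp: h0_def field_simps)
  have h: "0 < h k" "h k \<le> h0" for k using h0(1) by (auto simp: h_def field_simps)
  have hlim: "h \<longlonglongrightarrow> 0" unfolding h_def[abs_def] using LIMSEQ_Suc[OF lim_const_over_n[of h0]] by simp
  define w where "w k z = (\<Sum>\<xi>\<in>F. \<bar>quotient_error n \<xi> (h k) z\<bar>)" for k z
  have qi: "integrable ?P (\<lambda>z. \<bar>quotient_error n \<xi> (h k) z\<bar>)" if "\<xi> \<in> F" for \<xi> k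
    using quotient_error_L1(1)[OF _ h(1) h(2) h0(2) hlim] F(2) that by (intro integrable_abs) blast
  have "\<exists>r::nat\<Rightarrow>nat. strict_mono r \<and> (AE z in ?P. (\<lambda>k. w (r k) z) \<longlonglongrightarrow> 0)"
  proof (rule tendsto_L1_AE_subseq)
    show "integrable ?P (w k)" for k unfolding w_def by (intro Bochner_Integration.integrable_sum qi)
    have "(LINT z|?P. norm (w k z)) = (\<Sum>\<xi>\<in>F. LINT z|?P. \<bar>quotient_error n \<xi> (h k) z\<bar>)" for k
    proof -
      have "(LINT z|?P. norm (w k z)) = (LINT z|?P. (\<Sum>\<xi>\<in>F. \<bar>quotient_error n \<xi> (h k) z\<bar>))"
        by (intro Bochner_Integration.integral_cong refl) (simp add: w_def sum_nonneg)
      also have "\<dots> = (\<Sum>\<xi>\<in>F. LINT z|?P. \<bar>quotient_error n \<xi> (h k) z\<bar>)"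
        by (intro Bochner_Integration.integral_sum qi)
      finally show ?thesis .
    qed
    moreover have "(\<lambda>k. \<Sum>\<xi>\<in>F. LINT z|?P. \<bar>quotient_error n \<xi> (h k) z\<bar>) \<longlonglongrightarrow> (\<Sum>\<xi>\<in>F. 0)"
      using quotient_error_L1(2)[OF _ h(1) h(2) h0(2) hlim] F(2) by (intro tendsto_sum) blast
    ultimately show "(\<lambda>k. LINT z|?P. norm (w k z)) \<longlonglongrightarrow> 0" by simp
  qed
  then obtain r :: "nat \<Rightarrow> nat" where r: "strict_mono r" "AE z in ?P. (\<lambda>k. w (r k) z) \<longlonglongrightarrow> 0" by blast
  define f where "f k z = ennreal c * (ennreal (cutoff \<Omega> n (fst z)) * (quotient (h (r k)) (fst z) (snd z) * indicator (ball 0 1) (snd z)))" for k and z :: "'a \<times> 'a"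
  define s where "s z = ennreal (cutoff \<Omega> n (fst z)) * ((SUP \<xi>\<in>F. ennreal (\<bar>snd z \<bullet> G \<xi> (fst z)\<bar> powr p)) * indicator (ball 0 1) (snd z))" for z
  have [measurable]: "s \<in> borel_measurable ?P"
    unfolding s_def[abs_def] using F(1) by (intro borel_measurable_times_ennreal borel_measurable_SUP countable_finite) measurable
  have fm[measurable]: "f k \<in> borel_measurable ?P" for k unfolding f_def[abs_def] by measurable
  have c: "c > 0" using p unfolding c_def by (intro KS_constant_pos) simp
  have pointwise: "AE z in ?P. ennreal c * s z \<le> liminf (\<lambda>k. f k z)"
    using r(2)
  proof eventually_elim
    case (elim z)
    obtain x v where z: "z = (x, v)" by (cases z)
    show ?case
    proof (cases "cutoff \<Omega> n x \<noteq> 0 \<and> v \<in> ball 0 1")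
      case True
      then have x: "x \<in> inner_layer \<Omega> n" and v: "v \<in> ball 0 1" using cutoff_nonzero[OF \<Omega>] by auto
      let ?a = "c * cutoff \<Omega> n x"
      have a: "0 \<le> ?a" using c cutoff_bounds[OF \<Omega>] by simp
      have bd: "ennreal ?a * ennreal (\<bar>v \<bullet> G \<xi> x\<bar> powr p) \<le> liminf (\<lambda>k. f k z)" if \<xi>: "\<xi> \<in> F" for \<xi>
      proof -
        let ?q = "\<lambda>k. (rep \<xi> (x + h (r k) *\<^sub>R v) - rep \<xi> x) / h (r k)"
        have "(\<lambda>k. \<bar>quotient_error n \<xi> (h (r k)) z\<bar>) \<longlonglongrightarrow> 0"
        proof (rule tendsto_sandwich[OF _ _ tendsto_const elim])
          show "\<forall>\<^sub>F k in sequentially. \<bar>quotient_error n \<xi> (h (r k)) z\<bar> \<le> w (r k) z"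
            unfolding w_def using F(1) \<xi> by (intro always_eventually allI member_le_sum) auto
        qed simp
        then have "(\<lambda>k. ?q k - v \<bullet> G \<xi> x) \<longlonglongrightarrow> 0"
          using x v by (simp add: tendsto_rabs_zero_iff quotient_error_def z)
        then have "?q \<longlonglongrightarrow> v \<bullet> G \<xi> x" by (simp add: LIM_zero_iff)
        then have "(\<lambda>k. ?a * \<bar>?q k\<bar> powr p) \<longlonglongrightarrow> ?a * \<bar>v \<bullet> G \<xi> x\<bar> powr p"
          using p by (intro tendsto_mult tendsto_const tendsto_powr2 tendsto_rabs) auto
        then have "(\<lambda>k. ennreal (?a * \<bar>?q k\<bar> powr p)) \<longlonglongrightarrow> ennreal (?a * \<bar>v \<bullet> G \<xi> x\<bar> powr p)" by (rule tendsto_ennrealI)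
        then have "ennreal (?a * \<bar>v \<bullet> G \<xi> x\<bar> powr p) = liminf (\<lambda>k. ennreal (?a * \<bar>?q k\<bar> powr p))"
          by (intro lim_imp_Liminf[symmetric]) simp
        also have "\<dots> \<le> liminf (\<lambda>k. f k z)"
        proof (rule Liminf_mono, rule always_eventually, rule allI)
          fix k
          have "\<bar>?q k\<bar> = \<bar>rep \<xi> (x + h (r k) *\<^sub>R v) - rep \<xi> x\<bar> / h (r k)" using h(1)[of "r k"] by simp
          then have "ennreal (\<bar>?q k\<bar> powr p) \<le> quotient (h (r k)) x v"
            unfolding quotient_def using \<xi> F(2) by (intro SUP_upper2[of \<xi>]) auto
          then have "ennreal ?a * ennreal (\<bar>?q k\<bar> powr p) \<le> ennreal ?a * quotient (h (r k)) x v" by (rule mult_left_mono) simp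
          then show "ennreal (?a * \<bar>?q k\<bar> powr p) \<le> f k z"
            using a v c cutoff_bounds[OF \<Omega>] by (simp add: f_def z ennreal_mult mult.assoc)
        qed
        finally show ?thesis using a by (simp add: ennreal_mult)
      qed
      have "ennreal c * s z = ennreal ?a * (SUP \<xi>\<in>F. ennreal (\<bar>v \<bullet> G \<xi> x\<bar> powr p))"
        using v c cutoff_bounds[OF \<Omega>] by (simp add: s_def z ennreal_mult mult.assoc)
      also have "\<dots> = (SUP \<xi>\<in>F. ennreal ?a * ennreal (\<bar>v \<bullet> G \<xi> x\<bar> powr p))" by (rule SUP_mult_left_ennreal)
      also have "\<dots> \<le> liminf (\<lambda>k. f k z)" using bd by (rule SUP_least)
      finally show ?thesis .
    next
      case False
      then have "ennreal (cutoff \<Omega> n x) = 0 \<or> (indicator (ball 0 1) v :: ennreal) = 0" by auto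
      then have "s z = 0" unfolding s_def z fst_conv snd_conv by (elim disjE) simp_all
      then show ?thesis by simp
    qed
  qed
  have "ennreal c * (\<integral>\<^sup>+z. s z \<partial>?P) = (\<integral>\<^sup>+z. ennreal c * s z \<partial>?P)" by (rule nn_integral_cmult[symmetric]) fact
  also have "\<dots> \<le> (\<integral>\<^sup>+z. liminf (\<lambda>k. f k z) \<partial>?P)" using pointwise by (rule nn_integral_mono_AE)
  also have "\<dots> \<le> liminf (\<lambda>k. \<integral>\<^sup>+z. f k z \<partial>?P)" by (rule nn_integral_liminf[OF fm])
  also have "\<dots> \<le> limsup (\<lambda>k. \<integral>\<^sup>+z. f k z \<partial>?P)" by (rule Liminf_le_Limsup) simp
  also have "\<dots> \<le> E"
  proof (rule Limsup_bounded)
    have "filterlim (\<lambda>k. h (r k)) (at_right 0) sequentially"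
      using LIMSEQ_subseq_LIMSEQ[OF hlim r(1)] h(1) by (intro tendsto_imp_filterlim_at_right) (auto simp: o_def)
    from eventually_compose_filterlim[OF eventually_energy_integral_less[OF E cutoff_in_cutoffs] this]
    have "\<forall>\<^sub>F k in sequentially. energy_integral (h (r k)) (cutoff \<Omega> n) < E" .
    then show "\<forall>\<^sub>F k in sequentially. (\<integral>\<^sup>+z. f k z \<partial>?P) \<le> E"
    proof eventually_elim
      case (elim k)
      have "(\<integral>\<^sup>+z. f k z \<partial>?P) = energy_integral (h (r k)) (cutoff \<Omega> n)"
        unfolding f_def energy_integral_pair[OF \<open>cutoff \<Omega> n \<in> borel_measurable borel\<close>] c_def by (rule nn_integral_cmult) measurable
      then show ?case using elim by simp
    qed
  qed
  finally show ?thesis unfolding s_def c_def .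
qed

text \<open>Monotone convergence, simultaneously for an exhaustion of \<open>D\<close> by finite sets and of \<open>\<Omega>\<close> by cutoff functions.\<close>

theorem slope_energy_le_KS_energy: "slope_energy \<le> KS_energy p \<Omega> u"
proof (rule ccontr)
  assume "\<not> slope_energy \<le> KS_energy p \<Omega> u"
  then obtain E where E: "KS_energy p \<Omega> u < E" "E < slope_energy" using dense by (metis not_le)
  let ?P = "(lborel :: 'a measure) \<Otimes>\<^sub>M (lborel :: 'a measure)"
  define d where "d = from_nat_into D"
  have d: "range d = D" unfolding d_def using D_nonempty D(1) by (rule range_from_nat_into)
  define S where "S n x v = (SUP \<xi>\<in>d ` {..n}. ennreal (\<bar>v \<bullet> G \<xi> x\<bar> powr p))" for n x v
  have S_mono: "S m x v \<le> S n x v" if "m \<le> n" for m n x v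
    unfolding S_def using that by (intro SUP_subset_mono) auto
  have dD: "d j \<in> D" for j using d by blast
  define f where "f n z = ennreal (cutoff \<Omega> n (fst z)) * (S n (fst z) (snd z) * indicator (ball 0 1) (snd z))" for n z
  have [measurable]: "cutoff \<Omega> n \<in> borel_measurable borel" for n by (rule cutoffs_measurable[OF cutoff_in_cutoffs])
  have Sm[measurable]: "(\<lambda>z. S n (fst z) (snd z)) \<in> borel_measurable ?P" for n
    unfolding S_def
  proof (intro borel_measurable_SUP countable_finite finite_imageI finite_atMost)
    fix \<xi> assume "\<xi> \<in> d ` {..n}"
    then have [measurable]: "G \<xi> \<in> borel_measurable borel" using dD by (auto intro: G_measurable)
    show "(\<lambda>z. ennreal (\<bar>snd z \<bullet> G \<xi> (fst z)\<bar> powr p)) \<in> borel_measurable ?P" by measurable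
  qed
  have fm: "f n \<in> borel_measurable ?P" for n unfolding f_def[abs_def] by measurable
  have "incseq f"
    unfolding f_def incseq_def le_fun_def
    by (intro allI impI mult_mono ennreal_leI cutoff_mono[OF \<Omega>] S_mono) auto
  have le: "indicator \<Omega> (fst z) * (slope (fst z) (snd z) * indicator (ball 0 1) (snd z)) \<le> (SUP n. f n z)" for z
  proof (cases "fst z \<in> \<Omega> \<and> snd z \<in> ball 0 1")
    case True
    then obtain N where "fst z \<in> inner_layer \<Omega> N"
      using inner_layer_eventually[OF \<Omega>, of "{fst z}"] by (auto simp: eventually_sequentially)
    \<comment> \<open>From this index on the cutoff functions do not reduce the integrand at \<open>z\<close>.\<close>
    then have N: "cutoff \<Omega> (2 * N + 1) (fst z) = 1" by (rule cutoff_eq_1[OF \<Omega>])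
    have "ennreal (\<bar>snd z \<bullet> G (d j) (fst z)\<bar> powr p) \<le> (SUP n. f n z)" for j
    proof (rule SUP_upper2[of "max j (2 * N + 1)"])
      let ?n = "max j (2 * N + 1)"
      have "1 \<le> cutoff \<Omega> ?n (fst z)" using cutoff_mono[OF \<Omega>, of "2 * N + 1" ?n "fst z"] N by simp
      moreover have "ennreal (\<bar>snd z \<bullet> G (d j) (fst z)\<bar> powr p) \<le> S ?n (fst z) (snd z)"
        unfolding S_def by (rule SUP_upper) auto
      ultimately have "1 * ennreal (\<bar>snd z \<bullet> G (d j) (fst z)\<bar> powr p) \<le> ennreal (cutoff \<Omega> ?n (fst z)) * S ?n (fst z) (snd z)"
        by (intro mult_mono) auto
      then show "ennreal (\<bar>snd z \<bullet> G (d j) (fst z)\<bar> powr p) \<le> f ?n z" using True by (simp add: f_def)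
    qed simp
    then have "slope (fst z) (snd z) \<le> (SUP n. f n z)"
      unfolding slope_def using d by (intro SUP_least) auto
    then show ?thesis using True by simp
  next
    case False
    then have "indicator \<Omega> (fst z) * (slope (fst z) (snd z) * indicator (ball 0 1) (snd z)) = 0" by (auto simp: indicator_def)
    then show ?thesis by (simp only: zero_le)
  qed
  have "slope_energy \<le> ennreal (KS_constant TYPE('a) p) * (\<integral>\<^sup>+z. (SUP n. f n z) \<partial>?P)"
    unfolding slope_energy_def by (intro mult_left_mono nn_integral_mono le) simp
  also have "(\<integral>\<^sup>+z. (SUP n. f n z) \<partial>?P) = (SUP n. \<integral>\<^sup>+z. f n z \<partial>?P)"
    by (rule nn_integral_monotone_convergence_SUP[OF \<open>incseq f\<close> fm])
  also have "ennreal (KS_constant TYPE('a) p) * \<dots> = (SUP n. ennreal (KS_constant TYPE('a) p) * (\<integral>\<^sup>+z. f n z \<partial>?P))"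
    by (rule SUP_mult_left_ennreal)
  also have "\<dots> \<le> E"
  proof (rule SUP_least)
    fix n
    show "ennreal (KS_constant TYPE('a) p) * (\<integral>\<^sup>+z. f n z \<partial>?P) \<le> E"
      unfolding f_def S_def using dD by (intro truncated_slope_energy_le[OF E(1)]) auto
  qed
  finally show False using E(2) by simp
qed

end

theorem theorem1p1:
  fixes \<Omega> :: "'a::euclidean_space set" and u :: "'a \<Rightarrow> 'b::polish_space"
    and D :: "'b set" and p :: real
  assumes "1 \<le> p" and "open \<Omega>" and "bounded \<Omega>"
    and "Sobolev_map p \<Omega> u"
    and "countable D" and "closure D = UNIV"
  shows "KS_energy p \<Omega> u =
    (\<integral>\<^sup>+x\<in>\<Omega>.
       ((\<integral>\<^sup>+\<nu>\<in>sphere 0 1. ennreal_powr (abs_dir_deriv \<Omega> u D \<nu> x) p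
            \<partial>hausdorff_measure (DIM('a) - 1))
        / emeasure (hausdorff_measure (DIM('a) - 1)) (sphere (0::'a) 1))
     \<partial>lebesgue)"
proof -
  interpret KS_map \<Omega> u D p
    by unfold_locales (use assms in \<open>auto simp only: Sobolev_map_def\<close>)
  have "\<forall>\<xi>\<in>D. \<exists>G. borel_weak_gradient \<Omega> (rep \<xi>) G \<and> (AE x in lborel. x \<in> \<Omega> \<longrightarrow> weak_gradient \<Omega> (\<lambda>y. dist (u y) \<xi>) x = G x)"
    using weak_gradient_representative[OF assms(4)] by blast
  then obtain G where grad: "\<And>\<xi>. \<xi> \<in> D \<Longrightarrow> borel_weak_gradient \<Omega> (rep \<xi>) (G \<xi>)"
    "\<And>\<xi>. \<xi> \<in> D \<Longrightarrow> AE x in lborel. x \<in> \<Omega> \<longrightarrow> weak_gradient \<Omega> (\<lambda>y. dist (u y) \<xi>) x = G \<xi> x"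
    using bchoice[of D] by metis
  interpret KS_map_gradient \<Omega> u D p G by unfold_locales (rule grad(1))
  have p0: "p > 0" using p by simp
  have ae: "AE x in lborel. \<forall>\<xi>\<in>D. x \<in> \<Omega> \<longrightarrow> weak_gradient \<Omega> (\<lambda>y. dist (u y) \<xi>) x = G \<xi> x"
    using grad(2) D(1) by (subst AE_ball_countable) auto
  have slope: "ennreal_powr (abs_dir_deriv \<Omega> u D \<nu> x) p = slope x \<nu>"
    if "x \<in> \<Omega>" "\<forall>\<xi>\<in>D. x \<in> \<Omega> \<longrightarrow> weak_gradient \<Omega> (\<lambda>y. dist (u y) \<xi>) x = G \<xi> x" for x \<nu>
    unfolding abs_dir_deriv_def slope_def ennreal_powr_SUP[OF p0 D_nonempty]
    using that by (intro SUP_cong refl) (simp add: ennreal_powr_ennreal)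
  let ?A = "\<lambda>x. (\<integral>\<^sup>+\<nu>\<in>sphere 0 1. ennreal_powr (abs_dir_deriv \<Omega> u D \<nu> x) p \<partial>hausdorff_measure (DIM('a) - 1))
        / emeasure (hausdorff_measure (DIM('a) - 1)) (sphere (0::'a) 1)"
  have "(\<integral>\<^sup>+x\<in>\<Omega>. ?A x \<partial>lebesgue) = (\<integral>\<^sup>+x\<in>\<Omega>. ?A x \<partial>lborel)" by (rule nn_integral_completion)
  also have "\<dots> = (\<integral>\<^sup>+x. (ennreal (KS_constant TYPE('a) p) * (\<integral>\<^sup>+v. slope x v * indicator (ball 0 1) v \<partial>lborel)) * indicator \<Omega> x \<partial>lborel)"
  proof (rule nn_integral_cong_AE)
    show "AE x in lborel. ?A x * indicator \<Omega> x = (ennreal (KS_constant TYPE('a) p) * (\<integral>\<^sup>+v. slope x v * indicator (ball 0 1) v \<partial>lborel)) * indicator \<Omega> x"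
      using ae
    proof eventually_elim
      case (elim x)
      show ?case
      proof (cases "x \<in> \<Omega>")
        case True
        have "?A x = ennreal (KS_constant TYPE('a) p) * (\<integral>\<^sup>+v. slope x v * indicator (ball 0 1) v \<partial>lborel)"
          unfolding slope[OF True elim]
        proof (rule sphere_average_eq_ball_average[of p "slope x", OF p0])
          have "(\<lambda>v. slope ((\<lambda>_. x) v) ((\<lambda>v. v) v)) \<in> borel_measurable borel"
            by (rule slope_measurable_compose) simp_all
          then show "slope x \<in> borel_measurable borel" by (simp only:)
        qed (rule slope_scale)
        then show ?thesis by simp
      qed simp
    qed
  qed
  also have "\<dots> = slope_energy" by (rule slope_energy_iterated[symmetric])
  also have "\<dots> = KS_energy p \<Omega> u"
    by (rule antisym[OF slope_energy_le_KS_energy KS_energy_le_slope_energy])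
  finally show ?thesis by (rule sym)
qed

end
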